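(* Let $u\colon\mathscr P_2(\mathbb R^d)\to\mathbb R$ be a continuous function (with respect to the $2$-Wasserstein metric $\mathcal W_2$). Then there exists a sequence $\{u_k\}_k\subset C^\infty(\mathscr P_2(\mathbb R^d))$ such that $$\lim_{k\to\infty}\ \sup_{\mu\in\mathscr M}|u_k(\mu)-u(\mu)|=0$$ for any compact set $\mathscr M\subset\mathscr P_2(\mathbb R^d)$; moreover: 1) if $u\in C^1(\mathscr P_2(\mathbb R^d))$, then $$\lim_{k\to\infty}\ \sup_{(\mu,x)\in\mathscr M\times K}|\partial_\mu u_k(\mu)(x)-\partial_\mu u(\mu)(x)|=0$$ for any compact sets $\mathscr M\subset\mathscr P_2(\mathbb R^d)$ and $K\subset\mathbb R^d$; 2) if in addition $u\in C^2(\mathscr P_2(\mathbb R^d))$, then $$\lim_{k\to\infty}\ \sup_{(\mu,x,y)\in\mathscr M\times K\times K}\Big(\big|\partial_x\partial_\mu u_k(\mu)(x)-\partial_x\partial_\mu u(\mu)(x)\big|+\big|\partial_\mu^2u_k(\mu)(x,y)-\partial_\mu^2u(\mu)(x,y)\big|\Big)=0$$ for any compact sets $\mathscr M\subset\mathscr P_2(\mathbb R^d)$ and $K\subset\mathbb R^d$.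
   Context: Let $d\in\mathbb N$. $\mathscr P_2(\mathbb R^d)$ is the set of Borel probability measures $\mu$ on $\mathbb R^d$ with $\int|x|^2\,\mu(dx)<\infty$, endowed with the $2$-Wasserstein metric $\mathcal W_2(\mu,\nu)=\inf_{\pi\in\Pi(\mu,\nu)}\big(\int|x-y|^2\,\pi(dx,dy)\big)^{1/2}$, where $\Pi(\mu,\nu)$ is the set of couplings of $\mu$ and $\nu$ (probabilities on $\mathbb R^d\times\mathbb R^d$ with first marginal $\mu$ and second marginal $\nu$). Probability space. $(\Omega,\mathcal F,\mathbb P)$ is a fixed probability space on which there exists a real-valued random variable with uniform distribution on $[0,1]$. $\mathbb P_\xi$ denotes the law of a random variable $\xi$, and $L^2=L^2(\Omega,\mathcal F,\mathbb P;\mathbb R^d)$. Lions differentiability. The lifting of $u\colon\mathscr P_2(\mathbb R^d)\to\mathbb R$ is $\tilde u\colon L^2\to\mathbb R$, $\tilde u(\xi)=u(\mathbb P_\xi)$. Suppose that $\tilde u$ is everywhere Fréchet differentiable and that its gradient $D\tilde u\colon L^2\to L^2$ is continuous. Then there is at most one map $\partial_\mu u\colon\mathscr P_2(\mathbb R^d)\times\mathbb R^d\to\mathbb R^d$, $(\mu,x)\mapsto\partial_\mu u(\mu)(x)$, which is continuous on $\mathscr P_2(\mathbb R^d)\times\mathbb R^d$ and satisfies $D\tilde u(\xi)=\partial_\mu u(\mathbb P_\xi)(\xi)$ $\mathbb P$-a.s. for every $\xi\in L^2$. If such a map exists, $u$ is said to admit continuous $L$-derivative $\partial_\mu u$. $C^1(\mathscr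 P_2(\mathbb R^d))$ is the class of continuous $u$ admitting continuous $L$-derivative. Second-order derivatives. For $u\in C^1(\mathscr P_2(\mathbb R^d))$: $\partial_x\partial_\mu u(\mu)(x)\in\mathbb R^{d\times d}$ is the classical derivative of $x\mapsto\partial_\mu u(\mu)(x)$ for fixed $\mu$; $\partial_\mu^2u(\mu)(x,y)\in\mathbb R^{d\times d}$ is the (componentwise) $L$-derivative, evaluated at $y\in\mathbb R^d$, of $\mu\mapsto\partial_\mu u(\mu)(x)$ for fixed $x$. $C^2(\mathscr P_2(\mathbb R^d))$ is the class of $u\in C^1(\mathscr P_2(\mathbb R^d))$ admitting continuous second-order derivatives $\partial_x\partial_\mu u\colon\mathscr P_2(\mathbb R^d)\times\mathbb R^d\to\mathbb R^{d\times d}$ and $\partial_\mu^2u\colon\mathscr P_2(\mathbb R^d)\times\mathbb R^d\times\mathbb R^d\to\mathbb R^{d\times d}$. Higher-order derivatives are obtained by iteration: given a derivative $f(\mu,x_1,\dots,x_j)$ of $u$ (a tensor-valued map on $\mathscr P_2(\mathbb R^d)\times(\mathbb R^d)^j$), its derivatives are the classical partial derivatives $\partial_{x_i}f$, $i=1,\dots,j$, with $\mu$ and the other variables fixed, and the (componentwise) $L$-derivative $\partial_\mu f(\mu,x_1,\dots,x_j)(x_{j+1})$ of $\mu\mapsto f(\mu,x_1,\dots,x_j)$ with $x_1,\dots,x_j$ fixed, which depends on one additional variable $x_{j+1}\in\mathbb R^d$. $C^\infty(\mathscr P_2(\mathbb R^d))$ is the class of continuous functions $u\colon\mathscr P_2(\mathbb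 R^d)\to\mathbb R$ which admit continuous derivatives of any order, continuity being joint in all the variables (the measure and the spatial variables). *)

theory Defs
  imports "HOL-Probability.Probability"
begin

section \<open>The Wasserstein space\<close>

definition P2 :: "'a::euclidean_space measure set" where
  "P2 = {\<mu>. prob_space \<mu> \<and> sets \<mu> = sets borel \<and> integrable \<mu> (\<lambda>x. (norm x)\<^sup>2)}"

definition couplings ::
  "'a::euclidean_space measure \<Rightarrow> 'a measure \<Rightarrow> ('a \<times> 'a) measure set" where
  "couplings \<mu> \<nu> = {\<pi>. prob_space \<pi> \<and> sets \<pi> = sets (borel \<Otimes>\<^sub>M borel) \<and>
     distr \<pi> borel fst = \<mu> \<and> distr \<pi> borel snd = \<nu>}"

text \<open>The infimum is taken in \<^typ>\<open>ennreal\<close>; it is finite for measures in \<^const>\<open>P2\<close>.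
  Outside \<^const>\<open>P2\<close> the value is still nonnegative and symmetric, as the library's locale
  \<^locale>\<open>Metric_space\<close> demands of a metric on all arguments.\<close>

definition W2 :: "'a::euclidean_space measure \<Rightarrow> 'a measure \<Rightarrow> real" where
  "W2 \<mu> \<nu> = sqrt (enn2real (INF \<pi>\<in>couplings \<mu> \<nu>. \<integral>\<^sup>+ z. ennreal ((norm (fst z - snd z))\<^sup>2) \<partial>\<pi>))"

definition W2_top :: "'a::euclidean_space measure topology" where
  "W2_top = Metric_space.mtopology P2 W2"

section \<open>Lions differentiability\<close>

text \<open>Throughout, \<open>P\<close> is the underlying probability space. Elements of \<open>L2 P\<close> are
  representatives; almost surely equal functions are not identified, so \<^term>\<open>L2_norm\<close> is only
  a seminorm, and a gradient is determined only up to almost sure equality.\<close>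

definition L2 :: "'w measure \<Rightarrow> ('w \<Rightarrow> 'a::euclidean_space) set" where
  "L2 P = {\<xi> \<in> borel_measurable P. integrable P (\<lambda>\<omega>. (norm (\<xi> \<omega>))\<^sup>2)}"

definition L2_norm :: "'w measure \<Rightarrow> ('w \<Rightarrow> 'a::euclidean_space) \<Rightarrow> real" where
  "L2_norm P \<xi> = sqrt (\<integral>\<omega>. (norm (\<xi> \<omega>))\<^sup>2 \<partial>P)"

definition lifting ::
  "'w measure \<Rightarrow> ('a::euclidean_space measure \<Rightarrow> real) \<Rightarrow> ('w \<Rightarrow> 'a) \<Rightarrow> real" where
  "lifting P u \<xi> = u (distr P borel \<xi>)"

text \<open>\<open>F\<close> is Frechet differentiable at \<open>\<xi>\<close> with derivative \<open>\<eta> \<mapsto> E[G \<bullet> \<eta>]\<close>, that is, with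
  gradient \<open>G \<in> L2 P\<close>.\<close>

definition has_gradient ::
  "'w measure \<Rightarrow> (('w \<Rightarrow> 'a::euclidean_space) \<Rightarrow> real) \<Rightarrow> ('w \<Rightarrow> 'a) \<Rightarrow> ('w \<Rightarrow> 'a) \<Rightarrow> bool" where
  "has_gradient P F \<xi> G \<longleftrightarrow> G \<in> L2 P \<and>
     (\<forall>\<epsilon>>0. \<exists>\<delta>>0. \<forall>\<eta>\<in>L2 P. L2_norm P \<eta> < \<delta> \<longrightarrow>
        \<bar>F (\<lambda>\<omega>. \<xi> \<omega> + \<eta> \<omega>) - F \<xi> - (\<integral>\<omega>. G \<omega> \<bullet> \<eta> \<omega> \<partial>P)\<bar> \<le> \<epsilon> * L2_norm P \<eta>)"

definition continuous_L2 ::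
  "'w measure \<Rightarrow> (('w \<Rightarrow> 'a::euclidean_space) \<Rightarrow> ('w \<Rightarrow> 'a)) \<Rightarrow> bool" where
  "continuous_L2 P D \<longleftrightarrow>
     (\<forall>\<xi>\<in>L2 P. \<forall>\<epsilon>>0. \<exists>\<delta>>0. \<forall>\<eta>\<in>L2 P. L2_norm P (\<lambda>\<omega>. \<eta> \<omega> - \<xi> \<omega>) < \<delta> \<longrightarrow>
        L2_norm P (\<lambda>\<omega>. D \<eta> \<omega> - D \<xi> \<omega>) < \<epsilon>)"

definition has_L_deriv ::
  "'w measure \<Rightarrow> ('a::euclidean_space measure \<Rightarrow> real) \<Rightarrow> ('a measure \<Rightarrow> 'a \<Rightarrow> 'a) \<Rightarrow> bool" where
  "has_L_deriv P u p \<longleftrightarrow>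
     (\<exists>D. (\<forall>\<xi>\<in>L2 P. has_gradient P (lifting P u) \<xi> (D \<xi>)) \<and> continuous_L2 P D \<and>
        continuous_map (prod_topology W2_top euclidean) euclidean (\<lambda>(\<mu>, x). p \<mu> x) \<and>
        (\<forall>\<xi>\<in>L2 P. AE \<omega> in P. D \<xi> \<omega> = p (distr P borel \<xi>) (\<xi> \<omega>)))"

text \<open>The L-derivative is unique on \<^const>\<open>P2\<close> only: choice also fixes the irrelevant values
  at measures outside \<^const>\<open>P2\<close>.\<close>

definition L_deriv ::
  "'w measure \<Rightarrow> ('a::euclidean_space measure \<Rightarrow> real) \<Rightarrow> 'a measure \<Rightarrow> 'a \<Rightarrow> 'a" where
  "L_deriv P u = (SOME p. has_L_deriv P u p)"

definition C1 :: "'w measure \<Rightarrow> ('a::euclidean_space measure \<Rightarrow> real) set" where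
  "C1 P = {u. continuous_map W2_top euclideanreal u \<and> (\<exists>p. has_L_deriv P u p)}"

section \<open>Second-order derivatives\<close>

definition dx_L_deriv ::
  "'w measure \<Rightarrow> ((real^'n) measure \<Rightarrow> real) \<Rightarrow> (real^'n) measure \<Rightarrow> real^'n \<Rightarrow> real^'n^'n" where
  "dx_L_deriv P u \<mu> x = matrix (frechet_derivative (L_deriv P u \<mu>) (at x))"

definition L_deriv2 ::
  "'w measure \<Rightarrow> ((real^'n) measure \<Rightarrow> real) \<Rightarrow> (real^'n) measure \<Rightarrow> real^'n \<Rightarrow> real^'n \<Rightarrow> real^'n^'n"
  where
  "L_deriv2 P u \<mu> x y = (\<chi> i. L_deriv P (\<lambda>\<nu>. L_deriv P u \<nu> x $ i) \<mu> y)"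

definition C2 :: "'w measure \<Rightarrow> ((real^'n) measure \<Rightarrow> real) set" where
  "C2 P = {u \<in> C1 P.
     (\<forall>\<mu>\<in>P2. \<forall>x. L_deriv P u \<mu> differentiable (at x)) \<and>
     continuous_map (prod_topology W2_top euclidean) euclidean
       (\<lambda>(\<mu>, x). dx_L_deriv P u \<mu> x) \<and>
     (\<forall>x i. (\<lambda>\<nu>. L_deriv P u \<nu> x $ i) \<in> C1 P) \<and>
     continuous_map (prod_topology W2_top (prod_topology euclidean euclidean)) euclidean
       (\<lambda>(\<mu>, x, y). L_deriv2 P u \<mu> x y)}"

section \<open>Smooth functions\<close>

text \<open>Derivatives of all orders are treated componentwise. A scalar component of a derivative is
  a map \<open>f \<mu> x\<close> on \<open>P2 \<times> (R^d)^j\<close>, where the tuple of spatial variables is a function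
  \<open>x \<in> {..<j} \<rightarrow>\<^sub>E UNIV\<close>. Differentiating it again yields the components of the \<open>j\<close> partial
  derivatives, on the same domain, and those of the L-derivative, whose new spatial variable is
  \<open>x j\<close>.\<close>

definition dx_comp ::
  "nat \<Rightarrow> 'n \<Rightarrow> ((real^'n) measure \<Rightarrow> (nat \<Rightarrow> real^'n) \<Rightarrow> real)
     \<Rightarrow> (real^'n) measure \<Rightarrow> (nat \<Rightarrow> real^'n) \<Rightarrow> real" where
  "dx_comp i k f \<mu> x = frechet_derivative (\<lambda>z. f \<mu> (x(i := z))) (at (x i)) (axis k 1)"

definition L_comp ::
  "'w measure \<Rightarrow> nat \<Rightarrow> 'n \<Rightarrow> ((real^'n) measure \<Rightarrow> (nat \<Rightarrow> real^'n) \<Rightarrow> real)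
     \<Rightarrow> (real^'n) measure \<Rightarrow> (nat \<Rightarrow> real^'n) \<Rightarrow> real" where
  "L_comp P j k f \<mu> x = L_deriv P (\<lambda>\<nu>. f \<nu> (restrict x {..<j})) \<mu> (x j) $ k"

text \<open>\<open>Cn P n j f\<close>: the map \<open>f\<close> with \<open>j\<close> spatial variables is continuous and has jointly
  continuous derivatives up to order \<open>n\<close>.\<close>

primrec Cn ::
  "'w measure \<Rightarrow> nat \<Rightarrow> nat \<Rightarrow> ((real^'n) measure \<Rightarrow> (nat \<Rightarrow> real^'n) \<Rightarrow> real) \<Rightarrow> bool" where
  "Cn P 0 j f \<longleftrightarrow>
     continuous_map (prod_topology W2_top (product_topology (\<lambda>_. euclidean) {..<j})) euclideanreal
       (\<lambda>(\<mu>, x). f \<mu> x)"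
| "Cn P (Suc n) j f \<longleftrightarrow>
     continuous_map (prod_topology W2_top (product_topology (\<lambda>_. euclidean) {..<j})) euclideanreal
       (\<lambda>(\<mu>, x). f \<mu> x) \<and>
     (\<forall>i<j. (\<forall>\<mu>\<in>P2. \<forall>x \<in> {..<j} \<rightarrow>\<^sub>E UNIV. (\<lambda>z. f \<mu> (x(i := z))) differentiable (at (x i))) \<and>
        (\<forall>k. Cn P n j (dx_comp i k f))) \<and>
     (\<forall>x \<in> {..<j} \<rightarrow>\<^sub>E UNIV. (\<lambda>\<mu>. f \<mu> x) \<in> C1 P) \<and>
     (\<forall>k. Cn P n (Suc j) (L_comp P j k f))"

definition C_infty :: "'w measure \<Rightarrow> ((real^'n) measure \<Rightarrow> real) set" where
  "C_infty P = {u. \<forall>n. Cn P n 0 (\<lambda>\<mu> _. u \<mu>)}"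

end

theory Submission
  imports Defs
begin

text \<open>
  The approximants evaluate \<open>u\<close> at a random empirical measure. Fix a scale \<open>K\<close>. A point \<open>y\<close> is
  truncated to the point of the box \<open>[-K, K]^d\<close> with coordinates \<open>K * sin (y_a / K)\<close>, and this point
  is in turn replaced by a random grid point: for each coordinate \<open>a\<close>, \<open>m\<close> coins of bias
  \<open>(1 + sin (y_a / K)) / 2\<close> are tossed, and the rescaled number of heads is a random number with
  mean \<open>K * sin (y_a / K)\<close>. Draw \<open>n\<close> independent points from \<open>\<mu>\<close> and treat each of them in this
  way; the approximant at \<open>\<mu>\<close> is the expectation of \<open>u\<close> at the empirical measure of the resulting
  grid points. There are finitely many outcomes, and each has as its probability a product of
  integrals of trigonometric polynomials against \<open>\<mu>\<close>. Polynomials in such integrals and in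
  trigonometric functions of finitely many spatial variables are closed under all derivatives
  (\<open>cylinder_Cn\<close>), so that the approximants lie in \<^const>\<open>C_infty\<close>.

  Convergence is a law of large numbers. The frequencies of the coin patterns are close to their
  probabilities (\<open>frequency_deviation\<close>), so that the random empirical measure is close to \<open>\<mu>\<close> outside
  an event of small probability (\<open>W2_empirical_nodes\<close>); the truncation error is uniformly small on
  compact sets of measures (\<open>truncation_error_uniform\<close>). On the exceptional event \<open>u\<close> is still
  evaluated at empirical measures of points of the box. These belong to a compact set of measures
  (\<open>compact_superset_of_box_empiricals\<close>), so \<open>u\<close> is bounded there independently of \<open>n\<close>, and \<open>n\<close> may
  be chosen after this bound.

  The weight of a coin is affine in its bias. Differentiating the expectation in the bias of one coin
  therefore produces the expectation of the difference of \<open>u\<close> between the two outcomes of that coin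
  (\<open>sampled_partial\<close>), and no derivative falls on \<open>u\<close>. If \<open>u\<close> is continuously L-differentiable, the
  mean value theorem turns the difference into \<open>2 * K / (m * n)\<close> times a value of the L-derivative of
  \<open>u\<close> at a nearby empirical measure (\<open>coin_diff_mean_value\<close>). The derivative of the bias is
  \<open>cos (x_a / K) / (2 * K)\<close>, and there are \<open>m * n\<close> coins for each coordinate. The L-derivative of the
  approximant is thus \<open>cos (x_a / K)\<close> times an average of expectations to which the law of large numbers
  applies. Second derivatives lead in the same way
  to differences in two coins: two coins of the same sample yield the spatial derivative of the
  L-derivative, up to a term of order \<open>1 / n\<close>, and coins of two different samples yield the second
  L-derivative. The diagonal pairs of coins are a negligible fraction.

  The L-derivatives computed for the approximants are identified with \<^const>\<open>L_deriv\<close> by uniqueness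
  (\<open>has_L_deriv_unique\<close>): at an empirical measure the L-derivative is the derivative with respect to the
  position of one atom, and empirical measures with a prescribed atom are dense.
\<close>

section \<open>Square-integrable functions\<close>

lemma integrable_mult_square:
  fixes f g :: "'x \<Rightarrow> real"
  assumes [measurable]: "f \<in> borel_measurable M" "g \<in> borel_measurable M"
    and f: "integrable M (\<lambda>x. (f x)\<^sup>2)" and g: "integrable M (\<lambda>x. (g x)\<^sup>2)"
  shows "integrable M (\<lambda>x. f x * g x)"
proof (rule Bochner_Integration.integrable_bound[OF Bochner_Integration.integrable_add[OF f g]])
  show "AE x in M. norm (f x * g x) \<le> norm ((f x)\<^sup>2 + (g x)\<^sup>2)"
  proof (rule AE_I2)
    fix x
    have "2 * (\<bar>f x\<bar> * \<bar>g x\<bar>) \<le> (f x)\<^sup>2 + (g x)\<^sup>2"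
      using zero_le_power2[of "\<bar>f x\<bar> - \<bar>g x\<bar>"] by (simp add: power2_diff)
    moreover have "0 \<le> \<bar>f x\<bar> * \<bar>g x\<bar>" by simp
    ultimately have "\<bar>f x\<bar> * \<bar>g x\<bar> \<le> (f x)\<^sup>2 + (g x)\<^sup>2" by linarith
    then show "norm (f x * g x) \<le> norm ((f x)\<^sup>2 + (g x)\<^sup>2)" by (simp add: abs_mult)
  qed
qed measurable

lemma nonneg_quadratic_discriminant:
  fixes A B C :: real
  assumes A: "0 \<le> A" and q: "\<And>s. 0 \<le> s\<^sup>2 * A - 2 * s * C + B"
  shows "C\<^sup>2 \<le> A * B"
proof (cases "A = 0")
  case True
  have "C = 0"
  proof (rule ccontr)
    assume "C \<noteq> 0"
    with q[of "(B + 1) / (2 * C)"] True show False by simp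
  qed
  with True show ?thesis by simp
next
  case False
  have "0 \<le> A * ((C/A)\<^sup>2 * A - 2 * (C/A) * C + B)"
    using q[of "C/A"] A by (intro mult_nonneg_nonneg) auto
  also have "\<dots> = A * B - C\<^sup>2" using False by (simp add: field_simps power2_eq_square)
  finally show ?thesis by simp
qed

text \<open>The quadratic polynomial \<open>s \<mapsto> \<integral> (s * f - g)\<^sup>2\<close> is nonnegative.\<close>

lemma Cauchy_Schwarz_integral:
  fixes f g :: "'x \<Rightarrow> real"
  assumes [measurable]: "f \<in> borel_measurable M" "g \<in> borel_measurable M"
    and f: "integrable M (\<lambda>x. (f x)\<^sup>2)" and g: "integrable M (\<lambda>x. (g x)\<^sup>2)"
  shows "(\<integral>x. f x * g x \<partial>M) \<le> sqrt (\<integral>x. (f x)\<^sup>2 \<partial>M) * sqrt (\<integral>x. (g x)\<^sup>2 \<partial>M)"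
proof -
  let ?A = "\<integral>x. (f x)\<^sup>2 \<partial>M" and ?B = "\<integral>x. (g x)\<^sup>2 \<partial>M" and ?C = "\<integral>x. f x * g x \<partial>M"
  have fg: "integrable M (\<lambda>x. f x * g x)" by (rule integrable_mult_square[OF assms])
  have A0: "0 \<le> ?A" "0 \<le> ?B" by simp_all
  have q: "0 \<le> s\<^sup>2 * ?A - 2 * s * ?C + ?B" for s
  proof -
    have "0 \<le> (\<integral>x. (s * f x - g x)\<^sup>2 \<partial>M)" by simp
    also have "\<dots> = (\<integral>x. s\<^sup>2 * (f x)\<^sup>2 - (2 * s) * (f x * g x) + (g x)\<^sup>2 \<partial>M)"
      by (intro Bochner_Integration.integral_cong) (auto simp: power2_eq_square algebra_simps)
    also have "\<dots> = s\<^sup>2 * ?A - 2 * s * ?C + ?B"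
      using f g fg by simp
    finally show ?thesis .
  qed
  have "?C\<^sup>2 \<le> ?A * ?B"
    by (rule nonneg_quadratic_discriminant[OF A0(1) q])
  then have "sqrt (?C\<^sup>2) \<le> sqrt (?A * ?B)" by (rule real_sqrt_le_mono)
  then have "\<bar>?C\<bar> \<le> sqrt ?A * sqrt ?B" unfolding real_sqrt_abs real_sqrt_mult .
  then show ?thesis by linarith
qed

lemma integrable_square_add:
  fixes f g :: "'x \<Rightarrow> real"
  assumes [measurable]: "f \<in> borel_measurable M" "g \<in> borel_measurable M"
    and f: "integrable M (\<lambda>x. (f x)\<^sup>2)" and g: "integrable M (\<lambda>x. (g x)\<^sup>2)"
  shows "integrable M (\<lambda>x. (f x + g x)\<^sup>2)"
  using f g integrable_mult_square[OF assms] by (simp add: power2_sum mult.assoc)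

lemma Minkowski_integral:
  fixes f g :: "'x \<Rightarrow> real"
  assumes [measurable]: "f \<in> borel_measurable M" "g \<in> borel_measurable M"
    and f: "integrable M (\<lambda>x. (f x)\<^sup>2)" and g: "integrable M (\<lambda>x. (g x)\<^sup>2)"
  shows "sqrt (\<integral>x. (f x + g x)\<^sup>2 \<partial>M) \<le> sqrt (\<integral>x. (f x)\<^sup>2 \<partial>M) + sqrt (\<integral>x. (g x)\<^sup>2 \<partial>M)"
proof (rule real_le_lsqrt)
  have "(\<integral>x. (f x + g x)\<^sup>2 \<partial>M) = (\<integral>x. (f x)\<^sup>2 \<partial>M) + (\<integral>x. (g x)\<^sup>2 \<partial>M) + 2 * (\<integral>x. f x * g x \<partial>M)"
    using f g integrable_mult_square[OF assms] by (simp add: power2_sum mult.assoc)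
  then show "(\<integral>x. (f x + g x)\<^sup>2 \<partial>M) \<le> (sqrt (\<integral>x. (f x)\<^sup>2 \<partial>M) + sqrt (\<integral>x. (g x)\<^sup>2 \<partial>M))\<^sup>2"
    using Cauchy_Schwarz_integral[OF assms] by (simp add: power2_sum)
qed simp

section \<open>Couplings\<close>

lemma P2D:
  assumes "\<mu> \<in> P2"
  shows "prob_space \<mu>" "sets \<mu> = sets borel" "space \<mu> = UNIV" "integrable \<mu> (\<lambda>x. (norm x)\<^sup>2)"
proof -
  from assms show "prob_space \<mu>" "integrable \<mu> (\<lambda>x. (norm x)\<^sup>2)" and s: "sets \<mu> = sets borel"
    unfolding P2_def by simp_all
  show "space \<mu> = UNIV" using sets_eq_imp_space_eq[OF s] by simp
qed

lemma couplingD: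
  assumes "\<pi> \<in> couplings \<mu> \<nu>"
  shows "prob_space \<pi>" "sets \<pi> = sets borel" "space \<pi> = UNIV"
    "distr \<pi> borel fst = \<mu>" "distr \<pi> borel snd = \<nu>"
proof -
  from assms show "prob_space \<pi>" "distr \<pi> borel fst = \<mu>" "distr \<pi> borel snd = \<nu>"
    and s: "sets \<pi> = sets borel"
    unfolding couplings_def borel_prod by blast+
  show "space \<pi> = UNIV" using sets_eq_imp_space_eq[OF s] by simp
qed

lemma coupling_measurable:
  fixes \<mu> \<nu> :: "'a::euclidean_space measure"
  assumes \<pi>: "\<pi> \<in> couplings \<mu> \<nu>"
  shows "fst \<in> borel_measurable \<pi>" "snd \<in> borel_measurable \<pi>"
  unfolding measurable_cong_sets[OF couplingD(2)[OF \<pi>] refl, of borel]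
  by (rule borel_measurable_continuous_onI, rule continuous_on_fst[OF continuous_on_id],
      rule borel_measurable_continuous_onI, rule continuous_on_snd[OF continuous_on_id])

abbreviation transport_cost :: "('a::euclidean_space \<times> 'a) measure \<Rightarrow> real" where
  "transport_cost \<pi> \<equiv> \<integral>z. (norm (fst z - snd z))\<^sup>2 \<partial>\<pi>"

lemma coupling_sq_integrable:
  fixes \<mu> \<nu> :: "'a::euclidean_space measure"
  assumes \<pi>: "\<pi> \<in> couplings \<mu> \<nu>" and \<mu>: "\<mu> \<in> P2" and \<nu>: "\<nu> \<in> P2"
  shows "integrable \<pi> (\<lambda>z. (norm (fst z))\<^sup>2)" "integrable \<pi> (\<lambda>z. (norm (snd z))\<^sup>2)"
    "integrable \<pi> (\<lambda>z. (norm (fst z - snd z))\<^sup>2)"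
proof -
  note [measurable] = coupling_measurable[OF \<pi>]
  note d = couplingD[OF \<pi>]
  show 1: "integrable \<pi> (\<lambda>z. (norm (fst z))\<^sup>2)"
    using P2D(4)[OF \<mu>] unfolding d(4)[symmetric] by (subst (asm) integrable_distr_eq) measurable
  show 2: "integrable \<pi> (\<lambda>z. (norm (snd z))\<^sup>2)"
    using P2D(4)[OF \<nu>] unfolding d(5)[symmetric] by (subst (asm) integrable_distr_eq) measurable
  have "integrable \<pi> (\<lambda>z. (norm (fst z) + norm (snd z))\<^sup>2)"
    by (rule integrable_square_add[OF _ _ 1 2]) measurable
  then show "integrable \<pi> (\<lambda>z. (norm (fst z - snd z))\<^sup>2)"
  proof (rule Bochner_Integration.integrable_bound)
    show "AE z in \<pi>. norm ((norm (fst z - snd z))\<^sup>2) \<le> norm ((norm (fst z) + norm (snd z))\<^sup>2)"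
    proof (rule AE_I2)
      fix z :: "'a \<times> 'a"
      have "(norm (fst z - snd z))\<^sup>2 \<le> (norm (fst z) + norm (snd z))\<^sup>2"
        by (rule power_mono[OF norm_triangle_ineq4 norm_ge_zero])
      then show "norm ((norm (fst z - snd z))\<^sup>2) \<le> norm ((norm (fst z) + norm (snd z))\<^sup>2)"
        by simp
    qed
  qed measurable
qed

lemma nn_integral_coupling_cost:
  fixes \<mu> \<nu> :: "'a::euclidean_space measure"
  assumes \<pi>: "\<pi> \<in> couplings \<mu> \<nu>" and \<mu>: "\<mu> \<in> P2" and \<nu>: "\<nu> \<in> P2"
  shows "(\<integral>\<^sup>+ z. ennreal ((norm (fst z - snd z))\<^sup>2) \<partial>\<pi>) = ennreal (transport_cost \<pi>)"
  by (rule nn_integral_eq_integral[OF coupling_sq_integrable(3)[OF assms]]) simp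

lemma W2_le_coupling:
  fixes \<mu> \<nu> :: "'a::euclidean_space measure"
  assumes \<pi>: "\<pi> \<in> couplings \<mu> \<nu>" and \<mu>: "\<mu> \<in> P2" and \<nu>: "\<nu> \<in> P2"
  shows "W2 \<mu> \<nu> \<le> sqrt (transport_cost \<pi>)"
proof -
  have "(INF \<pi>\<in>couplings \<mu> \<nu>. \<integral>\<^sup>+ z. ennreal ((norm (fst z - snd z))\<^sup>2) \<partial>\<pi>)
      \<le> ennreal (transport_cost \<pi>)"
    unfolding nn_integral_coupling_cost[OF assms, symmetric] by (rule INF_lower[OF \<pi>])
  then show ?thesis unfolding W2_def
    by (intro real_sqrt_le_mono enn2real_leI) auto
qed

lemma pair_measure_coupling:
  fixes \<mu> \<nu> :: "'a::euclidean_space measure"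
  assumes \<mu>: "\<mu> \<in> P2" and \<nu>: "\<nu> \<in> P2"
  shows "\<mu> \<Otimes>\<^sub>M \<nu> \<in> couplings \<mu> \<nu>"
proof -
  interpret \<mu>: prob_space \<mu> by (rule P2D(1)[OF \<mu>])
  interpret \<nu>: prob_space \<nu> by (rule P2D(1)[OF \<nu>])
  interpret pair_prob_space \<mu> \<nu> ..
  have s: "sets (\<mu> \<Otimes>\<^sub>M \<nu>) = sets (borel \<Otimes>\<^sub>M borel)"
    by (rule sets_pair_measure_cong) (simp_all add: P2D[OF \<mu>] P2D[OF \<nu>])
  have 1: "distr (\<mu> \<Otimes>\<^sub>M \<nu>) borel fst = \<mu>"
    using \<nu>.distr_pair_fst[of \<mu>] distr_cong[OF refl, of borel \<mu> "\<mu> \<Otimes>\<^sub>M \<nu>" fst fst] P2D(2)[OF \<mu>] by metis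
  have "distr (\<mu> \<Otimes>\<^sub>M \<nu>) \<nu> snd = \<nu>"
  proof (rule measure_eqI)
    fix A assume "A \<in> sets (distr (\<mu> \<Otimes>\<^sub>M \<nu>) \<nu> snd)"
    then have A: "A \<in> sets \<nu>" by simp
    have "emeasure (distr (\<mu> \<Otimes>\<^sub>M \<nu>) \<nu> snd) A = emeasure (\<mu> \<Otimes>\<^sub>M \<nu>) (UNIV \<times> A)"
      using A by (subst emeasure_distr) (auto simp: space_pair_measure P2D[OF \<mu>] P2D[OF \<nu>] intro!: arg_cong[where f="emeasure (\<mu> \<Otimes>\<^sub>M \<nu>)"])
    also have "\<dots> = emeasure \<nu> A"
      using \<nu>.emeasure_pair_measure_Times[of UNIV \<mu> A] A \<mu>.emeasure_space_1 P2D[OF \<mu>] by auto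
    finally show "emeasure (distr (\<mu> \<Otimes>\<^sub>M \<nu>) \<nu> snd) A = emeasure \<nu> A" .
  qed simp
  then have 2: "distr (\<mu> \<Otimes>\<^sub>M \<nu>) borel snd = \<nu>"
    using distr_cong[OF refl, of borel \<nu> "\<mu> \<Otimes>\<^sub>M \<nu>" snd snd] P2D(2)[OF \<nu>] by metis
  show ?thesis
    unfolding couplings_def using s 1 2 prob_space_axioms by simp
qed

lemma near_optimal_coupling:
  fixes \<mu> \<nu> :: "'a::euclidean_space measure"
  assumes \<mu>: "\<mu> \<in> P2" and \<nu>: "\<nu> \<in> P2" and "0 < \<epsilon>"
  obtains \<pi> where "\<pi> \<in> couplings \<mu> \<nu>" "sqrt (transport_cost \<pi>) < W2 \<mu> \<nu> + \<epsilon>"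
proof -
  let ?I = "INF \<pi>\<in>couplings \<mu> \<nu>. \<integral>\<^sup>+ z. ennreal ((norm (fst z - snd z))\<^sup>2) \<partial>\<pi>"
  have W0: "0 \<le> W2 \<mu> \<nu>" unfolding W2_def by simp
  have "?I \<le> ennreal (\<integral>z. (norm (fst z - snd z))\<^sup>2 \<partial>(\<mu> \<Otimes>\<^sub>M \<nu>))"
    unfolding nn_integral_coupling_cost[OF pair_measure_coupling[OF \<mu> \<nu>] \<mu> \<nu>, symmetric]
    by (rule INF_lower[OF pair_measure_coupling[OF \<mu> \<nu>]])
  then have fin: "?I < \<infinity>" by (simp add: order_le_less_trans ennreal_less_top)
  then have I: "?I = ennreal ((W2 \<mu> \<nu>)\<^sup>2)"
    unfolding W2_def by (auto simp: less_top)
  have "?I < ennreal ((W2 \<mu> \<nu> + \<epsilon>)\<^sup>2)"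
    unfolding I using \<open>0 < \<epsilon>\<close> W0 by (intro ennreal_lessI) (auto intro!: power_strict_mono)
  then obtain \<pi> where \<pi>: "\<pi> \<in> couplings \<mu> \<nu>"
    "(\<integral>\<^sup>+ z. ennreal ((norm (fst z - snd z))\<^sup>2) \<partial>\<pi>) < ennreal ((W2 \<mu> \<nu> + \<epsilon>)\<^sup>2)"
    unfolding INF_less_iff by blast
  then have "transport_cost \<pi> < (W2 \<mu> \<nu> + \<epsilon>)\<^sup>2"
    unfolding nn_integral_coupling_cost[OF \<pi>(1) \<mu> \<nu>] by (simp add: ennreal_less_iff)
  then have "sqrt (transport_cost \<pi>) < W2 \<mu> \<nu> + \<epsilon>"
    using W0 \<open>0 < \<epsilon>\<close> by (intro real_less_lsqrt) auto
  with \<pi>(1) show ?thesis by (rule that)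
qed

lemma W2_nonneg [simp]: "0 \<le> W2 \<mu> \<nu>"
  unfolding W2_def by simp

lemma coupling_swap:
  assumes \<pi>: "\<pi> \<in> couplings \<mu> \<nu>"
  shows "distr \<pi> (borel \<Otimes>\<^sub>M borel) (\<lambda>z. (snd z, fst z)) \<in> couplings \<nu> \<mu>"
proof -
  note [measurable] = coupling_measurable[OF \<pi>]
  interpret prob_space \<pi> by (rule couplingD(1)[OF \<pi>])
  show ?thesis unfolding couplings_def
  proof (intro CollectI conjI)
    show "prob_space (distr \<pi> (borel \<Otimes>\<^sub>M borel) (\<lambda>z. (snd z, fst z)))"
      by (rule prob_space_distr) measurable
    have "distr (distr \<pi> (borel \<Otimes>\<^sub>M borel) (\<lambda>z. (snd z, fst z))) borel fst = distr \<pi> borel snd"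
      by (subst distr_distr) (measurable, simp add: o_def)
    then show "distr (distr \<pi> (borel \<Otimes>\<^sub>M borel) (\<lambda>z. (snd z, fst z))) borel fst = \<nu>"
      unfolding couplingD(5)[OF \<pi>] .
    have "distr (distr \<pi> (borel \<Otimes>\<^sub>M borel) (\<lambda>z. (snd z, fst z))) borel snd = distr \<pi> borel fst"
      by (subst distr_distr) (measurable, simp add: o_def)
    then show "distr (distr \<pi> (borel \<Otimes>\<^sub>M borel) (\<lambda>z. (snd z, fst z))) borel snd = \<mu>"
      unfolding couplingD(4)[OF \<pi>] .
  qed simp
qed

lemma W2_commute: "W2 \<mu> \<nu> = W2 \<nu> (\<mu> :: 'a::euclidean_space measure)"
proof -
  have le: "(INF \<pi>\<in>couplings \<nu> \<mu>. \<integral>\<^sup>+ z. ennreal ((norm (fst z - snd z))\<^sup>2) \<partial>\<pi>)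
    \<le> (INF \<pi>\<in>couplings \<mu> \<nu>. \<integral>\<^sup>+ z. ennreal ((norm (fst z - snd z))\<^sup>2) \<partial>\<pi>)" for \<mu> \<nu> :: "'a measure"
  proof (rule INF_mono)
    fix \<pi> assume \<pi>: "\<pi> \<in> couplings \<mu> \<nu>"
    note [measurable] = coupling_measurable[OF \<pi>]
    show "\<exists>\<pi>'\<in>couplings \<nu> \<mu>. (\<integral>\<^sup>+ z. ennreal ((norm (fst z - snd z))\<^sup>2) \<partial>\<pi>')
        \<le> (\<integral>\<^sup>+ z. ennreal ((norm (fst z - snd z))\<^sup>2) \<partial>\<pi>)"
      by (rule bexI[OF _ coupling_swap[OF \<pi>]], subst nn_integral_distr)
         (auto simp: norm_minus_commute)
  qed
  show ?thesis unfolding W2_def using le[of \<mu> \<nu>] le[of \<nu> \<mu>] by simp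
qed

lemma L2D:
  assumes "X \<in> L2 Q"
  shows "X \<in> borel_measurable Q" "integrable Q (\<lambda>\<omega>. (norm (X \<omega>))\<^sup>2)"
  using assms unfolding L2_def by auto

lemma distr_P2:
  assumes "prob_space Q" "X \<in> L2 Q"
  shows "distr Q borel X \<in> P2"
proof -
  interpret prob_space Q by fact
  note [measurable] = L2D(1)[OF assms(2)]
  show ?thesis unfolding P2_def
    using L2D[OF assms(2)] by (auto intro!: prob_space_distr simp: integrable_distr_eq)
qed

lemma L2_add: "X \<in> L2 Q \<Longrightarrow> Y \<in> L2 Q \<Longrightarrow> (\<lambda>\<omega>. X \<omega> + Y \<omega>) \<in> L2 Q"
proof -
  assume X: "X \<in> L2 Q" and Y: "Y \<in> L2 Q"
  note [measurable] = L2D(1)[OF X] L2D(1)[OF Y]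
  have "integrable Q (\<lambda>z. (norm (X z) + norm (Y z))\<^sup>2)"
    by (rule integrable_square_add) (use L2D[OF X] L2D[OF Y] in auto)
  then have "integrable Q (\<lambda>z. (norm (X z + Y z))\<^sup>2)"
    by (rule Bochner_Integration.integrable_bound) (auto intro!: power_mono norm_triangle_ineq)
  then show ?thesis unfolding L2_def by auto
qed

lemma L2_uminus: "X \<in> L2 Q \<Longrightarrow> (\<lambda>\<omega>. - X \<omega>) \<in> L2 Q"
  unfolding L2_def by auto

lemma L2_diff: "X \<in> L2 Q \<Longrightarrow> Y \<in> L2 Q \<Longrightarrow> (\<lambda>\<omega>. X \<omega> - Y \<omega>) \<in> L2 Q"
  using L2_add[OF _ L2_uminus, of X Q Y] by simp

lemma W2_distr_le:
  fixes X Y :: "'w \<Rightarrow> 'a::euclidean_space"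
  assumes Q: "prob_space Q" and X: "X \<in> L2 Q" and Y: "Y \<in> L2 Q"
  shows "W2 (distr Q borel X) (distr Q borel Y) \<le> L2_norm Q (\<lambda>\<omega>. X \<omega> - Y \<omega>)"
proof -
  interpret prob_space Q by fact
  note [measurable] = L2D(1)[OF X] L2D(1)[OF Y]
  let ?\<pi> = "distr Q (borel \<Otimes>\<^sub>M borel) (\<lambda>\<omega>. (X \<omega>, Y \<omega>))"
  have "?\<pi> \<in> couplings (distr Q borel X) (distr Q borel Y)"
    unfolding couplings_def by (auto intro!: prob_space_distr simp: distr_distr o_def)
  from W2_le_coupling[OF this distr_P2[OF Q X] distr_P2[OF Q Y]]
  show ?thesis unfolding L2_norm_def by (simp add: integral_distr)
qed

section \<open>The Wasserstein metric\<close>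

text \<open>The index of a cell is the first point of a countable dense set that is closer than \<open>\<epsilon> / 2\<close>.\<close>

lemma countable_cell_index:
  fixes \<epsilon> :: real
  assumes "0 < \<epsilon>"
  obtains c :: "'a::euclidean_space \<Rightarrow> nat"
  where "c \<in> measurable borel (count_space UNIV)" "\<And>x y. c x = c y \<Longrightarrow> norm (x - y) \<le> \<epsilon>"
proof -
  obtain D :: "'a set" where D: "countable D" "\<And>X. open X \<Longrightarrow> X \<noteq> {} \<Longrightarrow> \<exists>d\<in>D. d \<in> X"
    by (erule countable_dense_setE)
  have D0: "D \<noteq> {}" using D(2)[of UNIV] by auto
  define e where "e = from_nat_into D"
  define c where "c x = (LEAST i. dist x (e i) < \<epsilon> / 2)" for x :: 'a
  have near: "dist x (e (c x)) < \<epsilon> / 2" for x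
  proof -
    obtain d where "d \<in> D" "d \<in> ball x (\<epsilon> / 2)" using D(2)[of "ball x (\<epsilon> / 2)"] assms by auto
    then obtain i where "dist x (e i) < \<epsilon> / 2"
      unfolding e_def using from_nat_into_surj[OF D(1)] by (auto simp: mem_ball)
    then show ?thesis unfolding c_def by (rule LeastI)
  qed
  have "c \<in> measurable borel (count_space UNIV)" unfolding c_def by measurable
  moreover have "norm (x - y) \<le> \<epsilon>" if "c x = c y" for x y
    using near[of x] near[of y] that dist_triangle_half_l[of x "e (c x)" \<epsilon> y]
    by (simp add: dist_norm norm_minus_commute)
  ultimately show ?thesis by (rule that)
qed

lemma distr_eq_by_nn_integral:
  assumes f: "f \<in> measurable M N" and s: "sets K = sets N"
    and i: "\<And>h. h \<in> borel_measurable N \<Longrightarrow> (\<integral>\<^sup>+x. h (f x) \<partial>M) = (\<integral>\<^sup>+y. h y \<partial>K)"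
  shows "distr M N f = K"
proof (rule measure_eqI)
  fix A assume "A \<in> sets (distr M N f)"
  then have A: "A \<in> sets N" "A \<in> sets K" using s by auto
  have "emeasure (distr M N f) A = (\<integral>\<^sup>+x. indicator A x \<partial>distr M N f)"
    using A by simp
  also have "\<dots> = (\<integral>\<^sup>+x. indicator A (f x) \<partial>M)"
    using f A by (intro nn_integral_distr) auto
  also have "\<dots> = (\<integral>\<^sup>+x. indicator A x \<partial>K)"
    using A by (intro i) auto
  finally show "emeasure (distr M N f) A = emeasure K A" using A by simp
qed (simp add: s)

lemma AE_cell_not_null:
  fixes c :: "'a::euclidean_space \<Rightarrow> nat"
  assumes c: "c \<in> measurable borel (count_space UNIV)"
    and N: "prob_space N" "sets N = sets borel"
  shows "AE y in N. measure N (c -` {c y}) \<noteq> 0"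
proof -
  interpret prob_space N by fact
  have sp: "space N = UNIV" using sets_eq_imp_space_eq[OF N(2)] by simp
  have s: "c -` {i} \<in> sets N" for i
    using measurable_sets[OF c, of "{i}"] N(2) by simp
  have "AE y in N. \<forall>i. c y = i \<longrightarrow> measure N (c -` {i}) \<noteq> 0"
    unfolding AE_all_countable
  proof
    fix i
    show "AE y in N. c y = i \<longrightarrow> measure N (c -` {i}) \<noteq> 0"
    proof (cases "measure N (c -` {i}) = 0")
      case True
      then have "c -` {i} \<in> null_sets N" using s[of i] by (auto simp: null_sets_def emeasure_eq_measure)
      then have "AE y in N. y \<notin> c -` {i}" by (rule AE_not_in)
      then show ?thesis by (rule AE_mp) auto
    qed auto
  qed
  then show ?thesis by (rule AE_mp) auto
qed

text \<open>A cell indicator divided by the mass of the cell is a probability density; this gives the marginals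
  in the gluing below.\<close>

lemma nn_integral_normalised_cell:
  assumes N: "prob_space N" and c: "c \<in> measurable N (count_space UNIV)"
    and m: "measure N {r \<in> space N. c r = i} = m" "m \<noteq> 0"
  shows "(\<integral>\<^sup>+r. (if c r = i then ennreal (1 / m) else 0) * h \<partial>N) = h"
proof -
  interpret prob_space N by fact
  have "{r \<in> space N. c r = i} = c -` {i} \<inter> space N" by auto
  then have s: "{r \<in> space N. c r = i} \<in> sets N" using measurable_sets[OF c, of "{i}"] by simp
  have "(\<integral>\<^sup>+r. (if c r = i then ennreal (1 / m) else 0) * h \<partial>N)
      = (\<integral>\<^sup>+r. (ennreal (1 / m) * h) * indicator {r \<in> space N. c r = i} r \<partial>N)"
    by (rule nn_integral_cong) auto
  also have "\<dots> = ennreal (1 / m) * h * emeasure N {r \<in> space N. c r = i}"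
    by (rule nn_integral_cmult_indicator[OF s])
  also have "\<dots> = h * (ennreal (1 / m) * ennreal m)" unfolding emeasure_eq_measure m(1) by (simp only: ac_simps)
  also have "ennreal (1 / m) * ennreal m = 1"
    using m by (subst ennreal_mult[symmetric]) auto
  finally show ?thesis by simp
qed

text \<open>Two couplings that share the marginal \<open>\<nu>\<close> are glued along a countable partition of the space
  into small cells: given the cell of the shared coordinate, the two pairs are drawn independently.
  The two shared coordinates need not agree, but they lie in the same cell, so the error is at most
  the cell diameter. Conditioning on countably many cells takes the place of a disintegration.\<close>

lemma glue_couplings:
  fixes \<mu> \<nu> \<sigma> :: "'a::euclidean_space measure"
  assumes \<pi>: "\<pi> \<in> couplings \<mu> \<nu>" and \<rho>: "\<rho> \<in> couplings \<nu> \<sigma>"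
    and P: "\<mu> \<in> P2" "\<nu> \<in> P2" "\<sigma> \<in> P2" and "0 < \<epsilon>"
  obtains \<tau> where "\<tau> \<in> couplings \<mu> \<sigma>"
    "sqrt (transport_cost \<tau>)
      \<le> sqrt (transport_cost \<pi>) + \<epsilon> + sqrt (transport_cost \<rho>)"
proof -
  obtain c :: "'a \<Rightarrow> nat" where c [measurable]: "c \<in> measurable borel (count_space UNIV)"
    and cell: "\<And>x y. c x = c y \<Longrightarrow> norm (x - y) \<le> \<epsilon>"
    using countable_cell_index[OF \<open>0 < \<epsilon>\<close>, where 'a='a] by blast
  interpret \<pi>: prob_space \<pi> by (rule couplingD(1)[OF \<pi>])
  interpret \<rho>: prob_space \<rho> by (rule couplingD(1)[OF \<rho>])
  interpret \<nu>: prob_space \<nu> by (rule P2D(1)[OF P(2)])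
  interpret Q: pair_prob_space \<pi> \<rho> ..
  note [measurable] = coupling_measurable[OF \<pi>] coupling_measurable[OF \<rho>]
  define m where "m i = measure \<nu> (c -` {i})" for i
  \<comment> \<open>Density of the glued measure: the shared coordinates fall into the same cell.\<close>
  define w where "w z = (if c (snd (fst z)) = c (fst (snd z)) then ennreal (1 / m (c (snd (fst z)))) else 0)"
    for z :: "('a \<times> 'a) \<times> ('a \<times> 'a)"
  have cs: "c -` {i} \<in> sets \<nu>" for i
    using measurable_sets[OF c, of "{i}"] P2D(2)[OF P(2)] by simp
  have [measurable]: "(\<lambda>z. c (snd (fst z))) \<in> measurable (\<pi> \<Otimes>\<^sub>M \<rho>) (count_space UNIV)"
    by (rule measurable_compose[OF measurable_fst measurable_compose[OF coupling_measurable(2)[OF \<pi>] c]])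
  have [measurable]: "(\<lambda>z. c (fst (snd z))) \<in> measurable (\<pi> \<Otimes>\<^sub>M \<rho>) (count_space UNIV)"
    by (rule measurable_compose[OF measurable_snd measurable_compose[OF coupling_measurable(1)[OF \<rho>] c]])
  have "{z \<in> space (\<pi> \<Otimes>\<^sub>M \<rho>). c (snd (fst z)) = c (fst (snd z))}
      = (\<Union>i. {z \<in> space (\<pi> \<Otimes>\<^sub>M \<rho>). c (snd (fst z)) = i \<and> c (fst (snd z)) = i})"
    by auto
  also have "\<dots> \<in> sets (\<pi> \<Otimes>\<^sub>M \<rho>)" by measurable
  finally have S: "{z \<in> space (\<pi> \<Otimes>\<^sub>M \<rho>). c (snd (fst z)) = c (fst (snd z))} \<in> sets (\<pi> \<Otimes>\<^sub>M \<rho>)" .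
  have w [measurable]: "w \<in> borel_measurable (\<pi> \<Otimes>\<^sub>M \<rho>)"
    unfolding w_def by (rule measurable_If[OF _ _ S]) measurable
  define \<gamma> where "\<gamma> = density (\<pi> \<Otimes>\<^sub>M \<rho>) w"
  have AE\<nu>: "AE y in \<nu>. m (c y) \<noteq> 0"
    unfolding m_def by (rule AE_cell_not_null[OF c P2D(1,2)[OF P(2)]])
  have AE\<pi>: "AE p in \<pi>. m (c (snd p)) \<noteq> 0"
    using AE\<nu> unfolding couplingD(5)[OF \<pi>, symmetric] by (subst (asm) AE_distr_iff) auto
  have AE\<rho>: "AE p in \<rho>. m (c (fst p)) \<noteq> 0"
    using AE\<nu> unfolding couplingD(4)[OF \<rho>, symmetric] by (subst (asm) AE_distr_iff) auto
  have m\<rho>: "measure \<rho> {r \<in> space \<rho>. c (fst r) = i} = m i" for i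
    unfolding m_def couplingD(4)[OF \<rho>, symmetric]
    by (subst measure_distr) (use cs P2D(2)[OF P(2)] in \<open>auto intro!: arg_cong[where f="measure \<rho>"]\<close>)
  have m\<pi>: "measure \<pi> {r \<in> space \<pi>. c (snd r) = i} = m i" for i
    unfolding m_def couplingD(5)[OF \<pi>, symmetric]
    by (subst measure_distr) (use cs P2D(2)[OF P(2)] in \<open>auto intro!: arg_cong[where f="measure \<pi>"]\<close>)
  have i1: "(\<integral>\<^sup>+z. h (fst z) \<partial>\<gamma>) = (\<integral>\<^sup>+p. h p \<partial>\<pi>)" if h [measurable]: "h \<in> borel_measurable \<pi>" for h
  proof -
    have m1: "(\<lambda>z. w z * h (fst z)) \<in> borel_measurable (\<pi> \<Otimes>\<^sub>M \<rho>)" by measurable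
    have "(\<integral>\<^sup>+z. h (fst z) \<partial>\<gamma>) = (\<integral>\<^sup>+z. w z * h (fst z) \<partial>(\<pi> \<Otimes>\<^sub>M \<rho>))"
      unfolding \<gamma>_def by (rule nn_integral_density) measurable
    also have "\<dots> = (\<integral>\<^sup>+p. \<integral>\<^sup>+r. w (p, r) * h p \<partial>\<rho> \<partial>\<pi>)"
      using \<rho>.nn_integral_fst[OF m1] by simp
    also have "\<dots> = (\<integral>\<^sup>+p. h p \<partial>\<pi>)"
    proof (rule nn_integral_cong_AE, rule AE_mp[OF AE\<pi>], rule AE_I2, rule impI)
      fix p :: "'a \<times> 'a" assume p: "m (c (snd p)) \<noteq> 0"
      have "(\<integral>\<^sup>+r. w (p, r) * h p \<partial>\<rho>)
          = (\<integral>\<^sup>+r. (if c (fst r) = c (snd p) then ennreal (1 / m (c (snd p))) else 0) * h p \<partial>\<rho>)"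
        by (rule nn_integral_cong) (auto simp: w_def)
      also have "\<dots> = h p" by (rule nn_integral_normalised_cell[OF couplingD(1)[OF \<rho>] _ m\<rho> p]) measurable
      finally show "(\<integral>\<^sup>+r. w (p, r) * h p \<partial>\<rho>) = h p" .
    qed
    finally show ?thesis .
  qed
  have i2: "(\<integral>\<^sup>+z. h (snd z) \<partial>\<gamma>) = (\<integral>\<^sup>+p. h p \<partial>\<rho>)" if h [measurable]: "h \<in> borel_measurable \<rho>" for h
  proof -
    have m2: "(\<lambda>z. w z * h (snd z)) \<in> borel_measurable (\<pi> \<Otimes>\<^sub>M \<rho>)" by measurable
    have "(\<integral>\<^sup>+z. h (snd z) \<partial>\<gamma>) = (\<integral>\<^sup>+z. w z * h (snd z) \<partial>(\<pi> \<Otimes>\<^sub>M \<rho>))"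
      unfolding \<gamma>_def by (rule nn_integral_density) measurable
    also have "\<dots> = (\<integral>\<^sup>+r. \<integral>\<^sup>+p. w (p, r) * h r \<partial>\<pi> \<partial>\<rho>)"
      using Q.nn_integral_snd[OF m2] by simp
    also have "\<dots> = (\<integral>\<^sup>+p. h p \<partial>\<rho>)"
    proof (rule nn_integral_cong_AE, rule AE_mp[OF AE\<rho>], rule AE_I2, rule impI)
      fix p :: "'a \<times> 'a" assume p: "m (c (fst p)) \<noteq> 0"
      have "(\<integral>\<^sup>+r. w (r, p) * h p \<partial>\<pi>)
          = (\<integral>\<^sup>+r. (if c (snd r) = c (fst p) then ennreal (1 / m (c (fst p))) else 0) * h p \<partial>\<pi>)"
        by (rule nn_integral_cong) (auto simp: w_def)
      also have "\<dots> = h p" by (rule nn_integral_normalised_cell[OF couplingD(1)[OF \<pi>] _ m\<pi> p]) measurable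
      finally show "(\<integral>\<^sup>+r. w (r, p) * h p \<partial>\<pi>) = h p" .
    qed
    finally show ?thesis .
  qed
  have sg: "sets \<gamma> = sets (\<pi> \<Otimes>\<^sub>M \<rho>)" unfolding \<gamma>_def by simp
  have f1 [measurable]: "fst \<in> measurable \<gamma> \<pi>" and f2 [measurable]: "snd \<in> measurable \<gamma> \<rho>"
    unfolding measurable_cong_sets[OF sg refl] by measurable
  have d1: "distr \<gamma> \<pi> fst = \<pi>" by (rule distr_eq_by_nn_integral[OF f1 refl i1])
  have d2: "distr \<gamma> \<rho> snd = \<rho>" by (rule distr_eq_by_nn_integral[OF f2 refl i2])
  have "prob_space \<gamma>"
  proof
    have "emeasure \<gamma> (space \<gamma>) = (\<integral>\<^sup>+z. (\<lambda>_. 1) (fst z) \<partial>\<gamma>)" by simp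
    also have "\<dots> = 1" by (subst i1) (auto simp: \<pi>.emeasure_space_1)
    finally show "emeasure \<gamma> (space \<gamma>) = 1" .
  qed
  then interpret \<gamma>: prob_space \<gamma> .
  define \<tau> where "\<tau> = distr \<gamma> (borel \<Otimes>\<^sub>M borel) (\<lambda>z. (fst (fst z), snd (snd z)))"
  have \<tau>: "\<tau> \<in> couplings \<mu> \<sigma>"
    unfolding couplings_def
  proof (intro CollectI conjI)
    show "prob_space \<tau>" unfolding \<tau>_def by (rule \<gamma>.prob_space_distr) measurable
    have "distr \<tau> borel fst = distr (distr \<gamma> \<pi> fst) borel fst"
      unfolding \<tau>_def by (subst (1 2) distr_distr) (measurable, simp add: o_def)
    then show "distr \<tau> borel fst = \<mu>" unfolding d1 couplingD(4)[OF \<pi>] .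
    have "distr \<tau> borel snd = distr (distr \<gamma> \<rho> snd) borel snd"
      unfolding \<tau>_def by (subst (1 2) distr_distr) (measurable, simp add: o_def)
    then show "distr \<tau> borel snd = \<sigma>" unfolding d2 couplingD(5)[OF \<rho>] .
  qed (simp add: \<tau>_def)
  let ?A = "\<lambda>z :: ('a \<times> 'a) \<times> ('a \<times> 'a). norm (fst (fst z) - snd (fst z))"
  let ?B = "\<lambda>z :: ('a \<times> 'a) \<times> ('a \<times> 'a). norm (fst (snd z) - snd (snd z))"
  have iA: "integrable \<gamma> (\<lambda>z. (?A z)\<^sup>2)"
    using integrable_distr[OF f1, of "\<lambda>p. (norm (fst p - snd p))\<^sup>2"] coupling_sq_integrable(3)[OF \<pi> P(1,2)]
    unfolding d1 by simp
  have iB: "integrable \<gamma> (\<lambda>z. (?B z)\<^sup>2)"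
    using integrable_distr[OF f2, of "\<lambda>p. (norm (fst p - snd p))\<^sup>2"] coupling_sq_integrable(3)[OF \<rho> P(2,3)]
    unfolding d2 by simp
  have eA: "(\<integral>z. (?A z)\<^sup>2 \<partial>\<gamma>) = transport_cost \<pi>"
  proof -
    have "(\<integral>z. (norm (fst z - snd z))\<^sup>2 \<partial>distr \<gamma> \<pi> fst) = (\<integral>z. (?A z)\<^sup>2 \<partial>\<gamma>)"
      by (rule integral_distr[OF f1]) measurable
    then show ?thesis unfolding d1 by simp
  qed
  have eB: "(\<integral>z. (?B z)\<^sup>2 \<partial>\<gamma>) = transport_cost \<rho>"
  proof -
    have "(\<integral>z. (norm (fst z - snd z))\<^sup>2 \<partial>distr \<gamma> \<rho> snd) = (\<integral>z. (?B z)\<^sup>2 \<partial>\<gamma>)"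
      by (rule integral_distr[OF f2]) measurable
    then show ?thesis unfolding d2 by simp
  qed
  have mA [measurable]: "?A \<in> borel_measurable \<gamma>" and mB [measurable]: "?B \<in> borel_measurable \<gamma>"
    by measurable
  have i\<epsilon>: "integrable \<gamma> (\<lambda>z. \<epsilon>\<^sup>2)" by simp
  have m\<epsilon>: "(\<lambda>_. \<epsilon>) \<in> borel_measurable \<gamma>" by simp
  have iAe: "integrable \<gamma> (\<lambda>z. (?A z + \<epsilon>)\<^sup>2)"
    by (rule integrable_square_add[OF mA m\<epsilon> iA i\<epsilon>])
  have mAe: "(\<lambda>z. ?A z + \<epsilon>) \<in> borel_measurable \<gamma>" by measurable
  have iABe: "integrable \<gamma> (\<lambda>z. (?A z + \<epsilon> + ?B z)\<^sup>2)"
    by (rule integrable_square_add[OF mAe mB iAe iB])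
  have AEc: "AE z in \<gamma>. c (snd (fst z)) = c (fst (snd z))"
    unfolding \<gamma>_def by (subst AE_density[OF w]) (rule AE_I2, simp add: w_def)
  have le: "AE z in \<gamma>. (norm (fst (fst z) - snd (snd z)))\<^sup>2 \<le> (?A z + \<epsilon> + ?B z)\<^sup>2"
  proof (rule AE_mp[OF AEc], rule AE_I2, rule impI)
    fix z :: "('a \<times> 'a) \<times> ('a \<times> 'a)" assume "c (snd (fst z)) = c (fst (snd z))"
    then have n: "norm (snd (fst z) - fst (snd z)) \<le> \<epsilon>" by (rule cell)
    have "fst (fst z) - snd (snd z) = (fst (fst z) - snd (fst z)) + (snd (fst z) - fst (snd z)) + (fst (snd z) - snd (snd z))"
      by simp
    then have "norm (fst (fst z) - snd (snd z)) \<le> ?A z + norm (snd (fst z) - fst (snd z)) + ?B z"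
      by (metis norm_triangle_le norm_triangle_ineq add_mono order_refl)
    with n have "norm (fst (fst z) - snd (snd z)) \<le> ?A z + \<epsilon> + ?B z" by linarith
    then show "(norm (fst (fst z) - snd (snd z)))\<^sup>2 \<le> (?A z + \<epsilon> + ?B z)\<^sup>2"
      by (rule power_mono) simp
  qed
  have "transport_cost \<tau> = (\<integral>z. (norm (fst (fst z) - snd (snd z)))\<^sup>2 \<partial>\<gamma>)"
  proof -
    have mm: "(\<lambda>z. (fst (fst z), snd (snd z))) \<in> measurable \<gamma> (borel \<Otimes>\<^sub>M borel)" by measurable
    have mf: "(\<lambda>z :: 'a \<times> 'a. (norm (fst z - snd z))\<^sup>2) \<in> borel_measurable (borel \<Otimes>\<^sub>M borel)" by measurable
    show ?thesis unfolding \<tau>_def using integral_distr[OF mm mf] by simp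
  qed
  also have "\<dots> \<le> (\<integral>z. (?A z + \<epsilon> + ?B z)\<^sup>2 \<partial>\<gamma>)"
    by (rule integral_mono_AE'[OF iABe le]) simp
  finally have "sqrt (transport_cost \<tau>) \<le> sqrt (\<integral>z. (?A z + \<epsilon> + ?B z)\<^sup>2 \<partial>\<gamma>)"
    by (rule real_sqrt_le_mono)
  also have "\<dots> \<le> sqrt (\<integral>z. (?A z + \<epsilon>)\<^sup>2 \<partial>\<gamma>) + sqrt (\<integral>z. (?B z)\<^sup>2 \<partial>\<gamma>)"
    by (rule Minkowski_integral[OF mAe mB iAe iB])
  also have "sqrt (\<integral>z. (?A z + \<epsilon>)\<^sup>2 \<partial>\<gamma>) \<le> sqrt (\<integral>z. (?A z)\<^sup>2 \<partial>\<gamma>) + sqrt (\<integral>z. \<epsilon>\<^sup>2 \<partial>\<gamma>)"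
    by (rule Minkowski_integral[OF mA m\<epsilon> iA i\<epsilon>])
  also have "sqrt (\<integral>z. \<epsilon>\<^sup>2 \<partial>\<gamma>) = \<epsilon>"
    using \<open>0 < \<epsilon>\<close> by (simp add: \<gamma>.prob_space)
  finally show ?thesis using that[OF \<tau>] unfolding eA eB by simp
qed

lemma W2_triangle:
  fixes \<mu> \<nu> \<sigma> :: "'a::euclidean_space measure"
  assumes P: "\<mu> \<in> P2" "\<nu> \<in> P2" "\<sigma> \<in> P2"
  shows "W2 \<mu> \<sigma> \<le> W2 \<mu> \<nu> + W2 \<nu> \<sigma>"
proof (rule field_le_epsilon)
  fix e :: real assume "0 < e"
  then have e3: "0 < e / 3" by simp
  obtain \<pi> where \<pi>: "\<pi> \<in> couplings \<mu> \<nu>" "sqrt (transport_cost \<pi>) < W2 \<mu> \<nu> + e / 3"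
    using near_optimal_coupling[OF P(1,2) e3] by blast
  obtain \<rho> where \<rho>: "\<rho> \<in> couplings \<nu> \<sigma>" "sqrt (transport_cost \<rho>) < W2 \<nu> \<sigma> + e / 3"
    using near_optimal_coupling[OF P(2,3) e3] by blast
  obtain \<tau> where \<tau>: "\<tau> \<in> couplings \<mu> \<sigma>"
    "sqrt (transport_cost \<tau>)
      \<le> sqrt (transport_cost \<pi>) + e / 3 + sqrt (transport_cost \<rho>)"
    using glue_couplings[OF \<pi>(1) \<rho>(1) P e3] by blast
  show "W2 \<mu> \<sigma> \<le> W2 \<mu> \<nu> + W2 \<nu> \<sigma> + e"
    using W2_le_coupling[OF \<tau>(1) P(1,3)] \<tau>(2) \<pi>(2) \<rho>(2) by linarith
qed

text \<open>Along a nearly optimal coupling the increment of \<open>f\<close> is at most \<open>L\<close> times the distance of the two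
  points, whose mean is bounded by its quadratic mean.\<close>

lemma Lipschitz_integral_diff_le:
  fixes f :: "'a::euclidean_space \<Rightarrow> real"
  assumes P: "\<mu> \<in> P2" "\<nu> \<in> P2" and f [measurable]: "f \<in> borel_measurable borel"
    and B: "\<And>x. \<bar>f x\<bar> \<le> B" and L: "\<And>x y. \<bar>f x - f y\<bar> \<le> L * norm (x - y)" "0 \<le> L"
  shows "\<bar>(\<integral>x. f x \<partial>\<mu>) - (\<integral>x. f x \<partial>\<nu>)\<bar> \<le> L * W2 \<mu> \<nu>"
proof (rule field_le_epsilon)
  fix e :: real assume "0 < e"
  define e' where "e' = e / (L + 1)"
  have e': "0 < e'" "L * e' \<le> e" using \<open>0 < e\<close> L(2) by (auto simp: e'_def field_simps)
  obtain \<pi> where \<pi>: "\<pi> \<in> couplings \<mu> \<nu>" "sqrt (transport_cost \<pi>) < W2 \<mu> \<nu> + e'"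
    using near_optimal_coupling[OF P e'(1)] by blast
  interpret \<pi>: prob_space \<pi> by (rule couplingD(1)[OF \<pi>(1)])
  note [measurable] = coupling_measurable[OF \<pi>(1)]
  have i1: "integrable \<pi> (\<lambda>z. f (fst z))" and i2: "integrable \<pi> (\<lambda>z. f (snd z))"
    using B by (auto intro!: \<pi>.integrable_const_bound[of _ B])
  have e1: "(\<integral>x. f x \<partial>\<mu>) = (\<integral>z. f (fst z) \<partial>\<pi>)"
    unfolding couplingD(4)[OF \<pi>(1), symmetric] by (rule integral_distr) measurable
  have e2: "(\<integral>x. f x \<partial>\<nu>) = (\<integral>z. f (snd z) \<partial>\<pi>)"
    unfolding couplingD(5)[OF \<pi>(1), symmetric] by (rule integral_distr) measurable
  have iq: "integrable \<pi> (\<lambda>z. (norm (fst z - snd z))\<^sup>2)" by (rule coupling_sq_integrable(3)[OF \<pi>(1) P])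
  have i11: "integrable \<pi> (\<lambda>z. (1::real)\<^sup>2)" by simp
  have mn: "(\<lambda>z. norm (fst z - snd z)) \<in> borel_measurable \<pi>" and m1: "(\<lambda>z. 1::real) \<in> borel_measurable \<pi>"
    by measurable
  have inn: "integrable \<pi> (\<lambda>z. norm (fst z - snd z))"
    using integrable_mult_square[OF mn m1 iq i11] by simp
  have "\<bar>(\<integral>x. f x \<partial>\<mu>) - (\<integral>x. f x \<partial>\<nu>)\<bar> = \<bar>\<integral>z. f (fst z) - f (snd z) \<partial>\<pi>\<bar>"
    unfolding e1 e2 using i1 i2 by simp
  also have "\<dots> \<le> (\<integral>z. \<bar>f (fst z) - f (snd z)\<bar> \<partial>\<pi>)" by (rule integral_abs_bound)
  also have "\<dots> \<le> (\<integral>z. L * norm (fst z - snd z) \<partial>\<pi>)"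
    using i1 i2 inn L(1) by (intro integral_mono) auto
  also have "\<dots> = L * (\<integral>z. norm (fst z - snd z) * 1 \<partial>\<pi>)" by simp
  also have "\<dots> \<le> L * (sqrt (transport_cost \<pi>) * sqrt (\<integral>z. 1\<^sup>2 \<partial>\<pi>))"
    by (intro mult_left_mono Cauchy_Schwarz_integral[OF mn m1 iq i11] L(2))
  also have "\<dots> = L * sqrt (transport_cost \<pi>)" by (simp add: \<pi>.prob_space)
  also have "\<dots> \<le> L * (W2 \<mu> \<nu> + e')" using \<pi>(2) L(2) by (intro mult_left_mono) auto
  also have "\<dots> \<le> L * W2 \<mu> \<nu> + e" using e'(2) by (simp add: algebra_simps)
  finally show "\<bar>(\<integral>x. f x \<partial>\<mu>) - (\<integral>x. f x \<partial>\<nu>)\<bar> \<le> L * W2 \<mu> \<nu> + e" .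
qed

lemma integral_infdist_approx:
  fixes F :: "'a::euclidean_space set"
  assumes \<mu>: "\<mu> \<in> P2" and F: "closed F" "F \<noteq> {}"
  shows "(\<lambda>n. \<integral>x. max 0 (1 - real n * infdist x F) \<partial>\<mu>) \<longlonglongrightarrow> measure \<mu> F"
proof -
  interpret prob_space \<mu> by (rule P2D(1)[OF \<mu>])
  note [measurable_cong] = P2D(2)[OF \<mu>]
  have [measurable]: "(\<lambda>x. infdist x F) \<in> borel_measurable borel"
    by (intro borel_measurable_continuous_onI continuous_on_infdist continuous_on_id)
  have Fs: "F \<in> sets \<mu>" using F P2D(2)[OF \<mu>] by simp
  have "(\<lambda>n. \<integral>x. max 0 (1 - real n * infdist x F) \<partial>\<mu>) \<longlonglongrightarrow> (\<integral>x. indicator F x \<partial>\<mu>)"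
  proof (rule integral_dominated_convergence[where w="\<lambda>_. 1"])
    show "AE x in \<mu>. (\<lambda>n. max 0 (1 - real n * infdist x F)) \<longlonglongrightarrow> indicator F x"
    proof (rule AE_I2)
      fix x
      show "(\<lambda>n. max 0 (1 - real n * infdist x F)) \<longlonglongrightarrow> indicator F x"
      proof (cases "x \<in> F")
        case True then show ?thesis by simp
      next
        case False
        then have pos: "0 < infdist x F"
          using F infdist_nonneg[of x F] in_closed_iff_infdist_zero[OF F, of x] by linarith
        obtain N where N: "1 / infdist x F < real N" using reals_Archimedean2 by blast
        have "max 0 (1 - real n * infdist x F) = 0" if "n \<ge> N" for n
        proof -
          have "1 / infdist x F \<le> real n" using N that by linarith
          then have "1 \<le> real n * infdist x F" using pos by (simp add: field_simps)
          then show ?thesis by simp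
        qed
        then have "\<forall>\<^sub>F n in sequentially. max 0 (1 - real n * infdist x F) = 0"
          unfolding eventually_sequentially by blast
        then show ?thesis using False by (simp add: tendsto_eventually)
      qed
    qed
    show "(\<lambda>x. max 0 (1 - real n * infdist x F)) \<in> borel_measurable \<mu>" for n by measurable
    show "AE x in \<mu>. norm (max 0 (1 - real n * infdist x F)) \<le> 1" for n
      by (rule AE_I2) (simp add: infdist_nonneg)
  qed (use Fs in auto)
  then show ?thesis using Fs P2D(3)[OF \<mu>] by simp
qed

text \<open>Measures at distance \<open>0\<close> integrate bounded Lipschitz functions equally, and these approximate the
  indicators of closed sets, which generate the Borel sets.\<close>

lemma W2_eq_0_imp_eq:
  fixes \<mu> \<nu> :: "'a::euclidean_space measure"
  assumes P: "\<mu> \<in> P2" "\<nu> \<in> P2" and W: "W2 \<mu> \<nu> = 0"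
  shows "\<mu> = \<nu>"
proof -
  interpret \<mu>: prob_space \<mu> by (rule P2D(1)[OF P(1)])
  interpret \<nu>: prob_space \<nu> by (rule P2D(1)[OF P(2)])
  have eq: "emeasure \<mu> F = emeasure \<nu> F" if F: "closed F" for F
  proof (cases "F = {}")
    case False
    have "(\<integral>x. max 0 (1 - real n * infdist x F) \<partial>\<mu>) = (\<integral>x. max 0 (1 - real n * infdist x F) \<partial>\<nu>)" for n
    proof -
      have "\<bar>(\<integral>x. max 0 (1 - real n * infdist x F) \<partial>\<mu>) - (\<integral>x. max 0 (1 - real n * infdist x F) \<partial>\<nu>)\<bar> \<le> real n * W2 \<mu> \<nu>"
      proof (rule Lipschitz_integral_diff_le[OF P])
        show "(\<lambda>x. max 0 (1 - real n * infdist x F)) \<in> borel_measurable borel"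
          by (intro borel_measurable_continuous_onI continuous_intros)
        show "\<bar>max 0 (1 - real n * infdist x F)\<bar> \<le> 1" for x by (simp add: infdist_nonneg)
        show "\<bar>max 0 (1 - real n * infdist x F) - max 0 (1 - real n * infdist y F)\<bar> \<le> real n * norm (x - y)" for x y
        proof -
          have "\<bar>infdist x F - infdist y F\<bar> \<le> norm (x - y)"
            using infdist_triangle_abs[of x F y] by (simp add: dist_norm)
          then have "real n * \<bar>infdist x F - infdist y F\<bar> \<le> real n * norm (x - y)"
            by (intro mult_left_mono) auto
          moreover have "\<bar>max 0 (1 - real n * infdist x F) - max 0 (1 - real n * infdist y F)\<bar>
            \<le> \<bar>real n * infdist x F - real n * infdist y F\<bar>" by linarith
          moreover have "\<bar>real n * infdist x F - real n * infdist y F\<bar> = real n * \<bar>infdist x F - infdist y F\<bar>"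
            by (simp add: abs_mult right_diff_distrib[symmetric])
          ultimately show ?thesis by linarith
        qed
      qed simp
      then show ?thesis using W by simp
    qed
    then have "measure \<mu> F = measure \<nu> F"
      using LIMSEQ_unique[OF integral_infdist_approx[OF P(1) F False]] integral_infdist_approx[OF P(2) F False] by simp
    then show ?thesis by (simp add: \<mu>.emeasure_eq_measure \<nu>.emeasure_eq_measure)
  qed simp
  show ?thesis
  proof (rule measure_eqI_generator_eq[where E="Collect closed" and \<Omega>=UNIV and A="\<lambda>_. UNIV"])
    show "sets \<mu> = sigma_sets UNIV (Collect closed)" "sets \<nu> = sigma_sets UNIV (Collect closed)"
      unfolding P2D(2)[OF P(1)] P2D(2)[OF P(2)] borel_eq_closed by simp_all
    show "Int_stable (Collect (closed :: 'a set \<Rightarrow> bool))"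
      by (auto simp: Int_stable_def)
    show "emeasure \<mu> X = emeasure \<nu> X" if "X \<in> Collect closed" for X using eq that by simp
  qed auto
qed

lemma W2_self: "\<mu> \<in> P2 \<Longrightarrow> W2 \<mu> \<mu> = 0"
proof -
  assume \<mu>: "\<mu> \<in> P2"
  interpret prob_space \<mu> by (rule P2D(1)[OF \<mu>])
  have X: "(\<lambda>x. x) \<in> L2 \<mu>"
    using P2D(4)[OF \<mu>] unfolding L2_def by (simp add: measurable_ident_sets[OF P2D(2)[OF \<mu>]])
  have "distr \<mu> borel (\<lambda>x. x) = \<mu>" using P2D(2)[OF \<mu>] by (simp add: distr_id2)
  then have "W2 \<mu> \<mu> \<le> 0"
    using W2_distr_le[OF P2D(1)[OF \<mu>] X X] by (simp add: L2_norm_def)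
  then show ?thesis using W2_nonneg[of \<mu> \<mu>] by linarith
qed

interpretation Wass: Metric_space "P2 :: 'a::euclidean_space measure set" W2
proof
  show "W2 \<mu> \<nu> = 0 \<longleftrightarrow> \<mu> = \<nu>" if "\<mu> \<in> P2" "\<nu> \<in> P2" for \<mu> \<nu> :: "'a measure"
    using W2_eq_0_imp_eq[OF that] W2_self[OF that(1)] by auto
qed (auto intro: W2_commute W2_triangle)

lemma topspace_W2_top [simp]: "topspace W2_top = P2"
  unfolding W2_top_def by simp

lemma continuous_map_W2_iff:
  fixes f :: "'a::euclidean_space measure \<Rightarrow> 'b::metric_space"
  shows "continuous_map W2_top euclidean f \<longleftrightarrow>
    (\<forall>\<mu>\<in>P2. \<forall>\<epsilon>>0. \<exists>\<delta>>0. \<forall>\<nu>\<in>P2. W2 \<mu> \<nu> < \<delta> \<longrightarrow> dist (f \<mu>) (f \<nu>) < \<epsilon>)"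
  using Wass.metric_continuous_map[OF Met_TC.Metric_space_axioms, of f]
  unfolding mtopology_is_euclidean W2_top_def[symmetric]
  by (simp only: subset_UNIV simp_thms Ball_def imp_conjL)

text \<open>This is the form in which the continuity of derivatives enters all estimates.\<close>

lemma continuous_map_W2_prod_iff:
  fixes f :: "'a::euclidean_space measure \<times> 'b::metric_space \<Rightarrow> 'c::metric_space"
  shows "continuous_map (prod_topology W2_top euclidean) euclidean f \<longleftrightarrow>
    (\<forall>\<mu>\<in>P2. \<forall>x. \<forall>\<epsilon>>0. \<exists>\<delta>>0. \<forall>\<nu>\<in>P2. \<forall>y. W2 \<mu> \<nu> < \<delta> \<longrightarrow> dist x y < \<delta> \<longrightarrow> dist (f (\<mu>, x)) (f (\<nu>, y)) < \<epsilon>)"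
proof -
  interpret M: Metric_space12 "P2 :: 'a measure set" W2 "UNIV :: 'b set" dist
    by (simp add: Metric_space12_def Wass.Metric_space_axioms Met_TC.Metric_space_axioms)
  have top: "prod_topology W2_top euclidean = M.Prod_metric.mtopology"
    unfolding M.mtopology_prod_metric W2_top_def by simp
  have "continuous_map (prod_topology W2_top euclidean) euclidean f \<longleftrightarrow>
    (\<forall>a\<in>P2 \<times> UNIV. \<forall>\<epsilon>>0. \<exists>\<delta>>0. \<forall>x. x \<in> P2 \<times> UNIV \<and> prod_dist W2 dist a x < \<delta> \<longrightarrow> dist (f a) (f x) < \<epsilon>)"
    using M.Prod_metric.metric_continuous_map[OF Met_TC.Metric_space_axioms, of f]
    unfolding mtopology_is_euclidean top[symmetric] by (simp only: subset_UNIV simp_thms)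
  also have "\<dots> \<longleftrightarrow> (\<forall>\<mu>\<in>P2. \<forall>x. \<forall>\<epsilon>>0. \<exists>\<delta>>0. \<forall>\<nu>\<in>P2. \<forall>y. W2 \<mu> \<nu> < \<delta> \<longrightarrow> dist x y < \<delta> \<longrightarrow> dist (f (\<mu>, x)) (f (\<nu>, y)) < \<epsilon>)"
    (is "?l = ?r")
  proof
    assume l: ?l
    show ?r
    proof (intro ballI allI impI)
      fix \<mu> :: "'a measure" and x :: 'b and \<epsilon> :: real assume \<mu>: "\<mu> \<in> P2" and "0 < \<epsilon>"
      have "\<exists>\<delta>>0. \<forall>y. y \<in> P2 \<times> UNIV \<and> prod_dist W2 dist (\<mu>, x) y < \<delta> \<longrightarrow> dist (f (\<mu>, x)) (f y) < \<epsilon>"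
        by (rule mp[OF spec[OF bspec[OF l]]]) (use \<mu> \<open>0 < \<epsilon>\<close> in simp_all)
      then obtain \<delta> where \<delta>: "\<delta> > 0" "\<And>y. y \<in> P2 \<times> UNIV \<and> prod_dist W2 dist (\<mu>, x) y < \<delta> \<Longrightarrow> dist (f (\<mu>, x)) (f y) < \<epsilon>"
        by blast
      show "\<exists>\<delta>>0. \<forall>\<nu>\<in>P2. \<forall>y. W2 \<mu> \<nu> < \<delta> \<longrightarrow> dist x y < \<delta> \<longrightarrow> dist (f (\<mu>, x)) (f (\<nu>, y)) < \<epsilon>"
      proof (intro exI[of _ "\<delta> / 2"] conjI ballI allI impI)
        fix \<nu> :: "'a measure" and y assume \<nu>: "\<nu> \<in> P2" and "W2 \<mu> \<nu> < \<delta> / 2" "dist x y < \<delta> / 2"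
        then have "prod_dist W2 dist (\<mu>, x) (\<nu>, y) < \<delta>"
          unfolding prod_dist_def using sqrt_sum_squares_le_sum[of "W2 \<mu> \<nu>" "dist x y"] by simp
        then show "dist (f (\<mu>, x)) (f (\<nu>, y)) < \<epsilon>" using \<nu> by (intro \<delta>(2)) simp
      qed (use \<delta> in simp)
    qed
  next
    assume r: ?r
    show ?l
    proof (intro ballI allI impI)
      fix a :: "'a measure \<times> 'b" and \<epsilon> :: real assume a: "a \<in> P2 \<times> UNIV" and "0 < \<epsilon>"
      obtain \<mu> x where ax: "a = (\<mu>, x)" "\<mu> \<in> P2" using a by auto
      have "\<exists>\<delta>>0. \<forall>\<nu>\<in>P2. \<forall>y. W2 \<mu> \<nu> < \<delta> \<longrightarrow> dist x y < \<delta> \<longrightarrow> dist (f (\<mu>, x)) (f (\<nu>, y)) < \<epsilon>"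
        by (rule mp[OF spec[OF spec[OF bspec[OF r ax(2)]]] \<open>0 < \<epsilon>\<close>])
      then obtain \<delta> where \<delta>: "\<delta> > 0"
        "\<And>\<nu> y. \<nu> \<in> P2 \<Longrightarrow> W2 \<mu> \<nu> < \<delta> \<Longrightarrow> dist x y < \<delta> \<Longrightarrow> dist (f (\<mu>, x)) (f (\<nu>, y)) < \<epsilon>"
        by blast
      show "\<exists>\<delta>>0. \<forall>y. y \<in> P2 \<times> UNIV \<and> prod_dist W2 dist a y < \<delta> \<longrightarrow> dist (f a) (f y) < \<epsilon>"
      proof (intro exI[of _ \<delta>] conjI allI impI)
        fix b assume b: "b \<in> P2 \<times> UNIV \<and> prod_dist W2 dist a b < \<delta>"
        obtain \<nu> y where bq: "b = (\<nu>, y)" by (cases b)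
        have "W2 \<mu> \<nu> \<le> prod_dist W2 dist a b" "dist x y \<le> prod_dist W2 dist a b"
          unfolding ax bq prod_dist_def by auto
        then show "dist (f a) (f b) < \<epsilon>" using b unfolding ax bq by (intro \<delta>(2)) auto
      qed (use \<delta> in simp)
    qed
  qed
  finally show ?thesis .
qed

section \<open>Uniformity on compact sets\<close>

text \<open>Only one of the two points compared is confined to the compact set: the sampled empirical measures
  need not belong to it. A violating sequence would have a limit point at which \<open>f\<close> is not continuous.\<close>

lemma W2_prod_compact_uniform:
  fixes f :: "'a::euclidean_space measure \<times> 'b::metric_space \<Rightarrow> 'c::metric_space"
  assumes f: "continuous_map (prod_topology W2_top euclidean) euclidean f"
    and C: "compactin W2_top C" and K: "compact K" and \<epsilon>: "0 < \<epsilon>"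
  shows "\<exists>\<delta>>0. \<forall>\<mu>\<in>C. \<forall>x\<in>K. \<forall>\<nu>\<in>P2. \<forall>y. W2 \<mu> \<nu> < \<delta> \<longrightarrow> dist x y < \<delta> \<longrightarrow>
    dist (f (\<mu>, x)) (f (\<nu>, y)) < \<epsilon>"
proof (rule ccontr)
  assume neg: "\<not> ?thesis"
  have CP: "C \<subseteq> P2" using compactin_subset_topspace[OF C] by simp
  have "\<exists>\<mu> x \<nu> y. \<mu> \<in> C \<and> x \<in> K \<and> \<nu> \<in> P2 \<and> W2 \<mu> \<nu> < 1 / real (Suc n) \<and> dist x y < 1 / real (Suc n) \<and>
      \<not> dist (f (\<mu>, x)) (f (\<nu>, y)) < \<epsilon>" for n
  proof (rule ccontr)
    assume "\<not> ?thesis"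
    then have "\<forall>\<mu>\<in>C. \<forall>x\<in>K. \<forall>\<nu>\<in>P2. \<forall>y. W2 \<mu> \<nu> < 1 / real (Suc n) \<longrightarrow> dist x y < 1 / real (Suc n) \<longrightarrow>
      dist (f (\<mu>, x)) (f (\<nu>, y)) < \<epsilon>" by blast
    moreover have "0 < 1 / real (Suc n)" by simp
    ultimately show False using neg by blast
  qed
  then obtain \<mu> x \<nu> y where s: "\<And>n. \<mu> n \<in> C" "\<And>n. x n \<in> K" "\<And>n. \<nu> n \<in> P2"
    "\<And>n. W2 (\<mu> n) (\<nu> n) < 1 / real (Suc n)" "\<And>n. dist (x n) (y n) < 1 / real (Suc n)"
    "\<And>n. \<not> dist (f (\<mu> n, x n)) (f (\<nu> n, y n)) < \<epsilon>"
    by metis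
  have C': "compactin Wass.mtopology C" using C unfolding W2_top_def .
  obtain m r where m: "m \<in> C" "strict_mono r" "limitin Wass.mtopology (\<mu> \<circ> r) m sequentially"
    using C'[unfolded Wass.compactin_sequentially] s(1) by (meson image_subsetI)
  obtain q where q: "strict_mono q" and "\<exists>l\<in>K. ((x \<circ> r) \<circ> q) \<longlonglongrightarrow> l"
    using K[unfolded compact_def, rule_format, of "x \<circ> r"] s(2) by auto
  then obtain l where l: "l \<in> K" "((x \<circ> r) \<circ> q) \<longlonglongrightarrow> l" by blast
  have mP: "m \<in> P2" using m(1) CP by blast
  obtain \<delta> where \<delta>: "\<delta> > 0" "\<And>\<nu> y. \<nu> \<in> P2 \<Longrightarrow> W2 m \<nu> < \<delta> \<Longrightarrow> dist l y < \<delta> \<Longrightarrow> dist (f (m, l)) (f (\<nu>, y)) < \<epsilon> / 2"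
    using f[unfolded continuous_map_W2_prod_iff, rule_format, OF mP, of "\<epsilon> / 2" l] \<epsilon> by auto
  have "\<forall>\<^sub>F n in sequentially. W2 ((\<mu> \<circ> r) n) m < \<delta> / 2"
  proof -
    have "\<forall>\<^sub>F n in sequentially. (\<mu> \<circ> r) n \<in> P2 \<and> W2 ((\<mu> \<circ> r) n) m < \<delta> / 2"
      using m(3) half_gt_zero[OF \<delta>(1)] unfolding Wass.limitin_metric by blast
    then show ?thesis by (rule eventually_mono) simp
  qed
  then have 1: "\<forall>\<^sub>F n in sequentially. W2 ((\<mu> \<circ> r) (q n)) m < \<delta> / 2"
    using eventually_subseq[OF q] by blast
  have 2: "\<forall>\<^sub>F n in sequentially. dist (((x \<circ> r) \<circ> q) n) l < \<delta> / 2"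
    using tendstoD[OF l(2), of "\<delta> / 2"] \<delta>(1) by simp
  have rq: "strict_mono (r \<circ> q)" using m(2) q by (rule strict_mono_o)
  have "(\<lambda>n. 1 / real (Suc n)) \<longlonglongrightarrow> 0" using LIMSEQ_inverse_real_of_nat by (simp add: inverse_eq_divide)
  then have "\<forall>\<^sub>F n in sequentially. 1 / real (Suc n) < \<delta> / 2"
    using \<delta>(1) by (intro order_tendstoD(2)) auto
  then have 3: "\<forall>\<^sub>F n in sequentially. 1 / real (Suc ((r \<circ> q) n)) < \<delta> / 2"
    by (rule eventually_subseq[OF rq])
  have "\<forall>\<^sub>F n in sequentially. False"
    using 1 2 3
  proof eventually_elim
    case (elim n)
    let ?i = "r (q n)"
    have a: "W2 (\<mu> ?i) m < \<delta> / 2" "dist (x ?i) l < \<delta> / 2" "1 / real (Suc ?i) < \<delta> / 2"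
      using elim by simp_all
    have P: "\<mu> ?i \<in> P2" using s(1) CP by blast
    have b: "W2 m (\<mu> ?i) < \<delta> / 2" using a(1) W2_commute[of m "\<mu> ?i"] by simp
    have c: "W2 m (\<nu> ?i) < \<delta>"
      using W2_triangle[OF mP P s(3)[of ?i]] b s(4)[of ?i] a(3) by linarith
    have d: "dist l (y ?i) < \<delta>"
      using dist_triangle[of l "y ?i" "x ?i"] a(2,3) s(5)[of ?i] by (simp add: dist_commute)
    have "dist (f (m, l)) (f (\<mu> ?i, x ?i)) < \<epsilon> / 2"
      using \<delta>(2)[OF P, of "x ?i"] b a(2) \<delta>(1) by (simp add: dist_commute)
    moreover have "dist (f (m, l)) (f (\<nu> ?i, y ?i)) < \<epsilon> / 2"
      by (rule \<delta>(2)[OF s(3) c d])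
    ultimately have "dist (f (\<mu> ?i, x ?i)) (f (\<nu> ?i, y ?i)) < \<epsilon>"
      using dist_triangle2[of "f (\<mu> ?i, x ?i)" "f (\<nu> ?i, y ?i)" "f (m, l)"] by (simp add: dist_commute)
    with s(6)[of ?i] show False by simp
  qed
  then show False by simp
qed

lemma W2_prod_compact_bounded:
  fixes f :: "'a::euclidean_space measure \<times> 'b::metric_space \<Rightarrow> real"
  assumes f: "continuous_map (prod_topology W2_top euclidean) euclideanreal f"
    and C: "compactin W2_top C" and K: "compact K"
  obtains B where "0 \<le> B" "\<And>\<mu> x. \<mu> \<in> C \<Longrightarrow> x \<in> K \<Longrightarrow> \<bar>f (\<mu>, x)\<bar> \<le> B"
proof -
  have "compactin (prod_topology W2_top euclidean) (C \<times> K)"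
    unfolding compactin_Times using C K by simp
  then have "compactin euclideanreal (f ` (C \<times> K))"
    using f by (rule image_compactin)
  then have "bounded (f ` (C \<times> K))" by (simp add: compact_imp_bounded)
  then obtain B where B: "\<forall>z\<in>f ` (C \<times> K). norm z \<le> B" unfolding bounded_iff by blast
  show ?thesis
    by (rule that[of "max 0 B"]) (use B in \<open>force simp: max_def\<close>)+
qed

section \<open>A curve through a box\<close>

text \<open>The building block of Schoenberg's space-filling curve, a continuous function of period \<open>1\<close>. A
  measure on a box is the image under the curve of a measure on \<open>{0..1}\<close>; in this way compactness of
  the laws on an interval, where Helly's theorem applies, passes to measures on a box.\<close>

definition binary_wave :: "real \<Rightarrow> real" where
  "binary_wave t = max 0 (min 1 (1/2 - cos (2 * pi * t)))"

text \<open>At distance at most \<open>1/6\<close> to the right of \<open>b / 2\<close> the cosine is at least \<open>1/2\<close> in modulus, and the clamp is attained.\<close>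

lemma binary_wave_digit:
  assumes b: "b \<in> {0, 1::nat}" and r: "0 \<le> r" "r \<le> 1/6" and t: "t = real N + real b / 2 + r"
  shows "binary_wave t = real b"
proof -
  have c: "cos (2 * pi * r) \<ge> 1/2"
  proof -
    have "2 * pi * r \<le> 2 * pi * (1/6)" using r by (intro mult_left_mono) auto
    then have "cos (pi / 3) \<le> cos (2 * pi * r)"
      using r by (intro cos_monotone_0_pi_le) auto
    then show ?thesis by (simp add: cos_60)
  qed
  have per: "cos (2 * pi * (real N + s)) = cos (2 * pi * s)" for s
    using cos_add[of "2 * pi * real N" "2 * pi * s"] cos_2npi[of N] sin_2npi[of N]
    by (simp add: algebra_simps)
  show ?thesis
  proof (cases "b = 0")
    case True
    then have "cos (2 * pi * t) = cos (2 * pi * r)" using per[of r] t by simp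
    with c True show ?thesis by (simp add: binary_wave_def)
  next
    case False
    then have b1: "b = 1" using b by simp
    have "cos (2 * pi * t) = cos (2 * pi * (1/2 + r))" using per[of "1/2 + r"] t b1 by (simp add: add.assoc)
    also have "\<dots> = - cos (2 * pi * r)"
      using cos_add[of pi "2 * pi * r"] by (simp add: distrib_left)
    finally show ?thesis using c b1 by (simp add: binary_wave_def)
  qed
qed

text \<open>Multiplication by \<open>4 ^ k\<close> moves digit \<open>k\<close> in front. The digits \<open>2 * b i\<close> in base \<open>4\<close> leave a tail of at
  most \<open>1/6\<close>, so that the wave reads off \<open>b k\<close> exactly.\<close>

lemma binary_wave_shift:
  fixes b :: "nat \<Rightarrow> nat"
  assumes b: "\<And>i. b i \<in> {0, 1}"
  defines "t \<equiv> \<Sum>i. real (b i) / 2 / 4 ^ i"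
  shows "binary_wave (4 ^ k * t) = real (b k)"
proof -
  define h where "h i = real (b i) / 2 / 4 ^ i" for i
  have b1: "real (b i) \<le> 1" for i using b[of i] by auto
  have g: "summable (\<lambda>i. (1/4::real) ^ i)" by (rule summable_geometric) simp
  have hs: "summable h"
  proof (rule summable_comparison_test'[OF g, of 0])
    show "norm (h n) \<le> (1/4) ^ n" for n
      using b1[of n] by (simp add: h_def power_divide divide_simps)
  qed
  have "t = (\<Sum>i. h (i + Suc k)) + (\<Sum>i<Suc k. h i)"
    unfolding t_def h_def[symmetric] by (rule suminf_split_initial_segment[OF hs])
  then have t: "4 ^ k * t = 4 ^ k * (\<Sum>i<k. h i) + real (b k) / 2 + 4 ^ k * (\<Sum>i. h (i + Suc k))"
    by (simp add: distrib_left h_def)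
  have "\<exists>N. 4 ^ k * (\<Sum>i<k. h i) = real N"
  proof (intro exI)
    have "4 ^ k * (\<Sum>i<k. h i) = (\<Sum>i<k. real (2 * b i * 4 ^ (k - Suc i)))"
      unfolding sum_distrib_left
    proof (rule sum.cong[OF refl])
      fix i assume "i \<in> {..<k}"
      then have "k = Suc i + (k - Suc i)" by simp
      then have e: "(4::real) ^ k = 4 ^ i * 4 * 4 ^ (k - Suc i)"
        by (metis power_add power_Suc2)
      show "4 ^ k * h i = real (2 * b i * 4 ^ (k - Suc i))"
        unfolding h_def e by simp
    qed
    then show "4 ^ k * (\<Sum>i<k. h i) = real (\<Sum>i<k. 2 * b i * 4 ^ (k - Suc i))" by simp
  qed
  then obtain N where N: "4 ^ k * (\<Sum>i<k. h i) = real N" by blast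
  have hs': "summable (\<lambda>i. h (i + Suc k))" using hs by (rule summable_ignore_initial_segment)
  have h0: "0 \<le> h i" for i by (simp add: h_def)
  have r0: "0 \<le> 4 ^ k * (\<Sum>i. h (i + Suc k))"
    by (intro mult_nonneg_nonneg suminf_nonneg[OF hs'] h0) simp
  have "(\<Sum>i. h (i + Suc k)) \<le> (\<Sum>i. 1 / 8 / 4 ^ k * (1/4) ^ i)"
  proof (rule suminf_le[OF _ hs'])
    show "h (i + Suc k) \<le> 1 / 8 / 4 ^ k * (1/4) ^ i" for i
      using b1[of "i + Suc k"] by (simp add: h_def power_add power_divide field_simps)
    show "summable (\<lambda>i. 1 / 8 / 4 ^ k * (1/4::real) ^ i)" by (rule summable_mult[OF g])
  qed
  also have "\<dots> = 1 / 8 / 4 ^ k * (4 / 3)"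
    by (subst suminf_mult[OF g]) (simp add: suminf_geometric)
  finally have "4 ^ k * (\<Sum>i. h (i + Suc k)) \<le> 4 ^ k * (1 / 8 / 4 ^ k * (4 / 3))"
    by (intro mult_left_mono) auto
  then have r: "4 ^ k * (\<Sum>i. h (i + Suc k)) \<le> 1/6" by simp
  show ?thesis
    by (rule binary_wave_digit[OF b r0 r t[unfolded N]])
qed

lemma binary_expansion_sums:
  fixes x :: real
  assumes x: "0 \<le> x" "x < 1"
  shows "(\<lambda>j. real (nat \<lfloor>2 ^ Suc j * x\<rfloor> mod 2) / 2 ^ Suc j) sums x"
proof -
  define q where "q n = nat \<lfloor>2 ^ n * x\<rfloor>" for n
  have qn: "real (q n) = of_int \<lfloor>2 ^ n * x\<rfloor>" for n using x by (simp add: q_def)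
  have step: "q (Suc n) = 2 * q n + q (Suc n) mod 2" for n
  proof -
    have "q n = q (Suc n) div 2"
    proof -
      have "2 * real (q n) \<le> 2 ^ Suc n * x" using qn[of n] by (simp add: mult.assoc)
      then have "of_int (2 * int (q n)) \<le> 2 ^ Suc n * x" by simp
      then have "2 * int (q n) \<le> \<lfloor>2 ^ Suc n * x\<rfloor>" by (subst le_floor_iff)
      then have 1: "2 * q n \<le> q (Suc n)" unfolding q_def[of "Suc n"] by linarith
      have "2 ^ n * x < real (q n) + 1" using qn[of n] floor_correct[of "2 ^ n * x"] by simp
      then have "2 ^ Suc n * x < 2 * real (q n) + 2" by simp
      moreover have "real (q (Suc n)) \<le> 2 ^ Suc n * x" unfolding qn by (rule of_int_floor_le)
      ultimately have "q (Suc n) < 2 * q n + 2" by linarith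
      with 1 show ?thesis by linarith
    qed
    then show ?thesis by (metis mult_div_mod_eq)
  qed
  have partial: "(\<Sum>j<n. real (q (Suc j) mod 2) / 2 ^ Suc j) = real (q n) / 2 ^ n" for n
  proof (induction n)
    case 0
    have "\<lfloor>x\<rfloor> = 0" using x by (simp add: floor_eq_iff)
    then show ?case by (simp add: q_def)
  next
    case (Suc n)
    have "real (q (Suc n)) = 2 * real (q n) + real (q (Suc n) mod 2)"
      using arg_cong[OF step[of n], of real] by (metis of_nat_add of_nat_mult of_nat_numeral)
    then show ?case using Suc by (simp add: field_simps)
  qed
  have "(\<lambda>n. real (q n) / 2 ^ n) \<longlonglongrightarrow> x"
  proof (rule tendsto_sandwich[of "\<lambda>n. x - (1/2) ^ n" _ _ "\<lambda>n. x"])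
    show "\<forall>\<^sub>F n in sequentially. x - (1/2) ^ n \<le> real (q n) / 2 ^ n"
    proof (rule always_eventually, rule allI)
      fix n
      have "2 ^ n * x < real (q n) + 1" using qn[of n] floor_correct[of "2 ^ n * x"] by simp
      then have "x < (real (q n) + 1) / 2 ^ n" by (simp add: less_divide_eq mult.commute)
      then show "x - (1/2) ^ n \<le> real (q n) / 2 ^ n" by (simp add: power_divide add_divide_distrib)
    qed
    show "\<forall>\<^sub>F n in sequentially. real (q n) / 2 ^ n \<le> x"
      by (rule always_eventually, rule allI) (simp add: qn divide_le_eq mult.commute)
    have "(\<lambda>n. (1/2::real) ^ n) \<longlonglongrightarrow> 0" by (rule LIMSEQ_power_zero) simp
    from tendsto_diff[OF tendsto_const this, of x] show "(\<lambda>n. x - (1/2) ^ n) \<longlonglongrightarrow> x" by simp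
  qed simp
  then have "(\<lambda>n. \<Sum>j<n. real (q (Suc j) mod 2) / 2 ^ Suc j) \<longlonglongrightarrow> x"
    by (simp only: partial)
  then show ?thesis unfolding sums_def q_def .
qed

text \<open>The parameter interleaves the binary digits of the coordinates: coordinate \<open>a\<close>, numbered by \<open>e a\<close>, owns
  the digits at the places \<open>CARD('n) * j + e a\<close>.\<close>

definition box_curve :: "('n::finite \<Rightarrow> nat) \<Rightarrow> real \<Rightarrow> real^'n" where
  "box_curve e t = (\<chi> a. \<Sum>j. binary_wave (4 ^ (CARD('n) * j + e a) * t) / 2 ^ Suc j)"

lemma binary_wave_bounds: "0 \<le> binary_wave t" "binary_wave t \<le> 1"
  by (auto simp: binary_wave_def)

lemma continuous_box_curve: "continuous_on UNIV (box_curve e :: real \<Rightarrow> real^'n::finite)"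
  unfolding box_curve_def
proof (rule continuous_on_vec_lambda)
  fix a :: 'n
  have s: "summable (\<lambda>j. 1 / 2 ^ Suc j :: real)"
    using summable_mult[OF summable_geometric[of "1/2 :: real"], of "1/2"] by (simp add: power_divide)
  have "uniform_limit UNIV (\<lambda>n t. \<Sum>j<n. binary_wave (4 ^ (CARD('n) * j + e a) * t) / 2 ^ Suc j)
     (\<lambda>t. \<Sum>j. binary_wave (4 ^ (CARD('n) * j + e a) * t) / 2 ^ Suc j) sequentially"
    by (rule Weierstrass_m_test[OF _ s]) (simp add: binary_wave_bounds divide_right_mono)
  then show "continuous_on UNIV (\<lambda>t. \<Sum>j. binary_wave (4 ^ (CARD('n) * j + e a) * t) / 2 ^ Suc j)"
  proof (rule uniform_limit_theorem[rotated])
    show "\<forall>\<^sub>F n in sequentially. continuous_on UNIV (\<lambda>t. \<Sum>j<n. binary_wave (4 ^ (CARD('n) * j + e a) * t) / 2 ^ Suc j)"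
      unfolding binary_wave_def by (intro always_eventually allI continuous_intros) auto
  qed simp
qed

lemma box_curve_bounded: "norm (box_curve e t :: real^'n::finite) \<le> real CARD('n)"
proof -
  have s: "summable (\<lambda>j. 1 / 2 ^ Suc j :: real)"
    using summable_mult[OF summable_geometric[of "1/2 :: real"], of "1/2"] by (simp add: power_divide)
  have one: "(\<Sum>j. 1 / 2 ^ Suc j :: real) = 1"
    using power_half_series by (simp add: sums_iff power_divide)
  have "\<bar>(box_curve e t :: real^'n) $ a\<bar> \<le> 1" for a
  proof -
    have sb: "summable (\<lambda>j. binary_wave (4 ^ (CARD('n) * j + e a) * t) / 2 ^ Suc j)"
      by (rule summable_comparison_test'[OF s, of 0]) (simp add: binary_wave_bounds divide_right_mono)
    have "(\<Sum>j. binary_wave (4 ^ (CARD('n) * j + e a) * t) / 2 ^ Suc j) \<le> (\<Sum>j. 1 / 2 ^ Suc j)"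
      by (rule suminf_le[OF _ sb s]) (simp add: binary_wave_bounds divide_right_mono)
    with one have "(\<Sum>j. binary_wave (4 ^ (CARD('n) * j + e a) * t) / 2 ^ Suc j) \<le> 1" by linarith
    moreover have "0 \<le> (\<Sum>j. binary_wave (4 ^ (CARD('n) * j + e a) * t) / 2 ^ Suc j)"
      by (rule suminf_nonneg[OF sb]) (simp add: binary_wave_bounds)
    ultimately show ?thesis by (simp add: box_curve_def)
  qed
  then have "(\<Sum>a\<in>UNIV. \<bar>(box_curve e t :: real^'n) $ a\<bar>) \<le> (\<Sum>a\<in>(UNIV::'n set). 1)"
    by (intro sum_mono)
  then show ?thesis using norm_le_l1_cart[of "box_curve e t :: real^'n"] by simp
qed

lemma box_curve_surj:
  fixes x :: "real^'n::finite"
  assumes e: "bij_betw e (UNIV :: 'n set) {..<CARD('n)}" and x: "\<And>a. 0 \<le> x $ a" "\<And>a. x $ a < 1"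
  obtains t where "0 \<le> t" "t \<le> 1" "box_curve e t = x"
proof -
  let ?d = "CARD('n)"
  define f where "f = inv_into UNIV e"
  have fe: "f (e a) = a" for a
    unfolding f_def using e by (simp add: bij_betw_def inv_into_f_f)
  have ed: "e a < ?d" for a using e by (auto simp: bij_betw_def)
  define b where "b i = nat \<lfloor>2 ^ Suc (i div ?d) * (x $ f (i mod ?d))\<rfloor> mod 2" for i
  have b: "b i \<in> {0, 1}" for i by (auto simp: b_def)
  define t where "t = (\<Sum>i. real (b i) / 2 / 4 ^ i)"
  have "box_curve e t $ a = x $ a" for a
  proof -
    have "box_curve e t $ a = (\<Sum>j. real (b (?d * j + e a)) / 2 ^ Suc j)"
      unfolding box_curve_def using binary_wave_shift[of b, OF b] by (simp add: t_def)
    also have "\<dots> = (\<Sum>j. real (nat \<lfloor>2 ^ Suc j * x $ a\<rfloor> mod 2) / 2 ^ Suc j)"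
      unfolding b_def using ed[of a] by (simp add: fe)
    also have "\<dots> = x $ a"
      using binary_expansion_sums[OF x(1)[of a] x(2)[of a]] by (simp add: sums_iff)
    finally show ?thesis .
  qed
  then have bt: "box_curve e t = x" by (simp add: vec_eq_iff)
  have g: "summable (\<lambda>i. 1/2 * (1/4::real) ^ i)" by (intro summable_mult summable_geometric) simp
  have b1: "real (b i) \<le> 1" for i using b[of i] by auto
  have le: "real (b i) / 2 / 4 ^ i \<le> 1/2 * (1/4::real) ^ i" for i
    using b1[of i] by (simp add: power_divide field_simps)
  have s: "summable (\<lambda>i. real (b i) / 2 / 4 ^ i)"
    by (rule summable_comparison_test'[OF g, of 0]) (use le in simp)
  have "t \<le> (\<Sum>i. 1/2 * (1/4::real) ^ i)" unfolding t_def by (rule suminf_le[OF le s g])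
  also have "\<dots> = 2/3" by (subst suminf_mult) (auto simp: suminf_geometric)
  finally have "t \<le> 1" by simp
  moreover have "0 \<le> t" unfolding t_def by (rule suminf_nonneg[OF s]) simp
  ultimately show ?thesis using bt that by blast
qed


section \<open>Empirical measures\<close>

definition empirical :: "nat \<Rightarrow> (nat \<Rightarrow> 'a::euclidean_space) \<Rightarrow> 'a measure" where
  "empirical n z = distr (measure_pmf (pmf_of_set {..<n})) borel z"

lemma finite_range_L2:
  assumes Q: "prob_space Q" and N: "N \<in> measurable Q (count_space (UNIV :: nat set))"
    and n: "\<And>\<omega>. \<omega> \<in> space Q \<Longrightarrow> N \<omega> < n"
  shows "(\<lambda>\<omega>. z (N \<omega>) :: 'a::euclidean_space) \<in> L2 Q"
proof -
  interpret prob_space Q by fact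
  have m: "(\<lambda>\<omega>. z (N \<omega>)) \<in> borel_measurable Q"
    by (rule measurable_compose[OF N]) simp
  have "integrable Q (\<lambda>\<omega>. (norm (z (N \<omega>)))\<^sup>2)"
  proof (rule integrable_const_bound[where B="\<Sum>i<n. (norm (z i))\<^sup>2"])
    show "AE \<omega> in Q. norm ((norm (z (N \<omega>)))\<^sup>2) \<le> (\<Sum>i<n. (norm (z i))\<^sup>2)"
    proof (rule AE_I2)
      fix \<omega> assume "\<omega> \<in> space Q"
      then have "(norm (z (N \<omega>)))\<^sup>2 \<le> (\<Sum>i<n. (norm (z i))\<^sup>2)"
        using n by (intro member_le_sum) auto
      then show "norm ((norm (z (N \<omega>)))\<^sup>2) \<le> (\<Sum>i<n. (norm (z i))\<^sup>2)" by simp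
    qed
    show "(\<lambda>\<omega>. (norm (z (N \<omega>)))\<^sup>2) \<in> borel_measurable Q" using m by measurable
  qed
  with m show ?thesis unfolding L2_def by simp
qed

lemma pmf_of_set_lessThan:
  assumes "0 < n"
  shows "set_pmf (pmf_of_set {..<n}) = {..<n}" "i < n \<Longrightarrow> pmf (pmf_of_set {..<n}) i = 1 / real n"
  using assms by (auto simp: pmf_of_set lessThan_empty_iff)

lemma pmf_L2:
  assumes "finite (set_pmf p)"
  shows "(\<lambda>i. z i :: 'a::euclidean_space) \<in> L2 (measure_pmf p)"
  unfolding L2_def using integrable_measure_pmf_finite[OF assms] by simp

lemma empirical_P2: "0 < n \<Longrightarrow> empirical n z \<in> P2"
  unfolding empirical_def by (rule distr_P2[OF measure_pmf.prob_space_axioms pmf_L2]) (simp add: pmf_of_set_lessThan)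

lemma bounded_L2:
  assumes Q: "prob_space Q" and m: "X \<in> borel_measurable Q" and b: "\<And>\<omega>. norm (X \<omega>) \<le> B"
  shows "(X :: _ \<Rightarrow> 'a::euclidean_space) \<in> L2 Q"
proof -
  interpret prob_space Q by fact
  have "integrable Q (\<lambda>\<omega>. (norm (X \<omega>))\<^sup>2)"
    by (rule integrable_const_bound[where B="B\<^sup>2"]) (use m b in \<open>auto intro!: power_mono\<close>)
  with m show ?thesis unfolding L2_def by simp
qed

text \<open>The laws on the unit interval are sequentially compact by Helly's selection theorem, and
  Skorohod's representation turns weak into pointwise convergence, hence into convergence of the
  second moments of the difference, which the continuous curve preserves.\<close>

lemma compactin_curve_laws:
  fixes e :: "'n::finite \<Rightarrow> nat" and c :: "real^'n \<Rightarrow> real^'n"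
  assumes c: "continuous_on UNIV c"
  shows "compactin W2_top {distr \<nu> borel (\<lambda>t. c (box_curve e t)) | \<nu>. real_distribution \<nu> \<and> measure \<nu> {0..1} = 1}"
    (is "compactin _ ?C")
proof -
  define g where "g t = c (box_curve e t)" for t
  have gc: "continuous_on UNIV g"
    unfolding g_def by (rule continuous_on_compose2[OF c continuous_box_curve]) simp
  have gm [measurable]: "g \<in> borel_measurable borel"
    by (rule borel_measurable_continuous_onI[OF gc])
  have "bounded (c ` cball 0 (real CARD('n)))"
    by (rule compact_imp_bounded[OF compact_continuous_image[OF continuous_on_subset[OF c]]]) auto
  then obtain B where "\<forall>y\<in>c ` cball 0 (real CARD('n)). norm y \<le> B"
    unfolding bounded_iff by blast
  then have B: "norm (c x) \<le> B" if "norm x \<le> real CARD('n)" for x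
    using that by simp
  have gB: "norm (g t) \<le> B" for t unfolding g_def by (rule B[OF box_curve_bounded])
  have inP: "distr \<nu> borel g \<in> P2" if "real_distribution \<nu>" for \<nu>
  proof -
    interpret real_distribution \<nu> by fact
    show ?thesis by (rule distr_P2[OF prob_space_axioms bounded_L2[OF prob_space_axioms _ gB]]) measurable
  qed
  have "compactin Wass.mtopology ?C"
    unfolding Wass.compactin_sequentially
  proof (intro conjI allI impI)
    show "?C \<subseteq> P2" using inP unfolding g_def by auto
    fix \<sigma> :: "nat \<Rightarrow> (real^'n) measure" assume "range \<sigma> \<subseteq> ?C"
    then have "\<forall>i. \<exists>\<nu>. \<sigma> i = distr \<nu> borel g \<and> real_distribution \<nu> \<and> measure \<nu> {0..1} = 1"
      unfolding g_def by blast
    then obtain \<nu> where \<nu>: "\<And>i. \<sigma> i = distr (\<nu> i) borel g" "\<And>i. real_distribution (\<nu> i)"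
      "\<And>i. measure (\<nu> i) {0..1::real} = 1" by metis
    have "tight \<nu>"
      unfolding tight_def
    proof (intro conjI allI impI)
      fix \<epsilon> :: real assume "0 < \<epsilon>"
      have "1 - \<epsilon> < measure (\<nu> i) {-1<..1}" for i
      proof -
        interpret real_distribution "\<nu> i" by (rule \<nu>(2))
        have "measure (\<nu> i) {0..1} \<le> measure (\<nu> i) {-1<..1}"
          by (rule finite_measure_mono) auto
        with \<nu>(3)[of i] \<open>0 < \<epsilon>\<close> show ?thesis by simp
      qed
      then show "\<exists>a b. a < b \<and> (\<forall>i. 1 - \<epsilon> < measure (\<nu> i) {a<..b})"
        by (intro exI[of _ "-1"] exI[of _ 1]) simp
    qed (rule \<nu>(2))
    from tight_imp_convergent_subsubsequence[OF this strict_mono_id]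
    obtain r M where r: "strict_mono r" and M: "real_distribution M" and w: "weak_conv_m (\<nu> \<circ> id \<circ> r) M"
      by blast
    have rd: "real_distribution ((\<nu> \<circ> id \<circ> r) n)" for n using \<nu>(2) by simp
    obtain \<Omega> :: "real measure" and Ys Y where Q: "prob_space \<Omega>"
      and Ysm0: "\<forall>n. Ys n \<in> measurable \<Omega> borel" and Ysd0: "\<forall>n. distr \<Omega> borel (Ys n) = (\<nu> \<circ> id \<circ> r) n"
      and Ym0: "Y \<in> measurable \<Omega> lborel" and Yd: "distr \<Omega> borel Y = M"
      and lim0: "\<forall>x\<in>space \<Omega>. (\<lambda>n. Ys n x) \<longlonglongrightarrow> Y x"
      using Skorohod[OF rd M w] by blast
    have Ysm: "\<And>n. Ys n \<in> borel_measurable \<Omega>" and Ysd: "\<And>n. distr \<Omega> borel (Ys n) = (\<nu> \<circ> id \<circ> r) n"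
      and lim: "\<And>x. x \<in> space \<Omega> \<Longrightarrow> (\<lambda>n. Ys n x) \<longlonglongrightarrow> Y x"
      using Ysm0 Ysd0 lim0 by blast+
    have Ym: "Y \<in> borel_measurable \<Omega>" using Ym0 by simp
    interpret Q: prob_space \<Omega> by (rule Q)
    note [measurable] = Ysm Ym
    have AEn: "AE x in \<Omega>. \<forall>n. Ys n x \<in> {0..1}"
      unfolding AE_all_countable
    proof
      fix n
      have "measure (distr \<Omega> borel (Ys n)) {0..1} = 1" unfolding Ysd using \<nu>(3) by simp
      then have "Q.prob (Ys n -` {0..1} \<inter> space \<Omega>) = 1" by (simp add: measure_distr)
      then have "AE x in \<Omega>. x \<in> Ys n -` {0..1} \<inter> space \<Omega>" by (rule Q.AE_prob_1)
      then show "AE x in \<Omega>. Ys n x \<in> {0..1}" by (rule AE_mp) auto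
    qed
    have AEY: "AE x in \<Omega>. Y x \<in> {0..1}"
    proof (rule AE_mp[OF AEn], rule AE_I2, rule impI)
      fix x assume x: "x \<in> space \<Omega>" and *: "\<forall>n. Ys n x \<in> {0..1}"
      show "Y x \<in> {0..1}"
        by (rule closed_sequentially[OF closed_atLeastAtMost _ lim[OF x]]) (use * in blast)
    qed
    have "measure M {0..1} = Q.prob (Y -` {0..1} \<inter> space \<Omega>)"
      unfolding Yd[symmetric] by (simp add: measure_distr)
    also have "\<dots> = 1"
      by (subst Q.prob_eq_1) (use AEY in auto)
    finally have M1: "measure M {0..1} = 1" .
    let ?l = "distr M borel g"
    have Mm: "distr \<Omega> borel (\<lambda>x. g (Y x)) = ?l"
      unfolding Yd[symmetric] by (subst distr_distr) (auto simp: o_def)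
    have Mn: "distr \<Omega> borel (\<lambda>x. g (Ys n x)) = (\<sigma> \<circ> r) n" for n
    proof -
      have "(\<sigma> \<circ> r) n = distr (distr \<Omega> borel (Ys n)) borel g" unfolding Ysd using \<nu>(1) by simp
      also have "\<dots> = distr \<Omega> borel (\<lambda>x. g (Ys n x))" by (subst distr_distr) (auto simp: o_def)
      finally show ?thesis by simp
    qed
    have "(\<lambda>n. L2_norm \<Omega> (\<lambda>x. g (Ys n x) - g (Y x))) \<longlonglongrightarrow> sqrt (\<integral>x. 0 \<partial>\<Omega>)"
      unfolding L2_norm_def
    proof (rule tendsto_real_sqrt, rule integral_dominated_convergence[where w="\<lambda>_. (2 * B)\<^sup>2"])
      show "AE x in \<Omega>. (\<lambda>n. (norm (g (Ys n x) - g (Y x)))\<^sup>2) \<longlonglongrightarrow> 0"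
      proof (rule AE_I2)
        fix x assume "x \<in> space \<Omega>"
        from lim[OF this] have "(\<lambda>n. g (Ys n x)) \<longlonglongrightarrow> g (Y x)"
          by (rule continuous_on_tendsto_compose[OF gc]) auto
        then have "(\<lambda>n. (norm (g (Ys n x) - g (Y x)))\<^sup>2) \<longlonglongrightarrow> (norm (g (Y x) - g (Y x)))\<^sup>2"
          by (intro tendsto_intros)
        then show "(\<lambda>n. (norm (g (Ys n x) - g (Y x)))\<^sup>2) \<longlonglongrightarrow> 0" by simp
      qed
      show "AE x in \<Omega>. norm ((norm (g (Ys n x) - g (Y x)))\<^sup>2) \<le> (2 * B)\<^sup>2" for n
      proof (rule AE_I2)
        fix x
        have "norm (g (Ys n x) - g (Y x)) \<le> 2 * B"
          using norm_triangle_ineq4[of "g (Ys n x)" "g (Y x)"] gB[of "Ys n x"] gB[of "Y x"] by linarith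
        then have "(norm (g (Ys n x) - g (Y x)))\<^sup>2 \<le> (2 * B)\<^sup>2" by (rule power_mono) simp
        then show "norm ((norm (g (Ys n x) - g (Y x)))\<^sup>2) \<le> (2 * B)\<^sup>2" by simp
      qed
      show "(\<lambda>x. (norm (g (Ys n x) - g (Y x)))\<^sup>2) \<in> borel_measurable \<Omega>" for n by measurable
    qed simp_all
    then have lim0: "(\<lambda>n. L2_norm \<Omega> (\<lambda>x. g (Ys n x) - g (Y x))) \<longlonglongrightarrow> 0" by simp
    have LB: "(\<lambda>x. g (h x)) \<in> L2 \<Omega>" if "h \<in> borel_measurable \<Omega>" for h
      by (rule bounded_L2[OF Q measurable_compose[OF that gm] gB])
    have "(\<lambda>n. W2 ((\<sigma> \<circ> r) n) ?l) \<longlonglongrightarrow> 0"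
    proof (rule tendsto_sandwich[OF _ _ tendsto_const lim0])
      show "\<forall>\<^sub>F n in sequentially. W2 ((\<sigma> \<circ> r) n) ?l \<le> L2_norm \<Omega> (\<lambda>x. g (Ys n x) - g (Y x))"
        by (rule always_eventually, rule allI, unfold Mn[symmetric] Mm[symmetric], rule W2_distr_le[OF Q LB[OF Ysm] LB[OF Ym]])
    qed simp
    moreover have "(\<sigma> \<circ> r) n \<in> P2" for n
      using inP[OF \<nu>(2)] \<nu>(1) by simp
    ultimately have "limitin Wass.mtopology (\<sigma> \<circ> r) ?l sequentially"
      unfolding Wass.limitin_metric_dist_null using inP[OF M] by (simp add: always_eventually)
    moreover have "?l \<in> ?C" using M M1 unfolding g_def by blast
    ultimately show "\<exists>l r. l \<in> ?C \<and> strict_mono r \<and> limitin Wass.mtopology (\<sigma> \<circ> r) l sequentially"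
      using r by blast
  qed
  then show ?thesis unfolding W2_top_def .
qed

text \<open>Every point of the box is attained by the curve followed by an affine map, so an empirical measure
  of such points is the image of a law on \<open>{0..1}\<close>. The compact set is independent of the number of
  points.\<close>

lemma compact_superset_of_box_empiricals:
  fixes R :: real
  assumes "0 < R"
  obtains C :: "(real^'n::finite) measure set" where "compactin W2_top C"
    "\<And>n z. 0 < n \<Longrightarrow> (\<And>l a. l < n \<Longrightarrow> \<bar>z l $ a\<bar> \<le> R) \<Longrightarrow> empirical n z \<in> C"
proof -
  obtain e0 :: "'n \<Rightarrow> nat" where e: "bij_betw e0 UNIV {..<CARD('n)}"
    using ex_bij_betw_finite_nat[of "UNIV :: 'n set"] by (auto simp: atLeast0LessThan)
  define c :: "real^'n \<Rightarrow> real^'n" where "c x = (\<chi> a. R * (4 * x $ a - 2))" for x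
  have c: "continuous_on UNIV c"
    unfolding c_def by (intro continuous_on_vec_lambda continuous_intros)
  define C where "C = {distr \<nu> borel (\<lambda>t. c (box_curve e0 t)) | \<nu>. real_distribution \<nu> \<and> measure \<nu> {0..1} = 1}"
  have "empirical n z \<in> C" if n: "0 < n" and z: "\<And>l a. l < n \<Longrightarrow> \<bar>z l $ a\<bar> \<le> R" for n z
  proof -
    have "\<exists>t. 0 \<le> t \<and> t \<le> 1 \<and> (l < n \<longrightarrow> c (box_curve e0 t) = z l)" for l
    proof (cases "l < n")
      case True
      let ?x = "(\<chi> a. (z l $ a / R + 2) / 4) :: real^'n"
      have b: "-1 \<le> z l $ a / R \<and> z l $ a / R \<le> 1" for a
        using z[OF True, of a] \<open>0 < R\<close> by (auto simp: abs_le_iff field_simps)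
      have "0 \<le> ?x $ a" "?x $ a < 1" for a using b[of a] by auto
      then obtain t where "0 \<le> t" "t \<le> 1" "box_curve e0 t = ?x"
        using box_curve_surj[OF e, of ?x] by blast
      moreover have "R * (4 * ((z l $ a / R + 2) / 4) - 2) = z l $ a" for a
        using \<open>0 < R\<close> by (simp add: field_simps)
      then have "c ?x = z l" by (simp add: c_def vec_eq_iff del: times_divide_eq_right)
      ultimately show ?thesis by auto
    qed (auto intro: exI[of _ 0])
    then obtain s where s: "\<And>l. 0 \<le> s l" "\<And>l. s l \<le> 1" "\<And>l. l < n \<Longrightarrow> c (box_curve e0 (s l)) = z l"
      by metis
    let ?p = "measure_pmf (pmf_of_set {..<n})"
    let ?\<nu> = "distr ?p borel s"
    have gm: "(\<lambda>t. c (box_curve e0 t)) \<in> borel_measurable borel"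
      by (rule borel_measurable_continuous_onI[OF continuous_on_compose2[OF c continuous_box_curve]]) simp
    have "distr ?\<nu> borel (\<lambda>t. c (box_curve e0 t)) = distr ?p borel (\<lambda>l. c (box_curve e0 (s l)))"
      by (subst distr_distr[OF gm]) (auto simp: o_def)
    also have "\<dots> = empirical n z"
      unfolding empirical_def
      by (rule distr_cong_AE) (use n in \<open>auto simp: AE_measure_pmf_iff pmf_of_set_lessThan s(3)\<close>)
    finally have "empirical n z = distr ?\<nu> borel (\<lambda>t. c (box_curve e0 t))" by simp
    moreover have "real_distribution ?\<nu>"
      by (auto simp: real_distribution_def real_distribution_axioms_def intro!: measure_pmf.prob_space_distr)
    moreover have "measure ?\<nu> {0..1} = 1"
      using s(1,2) by (subst measure_distr) (auto simp: vimage_def)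
    ultimately show ?thesis unfolding C_def by blast
  qed
  moreover have "compactin W2_top C" unfolding C_def by (rule compactin_curve_laws[OF c])
  ultimately show ?thesis using that by blast
qed

section \<open>Product weights\<close>

text \<open>For probability weights this is the expectation of \<open>F\<close> under independent choices. The weights are
  arbitrary, so that the derivative of a weight can take the place of one of them.\<close>

definition product_sum :: "'i set \<Rightarrow> 'z set \<Rightarrow> ('i \<Rightarrow> 'z \<Rightarrow> real) \<Rightarrow> (('i \<Rightarrow> 'z) \<Rightarrow> real) \<Rightarrow> real" where
  "product_sum I Z w F = (\<Sum>\<alpha>\<in>PiE I (\<lambda>_. Z). (\<Prod>i\<in>I. w i (\<alpha> i)) * F \<alpha>)"

lemma product_sum_cong:
  "(\<And>i z. i \<in> I \<Longrightarrow> z \<in> Z \<Longrightarrow> w i z = w' i z) \<Longrightarrow> (\<And>\<alpha>. \<alpha> \<in> PiE I (\<lambda>_. Z) \<Longrightarrow> F \<alpha> = F' \<alpha>) \<Longrightarrow>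
    product_sum I Z w F = product_sum I Z w' F'"
  unfolding product_sum_def by (intro sum.cong arg_cong2[where f="(*)"] prod.cong) (auto simp: PiE_mem)

lemma product_sum_add: "product_sum I Z w (\<lambda>\<alpha>. F \<alpha> + G \<alpha>) = product_sum I Z w F + product_sum I Z w G"
  unfolding product_sum_def by (simp add: distrib_left sum.distrib)

lemma product_sum_diff: "product_sum I Z w (\<lambda>\<alpha>. F \<alpha> - G \<alpha>) = product_sum I Z w F - product_sum I Z w G"
  unfolding product_sum_def by (simp add: right_diff_distrib sum_subtractf)

lemma product_sum_cmult: "product_sum I Z w (\<lambda>\<alpha>. c * F \<alpha>) = c * product_sum I Z w F"
  unfolding product_sum_def sum_distrib_left by (intro sum.cong) auto

lemma product_sum_sum: "product_sum I Z w (\<lambda>\<alpha>. \<Sum>j\<in>J. F j \<alpha>) = (\<Sum>j\<in>J. product_sum I Z w (F j))"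
  unfolding product_sum_def sum_distrib_left by (rule sum.swap)

lemma product_sum_split:
  assumes I: "finite I" "i \<in> I" and Z: "finite Z"
  shows "product_sum I Z w F =
    product_sum (I - {i}) Z w (\<lambda>\<alpha>. \<Sum>z\<in>Z. w i z * F (\<alpha>(i := z)))"
proof -
  let ?J = "I - {i}"
  have II: "I = insert i ?J" using I by auto
  have inj: "inj_on (\<lambda>(z, \<alpha>). \<alpha>(i := z)) (Z \<times> PiE ?J (\<lambda>_. Z))"
    by (rule inj_combinator[of i ?J "\<lambda>_. Z"]) simp
  have "product_sum I Z w F = (\<Sum>\<alpha>\<in>(\<lambda>(z, \<alpha>). \<alpha>(i := z)) ` (Z \<times> PiE ?J (\<lambda>_. Z)). (\<Prod>j\<in>I. w j (\<alpha> j)) * F \<alpha>)"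
    unfolding product_sum_def by (subst (1) II, subst PiE_insert_eq) simp
  also have "\<dots> = (\<Sum>(z, \<alpha>)\<in>Z \<times> PiE ?J (\<lambda>_. Z). (\<Prod>j\<in>I. w j ((\<alpha>(i := z)) j)) * F (\<alpha>(i := z)))"
    by (subst sum.reindex[OF inj]) (simp add: case_prod_unfold)
  also have "\<dots> = (\<Sum>z\<in>Z. \<Sum>\<alpha>\<in>PiE ?J (\<lambda>_. Z). (\<Prod>j\<in>I. w j ((\<alpha>(i := z)) j)) * F (\<alpha>(i := z)))"
    by (rule sum.cartesian_product[symmetric])
  also have "\<dots> = (\<Sum>\<alpha>\<in>PiE ?J (\<lambda>_. Z). \<Sum>z\<in>Z. (\<Prod>j\<in>I. w j ((\<alpha>(i := z)) j)) * F (\<alpha>(i := z)))"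
    by (rule sum.swap)
  also have "\<dots> = product_sum ?J Z w (\<lambda>\<alpha>. \<Sum>z\<in>Z. w i z * F (\<alpha>(i := z)))"
    unfolding product_sum_def sum_distrib_left
  proof (intro sum.cong refl)
    fix \<alpha> z assume "\<alpha> \<in> PiE ?J (\<lambda>_. Z)" "z \<in> Z"
    have "(\<Prod>j\<in>I. w j ((\<alpha>(i := z)) j)) = w i z * (\<Prod>j\<in>?J. w j ((\<alpha>(i := z)) j))"
      using prod.remove[OF I, of "\<lambda>j. w j ((\<alpha>(i := z)) j)"] by simp
    also have "(\<Prod>j\<in>?J. w j ((\<alpha>(i := z)) j)) = (\<Prod>j\<in>?J. w j (\<alpha> j))"
      by (rule prod.cong) auto
    finally show "(\<Prod>j\<in>I. w j ((\<alpha>(i := z)) j)) * F (\<alpha>(i := z)) = (\<Prod>j\<in>?J. w j (\<alpha> j)) * (w i z * F (\<alpha>(i := z)))"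
      by simp
  qed
  finally show ?thesis .
qed

lemma product_sum_const:
  assumes "finite I" "finite Z" "\<And>i. i \<in> I \<Longrightarrow> (\<Sum>z\<in>Z. w i z) = 1"
  shows "product_sum I Z w (\<lambda>_. c) = c"
proof -
  have "product_sum I Z w (\<lambda>_. c) = (\<Sum>\<alpha>\<in>PiE I (\<lambda>_. Z). (\<Prod>i\<in>I. w i (\<alpha> i))) * c"
    unfolding product_sum_def by (simp add: sum_distrib_right)
  also have "(\<Sum>\<alpha>\<in>PiE I (\<lambda>_. Z). (\<Prod>i\<in>I. w i (\<alpha> i))) = (\<Prod>i\<in>I. \<Sum>z\<in>Z. w i z)"
    by (rule prod_sum_PiE[symmetric]) (use assms in auto)
  also have "\<dots> = 1" using assms(3) by simp
  finally show ?thesis by simp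
qed

lemma product_sum_mono:
  assumes "\<And>i z. i \<in> I \<Longrightarrow> z \<in> Z \<Longrightarrow> 0 \<le> w i z" "\<And>\<alpha>. \<alpha> \<in> PiE I (\<lambda>_. Z) \<Longrightarrow> F \<alpha> \<le> G \<alpha>"
  shows "product_sum I Z w F \<le> product_sum I Z w G"
  unfolding product_sum_def
  by (intro sum_mono mult_left_mono prod_nonneg ballI assms) (auto simp: PiE_mem)

lemma product_sum_abs:
  assumes "\<And>i z. i \<in> I \<Longrightarrow> z \<in> Z \<Longrightarrow> 0 \<le> w i z"
  shows "\<bar>product_sum I Z w F\<bar> \<le> product_sum I Z w (\<lambda>\<alpha>. \<bar>F \<alpha>\<bar>)"
proof -
  have "\<bar>product_sum I Z w F\<bar> \<le> (\<Sum>\<alpha>\<in>PiE I (\<lambda>_. Z). \<bar>(\<Prod>i\<in>I. w i (\<alpha> i)) * F \<alpha>\<bar>)"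
    unfolding product_sum_def by (rule sum_abs)
  also have "\<dots> = product_sum I Z w (\<lambda>\<alpha>. \<bar>F \<alpha>\<bar>)"
    unfolding product_sum_def abs_mult
  proof (intro sum.cong refl arg_cong2[where f="(*)"] abs_of_nonneg prod_nonneg ballI)
    fix \<alpha> i assume "\<alpha> \<in> PiE I (\<lambda>_. Z)" "i \<in> I"
    then have "\<alpha> i \<in> Z" by (rule PiE_mem)
    with \<open>i \<in> I\<close> show "0 \<le> w i (\<alpha> i)" by (rule assms)
  qed
  finally show ?thesis .
qed

lemma product_sum_one_factor:
  assumes I: "finite I" "i \<in> I" and Z: "finite Z" and w: "\<And>i. i \<in> I \<Longrightarrow> (\<Sum>z\<in>Z. w i z) = 1"
  shows "product_sum I Z w (\<lambda>\<alpha>. X (\<alpha> i)) = (\<Sum>z\<in>Z. w i z * X z)"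
  unfolding product_sum_split[OF I Z] fun_upd_same
  by (rule product_sum_const) (use I Z w in auto)

lemma product_sum_two_factors:
  assumes I: "finite I" "i \<in> I" "j \<in> I" "i \<noteq> j" and Z: "finite Z" and w: "\<And>i. i \<in> I \<Longrightarrow> (\<Sum>z\<in>Z. w i z) = 1"
  shows "product_sum I Z w (\<lambda>\<alpha>. X (\<alpha> i) * Y (\<alpha> j)) = (\<Sum>z\<in>Z. w i z * X z) * (\<Sum>z\<in>Z. w j z * Y z)"
proof -
  have "product_sum I Z w (\<lambda>\<alpha>. X (\<alpha> i) * Y (\<alpha> j))
      = product_sum (I - {i}) Z w (\<lambda>\<alpha>. (\<Sum>z\<in>Z. w i z * X z) * Y (\<alpha> j))"
    unfolding product_sum_split[OF I(1,2) Z] using I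
    by (intro product_sum_cong) (auto simp: sum_distrib_right mult.assoc)
  also have "\<dots> = (\<Sum>z\<in>Z. w i z * X z) * product_sum (I - {i}) Z w (\<lambda>\<alpha>. Y (\<alpha> j))"
    by (rule product_sum_cmult)
  also have "product_sum (I - {i}) Z w (\<lambda>\<alpha>. Y (\<alpha> j)) = (\<Sum>z\<in>Z. w j z * Y z)"
    by (rule product_sum_one_factor) (use I Z w in auto)
  finally show ?thesis .
qed

text \<open>By independence, the mixed terms of the square have mean zero.\<close>

lemma product_sum_variance:
  assumes I: "finite I" and Z: "finite Z" and w: "\<And>i. i \<in> I \<Longrightarrow> (\<Sum>z\<in>Z. w i z) = 1"
    and X: "\<And>i. i \<in> I \<Longrightarrow> (\<Sum>z\<in>Z. w i z * X i z) = 0"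
  shows "product_sum I Z w (\<lambda>\<alpha>. (\<Sum>i\<in>I. X i (\<alpha> i))\<^sup>2) = (\<Sum>i\<in>I. \<Sum>z\<in>Z. w i z * (X i z)\<^sup>2)"
proof -
  have "product_sum I Z w (\<lambda>\<alpha>. (\<Sum>i\<in>I. X i (\<alpha> i))\<^sup>2)
      = (\<Sum>i\<in>I. \<Sum>j\<in>I. product_sum I Z w (\<lambda>\<alpha>. X i (\<alpha> i) * X j (\<alpha> j)))"
    unfolding power2_eq_square sum_product product_sum_sum ..
  also have "\<dots> = (\<Sum>i\<in>I. \<Sum>j\<in>I. if j = i then \<Sum>z\<in>Z. w i z * (X i z)\<^sup>2 else 0)"
  proof (intro sum.cong refl)
    fix i j assume ij: "i \<in> I" "j \<in> I"
    show "product_sum I Z w (\<lambda>\<alpha>. X i (\<alpha> i) * X j (\<alpha> j)) = (if j = i then \<Sum>z\<in>Z. w i z * (X i z)\<^sup>2 else 0)"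
    proof (cases "j = i")
      case True
      then show ?thesis
        using product_sum_one_factor[OF I ij(1) Z w, where X="\<lambda>z. X i z * X i z"] by (simp add: power2_eq_square)
    next
      case False
      then show ?thesis
        using product_sum_two_factors[OF I ij _ Z w, where X="X i" and Y="X j"] X[OF ij(1)] by auto
    qed
  qed
  also have "\<dots> = (\<Sum>i\<in>I. \<Sum>z\<in>Z. w i z * (X i z)\<^sup>2)" using I by (simp add: sum.delta)
  finally show ?thesis .
qed

section \<open>Coin patterns\<close>

type_synonym 'n pattern = "'n \<times> nat \<Rightarrow> bool"

definition coins :: "nat \<Rightarrow> ('n \<times> nat) set" where "coins m = UNIV \<times> {..<m}"

text \<open>A pattern records the outcomes of \<open>m\<close> coins for each coordinate.\<close>

definition patterns :: "nat \<Rightarrow> 'n pattern set" where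
  "patterns m = PiE (coins m) (\<lambda>_. UNIV)"

definition bias :: "real \<Rightarrow> real^'n \<Rightarrow> 'n \<Rightarrow> real" where
  "bias k y a = (1 + sin (y $ a / k)) / 2"

definition coin_weight :: "real \<Rightarrow> real^'n \<Rightarrow> 'n \<times> nat \<Rightarrow> bool \<Rightarrow> real" where
  "coin_weight k y e b = (if b then bias k y (fst e) else 1 - bias k y (fst e))"

definition pattern_weight :: "real \<Rightarrow> nat \<Rightarrow> 'n pattern \<Rightarrow> real^'n \<Rightarrow> real" where
  "pattern_weight k m \<zeta> y = (\<Prod>e\<in>coins m. coin_weight k y e (\<zeta> e))"

text \<open>The mean of this grid point under the coins of bias \<open>bias k y\<close> is the truncated point
  \<open>sine_map k y\<close> below.\<close>

definition node :: "real \<Rightarrow> nat \<Rightarrow> 'n pattern \<Rightarrow> real^'n" where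
  "node k m \<zeta> = (\<chi> a. k * (2 / real m * (\<Sum>r<m. of_bool (\<zeta> (a, r))) - 1))"

definition sine_map :: "real \<Rightarrow> real^'n \<Rightarrow> real^'n" where
  "sine_map k y = (\<chi> a. k * sin (y $ a / k))"

lemma finite_coins [simp]: "finite (coins m :: ('n::finite \<times> nat) set)"
  by (simp add: coins_def)

lemma finite_patterns [simp]: "finite (patterns m :: ('n::finite \<times> nat \<Rightarrow> bool) set)"
  unfolding patterns_def by (rule finite_PiE) auto

lemma bias_bounds: "0 \<le> bias k y a" "bias k y a \<le> 1"
proof -
  have "0 \<le> 1 + sin t" for t :: real using sin_ge_minus_one[of t] by linarith
  then show "0 \<le> bias k y a" unfolding bias_def by simp
  have "1 + sin t \<le> 2" for t :: real using sin_le_one[of t] by linarith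
  then show "bias k y a \<le> 1" unfolding bias_def by simp
qed

lemma coin_weight_nonneg: "0 \<le> coin_weight k y e b"
  using bias_bounds[of k y "fst e"] by (simp add: coin_weight_def)

lemma sum_coin_weight: "(\<Sum>b\<in>UNIV. coin_weight k y e b) = 1"
  by (simp add: coin_weight_def UNIV_bool)

lemma pattern_weight_nonneg: "0 \<le> pattern_weight k m \<zeta> y"
  unfolding pattern_weight_def by (intro prod_nonneg ballI coin_weight_nonneg)

lemma product_sum_coins:
  "product_sum (coins m) UNIV (coin_weight k y) F = (\<Sum>\<zeta>\<in>patterns m. pattern_weight k m \<zeta> y * F \<zeta>)"
  unfolding product_sum_def patterns_def pattern_weight_def ..

lemma sum_pattern_weight: "(\<Sum>\<zeta>\<in>patterns m. pattern_weight k m \<zeta> (y :: real^'n::finite)) = 1"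
  using product_sum_const[of "coins m" UNIV "coin_weight k y" 1] by (simp add: product_sum_coins sum_coin_weight)

lemma pattern_weight_le_1: "\<zeta> \<in> patterns m \<Longrightarrow> pattern_weight k m \<zeta> (y :: real^'n::finite) \<le> 1"
  unfolding sum_pattern_weight[symmetric, of k m y]
  by (rule member_le_sum) (auto simp: pattern_weight_nonneg)

lemma node_bound:
  assumes "0 \<le> k"
  shows "\<bar>node k m \<zeta> $ a\<bar> \<le> k"
proof -
  let ?s = "\<Sum>r<m. of_bool (\<zeta> (a, r)) :: real"
  have "?s \<le> (\<Sum>r<m. 1)" by (intro sum_mono) simp
  then have s: "0 \<le> ?s" "?s \<le> real m" by (auto intro: sum_nonneg)
  have "0 \<le> 2 / real m * ?s" using s by simp
  moreover have "2 / real m * ?s \<le> 2" using s by (simp add: divide_le_eq)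
  ultimately have "\<bar>2 / real m * ?s - 1\<bar> \<le> 1" by linarith
  then have "k * \<bar>2 / real m * ?s - 1\<bar> \<le> k * 1" using assms by (rule mult_left_mono)
  then show ?thesis using assms by (simp add: node_def abs_mult)
qed

text \<open>The coins are independent with the right mean, so that their variances add up.\<close>

lemma node_variance_component:
  fixes y :: "real^'n::finite"
  assumes m: "0 < m"
  shows "(\<Sum>\<zeta>\<in>patterns m. pattern_weight k m \<zeta> y * (node k m \<zeta> $ a - sine_map k y $ a)\<^sup>2) \<le> k\<^sup>2 / real m"
proof -
  define c where "c = 2 * k / real m"
  define X :: "'n \<times> nat \<Rightarrow> bool \<Rightarrow> real" where
    "X e b = (if fst e = a then c * (of_bool b - bias k y a) else 0)" for e b
  have row: "(\<Sum>e\<in>coins m. if fst e = a then h e else 0) = (\<Sum>r<m. h (a, r))" for h :: "'n \<times> nat \<Rightarrow> real"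
  proof -
    have "(\<Sum>e\<in>coins m. if fst e = a then h e else 0) = (\<Sum>b\<in>UNIV. \<Sum>r<m. if b = a then h (b, r) else 0)"
      unfolding coins_def sum.cartesian_product by (rule sum.cong) auto
    also have "\<dots> = (\<Sum>b\<in>UNIV. if b = a then \<Sum>r<m. h (b, r) else 0)"
      by (rule sum.cong) auto
    finally show ?thesis by (simp add: sum.delta)
  qed
  have eq: "node k m \<zeta> $ a - sine_map k y $ a = (\<Sum>e\<in>coins m. X e (\<zeta> e))" for \<zeta>
  proof -
    have "(\<Sum>e\<in>coins m. X e (\<zeta> e)) = (\<Sum>r<m. c * (of_bool (\<zeta> (a, r)) - bias k y a))"
      unfolding X_def by (rule row[of "\<lambda>e. c * (of_bool (\<zeta> e) - bias k y a)"])
    also have "\<dots> = 2 * k / real m * (\<Sum>r<m. of_bool (\<zeta> (a, r))) - 2 * k / real m * (real m * bias k y a)"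
      unfolding c_def sum_distrib_left[symmetric] sum_subtractf right_diff_distrib by simp
    also have "2 * k / real m * (real m * bias k y a) = 2 * k * bias k y a" using m by simp
    also have "2 * k / real m * (\<Sum>r<m. of_bool (\<zeta> (a, r))) - 2 * k * bias k y a = node k m \<zeta> $ a - sine_map k y $ a"
    proof -
      have "2 * k / M * S - 2 * k * ((1 + s) / 2) = k * (2 / M * S - 1) - k * s" for M S s :: real
        by (simp add: algebra_simps add_divide_distrib)
      then show ?thesis unfolding node_def sine_map_def bias_def vec_lambda_beta .
    qed
    finally show ?thesis by simp
  qed
  have "(\<Sum>\<zeta>\<in>patterns m. pattern_weight k m \<zeta> y * (node k m \<zeta> $ a - sine_map k y $ a)\<^sup>2)
      = product_sum (coins m) UNIV (coin_weight k y) (\<lambda>\<zeta>. (\<Sum>e\<in>coins m. X e (\<zeta> e))\<^sup>2)"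
    unfolding product_sum_coins eq ..
  also have "\<dots> = (\<Sum>e\<in>coins m. \<Sum>b\<in>UNIV. coin_weight k y e b * (X e b)\<^sup>2)"
    by (rule product_sum_variance) (auto simp: sum_coin_weight, simp add: X_def coin_weight_def UNIV_bool algebra_simps)
  also have "\<dots> = (\<Sum>e\<in>coins m. if fst e = a then c\<^sup>2 * (bias k y a * (1 - bias k y a)) else 0)"
  proof (rule sum.cong[OF refl])
    fix e :: "'n \<times> nat"
    have v: "t * (1 - t)\<^sup>2 + (1 - t) * (0 - t)\<^sup>2 = t * (1 - t)" for t :: real
      by (simp add: power2_eq_square algebra_simps)
    show "(\<Sum>b\<in>UNIV. coin_weight k y e b * (X e b)\<^sup>2)
        = (if fst e = a then c\<^sup>2 * (bias k y a * (1 - bias k y a)) else 0)"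
      unfolding v[symmetric] by (simp add: X_def coin_weight_def UNIV_bool power2_eq_square algebra_simps)
  qed
  also have "\<dots> = real m * (c\<^sup>2 * (bias k y a * (1 - bias k y a)))"
    unfolding row by simp
  also have "\<dots> \<le> real m * (c\<^sup>2 * (1 / 4))"
  proof (intro mult_left_mono)
    have "0 \<le> (bias k y a - 1/2)\<^sup>2" by simp
    then show "bias k y a * (1 - bias k y a) \<le> 1 / 4" by (simp add: power2_eq_square algebra_simps)
  qed auto
  also have "\<dots> = k\<^sup>2 / real m" using m by (simp add: c_def power2_eq_square)
  finally show ?thesis .
qed

lemma norm_vec_sq: "(norm (x :: real^'n::finite))\<^sup>2 = (\<Sum>a\<in>UNIV. (x $ a)\<^sup>2)"
  by (simp add: norm_vec_def L2_set_def sum_nonneg)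

lemma node_variance:
  fixes y :: "real^'n::finite"
  assumes m: "0 < m"
  shows "(\<Sum>\<zeta>\<in>patterns m. pattern_weight k m \<zeta> y * (norm (node k m \<zeta> - sine_map k y))\<^sup>2)
    \<le> real CARD('n) * k\<^sup>2 / real m"
proof -
  have "(\<Sum>\<zeta>\<in>patterns m. pattern_weight k m \<zeta> y * (norm (node k m \<zeta> - sine_map k y))\<^sup>2)
      = (\<Sum>a\<in>UNIV. \<Sum>\<zeta>\<in>patterns m. pattern_weight k m \<zeta> y * (node k m \<zeta> $ a - sine_map k y $ a)\<^sup>2)"
    unfolding norm_vec_sq sum_distrib_left by (subst sum.swap) simp
  also have "\<dots> \<le> (\<Sum>a\<in>(UNIV::'n set). k\<^sup>2 / real m)"
    by (intro sum_mono node_variance_component m)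
  finally show ?thesis by simp
qed

section \<open>Derivatives of pattern weights\<close>

definition pattern_weight_partial :: "real \<Rightarrow> nat \<Rightarrow> 'n \<Rightarrow> 'n pattern \<Rightarrow> real^'n \<Rightarrow> real" where
  "pattern_weight_partial k m a \<zeta> y = cos (y $ a / k) / (2 * k) *
     (\<Sum>r<m. (if \<zeta> (a, r) then 1 else -1) * (\<Prod>e\<in>coins m - {(a, r)}. coin_weight k y e (\<zeta> e)))"

text \<open>The weight is \<open>1/2 \<plusminus> sin (y_a / k) / 2\<close>.\<close>

lemma coin_weight_has_derivative:
  fixes y :: "real^'n::finite"
  shows "((\<lambda>y. coin_weight k y e b) has_derivative
    (\<lambda>h. (if b then 1 else -1) * (cos (y $ fst e / k) / (2 * k)) * h $ fst e)) (at y)"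
proof -
  have "((\<lambda>y :: real^'n. y $ fst e / k) has_derivative (\<lambda>h. h $ fst e / k)) (at y)"
    by (rule bounded_linear_imp_has_derivative)
       (rule bounded_linear_compose[OF bounded_linear_divide bounded_linear_vec_nth])
  from has_derivative_add[OF has_derivative_const has_derivative_mult_right[OF has_derivative_sin[OF this]],
      of "1 / 2" "if b then 1 / 2 else - 1 / 2"]
  have "((\<lambda>y. 1 / 2 + (if b then 1 / 2 else - 1 / 2) * sin (y $ fst e / k)) has_derivative
      (\<lambda>h. (if b then 1 else -1) * (cos (y $ fst e / k) / (2 * k)) * h $ fst e)) (at y)"
    by (cases b) (simp_all add: mult.commute)
  moreover have "(\<lambda>y. 1 / 2 + (if b then 1 / 2 else - 1 / 2) * sin (y $ fst e / k)) = (\<lambda>y. coin_weight k y e b)"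
    by (rule ext) (simp add: coin_weight_def bias_def add_divide_distrib)
  ultimately show ?thesis by simp
qed

lemma pattern_weight_has_derivative:
  fixes y :: "real^'n::finite"
  shows "(pattern_weight k m \<zeta> has_derivative (\<lambda>h. \<Sum>a\<in>UNIV. pattern_weight_partial k m a \<zeta> y * h $ a)) (at y)"
proof -
  have "((\<lambda>y. \<Prod>e\<in>coins m. coin_weight k y e (\<zeta> e)) has_derivative
     (\<lambda>h. \<Sum>e\<in>coins m. ((if \<zeta> e then 1 else -1) * (cos (y $ fst e / k) / (2 * k)) * h $ fst e)
        * (\<Prod>j\<in>coins m - {e}. coin_weight k y j (\<zeta> j)))) (at y)"
    by (rule has_derivative_prod) (rule coin_weight_has_derivative)
  moreover have "(\<Sum>e\<in>coins m. ((if \<zeta> e then 1 else -1) * (cos (y $ fst e / k) / (2 * k)) * h $ fst e)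
        * (\<Prod>j\<in>coins m - {e}. coin_weight k y j (\<zeta> j))) = (\<Sum>a\<in>UNIV. pattern_weight_partial k m a \<zeta> y * h $ a)" for h
    unfolding coins_def pattern_weight_partial_def sum_distrib_left sum_distrib_right
    unfolding sum.cartesian_product' by (intro sum.cong refl) simp
  ultimately show ?thesis unfolding pattern_weight_def[abs_def] by simp
qed

text \<open>Each coin enters its weight affinely, so differentiating in its bias compares the two outcomes
  of that coin and keeps the law of all the others; re-tossing it afterwards changes nothing.\<close>

lemma sum_pattern_weight_partial:
  fixes y :: "real^'n::finite"
  shows "(\<Sum>\<zeta>\<in>patterns m. pattern_weight_partial k m a \<zeta> y * f \<zeta>) =
    cos (y $ a / k) / (2 * k) * (\<Sum>r<m. \<Sum>\<zeta>\<in>patterns m. pattern_weight k m \<zeta> y *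
      (f (\<zeta>((a, r) := True)) - f (\<zeta>((a, r) := False))))"
proof -
  have step: "(\<Sum>\<zeta>\<in>patterns m. (if \<zeta> (a, r) then 1 else -1) * (\<Prod>e\<in>coins m - {(a, r)}. coin_weight k y e (\<zeta> e)) * f \<zeta>)
      = (\<Sum>\<zeta>\<in>patterns m. pattern_weight k m \<zeta> y * (f (\<zeta>((a, r) := True)) - f (\<zeta>((a, r) := False))))"
    if r: "r < m" for r
  proof -
    let ?e = "(a, r)"
    have e: "?e \<in> coins m" using r by (simp add: coins_def)
    let ?w = "(coin_weight k y)(?e := (\<lambda>b. if b then 1 else -1))"
    let ?G = "\<lambda>\<zeta>. f (\<zeta>(?e := True)) - f (\<zeta>(?e := False))"
    have "(\<Sum>\<zeta>\<in>patterns m. (if \<zeta> ?e then 1 else -1) * (\<Prod>e\<in>coins m - {?e}. coin_weight k y e (\<zeta> e)) * f \<zeta>)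
        = product_sum (coins m) UNIV ?w f"
      unfolding product_sum_def patterns_def
    proof (rule sum.cong[OF refl])
      fix \<zeta> :: "'n \<times> nat \<Rightarrow> bool"
      have "(\<Prod>i\<in>coins m. ?w i (\<zeta> i)) = ?w ?e (\<zeta> ?e) * (\<Prod>i\<in>coins m - {?e}. ?w i (\<zeta> i))"
        by (rule prod.remove[OF finite_coins e])
      also have "(\<Prod>i\<in>coins m - {?e}. ?w i (\<zeta> i)) = (\<Prod>i\<in>coins m - {?e}. coin_weight k y i (\<zeta> i))"
        by (rule prod.cong) auto
      finally show "(if \<zeta> ?e then 1 else -1) * (\<Prod>e\<in>coins m - {?e}. coin_weight k y e (\<zeta> e)) * f \<zeta>
          = (\<Prod>i\<in>coins m. ?w i (\<zeta> i)) * f \<zeta>" by simp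
    qed
    also have "\<dots> = product_sum (coins m - {?e}) UNIV ?w ?G"
      unfolding product_sum_split[OF finite_coins e finite] by (simp add: UNIV_bool)
    also have "\<dots> = product_sum (coins m - {?e}) UNIV (coin_weight k y) ?G"
      by (rule product_sum_cong) auto
    also have "\<dots> = product_sum (coins m - {?e}) UNIV (coin_weight k y)
        (\<lambda>\<zeta>. \<Sum>b\<in>UNIV. coin_weight k y ?e b * ?G (\<zeta>(?e := b)))"
      by (rule product_sum_cong) (simp_all add: sum_distrib_right[symmetric] sum_coin_weight)
    also have "\<dots> = product_sum (coins m) UNIV (coin_weight k y) ?G"
      by (rule product_sum_split[OF finite_coins e finite, symmetric])
    finally show ?thesis unfolding product_sum_coins .
  qed
  have "(\<Sum>\<zeta>\<in>patterns m. pattern_weight_partial k m a \<zeta> y * f \<zeta>) = cos (y $ a / k) / (2 * k) *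
      (\<Sum>r<m. \<Sum>\<zeta>\<in>patterns m. (if \<zeta> (a, r) then 1 else -1) * (\<Prod>e\<in>coins m - {(a, r)}. coin_weight k y e (\<zeta> e)) * f \<zeta>)"
    unfolding pattern_weight_partial_def
    by (subst sum.swap) (simp add: sum_distrib_left sum_distrib_right mult.assoc)
  also have "(\<Sum>r<m. \<Sum>\<zeta>\<in>patterns m. (if \<zeta> (a, r) then 1 else -1) * (\<Prod>e\<in>coins m - {(a, r)}. coin_weight k y e (\<zeta> e)) * f \<zeta>)
     = (\<Sum>r<m. \<Sum>\<zeta>\<in>patterns m. pattern_weight k m \<zeta> y * (f (\<zeta>((a, r) := True)) - f (\<zeta>((a, r) := False))))"
    by (rule sum.cong[OF refl]) (use step in simp)
  finally show ?thesis .
qed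


section \<open>The law of large numbers\<close>

definition frequency :: "nat \<Rightarrow> (nat \<Rightarrow> 'z) \<Rightarrow> 'z \<Rightarrow> real" where
  "frequency n \<alpha> z = (\<Sum>l<n. of_bool (\<alpha> l = z)) / real n"

text \<open>Up to two of the \<open>n\<close> samples, those in \<open>R\<close>, may follow a law different from \<open>q\<close>. They shift the mean of
  the frequency by at most \<open>2 / n\<close>, and the centred part has variance at most \<open>1 / n\<close>; hence the
  constant \<open>10 = 2 * 1 + 2 * 2^2\<close>.\<close>

lemma frequency_second_moment:
  assumes n: "0 < n" and Z: "finite Z" "z \<in> Z" and R: "finite R" "card R \<le> 2"
    and w0: "\<And>l z. l < n \<Longrightarrow> z \<in> Z \<Longrightarrow> 0 \<le> w l z" and w1: "\<And>l. l < n \<Longrightarrow> (\<Sum>z\<in>Z. w l z) = 1"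
    and q: "0 \<le> q z" "q z \<le> 1" and wq: "\<And>l. l < n \<Longrightarrow> l \<notin> R \<Longrightarrow> w l z = q z"
  shows "product_sum {..<n} Z w (\<lambda>\<alpha>. (frequency n \<alpha> z - q z)\<^sup>2) \<le> 10 / real n"
proof -
  have wl: "w l z \<le> 1" if "l < n" for l
    unfolding w1[OF that, symmetric] using Z w0[OF that] by (intro member_le_sum) auto
  define X where "X l x = of_bool (x = z) - w l z" for l x
  define b where "b = (\<Sum>l<n. w l z - q z)"
  have b: "\<bar>b\<bar> \<le> 2"
  proof -
    have "\<bar>b\<bar> \<le> (\<Sum>l<n. \<bar>w l z - q z\<bar>)" unfolding b_def by (rule sum_abs)
    also have "\<dots> \<le> (\<Sum>l<n. if l \<in> R then 1 else 0)"
    proof (rule sum_mono)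
      fix l assume "l \<in> {..<n}"
      then have l: "l < n" by simp
      show "\<bar>w l z - q z\<bar> \<le> (if l \<in> R then 1 else 0)"
        using wq[OF l] w0[OF l Z(2)] wl[OF l] q by (auto simp: abs_le_iff)
    qed
    also have "\<dots> = real (card ({..<n} \<inter> R))" by (simp add: sum.If_cases Int_def)
    also have "\<dots> \<le> real (card R)" using R(1) by (simp add: card_mono)
    finally show ?thesis using R(2) by linarith
  qed
  have dec: "frequency n \<alpha> z - q z = ((\<Sum>l<n. X l (\<alpha> l)) + b) / real n" for \<alpha>
  proof -
    have "(\<Sum>l<n. X l (\<alpha> l)) + b = (\<Sum>l<n. of_bool (\<alpha> l = z) - q z)"
      unfolding X_def b_def sum.distrib[symmetric] by (rule sum.cong) simp_all
    also have "\<dots> = (\<Sum>l<n. of_bool (\<alpha> l = z)) - real n * q z" unfolding sum_subtractf by simp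
    finally show ?thesis using n unfolding frequency_def by (simp add: diff_divide_distrib)
  qed
  have X0: "(\<Sum>x\<in>Z. w l x * X l x) = 0" if "l < n" for l
  proof -
    have "(\<Sum>x\<in>Z. w l x * X l x) = (\<Sum>x\<in>Z. (if x = z then w l x else 0) - w l z * w l x)"
      unfolding X_def by (rule sum.cong) (auto simp: algebra_simps)
    also have "\<dots> = w l z - w l z * (\<Sum>x\<in>Z. w l x)"
      using Z by (simp add: sum_subtractf sum_distrib_left sum.delta)
    finally show ?thesis using w1[OF that] by simp
  qed
  have V: "product_sum {..<n} Z w (\<lambda>\<alpha>. (\<Sum>l<n. X l (\<alpha> l))\<^sup>2) \<le> real n"
  proof -
    have "product_sum {..<n} Z w (\<lambda>\<alpha>. (\<Sum>l<n. X l (\<alpha> l))\<^sup>2) = (\<Sum>l<n. \<Sum>x\<in>Z. w l x * (X l x)\<^sup>2)"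
      by (rule product_sum_variance) (use Z w1 X0 in auto)
    also have "\<dots> \<le> (\<Sum>l<n. \<Sum>x\<in>Z. w l x * 1)"
    proof (intro sum_mono mult_left_mono)
      fix l x assume l: "l \<in> {..<n}" and x: "x \<in> Z"
      have "\<bar>X l x\<bar> \<le> 1" using w0[of l z] wl[of l] l Z(2) by (auto simp: X_def abs_le_iff)
      then show "(X l x)\<^sup>2 \<le> 1" by (simp add: abs_square_le_1)
      show "0 \<le> w l x" using w0 l x by simp
    qed
    also have "\<dots> = real n" using w1 by simp
    finally show ?thesis .
  qed
  have "product_sum {..<n} Z w (\<lambda>\<alpha>. (frequency n \<alpha> z - q z)\<^sup>2)
      \<le> product_sum {..<n} Z w (\<lambda>\<alpha>. 2 / (real n)\<^sup>2 * (\<Sum>l<n. X l (\<alpha> l))\<^sup>2 + 8 / (real n)\<^sup>2)"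
  proof (rule product_sum_mono)
    fix \<alpha>
    let ?s = "\<Sum>l<n. X l (\<alpha> l)"
    have "b\<^sup>2 \<le> 2\<^sup>2" using b by (metis abs_le_square_iff abs_numeral)
    moreover have "0 \<le> (?s - b)\<^sup>2" by simp
    ultimately have "(?s + b)\<^sup>2 \<le> 2 * ?s\<^sup>2 + 8" by (simp add: power2_eq_square algebra_simps)
    then have "(?s + b)\<^sup>2 / (real n)\<^sup>2 \<le> (2 * ?s\<^sup>2 + 8) / (real n)\<^sup>2" by (rule divide_right_mono) simp
    then show "(frequency n \<alpha> z - q z)\<^sup>2 \<le> 2 / (real n)\<^sup>2 * ?s\<^sup>2 + 8 / (real n)\<^sup>2"
      unfolding dec power_divide by (simp add: add_divide_distrib)
  qed (use w0 in auto)
  also have "\<dots> = 2 / (real n)\<^sup>2 * product_sum {..<n} Z w (\<lambda>\<alpha>. (\<Sum>l<n. X l (\<alpha> l))\<^sup>2) + 8 / (real n)\<^sup>2"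
    unfolding product_sum_add product_sum_cmult
    by (subst product_sum_const[of "{..<n}"]) (use Z w1 in auto)
  also have "\<dots> \<le> 2 / (real n)\<^sup>2 * real n + 8 / (real n)\<^sup>2"
    by (intro add_right_mono mult_left_mono V) simp
  also have "\<dots> \<le> 10 / real n" using n by (simp add: power2_eq_square field_simps)
  finally show ?thesis .
qed

text \<open>This is \<open>\<bar>X\<bar> \<le> t + X\<^sup>2 / t\<close> for each of the finitely many patterns.\<close>

lemma frequency_deviation:
  assumes n: "0 < n" and Z: "finite Z" and R: "finite R" "card R \<le> 2"
    and w0: "\<And>l z. l < n \<Longrightarrow> z \<in> Z \<Longrightarrow> 0 \<le> w l z" and w1: "\<And>l. l < n \<Longrightarrow> (\<Sum>z\<in>Z. w l z) = 1"
    and q: "\<And>z. z \<in> Z \<Longrightarrow> 0 \<le> q z" "\<And>z. z \<in> Z \<Longrightarrow> q z \<le> 1"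
    and wq: "\<And>l z. l < n \<Longrightarrow> l \<notin> R \<Longrightarrow> z \<in> Z \<Longrightarrow> w l z = q z" and t: "0 < t"
  shows "product_sum {..<n} Z w (\<lambda>\<alpha>. \<Sum>z\<in>Z. \<bar>frequency n \<alpha> z - q z\<bar>)
    \<le> real (card Z) * (t + 10 / (real n * t))"
proof -
  have "product_sum {..<n} Z w (\<lambda>\<alpha>. \<bar>frequency n \<alpha> z - q z\<bar>) \<le> t + 10 / (real n * t)" if z: "z \<in> Z" for z
  proof -
    have "product_sum {..<n} Z w (\<lambda>\<alpha>. \<bar>frequency n \<alpha> z - q z\<bar>)
        \<le> product_sum {..<n} Z w (\<lambda>\<alpha>. t + (1 / t) * (frequency n \<alpha> z - q z)\<^sup>2)"
    proof (rule product_sum_mono)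
      fix \<alpha>
      have ab: "x \<le> t + (1 / t) * x\<^sup>2" if "0 \<le> x" for x
      proof -
        have "2 * (x * t) \<le> t\<^sup>2 + x\<^sup>2"
          using zero_le_power2[of "x - t"] by (simp add: power2_eq_square algebra_simps)
        moreover have "0 \<le> x * t" using that t by simp
        ultimately have "x * t \<le> t\<^sup>2 + x\<^sup>2" by linarith
        then show ?thesis using t by (simp add: field_simps power2_eq_square)
      qed
      show "\<bar>frequency n \<alpha> z - q z\<bar> \<le> t + (1 / t) * (frequency n \<alpha> z - q z)\<^sup>2"
        using ab[of "\<bar>frequency n \<alpha> z - q z\<bar>"] by simp
    qed (use w0 in auto)
    also have "\<dots> = t + (1 / t) * product_sum {..<n} Z w (\<lambda>\<alpha>. (frequency n \<alpha> z - q z)\<^sup>2)"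
      unfolding product_sum_add product_sum_cmult
      by (subst product_sum_const[of "{..<n}"]) (use Z w1 in auto)
    also have "\<dots> \<le> t + (1 / t) * (10 / real n)"
      by (intro add_left_mono mult_left_mono frequency_second_moment[where R=R])
         (use n Z z R w0 w1 q wq t in auto)
    finally show ?thesis by (simp add: mult.commute)
  qed
  then have "(\<Sum>z\<in>Z. product_sum {..<n} Z w (\<lambda>\<alpha>. \<bar>frequency n \<alpha> z - q z\<bar>)) \<le> (\<Sum>z\<in>Z. t + 10 / (real n * t))"
    by (rule sum_mono)
  then show ?thesis unfolding product_sum_sum by simp
qed

section \<open>Wasserstein distances between discrete measures\<close>

text \<open>The common part \<open>min A B\<close> stays in place and the remainders are coupled independently; they have the
  same mass, which the variation distance bounds, and move by at most \<open>D\<close>.\<close>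

lemma W2_pmf_le_variation:
  fixes A B :: "'z pmf" and Y :: "'z \<Rightarrow> 'a::euclidean_space"
  assumes Z: "finite Z" "set_pmf A \<subseteq> Z" "set_pmf B \<subseteq> Z"
    and D: "\<And>i j. i \<in> Z \<Longrightarrow> j \<in> Z \<Longrightarrow> norm (Y i - Y j) \<le> D"
  shows "W2 (distr (measure_pmf A) borel Y) (distr (measure_pmf B) borel Y)
    \<le> sqrt (D\<^sup>2 * (\<Sum>i\<in>Z. \<bar>pmf A i - pmf B i\<bar>))"
proof -
  define c where "c i = min (pmf A i) (pmf B i)" for i
  define \<tau> where "\<tau> = (\<Sum>i\<in>Z. pmf A i - c i)"
  define f where "f z = (if z \<in> Z \<times> Z then (if fst z = snd z then c (fst z) else 0)
      + (pmf A (fst z) - c (fst z)) * (pmf B (snd z) - c (snd z)) / \<tau> else 0)" for z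
  have sA: "(\<Sum>i\<in>Z. pmf A i) = 1" and sB: "(\<Sum>i\<in>Z. pmf B i) = 1"
    using sum_pmf_eq_1[OF Z(1,2)] sum_pmf_eq_1[OF Z(1,3)] by auto
  have c0: "0 \<le> c i" "0 \<le> pmf A i - c i" "0 \<le> pmf B i - c i" for i by (auto simp: c_def)
  have \<tau>0: "0 \<le> \<tau>" unfolding \<tau>_def by (intro sum_nonneg c0)
  have \<tau>B: "\<tau> = (\<Sum>i\<in>Z. pmf B i - c i)" unfolding \<tau>_def sum_subtractf sA sB ..
  have fin: "finite (Z \<times> Z)" using Z(1) by simp
  have f0: "0 \<le> f z" for z unfolding f_def using c0 \<tau>0 by auto
  have zA: "pmf A i - c i = 0" if "\<tau> = 0" "i \<in> Z" for i
    using that c0 Z(1) sum_nonneg_eq_0_iff[of Z "\<lambda>i. pmf A i - c i"] unfolding \<tau>_def by auto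
  have zB: "pmf B i - c i = 0" if "\<tau> = 0" "i \<in> Z" for i
    using that c0 Z(1) sum_nonneg_eq_0_iff[of Z "\<lambda>i. pmf B i - c i"] unfolding \<tau>B by auto
  have row: "(\<Sum>j\<in>Z. f (i, j)) = pmf A i" if i: "i \<in> Z" for i
  proof -
    have "(\<Sum>j\<in>Z. f (i, j)) = (\<Sum>j\<in>Z. (if j = i then c i else 0) + (pmf A i - c i) / \<tau> * (pmf B j - c j))"
      by (rule sum.cong) (auto simp: f_def i)
    also have "\<dots> = c i + (pmf A i - c i) / \<tau> * \<tau>"
      unfolding sum.distrib sum_distrib_left[symmetric] \<tau>B[symmetric] using i Z(1) by (simp add: sum.delta)
    finally show ?thesis using zA[OF _ i] by (cases "\<tau> = 0") auto
  qed
  have col: "(\<Sum>i\<in>Z. f (i, j)) = pmf B j" if j: "j \<in> Z" for j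
  proof -
    have "(\<Sum>i\<in>Z. f (i, j)) = (\<Sum>i\<in>Z. (if i = j then c j else 0) + (pmf B j - c j) / \<tau> * (pmf A i - c i))"
      by (rule sum.cong) (auto simp: f_def j)
    also have "\<dots> = c j + (pmf B j - c j) / \<tau> * \<tau>"
      unfolding sum.distrib sum_distrib_left[symmetric] \<tau>_def[symmetric] using j Z(1) by (simp add: sum.delta)
    finally show ?thesis using zB[OF _ j] by (cases "\<tau> = 0") auto
  qed
  have tot: "(\<Sum>z\<in>Z \<times> Z. f z) = 1"
    unfolding sum.cartesian_product' using row sA by simp
  have "(\<integral>\<^sup>+z. ennreal (f z) \<partial>count_space UNIV) = (\<Sum>z\<in>Z \<times> Z. ennreal (f z))"
    by (rule nn_integral_count_space'[OF fin]) (auto simp: f_def)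
  also have "\<dots> = 1" using tot f0 by (subst sum_ennreal) auto
  finally have e1: "(\<integral>\<^sup>+z. ennreal (f z) \<partial>count_space UNIV) = 1" .
  define q where "q = embed_pmf f"
  have pq: "pmf q z = f z" for z unfolding q_def by (rule pmf_embed_pmf[OF f0 e1])
  have supp: "z \<in> Z \<times> Z" if "z \<in> set_pmf q" for z
    using that unfolding set_pmf_iff pq by (auto simp: f_def split: if_splits)
  have int: "(\<integral>z. h z \<partial>measure_pmf q) = (\<Sum>z\<in>Z \<times> Z. f z * h z)" for h :: "_ \<Rightarrow> real"
    using integral_measure_pmf_real[OF fin, of q h] supp unfolding pq by (simp add: mult.commute)
  have mf: "map_pmf fst q = A"
  proof (rule pmf_eqI)
    fix i
    have "pmf (map_pmf fst q) i = (\<integral>z. indicator (fst -` {i}) z \<partial>measure_pmf q)"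
      by (simp add: pmf_map)
    also have "\<dots> = (\<Sum>i'\<in>Z. \<Sum>j\<in>Z. if i' = i then f (i', j) else 0)"
      unfolding int sum.cartesian_product' by (intro sum.cong refl) (auto simp: indicator_def)
    also have "\<dots> = (\<Sum>i'\<in>Z. if i' = i then \<Sum>j\<in>Z. f (i', j) else 0)"
      by (rule sum.cong) auto
    also have "\<dots> = pmf A i"
      using row Z by (auto simp: sum.delta set_pmf_iff)
    finally show "pmf (map_pmf fst q) i = pmf A i" .
  qed
  have ms: "map_pmf snd q = B"
  proof (rule pmf_eqI)
    fix j
    have "pmf (map_pmf snd q) j = (\<integral>z. indicator (snd -` {j}) z \<partial>measure_pmf q)"
      by (simp add: pmf_map)
    also have "\<dots> = (\<Sum>i\<in>Z. \<Sum>j'\<in>Z. if j' = j then f (i, j') else 0)"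
      unfolding int sum.cartesian_product' by (intro sum.cong refl) (auto simp: indicator_def)
    also have "\<dots> = (\<Sum>j'\<in>Z. if j' = j then \<Sum>i\<in>Z. f (i, j') else 0)"
      by (subst sum.swap) (rule sum.cong, auto)
    also have "\<dots> = pmf B j"
      using col Z by (auto simp: sum.delta set_pmf_iff)
    finally show "pmf (map_pmf snd q) j = pmf B j" .
  qed
  have finq: "finite (set_pmf q)" by (rule finite_subset[OF _ fin]) (use supp in blast)
  have LX: "(\<lambda>z. Y (fst z)) \<in> L2 (measure_pmf q)" and LY: "(\<lambda>z. Y (snd z)) \<in> L2 (measure_pmf q)"
    by (rule pmf_L2[OF finq])+
  have dA: "distr (measure_pmf q) borel (\<lambda>z. Y (fst z)) = distr (measure_pmf A) borel Y"
    unfolding mf[symmetric] map_pmf_rep_eq by (subst distr_distr) (auto simp: o_def)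
  have dB: "distr (measure_pmf q) borel (\<lambda>z. Y (snd z)) = distr (measure_pmf B) borel Y"
    unfolding ms[symmetric] map_pmf_rep_eq by (subst distr_distr) (auto simp: o_def)
  have "(\<integral>z. (norm (Y (fst z) - Y (snd z)))\<^sup>2 \<partial>measure_pmf q)
      \<le> (\<Sum>z\<in>Z \<times> Z. D\<^sup>2 * ((pmf A (fst z) - c (fst z)) * (pmf B (snd z) - c (snd z)) / \<tau>))"
    unfolding int
  proof (rule sum_mono)
    fix z assume z: "z \<in> Z \<times> Z"
    let ?p = "(pmf A (fst z) - c (fst z)) * (pmf B (snd z) - c (snd z)) / \<tau>"
    have "norm (Y (fst z) - Y (snd z)) \<le> D" using z D by auto
    then have n: "(norm (Y (fst z) - Y (snd z)))\<^sup>2 \<le> D\<^sup>2" by (rule power_mono) simp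
    have p0: "0 \<le> ?p" using c0 \<tau>0 by simp
    show "f z * (norm (Y (fst z) - Y (snd z)))\<^sup>2 \<le> D\<^sup>2 * ?p"
    proof (cases "fst z = snd z")
      case True
      then have "norm (Y (fst z) - Y (snd z)) = 0" by simp
      moreover have "0 \<le> D\<^sup>2 * ?p" using p0 by (intro mult_nonneg_nonneg) auto
      ultimately show ?thesis by (simp only: power_zero_numeral mult_zero_right)
    next
      case False
      then have "f z = ?p" using z by (simp add: f_def)
      then show ?thesis using mult_right_mono[OF n p0] by (simp add: mult.commute)
    qed
  qed
  also have "\<dots> = D\<^sup>2 * ((\<Sum>i\<in>Z. pmf A i - c i) * (\<Sum>j\<in>Z. pmf B j - c j) / \<tau>)"
    unfolding sum.cartesian_product' sum_product by (simp add: sum_divide_distrib sum_distrib_left)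
  also have "\<dots> = D\<^sup>2 * \<tau>" unfolding \<tau>_def[symmetric] \<tau>B[symmetric] by simp
  also have "\<tau> \<le> (\<Sum>i\<in>Z. \<bar>pmf A i - pmf B i\<bar>)"
    unfolding \<tau>_def by (rule sum_mono) (auto simp: c_def)
  finally have le: "(\<integral>z. (norm (Y (fst z) - Y (snd z)))\<^sup>2 \<partial>measure_pmf q) \<le> D\<^sup>2 * (\<Sum>i\<in>Z. \<bar>pmf A i - pmf B i\<bar>)"
    by (simp add: mult_left_mono)
  have "W2 (distr (measure_pmf A) borel Y) (distr (measure_pmf B) borel Y) \<le> L2_norm (measure_pmf q) (\<lambda>z. Y (fst z) - Y (snd z))"
    unfolding dA[symmetric] dB[symmetric] by (rule W2_distr_le[OF measure_pmf.prob_space_axioms LX LY])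
  also have "\<dots> \<le> sqrt (D\<^sup>2 * (\<Sum>i\<in>Z. \<bar>pmf A i - pmf B i\<bar>))"
    unfolding L2_norm_def by (rule real_sqrt_le_mono[OF le])
  finally show ?thesis .
qed

lemma W2_empirical_le:
  assumes n: "0 < n" and h: "\<And>l. l < n \<Longrightarrow> norm (z l - z' l) \<le> h"
  shows "W2 (empirical n z) (empirical n z') \<le> (h :: real)"
proof -
  let ?p = "measure_pmf (pmf_of_set {..<n})"
  have fin: "finite (set_pmf (pmf_of_set {..<n}))" using n by (simp add: pmf_of_set_lessThan)
  have h0: "0 \<le> h" using h[OF n] norm_ge_zero[of "z 0 - z' 0"] by linarith
  have "W2 (empirical n z) (empirical n z') \<le> L2_norm ?p (\<lambda>l. z l - z' l)"
    unfolding empirical_def by (rule W2_distr_le[OF measure_pmf.prob_space_axioms pmf_L2[OF fin] pmf_L2[OF fin]])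
  also have "\<dots> \<le> sqrt (\<integral>l. h\<^sup>2 \<partial>?p)"
    unfolding L2_norm_def
  proof (intro real_sqrt_le_mono integral_mono_AE)
    show "AE l in ?p. (norm (z l - z' l))\<^sup>2 \<le> h\<^sup>2"
      using h n by (auto simp: AE_measure_pmf_iff pmf_of_set_lessThan intro!: power_mono)
  qed (auto intro!: integrable_measure_pmf_finite fin)
  also have "\<dots> = h" using h0 by simp
  finally show ?thesis .
qed

text \<open>One atom of mass \<open>1 / n\<close> is moved.\<close>

lemma W2_empirical_upd:
  assumes n: "0 < n" "l < n"
  shows "W2 (empirical n (z(l := x))) (empirical n z) \<le> norm (x - z l) / sqrt (real n)"
proof -
  let ?p = "measure_pmf (pmf_of_set {..<n})"
  have fin: "finite (set_pmf (pmf_of_set {..<n}))" using n by (simp add: pmf_of_set_lessThan)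
  have "W2 (empirical n (z(l := x))) (empirical n z) \<le> L2_norm ?p (\<lambda>i. (z(l := x)) i - z i)"
    unfolding empirical_def by (rule W2_distr_le[OF measure_pmf.prob_space_axioms pmf_L2[OF fin] pmf_L2[OF fin]])
  then have W: "W2 (empirical n (z(l := x))) (empirical n z) \<le> sqrt (\<integral>i. (norm ((z(l := x)) i - z i))\<^sup>2 \<partial>?p)"
    unfolding L2_norm_def .
  have "(\<integral>i. (norm ((z(l := x)) i - z i))\<^sup>2 \<partial>?p) = (\<Sum>i<n. (norm ((z(l := x)) i - z i))\<^sup>2 * (1 / real n))"
    using n by (subst integral_measure_pmf_real[of "{..<n}"]) (auto simp: pmf_of_set_lessThan)
  also have "\<dots> = (\<Sum>i<n. if i = l then (norm (x - z l))\<^sup>2 / real n else 0)"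
    by (rule sum.cong) auto
  also have "\<dots> = (norm (x - z l))\<^sup>2 / real n" using n by (simp add: sum.delta)
  finally show ?thesis using W by (simp only: real_sqrt_divide real_sqrt_abs abs_norm_cancel)
qed

section \<open>Truncation\<close>

definition truncation_error :: "real \<Rightarrow> (real^'n::finite) measure \<Rightarrow> real" where
  "truncation_error k \<mu> = (\<integral>y. (norm (sine_map k y - y))\<^sup>2 \<partial>\<mu>)"

lemma abs_sin_diff_le: "\<bar>sin a - sin b\<bar> \<le> \<bar>a - b\<bar>" for a b :: real
proof -
  have "\<bar>sin a - sin b\<bar> = 2 * (\<bar>sin ((a - b) / 2)\<bar> * \<bar>cos ((a + b) / 2)\<bar>)"
    by (simp add: sin_diff_sin abs_mult)
  also have "\<dots> \<le> 2 * (\<bar>(a - b) / 2\<bar> * 1)"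
    by (intro mult_left_mono mult_mono abs_sin_x_le_abs_x abs_cos_le_one) auto
  finally show ?thesis by simp
qed

lemma sine_map_diff_le:
  fixes y z :: "real^'n::finite"
  assumes k: "0 < k"
  shows "norm ((sine_map k y - y) - (sine_map k z - z)) \<le> 2 * norm (y - z)"
proof -
  have "norm ((sine_map k y - y) - (sine_map k z - z)) \<le> norm (2 *\<^sub>R (y - z))"
  proof (rule norm_le_componentwise_cart)
    fix a
    have "\<bar>k * sin (y $ a / k) - k * sin (z $ a / k)\<bar> = k * \<bar>sin (y $ a / k) - sin (z $ a / k)\<bar>"
      using k by (simp add: right_diff_distrib[symmetric] abs_mult)
    also have "\<dots> \<le> k * \<bar>y $ a / k - z $ a / k\<bar>" using k by (intro mult_left_mono abs_sin_diff_le) auto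
    also have "\<dots> = \<bar>y $ a - z $ a\<bar>" using k by (simp add: diff_divide_distrib[symmetric] abs_divide)
    finally show "norm ((sine_map k y - y - (sine_map k z - z)) $ a) \<le> norm ((2 *\<^sub>R (y - z)) $ a)"
      unfolding sine_map_def by simp
  qed
  then show ?thesis by simp
qed

lemma sine_map_0: "sine_map k 0 = 0" by (simp add: sine_map_def vec_eq_iff)

lemma sine_map_error_le: "0 < k \<Longrightarrow> norm (sine_map k y - y) \<le> 2 * norm (y :: real^'n::finite)"
  using sine_map_diff_le[of k y 0] by (simp add: sine_map_0)

lemma sine_map_error_square:
  fixes y :: "real^'n::finite"
  assumes k: "0 < k"
  shows "norm (sine_map k y - y) \<le> real CARD('n) * (norm y)\<^sup>2 / (2 * k)"
proof -
  have "\<bar>(sine_map k y - y) $ a\<bar> \<le> (norm y)\<^sup>2 / (2 * k)" for a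
  proof -
    have "\<bar>sin x - x\<bar> \<le> x\<^sup>2 / 2" for x :: real
      using Maclaurin_sin_bound[of x 2] by (simp add: sin_coeff_def numeral_2_eq_2 divide_simps)
    then have "k * \<bar>sin (y $ a / k) - y $ a / k\<bar> \<le> k * ((y $ a / k)\<^sup>2 / 2)" using k by (intro mult_left_mono) auto
    also have "k * ((y $ a / k)\<^sup>2 / 2) = (y $ a)\<^sup>2 / (2 * k)" using k by (simp add: power2_eq_square)
    also have "\<dots> \<le> (norm y)\<^sup>2 / (2 * k)"
    proof (rule divide_right_mono)
      have "\<bar>y $ a\<bar> \<le> norm y" using component_le_norm_cart by blast
      then have "\<bar>y $ a\<bar>\<^sup>2 \<le> (norm y)\<^sup>2" by (rule power_mono) simp
      then show "(y $ a)\<^sup>2 \<le> (norm y)\<^sup>2" by simp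
    qed (use k in simp)
    also have "k * \<bar>sin (y $ a / k) - y $ a / k\<bar> = \<bar>k * (sin (y $ a / k) - y $ a / k)\<bar>"
      using k by (simp add: abs_mult)
    also have "k * (sin (y $ a / k) - y $ a / k) = (sine_map k y - y) $ a"
      using k by (simp add: sine_map_def right_diff_distrib)
    finally show ?thesis .
  qed
  then have "(\<Sum>a\<in>UNIV. \<bar>(sine_map k y - y) $ a\<bar>) \<le> (\<Sum>a\<in>(UNIV::'n set). (norm y)\<^sup>2 / (2 * k))"
    by (intro sum_mono)
  then show ?thesis using norm_le_l1_cart[of "sine_map k y - y"] by simp
qed

lemma continuous_sine_map: "continuous_on UNIV (sine_map k :: real^'n::finite \<Rightarrow> real^'n)"
proof -
  have "continuous_on UNIV (\<lambda>y :: real^'n. k * sin (inverse k * y $ a))" for a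
    by (intro continuous_on_mult continuous_on_const continuous_on_sin continuous_on_component continuous_on_id)
  then show ?thesis unfolding sine_map_def divide_inverse
    by (intro continuous_on_vec_lambda) (simp add: mult.commute)
qed

lemma sine_map_measurable [measurable]: "sine_map k \<in> borel_measurable (borel :: (real^'n::finite) measure)"
  by (rule borel_measurable_continuous_onI[OF continuous_sine_map])

lemma truncation_integrable:
  assumes k: "0 < k" and \<mu>: "\<mu> \<in> P2"
  shows "integrable \<mu> (\<lambda>y :: real^'n::finite. (norm (sine_map k y - y))\<^sup>2)"
proof -
  have "integrable \<mu> (\<lambda>y. 4 * (norm y)\<^sup>2)" using P2D(4)[OF \<mu>] by simp
  then show ?thesis
  proof (rule Bochner_Integration.integrable_bound)
    show "(\<lambda>y. (norm (sine_map k y - y))\<^sup>2) \<in> borel_measurable \<mu>"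
      unfolding measurable_cong_sets[OF P2D(2)[OF \<mu>] refl] by measurable
    show "AE y in \<mu>. norm ((norm (sine_map k y - y))\<^sup>2) \<le> norm (4 * (norm y)\<^sup>2)"
    proof (rule AE_I2)
      fix y :: "real^'n"
      have "(norm (sine_map k y - y))\<^sup>2 \<le> (2 * norm y)\<^sup>2" by (rule power_mono[OF sine_map_error_le[OF k]]) simp
      then show "norm ((norm (sine_map k y - y))\<^sup>2) \<le> norm (4 * (norm y)\<^sup>2)" by (simp add: power_mult_distrib)
    qed
  qed
qed

lemma truncation_error_nonneg: "0 \<le> truncation_error k \<mu>"
  unfolding truncation_error_def by simp

text \<open>The map \<open>y \<mapsto> sine_map k y - y\<close> is Lipschitz with constant \<open>2\<close>.\<close>

lemma truncation_error_W2:
  assumes k: "0 < k" and P: "\<mu> \<in> P2" "\<nu> \<in> P2"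
  shows "sqrt (truncation_error k \<mu>) \<le> sqrt (truncation_error k \<nu>) + 2 * W2 \<mu> (\<nu> :: (real^'n::finite) measure)"
proof (rule field_le_epsilon)
  fix e :: real assume "0 < e"
  then have e2: "0 < e / 2" by simp
  obtain \<pi> where \<pi>: "\<pi> \<in> couplings \<mu> \<nu>" "sqrt (transport_cost \<pi>) < W2 \<mu> \<nu> + e / 2"
    using near_optimal_coupling[OF P e2] by blast
  note [measurable] = coupling_measurable[OF \<pi>(1)]
  let ?g = "\<lambda>y :: real^'n. norm (sine_map k y - y)"
  have gm: "(\<lambda>y. (?g y)\<^sup>2) \<in> borel_measurable borel" by measurable
  have i1: "integrable \<pi> (\<lambda>z. (?g (fst z))\<^sup>2)"
    using truncation_integrable[OF k P(1)] unfolding couplingD(4)[OF \<pi>(1), symmetric]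
    by (rule integrable_distr[OF coupling_measurable(1)[OF \<pi>(1)]])
  have i2: "integrable \<pi> (\<lambda>z. (?g (snd z))\<^sup>2)"
    using truncation_integrable[OF k P(2)] unfolding couplingD(5)[OF \<pi>(1), symmetric]
    by (rule integrable_distr[OF coupling_measurable(2)[OF \<pi>(1)]])
  have e1: "truncation_error k \<mu> = (\<integral>z. (?g (fst z))\<^sup>2 \<partial>\<pi>)"
    unfolding truncation_error_def couplingD(4)[OF \<pi>(1), symmetric]
    by (rule integral_distr[OF coupling_measurable(1)[OF \<pi>(1)] gm])
  have e2: "truncation_error k \<nu> = (\<integral>z. (?g (snd z))\<^sup>2 \<partial>\<pi>)"
    unfolding truncation_error_def couplingD(5)[OF \<pi>(1), symmetric]
    by (rule integral_distr[OF coupling_measurable(2)[OF \<pi>(1)] gm])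
  have i3: "integrable \<pi> (\<lambda>z. (2 * norm (fst z - snd z))\<^sup>2)"
    using coupling_sq_integrable(3)[OF \<pi>(1) P] by (simp add: power_mult_distrib)
  have m2: "(\<lambda>z. ?g (snd z)) \<in> borel_measurable \<pi>" and m3: "(\<lambda>z. 2 * norm (fst z - snd z)) \<in> borel_measurable \<pi>"
    by measurable
  have "(\<integral>z. (?g (fst z))\<^sup>2 \<partial>\<pi>) \<le> (\<integral>z. (?g (snd z) + 2 * norm (fst z - snd z))\<^sup>2 \<partial>\<pi>)"
  proof (rule integral_mono[OF i1 integrable_square_add[OF m2 m3 i2 i3]])
    fix z :: "(real^'n) \<times> (real^'n)"
    have "?g (fst z) \<le> ?g (snd z) + norm ((sine_map k (fst z) - fst z) - (sine_map k (snd z) - snd z))"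
      using norm_triangle_sub by blast
    also have "\<dots> \<le> ?g (snd z) + 2 * norm (fst z - snd z)" using sine_map_diff_le[OF k] by simp
    finally show "(?g (fst z))\<^sup>2 \<le> (?g (snd z) + 2 * norm (fst z - snd z))\<^sup>2" by (rule power_mono) simp
  qed
  then have "sqrt (truncation_error k \<mu>) \<le> sqrt (\<integral>z. (?g (snd z) + 2 * norm (fst z - snd z))\<^sup>2 \<partial>\<pi>)"
    unfolding e1 by (rule real_sqrt_le_mono)
  also have "\<dots> \<le> sqrt (truncation_error k \<nu>) + sqrt (\<integral>z. (2 * norm (fst z - snd z))\<^sup>2 \<partial>\<pi>)"
    unfolding e2 by (rule Minkowski_integral[OF m2 m3 i2 i3])
  also have "sqrt (\<integral>z. (2 * norm (fst z - snd z))\<^sup>2 \<partial>\<pi>) = 2 * sqrt (transport_cost \<pi>)"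
    by (simp add: power_mult_distrib real_sqrt_mult)
  finally show "sqrt (truncation_error k \<mu>) \<le> sqrt (truncation_error k \<nu>) + 2 * W2 \<mu> \<nu> + e"
    using \<pi>(2) by linarith
qed

lemma truncation_error_tendsto_0:
  assumes \<mu>: "\<mu> \<in> P2"
  shows "(\<lambda>k. truncation_error (real (Suc k)) (\<mu> :: (real^'n::finite) measure)) \<longlonglongrightarrow> 0"
proof -
  have "(\<lambda>k. \<integral>y. (norm (sine_map (real (Suc k)) y - y))\<^sup>2 \<partial>\<mu>) \<longlonglongrightarrow> (\<integral>y. 0 \<partial>\<mu>)"
  proof (rule integral_dominated_convergence[where w="\<lambda>y. 4 * (norm y)\<^sup>2"])
    show "integrable \<mu> (\<lambda>y. 4 * (norm y)\<^sup>2)" using P2D(4)[OF \<mu>] by simp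
    show "AE y in \<mu>. (\<lambda>k. (norm (sine_map (real (Suc k)) y - y))\<^sup>2) \<longlonglongrightarrow> 0"
    proof (rule AE_I2)
      fix y :: "real^'n"
      let ?c = "real CARD('n) * (norm y)\<^sup>2 / 2"
      have "(\<lambda>k. ?c * (1 / real (Suc k))) \<longlonglongrightarrow> ?c * 0"
        using LIMSEQ_inverse_real_of_nat by (intro tendsto_mult tendsto_const) (simp add: inverse_eq_divide)
      then have lim: "(\<lambda>k. ?c * (1 / real (Suc k))) \<longlonglongrightarrow> 0" by simp
      have "(\<lambda>k. norm (sine_map (real (Suc k)) y - y)) \<longlonglongrightarrow> 0"
      proof (rule tendsto_sandwich[OF _ _ tendsto_const lim])
        show "\<forall>\<^sub>F k in sequentially. norm (sine_map (real (Suc k)) y - y) \<le> ?c * (1 / real (Suc k))"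
          by (rule always_eventually, rule allI) (use sine_map_error_square[of "real (Suc _)" y] in simp)
      qed simp
      then have "(\<lambda>k. (norm (sine_map (real (Suc k)) y - y))\<^sup>2) \<longlonglongrightarrow> 0\<^sup>2" by (rule tendsto_power)
      then show "(\<lambda>k. (norm (sine_map (real (Suc k)) y - y))\<^sup>2) \<longlonglongrightarrow> 0" by simp
    qed
    show "AE y in \<mu>. norm ((norm (sine_map (real (Suc k)) y - y))\<^sup>2) \<le> 4 * (norm y)\<^sup>2" for k
    proof (rule AE_I2)
      fix y :: "real^'n"
      have "(norm (sine_map (real (Suc k)) y - y))\<^sup>2 \<le> (2 * norm y)\<^sup>2" by (rule power_mono[OF sine_map_error_le]) auto
      then show "norm ((norm (sine_map (real (Suc k)) y - y))\<^sup>2) \<le> 4 * (norm y)\<^sup>2" by (simp add: power_mult_distrib)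
    qed
    show "(\<lambda>y. (norm (sine_map (real (Suc k)) y - y))\<^sup>2) \<in> borel_measurable \<mu>" for k
      unfolding measurable_cong_sets[OF P2D(2)[OF \<mu>] refl] by measurable
  qed simp
  then show ?thesis unfolding truncation_error_def by simp
qed

text \<open>The square roots are equicontinuous in \<open>\<mu>\<close> by
  \<open>truncation_error_W2\<close>, so pointwise convergence on a
  finite net suffices.\<close>

lemma truncation_error_uniform:
  assumes M: "compactin W2_top M" and \<epsilon>: "0 < \<epsilon>"
  shows "\<forall>\<^sub>F k in sequentially. \<forall>\<mu>\<in>M. sqrt (truncation_error (real (Suc k)) (\<mu> :: (real^'n::finite) measure)) < \<epsilon>"
proof -
  have MP: "M \<subseteq> P2" using compactin_subset_topspace[OF M] by simp
  have tb: "Wass.mtotally_bounded M"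
    using M unfolding W2_top_def by (rule Wass.compactin_imp_mtotally_bounded)
  have e4: "0 < \<epsilon> / 4" using \<epsilon> by simp
  obtain T where T: "finite T" "T \<subseteq> M" "M \<subseteq> (\<Union>x\<in>T. Wass.mball x (\<epsilon> / 4))"
    using mp[OF spec[OF tb[unfolded Wass.mtotally_bounded_def]] e4] by (elim exE conjE)
  have "\<forall>\<^sub>F k in sequentially. \<forall>\<nu>\<in>T. sqrt (truncation_error (real (Suc k)) \<nu>) < \<epsilon> / 4"
  proof (rule eventually_ball_finite[OF T(1)], rule ballI)
    fix \<nu> assume "\<nu> \<in> T"
    then have "\<nu> \<in> P2" using T(2) MP by blast
    then have "(\<lambda>k. sqrt (truncation_error (real (Suc k)) \<nu>)) \<longlonglongrightarrow> sqrt 0"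
      by (intro tendsto_real_sqrt truncation_error_tendsto_0)
    then show "\<forall>\<^sub>F k in sequentially. sqrt (truncation_error (real (Suc k)) \<nu>) < \<epsilon> / 4"
      using \<epsilon> by (intro order_tendstoD(2)) auto
  qed
  then show ?thesis
  proof (rule eventually_mono, intro ballI)
    fix k \<mu> assume k: "\<forall>\<nu>\<in>T. sqrt (truncation_error (real (Suc k)) \<nu>) < \<epsilon> / 4" and \<mu>: "\<mu> \<in> M"
    obtain \<nu> where \<nu>: "\<nu> \<in> T" "\<mu> \<in> Wass.mball \<nu> (\<epsilon> / 4)" using T(3) \<mu> by blast
    then have "W2 \<nu> \<mu> < \<epsilon> / 4" and P: "\<mu> \<in> P2" "\<nu> \<in> P2" by simp_all
    then have "W2 \<mu> \<nu> < \<epsilon> / 4" using W2_commute[of \<mu> \<nu>] by simp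
    moreover have "sqrt (truncation_error (real (Suc k)) \<mu>) \<le> sqrt (truncation_error (real (Suc k)) \<nu>) + 2 * W2 \<mu> \<nu>"
      by (rule truncation_error_W2[OF _ P]) simp
    moreover have "sqrt (truncation_error (real (Suc k)) \<nu>) < \<epsilon> / 4" using k \<nu>(1) by blast
    ultimately show "sqrt (truncation_error (real (Suc k)) \<mu>) < \<epsilon>" using \<epsilon> by linarith
  qed
qed


section \<open>The law of the coin patterns\<close>

definition mass :: "real \<Rightarrow> nat \<Rightarrow> (real^'n::finite) measure \<Rightarrow> 'n pattern \<Rightarrow> real" where
  "mass k m \<mu> \<zeta> = (\<integral>y. pattern_weight k m \<zeta> y \<partial>\<mu>)"

definition pattern_pmf :: "real \<Rightarrow> nat \<Rightarrow> (real^'n::finite) measure \<Rightarrow> 'n pattern pmf" where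
  "pattern_pmf k m \<mu> = embed_pmf (\<lambda>\<zeta>. if \<zeta> \<in> patterns m then mass k m \<mu> \<zeta> else 0)"

lemma continuous_pattern_weight: "continuous_on UNIV (pattern_weight k m \<zeta> :: real^'n::finite \<Rightarrow> real)"
  by (rule continuous_at_imp_continuous_on, rule ballI, rule has_derivative_continuous[OF pattern_weight_has_derivative])

lemma pattern_weight_measurable [measurable]: "pattern_weight k m \<zeta> \<in> borel_measurable (borel :: (real^'n::finite) measure)"
  by (rule borel_measurable_continuous_onI[OF continuous_pattern_weight])

lemma pattern_weight_integrable:
  assumes \<mu>: "\<mu> \<in> P2" and \<zeta>: "\<zeta> \<in> patterns m"
  shows "integrable \<mu> (\<lambda>y :: real^'n::finite. pattern_weight k m \<zeta> y)"
proof -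
  interpret prob_space \<mu> by (rule P2D(1)[OF \<mu>])
  show ?thesis
  proof (rule integrable_const_bound[where B=1])
    show "AE y in \<mu>. norm (pattern_weight k m \<zeta> y) \<le> 1"
      by (rule AE_I2) (use pattern_weight_nonneg[of k m \<zeta>] pattern_weight_le_1[OF \<zeta>, of k] in simp)
    show "pattern_weight k m \<zeta> \<in> borel_measurable \<mu>"
      unfolding measurable_cong_sets[OF P2D(2)[OF \<mu>] refl] by (rule pattern_weight_measurable)
  qed
qed

lemma mass_nonneg: "0 \<le> mass k m \<mu> \<zeta>"
  unfolding mass_def by (simp add: pattern_weight_nonneg)

lemma sum_mass:
  assumes \<mu>: "\<mu> \<in> P2"
  shows "(\<Sum>\<zeta>\<in>patterns m. mass k m \<mu> \<zeta>) = 1"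
proof -
  interpret prob_space \<mu> by (rule P2D(1)[OF \<mu>])
  have "(\<Sum>\<zeta>\<in>patterns m. mass k m \<mu> \<zeta>) = (\<integral>y. (\<Sum>\<zeta>\<in>patterns m. pattern_weight k m \<zeta> y) \<partial>\<mu>)"
    unfolding mass_def by (rule Bochner_Integration.integral_sum[symmetric]) (rule pattern_weight_integrable[OF \<mu>])
  also have "\<dots> = 1" unfolding sum_pattern_weight by (simp add: prob_space)
  finally show ?thesis .
qed

lemma mass_le_1: "\<mu> \<in> P2 \<Longrightarrow> \<zeta> \<in> patterns m \<Longrightarrow> mass k m \<mu> \<zeta> \<le> 1"
  using member_le_sum[of \<zeta> "patterns m" "mass k m \<mu>"] sum_mass[of \<mu> k m] mass_nonneg[of k m \<mu>] by simp

lemma pmf_pattern_pmf: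
  assumes \<mu>: "\<mu> \<in> P2"
  shows "pmf (pattern_pmf k m \<mu>) \<zeta> = (if \<zeta> \<in> patterns m then mass k m \<mu> \<zeta> else 0)"
  unfolding pattern_pmf_def
proof (rule pmf_embed_pmf)
  show "0 \<le> (if \<zeta> \<in> patterns m then mass k m \<mu> \<zeta> else 0)" for \<zeta> by (simp add: mass_nonneg)
  have "(\<integral>\<^sup>+\<zeta>. ennreal (if \<zeta> \<in> patterns m then mass k m \<mu> \<zeta> else 0) \<partial>count_space UNIV)
      = (\<Sum>\<zeta>\<in>patterns m. ennreal (if \<zeta> \<in> patterns m then mass k m \<mu> \<zeta> else 0))"
    by (rule nn_integral_count_space') auto
  also have "\<dots> = (\<Sum>\<zeta>\<in>patterns m. ennreal (mass k m \<mu> \<zeta>))" by (rule sum.cong) auto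
  also have "\<dots> = 1" by (subst sum_ennreal) (auto simp: mass_nonneg sum_mass[OF \<mu>])
  finally show "(\<integral>\<^sup>+\<zeta>. ennreal (if \<zeta> \<in> patterns m then mass k m \<mu> \<zeta> else 0) \<partial>count_space UNIV) = 1" .
qed

lemma set_pattern_pmf: "\<mu> \<in> P2 \<Longrightarrow> set_pmf (pattern_pmf k m \<mu>) \<subseteq> patterns m"
  by (auto simp: set_pmf_iff pmf_pattern_pmf split: if_splits)

lemma measurable_pair_count_space_right:
  assumes A: "countable A" and [measurable]: "\<And>x. x \<in> A \<Longrightarrow> (\<lambda>y. f (y, x)) \<in> measurable N K"
  shows "f \<in> measurable (N \<Otimes>\<^sub>M count_space A) K"
  using _ _ A
  by (rule measurable_compose_countable'[where f="\<lambda>a b. f (fst b, a)" and g=snd and I=A, simplified]) simp_all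

lemma norm_node_le:
  assumes k: "0 \<le> k"
  shows "norm (node k m \<zeta> :: real^'n::finite) \<le> real CARD('n) * k"
proof -
  have "(\<Sum>a\<in>UNIV. \<bar>node k m \<zeta> $ a\<bar>) \<le> (\<Sum>a\<in>(UNIV::'n set). k)"
    by (intro sum_mono node_bound k)
  then show ?thesis using norm_le_l1_cart[of "node k m \<zeta>"] by simp
qed

text \<open>Draw \<open>y\<close> from \<open>\<mu>\<close> and toss the coins with the biases of \<open>y\<close>. The grid point differs from \<open>y\<close> by the
  noise of the coins and by the truncation.\<close>

lemma W2_pattern_law:
  fixes \<mu> :: "(real^'n::finite) measure"
  assumes \<mu>: "\<mu> \<in> P2" and k: "0 < k" and m: "0 < m"
  shows "W2 (distr (measure_pmf (pattern_pmf k m \<mu>)) borel (node k m)) \<mu>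
    \<le> sqrt (2 * (real CARD('n) * k\<^sup>2 / real m) + 2 * truncation_error k \<mu>)"
proof -
  interpret \<mu>: prob_space \<mu> by (rule P2D(1)[OF \<mu>])
  let ?Z = "patterns m :: 'n pattern set"
  let ?C = "count_space ?Z"
  interpret C: sigma_finite_measure ?C by (rule sigma_finite_measure_count_space_finite) simp
  have msets: "borel_measurable \<mu> = borel_measurable borel" for x
    by (rule measurable_cong_sets[OF P2D(2)[OF \<mu>] refl])
  define w where "w z = ennreal (pattern_weight k m (snd z) (fst z))" for z :: "(real^'n) \<times> 'n pattern"
  have cm: "f \<in> borel_measurable (\<mu> \<Otimes>\<^sub>M ?C)" if "\<And>\<zeta>. \<zeta> \<in> ?Z \<Longrightarrow> (\<lambda>y. f (y, \<zeta>)) \<in> borel_measurable borel"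
    for f :: "_ \<Rightarrow> ennreal"
    by (rule measurable_pair_count_space_right) (use that countable_finite[OF finite_patterns] in \<open>auto simp: msets\<close>)
  have cm': "f \<in> borel_measurable (\<mu> \<Otimes>\<^sub>M ?C)" if "\<And>\<zeta>. \<zeta> \<in> ?Z \<Longrightarrow> (\<lambda>y. f (y, \<zeta>)) \<in> borel_measurable borel"
    for f :: "_ \<Rightarrow> real^'n"
    by (rule measurable_pair_count_space_right) (use that countable_finite[OF finite_patterns] in \<open>auto simp: msets\<close>)
  have wm: "w \<in> borel_measurable (\<mu> \<Otimes>\<^sub>M ?C)" by (rule cm) (simp add: w_def)
  \<comment> \<open>The joint law of \<open>y\<close> and its pattern.\<close>
  define Q where "Q = density (\<mu> \<Otimes>\<^sub>M ?C) w"
  have Qint: "(\<integral>\<^sup>+z. h z \<partial>Q) = (\<integral>\<^sup>+y. (\<Sum>\<zeta>\<in>?Z. ennreal (pattern_weight k m \<zeta> y) * h (y, \<zeta>)) \<partial>\<mu>)"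
    if h: "\<And>\<zeta>. \<zeta> \<in> ?Z \<Longrightarrow> (\<lambda>y. h (y, \<zeta>)) \<in> borel_measurable borel" for h
  proof -
    have hm: "h \<in> borel_measurable (\<mu> \<Otimes>\<^sub>M ?C)" by (rule cm[OF h])
    have whm: "(\<lambda>z. w z * h z) \<in> borel_measurable (\<mu> \<Otimes>\<^sub>M ?C)"
      by (rule borel_measurable_times_ennreal[OF wm hm])
    have "(\<integral>\<^sup>+z. h z \<partial>Q) = (\<integral>\<^sup>+z. w z * h z \<partial>(\<mu> \<Otimes>\<^sub>M ?C))"
      unfolding Q_def by (rule nn_integral_density[OF wm hm])
    also have "\<dots> = (\<integral>\<^sup>+y. \<integral>\<^sup>+\<zeta>. w (y, \<zeta>) * h (y, \<zeta>) \<partial>?C \<partial>\<mu>)"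
      using C.nn_integral_fst[OF whm] by simp
    finally show ?thesis by (simp add: nn_integral_count_space_finite w_def)
  qed
  have pw1: "(\<Sum>\<zeta>\<in>?Z. ennreal (pattern_weight k m \<zeta> y)) = 1" for y :: "real^'n"
    by (subst sum_ennreal) (simp_all add: pattern_weight_nonneg sum_pattern_weight)
  have Qfst: "(\<integral>\<^sup>+z. h (fst z) \<partial>Q) = (\<integral>\<^sup>+y. h y \<partial>\<mu>)" if h: "h \<in> borel_measurable borel" for h
  proof -
    have "(\<integral>\<^sup>+z. h (fst z) \<partial>Q) = (\<integral>\<^sup>+y. (\<Sum>\<zeta>\<in>?Z. ennreal (pattern_weight k m \<zeta> y) * h y) \<partial>\<mu>)"
      by (subst Qint) (use h in simp_all)
    also have "\<dots> = (\<integral>\<^sup>+y. h y \<partial>\<mu>)" unfolding sum_distrib_right[symmetric] pw1 by simp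
    finally show ?thesis .
  qed
  have setsQ: "sets Q = sets (\<mu> \<Otimes>\<^sub>M ?C)" unfolding Q_def by simp
  have "prob_space Q"
  proof
    show "emeasure Q (space Q) = 1" using Qfst[of "\<lambda>_. 1"] by (simp add: \<mu>.emeasure_space_1)
  qed
  then interpret Q: prob_space Q .
  have fm: "fst \<in> borel_measurable Q" and nm: "(\<lambda>z. node k m (snd z)) \<in> borel_measurable Q"
    unfolding measurable_cong_sets[OF setsQ refl] by (rule cm', simp)+
  have dfst: "distr Q borel fst = \<mu>"
    by (rule distr_eq_by_nn_integral[OF fm]) (use Qfst P2D(2)[OF \<mu>] in auto)
  have dnode: "distr Q borel (\<lambda>z. node k m (snd z)) = distr (measure_pmf (pattern_pmf k m \<mu>)) borel (node k m)"
  proof (rule distr_eq_by_nn_integral[OF nm])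
    fix h :: "real^'n \<Rightarrow> ennreal" assume h: "h \<in> borel_measurable borel"
    have "(\<integral>\<^sup>+z. h (node k m (snd z)) \<partial>Q) = (\<integral>\<^sup>+y. (\<Sum>\<zeta>\<in>?Z. ennreal (pattern_weight k m \<zeta> y) * h (node k m \<zeta>)) \<partial>\<mu>)"
      by (subst Qint) simp_all
    also have "\<dots> = (\<Sum>\<zeta>\<in>?Z. \<integral>\<^sup>+y. ennreal (pattern_weight k m \<zeta> y) * h (node k m \<zeta>) \<partial>\<mu>)"
      by (rule nn_integral_sum) (simp add: msets)
    also have "\<dots> = (\<Sum>\<zeta>\<in>?Z. ennreal (mass k m \<mu> \<zeta>) * h (node k m \<zeta>))"
    proof (rule sum.cong[OF refl])
      fix \<zeta> assume \<zeta>: "\<zeta> \<in> ?Z"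
      have "(\<integral>\<^sup>+y. ennreal (pattern_weight k m \<zeta> y) * h (node k m \<zeta>) \<partial>\<mu>)
          = (\<integral>\<^sup>+y. ennreal (pattern_weight k m \<zeta> y) \<partial>\<mu>) * h (node k m \<zeta>)"
        by (rule nn_integral_multc) (simp add: msets)
      also have "(\<integral>\<^sup>+y. ennreal (pattern_weight k m \<zeta> y) \<partial>\<mu>) = ennreal (mass k m \<mu> \<zeta>)"
        unfolding mass_def
        by (rule nn_integral_eq_integral[OF pattern_weight_integrable[OF \<mu> \<zeta>]]) (simp add: pattern_weight_nonneg)
      finally show "(\<integral>\<^sup>+y. ennreal (pattern_weight k m \<zeta> y) * h (node k m \<zeta>) \<partial>\<mu>) = ennreal (mass k m \<mu> \<zeta>) * h (node k m \<zeta>)" .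
    qed
    also have "\<dots> = (\<Sum>\<zeta>\<in>?Z. h (node k m \<zeta>) * ennreal (pmf (pattern_pmf k m \<mu>) \<zeta>))"
      by (rule sum.cong) (simp_all add: pmf_pattern_pmf[OF \<mu>] mult.commute)
    also have "\<dots> = (\<integral>\<^sup>+\<zeta>. h (node k m \<zeta>) \<partial>measure_pmf (pattern_pmf k m \<mu>))"
      by (rule nn_integral_measure_pmf_support[symmetric]) (use set_pattern_pmf[OF \<mu>, of k m] in auto)
    also have "\<dots> = (\<integral>\<^sup>+y. h y \<partial>distr (measure_pmf (pattern_pmf k m \<mu>)) borel (node k m))"
      by (rule nn_integral_distr[symmetric]) (use h in auto)
    finally show "(\<integral>\<^sup>+z. h (node k m (snd z)) \<partial>Q) = (\<integral>\<^sup>+y. h y \<partial>distr (measure_pmf (pattern_pmf k m \<mu>)) borel (node k m))" .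
  qed simp
  have Lfst: "fst \<in> L2 Q"
  proof -
    have "integrable Q (\<lambda>z. (norm (fst z))\<^sup>2)"
      by (rule integrable_distr[OF fm, of "\<lambda>y. (norm y)\<^sup>2"]) (simp add: dfst P2D(4)[OF \<mu>])
    with fm show ?thesis unfolding L2_def by simp
  qed
  have Lnode: "(\<lambda>z. node k m (snd z)) \<in> L2 Q"
    by (rule bounded_L2[OF Q.prob_space_axioms nm norm_node_le[OF less_imp_le[OF k]]])
  have "(\<integral>\<^sup>+z. ennreal ((norm (node k m (snd z) - fst z))\<^sup>2) \<partial>Q)
      = (\<integral>\<^sup>+y. (\<Sum>\<zeta>\<in>?Z. ennreal (pattern_weight k m \<zeta> y) * ennreal ((norm (node k m \<zeta> - y))\<^sup>2)) \<partial>\<mu>)"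
    by (subst Qint) simp_all
  also have "\<dots> \<le> (\<integral>\<^sup>+y. ennreal (2 * (real CARD('n) * k\<^sup>2 / real m) + 2 * (norm (sine_map k y - y))\<^sup>2) \<partial>\<mu>)"
  proof (rule nn_integral_mono)
    fix y :: "real^'n"
    have sq: "(norm (a + b))\<^sup>2 \<le> 2 * (norm a)\<^sup>2 + 2 * (norm b)\<^sup>2" for a b :: "real^'n"
    proof -
      have "(norm (a + b))\<^sup>2 \<le> (norm a + norm b)\<^sup>2" by (rule power_mono[OF norm_triangle_ineq]) simp
      also have "\<dots> \<le> 2 * (norm a)\<^sup>2 + 2 * (norm b)\<^sup>2"
        using zero_le_power2[of "norm a - norm b"] by (simp add: power2_eq_square algebra_simps)
      finally show ?thesis .
    qed
    have "(\<Sum>\<zeta>\<in>?Z. pattern_weight k m \<zeta> y * (norm (node k m \<zeta> - y))\<^sup>2)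
        \<le> (\<Sum>\<zeta>\<in>?Z. pattern_weight k m \<zeta> y * (2 * (norm (node k m \<zeta> - sine_map k y))\<^sup>2 + 2 * (norm (sine_map k y - y))\<^sup>2))"
      by (intro sum_mono mult_left_mono pattern_weight_nonneg) (use sq[of "node k m _ - sine_map k y" "sine_map k y - y"] in simp)
    also have "\<dots> = 2 * (\<Sum>\<zeta>\<in>?Z. pattern_weight k m \<zeta> y * (norm (node k m \<zeta> - sine_map k y))\<^sup>2)
        + (\<Sum>\<zeta>\<in>?Z. pattern_weight k m \<zeta> y) * (2 * (norm (sine_map k y - y))\<^sup>2)"
      unfolding sum_distrib_left sum_distrib_right sum.distrib[symmetric]
      by (rule sum.cong) (simp_all add: algebra_simps)
    also have "\<dots> \<le> 2 * (real CARD('n) * k\<^sup>2 / real m) + 2 * (norm (sine_map k y - y))\<^sup>2"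
      unfolding sum_pattern_weight using node_variance[OF m, of k y] by simp
    finally have le: "(\<Sum>\<zeta>\<in>?Z. pattern_weight k m \<zeta> y * (norm (node k m \<zeta> - y))\<^sup>2)
      \<le> 2 * (real CARD('n) * k\<^sup>2 / real m) + 2 * (norm (sine_map k y - y))\<^sup>2" .
    have "(\<Sum>\<zeta>\<in>?Z. ennreal (pattern_weight k m \<zeta> y) * ennreal ((norm (node k m \<zeta> - y))\<^sup>2))
        = ennreal (\<Sum>\<zeta>\<in>?Z. pattern_weight k m \<zeta> y * (norm (node k m \<zeta> - y))\<^sup>2)"
      by (subst sum_ennreal[symmetric]) (auto simp: pattern_weight_nonneg ennreal_mult)
    also have "\<dots> \<le> ennreal (2 * (real CARD('n) * k\<^sup>2 / real m) + 2 * (norm (sine_map k y - y))\<^sup>2)"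
      by (rule ennreal_leI[OF le])
    finally show "(\<Sum>\<zeta>\<in>?Z. ennreal (pattern_weight k m \<zeta> y) * ennreal ((norm (node k m \<zeta> - y))\<^sup>2))
        \<le> ennreal (2 * (real CARD('n) * k\<^sup>2 / real m) + 2 * (norm (sine_map k y - y))\<^sup>2)" .
  qed
  also have "\<dots> = ennreal (\<integral>y. 2 * (real CARD('n) * k\<^sup>2 / real m) + 2 * (norm (sine_map k y - y))\<^sup>2 \<partial>\<mu>)"
    by (rule nn_integral_eq_integral) (auto intro!: Bochner_Integration.integrable_add truncation_integrable[OF k \<mu>])
  also have "(\<integral>y. 2 * (real CARD('n) * k\<^sup>2 / real m) + 2 * (norm (sine_map k y - y))\<^sup>2 \<partial>\<mu>)
      = 2 * (real CARD('n) * k\<^sup>2 / real m) + 2 * truncation_error k \<mu>"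
    unfolding truncation_error_def
    by (subst Bochner_Integration.integral_add) (auto simp: \<mu>.prob_space intro!: truncation_integrable[OF k \<mu>])
  finally have nn: "(\<integral>\<^sup>+z. ennreal ((norm (node k m (snd z) - fst z))\<^sup>2) \<partial>Q)
      \<le> ennreal (2 * (real CARD('n) * k\<^sup>2 / real m) + 2 * truncation_error k \<mu>)" .
  have "(\<integral>z. (norm (node k m (snd z) - fst z))\<^sup>2 \<partial>Q) \<le> 2 * (real CARD('n) * k\<^sup>2 / real m) + 2 * truncation_error k \<mu>"
  proof -
    have c0: "0 \<le> 2 * (real CARD('n) * k\<^sup>2 / real m) + 2 * truncation_error k \<mu>"
      by (simp add: truncation_error_nonneg)
    have "(\<integral>\<^sup>+z. ennreal ((norm (node k m (snd z) - fst z))\<^sup>2) \<partial>Q) = ennreal (\<integral>z. (norm (node k m (snd z) - fst z))\<^sup>2 \<partial>Q)"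
      by (rule nn_integral_eq_integral[OF L2D(2)[OF L2_diff[OF Lnode Lfst]]]) simp
    with nn show ?thesis unfolding ennreal_le_iff[OF c0, symmetric] by (simp only:)
  qed
  then have "L2_norm Q (\<lambda>z. node k m (snd z) - fst z) \<le> sqrt (2 * (real CARD('n) * k\<^sup>2 / real m) + 2 * truncation_error k \<mu>)"
    unfolding L2_norm_def by (rule real_sqrt_le_mono)
  moreover have "W2 (distr (measure_pmf (pattern_pmf k m \<mu>)) borel (node k m)) \<mu> \<le> L2_norm Q (\<lambda>z. node k m (snd z) - fst z)"
    using W2_distr_le[OF Q.prob_space_axioms Lnode Lfst] unfolding dfst dnode .
  ultimately show ?thesis by linarith
qed


lemma pmf_map_frequency:
  assumes n: "0 < n"
  shows "pmf (map_pmf \<alpha> (pmf_of_set {..<n})) z = frequency n \<alpha> z"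
proof -
  have "{..<n} \<inter> \<alpha> -` {z} = {..<n} \<inter> {l. \<alpha> l = z}" by auto
  then show ?thesis
    using n by (simp add: pmf_map measure_pmf_of_set lessThan_empty_iff frequency_def)
qed

text \<open>The empirical measure is compared with the law of a random pattern through the variation distance,
  and that law with \<open>\<mu>\<close>.\<close>

lemma W2_empirical_nodes:
  fixes \<mu> :: "(real^'n::finite) measure"
  assumes \<mu>: "\<mu> \<in> P2" and k: "0 < k" and m: "0 < m" and n: "0 < n"
    and \<alpha>: "\<alpha> \<in> PiE {..<n} (\<lambda>_. patterns m)"
  shows "W2 (empirical n (\<lambda>l. node k m (\<alpha> l))) \<mu>
    \<le> sqrt ((2 * (real CARD('n) * k))\<^sup>2 * (\<Sum>\<zeta>\<in>patterns m. \<bar>frequency n \<alpha> \<zeta> - mass k m \<mu> \<zeta>\<bar>))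
      + sqrt (2 * (real CARD('n) * k\<^sup>2 / real m) + 2 * truncation_error k \<mu>)"
proof -
  let ?A = "map_pmf \<alpha> (pmf_of_set {..<n})" and ?B = "pattern_pmf k m \<mu>"
  have sA: "set_pmf ?A \<subseteq> patterns m"
    using \<alpha> n by (auto simp: pmf_of_set_lessThan PiE_mem)
  have eA: "empirical n (\<lambda>l. node k m (\<alpha> l)) = distr (measure_pmf ?A) borel (node k m)"
    unfolding empirical_def map_pmf_rep_eq by (subst distr_distr) (auto simp: o_def)
  have "W2 (distr (measure_pmf ?A) borel (node k m)) (distr (measure_pmf ?B) borel (node k m))
      \<le> sqrt ((2 * (real CARD('n) * k))\<^sup>2 * (\<Sum>\<zeta>\<in>patterns m. \<bar>pmf ?A \<zeta> - pmf ?B \<zeta>\<bar>))"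
  proof (rule W2_pmf_le_variation[OF finite_patterns sA set_pattern_pmf[OF \<mu>]])
    fix i j :: "'n \<times> nat \<Rightarrow> bool"
    show "norm (node k m i - node k m j) \<le> 2 * (real CARD('n) * k)"
      using norm_triangle_ineq4[of "node k m i" "node k m j"] norm_node_le[of k m i] norm_node_le[of k m j] k
      by linarith
  qed
  also have "(\<Sum>\<zeta>\<in>patterns m. \<bar>pmf ?A \<zeta> - pmf ?B \<zeta>\<bar>) = (\<Sum>\<zeta>\<in>patterns m. \<bar>frequency n \<alpha> \<zeta> - mass k m \<mu> \<zeta>\<bar>)"
    by (rule sum.cong) (simp_all add: pmf_map_frequency[OF n] pmf_pattern_pmf[OF \<mu>])
  finally have 1: "W2 (empirical n (\<lambda>l. node k m (\<alpha> l))) (distr (measure_pmf ?B) borel (node k m))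
      \<le> sqrt ((2 * (real CARD('n) * k))\<^sup>2 * (\<Sum>\<zeta>\<in>patterns m. \<bar>frequency n \<alpha> \<zeta> - mass k m \<mu> \<zeta>\<bar>))"
    unfolding eA .
  have "finite (set_pmf ?B)" by (rule finite_subset[OF set_pattern_pmf[OF \<mu>]]) simp
  then have P: "distr (measure_pmf ?B) borel (node k m) \<in> P2"
    by (intro distr_P2[OF measure_pmf.prob_space_axioms pmf_L2])
  show ?thesis
    using W2_triangle[OF empirical_P2[OF n] P \<mu>, of "\<lambda>l. node k m (\<alpha> l)"] 1 W2_pattern_law[OF \<mu> k m] by linarith
qed

lemma product_sum_less_ex:
  assumes "finite I" "finite Z" "\<And>i z. i \<in> I \<Longrightarrow> z \<in> Z \<Longrightarrow> 0 \<le> w i z" "\<And>i. i \<in> I \<Longrightarrow> (\<Sum>z\<in>Z. w i z) = 1"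
    and lt: "product_sum I Z w F < c"
  obtains \<alpha> where "\<alpha> \<in> PiE I (\<lambda>_. Z)" "F \<alpha> < c"
proof (rule ccontr)
  assume neg: "\<not> thesis"
  have "product_sum I Z w (\<lambda>_. c) \<le> product_sum I Z w F"
    by (rule product_sum_mono) (use assms(3) neg that in \<open>auto simp: not_less[symmetric]\<close>)
  then show False using product_sum_const[OF assms(1,2,4), where c=c] lt by simp
qed

lemma eventually_small_deviation_bound:
  fixes c \<eta> :: real
  assumes c: "0 \<le> c" and \<eta>: "0 < \<eta>"
  obtains t where "0 < t" "\<forall>\<^sub>F n in sequentially. c * (t + 10 / (real n * t)) < \<eta>"
proof -
  define t where "t = \<eta> / (2 * (c + 1))"
  have t: "0 < t" using c \<eta> by (simp add: t_def)
  have ct: "c * t < \<eta>" using c \<eta> by (simp add: t_def field_simps add_nonneg_pos)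
  have "(\<lambda>n. 1 / real n) \<longlonglongrightarrow> 0" by (rule lim_const_over_n)
  then have "(\<lambda>n. c * (t + 10 / t * (1 / real n))) \<longlonglongrightarrow> c * (t + 10 / t * 0)"
    by (intro tendsto_intros)
  then have "\<forall>\<^sub>F n in sequentially. c * (t + 10 / t * (1 / real n)) < \<eta>"
    using ct by (intro order_tendstoD(2)) auto
  then have "\<forall>\<^sub>F n in sequentially. c * (t + 10 / (real n * t)) < \<eta>"
    by (rule eventually_mono) (simp add: mult.commute)
  with t show ?thesis by (rule that)
qed

text \<open>Some sample deviates no more than the mean deviation. Afterwards one sample point may be replaced
  by \<open>x\<close>, which costs \<open>O(1 / sqrt n)\<close>.\<close>

lemma empirical_dense:
  fixes \<mu> :: "(real^'n::finite) measure" and x :: "real^'n"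
  assumes \<mu>: "\<mu> \<in> P2" and \<epsilon>: "0 < \<epsilon>"
  obtains n z l where "0 < n" "l < n" "z l = x" "W2 (empirical n z) \<mu> < \<epsilon>"
proof -
  let ?d = "real CARD('n)"
  define \<eta> where "\<eta> = (\<epsilon> / 3)\<^sup>2"
  have \<eta>: "0 < \<eta>" using \<epsilon> by (simp add: \<eta>_def)
  have sqrt\<eta>: "sqrt \<eta> = \<epsilon> / 3" using \<epsilon> by (simp add: \<eta>_def)
  have "\<forall>\<^sub>F k in sequentially. truncation_error (real (Suc k)) \<mu> < \<eta> / 4"
    by (rule order_tendstoD(2)[OF truncation_error_tendsto_0[OF \<mu>]]) (use \<eta> in simp)
  then obtain k0 where k0: "truncation_error (real (Suc k0)) \<mu> < \<eta> / 4"
    unfolding eventually_sequentially by blast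
  define k where "k = real (Suc k0)"
  have k: "0 < k" by (simp add: k_def)
  have "(\<lambda>m. ?d * k\<^sup>2 / real m) \<longlonglongrightarrow> 0" by (rule lim_const_over_n)
  then have "\<forall>\<^sub>F m in sequentially. ?d * k\<^sup>2 / real m < \<eta> / 4" using \<eta> by (intro order_tendstoD(2)) auto
  then obtain m where m: "0 < m" "?d * k\<^sup>2 / real m < \<eta> / 4"
    using eventually_conj[OF _ eventually_gt_at_top[of 0]] eventually_happens by (metis (no_types, lifting) sequentially_bot)
  let ?Z = "patterns m :: 'n pattern set"
  define \<delta> where "\<delta> = \<eta> / ((2 * (?d * k))\<^sup>2 + 1)"
  have dp: "0 < (2 * (?d * k))\<^sup>2 + 1" by (simp add: add_nonneg_pos)
  have \<delta>: "0 < \<delta>" unfolding \<delta>_def using \<eta> dp by simp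
  have d\<delta>: "(2 * (?d * k))\<^sup>2 * \<delta> \<le> \<eta>"
    unfolding \<delta>_def using \<eta> dp by (simp add: divide_le_eq algebra_simps)
  obtain t where t: "0 < t" "\<forall>\<^sub>F n in sequentially. real (card ?Z) * (t + 10 / (real n * t)) < \<delta>"
    using eventually_small_deviation_bound[of "real (card ?Z)" \<delta>] \<delta> by auto
  have "(\<lambda>n. (norm x + ?d * k) / sqrt (real n)) \<longlonglongrightarrow> 0"
    by (intro tendsto_divide_0[OF tendsto_const] filterlim_at_top_imp_at_infinity
        filterlim_compose[OF sqrt_at_top filterlim_real_sequentially])
  then have "\<forall>\<^sub>F n in sequentially. (norm x + ?d * k) / sqrt (real n) < \<epsilon> / 3"
    using \<epsilon> by (intro order_tendstoD(2)) auto
  with t(2) eventually_gt_at_top[of "0::nat"]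
  have "\<forall>\<^sub>F n in sequentially. 0 < n \<and> real (card ?Z) * (t + 10 / (real n * t)) < \<delta> \<and> (norm x + ?d * k) / sqrt (real n) < \<epsilon> / 3"
    by eventually_elim simp
  then obtain n where n: "0 < n" "real (card ?Z) * (t + 10 / (real n * t)) < \<delta>" "(norm x + ?d * k) / sqrt (real n) < \<epsilon> / 3"
    unfolding eventually_sequentially by blast
  have "product_sum {..<n} ?Z (\<lambda>_. mass k m \<mu>) (\<lambda>\<alpha>. \<Sum>\<zeta>\<in>?Z. \<bar>frequency n \<alpha> \<zeta> - mass k m \<mu> \<zeta>\<bar>)
      \<le> real (card ?Z) * (t + 10 / (real n * t))"
    by (rule frequency_deviation[OF n(1), where R="{}"])
       (use t(1) in \<open>simp_all add: mass_nonneg sum_mass[OF \<mu>] mass_le_1[OF \<mu>]\<close>)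
  then have "product_sum {..<n} ?Z (\<lambda>_. mass k m \<mu>) (\<lambda>\<alpha>. \<Sum>\<zeta>\<in>?Z. \<bar>frequency n \<alpha> \<zeta> - mass k m \<mu> \<zeta>\<bar>) < \<delta>"
    using n(2) by linarith
  then obtain \<alpha> where \<alpha>: "\<alpha> \<in> PiE {..<n} (\<lambda>_. ?Z)" "(\<Sum>\<zeta>\<in>?Z. \<bar>frequency n \<alpha> \<zeta> - mass k m \<mu> \<zeta>\<bar>) < \<delta>"
    by (rule product_sum_less_ex[rotated 4]) (simp_all add: mass_nonneg sum_mass[OF \<mu>])
  let ?z = "\<lambda>l. node k m (\<alpha> l)"
  have "(2 * (?d * k))\<^sup>2 * (\<Sum>\<zeta>\<in>?Z. \<bar>frequency n \<alpha> \<zeta> - mass k m \<mu> \<zeta>\<bar>) \<le> (2 * (?d * k))\<^sup>2 * \<delta>"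
    using \<alpha>(2) by (intro mult_left_mono) auto
  also note d\<delta>
  finally have a: "sqrt ((2 * (?d * k))\<^sup>2 * (\<Sum>\<zeta>\<in>?Z. \<bar>frequency n \<alpha> \<zeta> - mass k m \<mu> \<zeta>\<bar>)) \<le> \<epsilon> / 3"
    unfolding sqrt\<eta>[symmetric] by (rule real_sqrt_le_mono)
  have "2 * (?d * k\<^sup>2 / real m) + 2 * truncation_error k \<mu> < \<eta>"
    using m(2) k0 unfolding k_def[symmetric] by linarith
  then have b: "sqrt (2 * (?d * k\<^sup>2 / real m) + 2 * truncation_error k \<mu>) < \<epsilon> / 3"
    unfolding sqrt\<eta>[symmetric] by (rule real_sqrt_less_mono)
  have "W2 (empirical n (?z(0 := x))) (empirical n ?z) \<le> norm (x - ?z 0) / sqrt (real n)"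
    by (rule W2_empirical_upd[OF n(1) n(1)])
  also have "\<dots> \<le> (norm x + ?d * k) / sqrt (real n)"
    using norm_triangle_ineq4[of x "?z 0"] norm_node_le[of k m "\<alpha> 0"] k by (intro divide_right_mono) auto
  also have "\<dots> < \<epsilon> / 3" by (rule n(3))
  finally have c: "W2 (empirical n (?z(0 := x))) (empirical n ?z) < \<epsilon> / 3" .
  have "W2 (empirical n (?z(0 := x))) \<mu> < \<epsilon>"
    using W2_triangle[OF empirical_P2[OF n(1)] empirical_P2[OF n(1)] \<mu>, of "?z(0 := x)" ?z]
      W2_empirical_nodes[OF \<mu> k m(1) n(1) \<alpha>(1)] a b c by linarith
  then show ?thesis using that[of n 0 "?z(0 := x)"] n(1) by simp
qed

section \<open>Uniformly distributed indices\<close>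

abbreviation has_uniform_variable :: "'w measure \<Rightarrow> bool" where
  "has_uniform_variable P \<equiv> \<exists>U \<in> borel_measurable P. distr P borel U = uniform_measure lborel {0..1::real}"

text \<open>\<open>N\<close> is the integer part of \<open>n * U\<close>, capped at \<open>n - 1\<close> because of the value \<open>U = 1\<close>. Each level set lies
  between an open interval and its closure.\<close>

lemma uniform_index:
  fixes P :: "'w measure"
  assumes P: "prob_space P" and U: "has_uniform_variable P"
    and n: "0 < n"
  obtains N :: "'w \<Rightarrow> nat" where "N \<in> measurable P (count_space UNIV)" "\<And>\<omega>. \<omega> \<in> space P \<Longrightarrow> N \<omega> < n"
    "distr P (count_space UNIV) N = measure_pmf (pmf_of_set {..<n})"
proof -
  interpret prob_space P by fact
  obtain U where Um [measurable]: "U \<in> borel_measurable P" and Ud: "distr P borel U = uniform_measure lborel {0..1::real}"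
    using U by blast
  define h where "h t = min (n - 1) (nat \<lfloor>real n * t\<rfloor>)" for t :: real
  have hm [measurable]: "h \<in> measurable borel (count_space UNIV)" unfolding h_def by measurable
  define N where "N \<omega> = h (U \<omega>)" for \<omega>
  have Nm: "N \<in> measurable P (count_space UNIV)" unfolding N_def by measurable
  have Nn: "N \<omega> < n" for \<omega> using n by (simp add: N_def h_def)
  have em: "emeasure P {\<omega> \<in> space P. N \<omega> = l} = ennreal (1 / real n)" if l: "l < n" for l
  proof -
    let ?A = "h -` {l}"
    have As: "?A \<in> sets borel" using measurable_sets[OF hm, of "{l}"] by simp
    have "emeasure P {\<omega> \<in> space P. N \<omega> = l} = emeasure (distr P borel U) ?A"
      using As by (subst emeasure_distr) (auto simp: N_def intro!: arg_cong[where f="emeasure P"])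
    also have "\<dots> = emeasure lborel ({0..1} \<inter> ?A) / emeasure lborel {0..1::real}"
      unfolding Ud by (rule emeasure_uniform_measure) (use As in auto)
    also have "\<dots> = emeasure lborel ({0..1} \<inter> ?A)" by (simp add: divide_ennreal_def)
    also have "\<dots> = ennreal (1 / real n)"
    proof (rule antisym)
      have len: "real (Suc l) / real n - real l / real n = 1 / real n" by (simp add: diff_divide_distrib[symmetric])
      have "{0..1} \<inter> ?A \<subseteq> {real l / real n .. real (Suc l) / real n}"
      proof
        fix t assume t: "t \<in> {0..1} \<inter> ?A"
        then have t01: "0 \<le> t" "t \<le> 1" and ht: "h t = l" by auto
        have fl: "real (nat \<lfloor>real n * t\<rfloor>) \<le> real n * t" "real n * t < real (nat \<lfloor>real n * t\<rfloor>) + 1"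
          using t01 by (auto simp: of_nat_nat)
        have "real l \<le> real n * t"
          using ht fl(1) by (auto simp: h_def min_def split: if_splits)
        moreover have "real n * t \<le> real (Suc l)"
        proof (cases "nat \<lfloor>real n * t\<rfloor> \<le> n - 1")
          case True then show ?thesis using ht fl(2) by (simp add: h_def)
        next
          case False
          then have "l = n - 1" using ht by (simp add: h_def)
          then show ?thesis using t01 n mult_left_mono[of t 1 "real n"] by simp
        qed
        ultimately show "t \<in> {real l / real n .. real (Suc l) / real n}"
          using n by (simp add: divide_le_eq le_divide_eq mult.commute)
      qed
      then have "emeasure lborel ({0..1} \<inter> ?A) \<le> emeasure lborel {real l / real n .. real (Suc l) / real n}"
        by (rule emeasure_mono) simp
      also have "\<dots> = ennreal (1 / real n)"
        unfolding len[symmetric] by (rule emeasure_lborel_Icc) (simp add: divide_right_mono)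
      finally show "emeasure lborel ({0..1} \<inter> ?A) \<le> ennreal (1 / real n)" .
      have "{real l / real n <..< real (Suc l) / real n} \<subseteq> {0..1} \<inter> ?A"
      proof
        fix t assume t: "t \<in> {real l / real n <..< real (Suc l) / real n}"
        then have b: "real l < real n * t" "real n * t < real (Suc l)"
          using n by (auto simp: divide_less_eq less_divide_eq mult.commute)
        have "0 \<le> real l / real n" by simp
        moreover have "real l / real n < t" using t by simp
        ultimately have t0: "0 \<le> t" by linarith
        have "real (Suc l) / real n \<le> 1" using l n by (simp add: divide_le_eq)
        then have t1: "t \<le> 1" using t by auto
        have "\<lfloor>real n * t\<rfloor> = int l" using b by (intro floor_unique) auto
        then have "h t = l" using l by (simp add: h_def)
        with t0 t1 show "t \<in> {0..1} \<inter> ?A" by simp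
      qed
      then have "emeasure lborel {real l / real n <..< real (Suc l) / real n} \<le> emeasure lborel ({0..1} \<inter> ?A)"
        by (rule emeasure_mono) (use As in simp)
      moreover have "emeasure lborel {real l / real n <..< real (Suc l) / real n} = ennreal (1 / real n)"
        unfolding len[symmetric] by (rule emeasure_lborel_Ioo) (simp add: divide_right_mono)
      ultimately show "ennreal (1 / real n) \<le> emeasure lborel ({0..1} \<inter> ?A)" by simp
    qed
    finally show ?thesis .
  qed
  have "distr P (count_space UNIV) N = measure_pmf (pmf_of_set {..<n})"
  proof (rule measure_eqI_countable[where A=UNIV])
    fix l :: nat
    have "emeasure (distr P (count_space UNIV) N) {l} = emeasure P {\<omega> \<in> space P. N \<omega> = l}"
      using Nm by (subst emeasure_distr) (auto intro!: arg_cong[where f="emeasure P"])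
    also have "\<dots> = emeasure (measure_pmf (pmf_of_set {..<n})) {l}"
    proof (cases "l < n")
      case True
      then show ?thesis using em[OF True] n by (simp add: emeasure_pmf_single pmf_of_set_lessThan)
    next
      case False
      then have "{\<omega> \<in> space P. N \<omega> = l} = {}" using Nn by fastforce
      moreover have "pmf (pmf_of_set {..<n}) l = 0"
        using False n pmf_of_set_lessThan(1)[OF n] by (simp add: pmf_eq_0_set_pmf)
      ultimately show ?thesis by (simp only: emeasure_pmf_single emeasure_empty ennreal_0)
    qed
    finally show "emeasure (distr P (count_space UNIV) N) {l} = emeasure (measure_pmf (pmf_of_set {..<n})) {l}" .
  qed auto
  then show ?thesis using that[of N] Nm Nn by blast
qed

section \<open>L-derivatives at empirical measures\<close>

text \<open>If \<open>N\<close> is a uniformly distributed index, \<open>empirical n z\<close> is the law of \<open>z N\<close>, and moving \<open>z l\<close> is a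
  perturbation in \<open>L2\<close> supported on the event \<open>N = l\<close>, which has probability \<open>1 / n\<close>.\<close>

lemma has_L_deriv_empirical_at_0:
  fixes u :: "'a::euclidean_space measure \<Rightarrow> real"
  assumes P: "prob_space P" and U: "has_uniform_variable P"
    and u: "has_L_deriv P u p" and l: "l < n"
  shows "((\<lambda>s. u (empirical n (z(l := z l + s *\<^sub>R e)))) has_real_derivative (p (empirical n z) (z l) \<bullet> e) / real n) (at 0)"
proof -
  interpret prob_space P by fact
  have n: "0 < n" using l by simp
  obtain N where N: "N \<in> measurable P (count_space UNIV)" "\<And>\<omega>. \<omega> \<in> space P \<Longrightarrow> N \<omega> < n"
    and Nd: "distr P (count_space UNIV) N = measure_pmf (pmf_of_set {..<n})"
    using uniform_index[OF P U n] by blast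
  have emp: "distr P borel (\<lambda>\<omega>. z (N \<omega>)) = empirical n z" for z :: "nat \<Rightarrow> 'a"
    unfolding empirical_def Nd[symmetric] by (subst distr_distr) (use N in \<open>auto simp: o_def\<close>)
  have int: "(\<integral>\<omega>. f (N \<omega>) \<partial>P) = (\<Sum>i<n. f i) / real n" for f :: "nat \<Rightarrow> real"
  proof -
    have "(\<integral>\<omega>. f (N \<omega>) \<partial>P) = (\<integral>i. f i \<partial>measure_pmf (pmf_of_set {..<n}))"
      unfolding Nd[symmetric] by (rule integral_distr[OF N(1), symmetric]) simp
    then show ?thesis using n by (simp add: integral_pmf_of_set lessThan_empty_iff)
  qed
  have L: "(\<lambda>\<omega>. z (N \<omega>)) \<in> L2 P" for z :: "nat \<Rightarrow> 'a" by (rule finite_range_L2[OF P N])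
  obtain D where D: "\<And>\<xi>. \<xi> \<in> L2 P \<Longrightarrow> has_gradient P (lifting P u) \<xi> (D \<xi>)"
    "\<And>\<xi>. \<xi> \<in> L2 P \<Longrightarrow> AE \<omega> in P. D \<xi> \<omega> = p (distr P borel \<xi>) (\<xi> \<omega>)"
    using u unfolding has_L_deriv_def by blast
  let ?\<xi> = "\<lambda>\<omega>. z (N \<omega>)"
  let ?\<eta> = "\<lambda>s \<omega>. (if N \<omega> = l then s *\<^sub>R e else 0)"
  let ?c = "(p (empirical n z) (z l) \<bullet> e) / real n"
  let ?K = "norm e / sqrt (real n)"
  have \<eta>L: "?\<eta> s \<in> L2 P" for s using L[of "\<lambda>i. if i = l then s *\<^sub>R e else 0"] by simp
  have \<eta>n: "L2_norm P (?\<eta> s) = \<bar>s\<bar> * ?K" for s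
  proof -
    have "(\<integral>\<omega>. (norm (?\<eta> s \<omega>))\<^sup>2 \<partial>P) = (\<Sum>i<n. (norm (if i = l then s *\<^sub>R e else 0))\<^sup>2) / real n"
      by (rule int[of "\<lambda>i. (norm (if i = l then s *\<^sub>R e else 0))\<^sup>2"])
    also have "(\<Sum>i<n. (norm (if i = l then s *\<^sub>R e else 0))\<^sup>2) = (\<Sum>i<n. if i = l then (\<bar>s\<bar> * norm e)\<^sup>2 else 0)"
      by (rule sum.cong) auto
    also have "\<dots> = (\<bar>s\<bar> * norm e)\<^sup>2" using l by (simp add: sum.delta)
    finally show ?thesis unfolding L2_norm_def by (simp add: real_sqrt_divide)
  qed
  have mD: "D ?\<xi> \<in> borel_measurable P" using D(1)[OF L] unfolding has_gradient_def L2_def by blast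
  have G: "(\<integral>\<omega>. D ?\<xi> \<omega> \<bullet> ?\<eta> s \<omega> \<partial>P) = s * ?c" for s
  proof -
    have mp: "(\<lambda>\<omega>. p (empirical n z) (z (N \<omega>)) \<bullet> ?\<eta> s \<omega>) \<in> borel_measurable P"
      by (rule measurable_compose[OF N(1), of "\<lambda>i. p (empirical n z) (z i) \<bullet> (if i = l then s *\<^sub>R e else 0)"]) simp
    have m\<eta>: "?\<eta> s \<in> borel_measurable P" using \<eta>L unfolding L2_def by blast
    have "(\<integral>\<omega>. D ?\<xi> \<omega> \<bullet> ?\<eta> s \<omega> \<partial>P) = (\<integral>\<omega>. p (empirical n z) (z (N \<omega>)) \<bullet> ?\<eta> s \<omega> \<partial>P)"
    proof (rule integral_cong_AE[OF borel_measurable_inner[OF mD m\<eta>] mp])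
      show "AE \<omega> in P. D ?\<xi> \<omega> \<bullet> ?\<eta> s \<omega> = p (empirical n z) (z (N \<omega>)) \<bullet> ?\<eta> s \<omega>"
        using D(2)[OF L[of z]] unfolding emp by (rule AE_mp) (rule AE_I2, simp)
    qed
    also have "\<dots> = (\<Sum>i<n. p (empirical n z) (z i) \<bullet> (if i = l then s *\<^sub>R e else 0)) / real n"
      by (rule int[of "\<lambda>i. p (empirical n z) (z i) \<bullet> (if i = l then s *\<^sub>R e else 0)"])
    also have "(\<Sum>i<n. p (empirical n z) (z i) \<bullet> (if i = l then s *\<^sub>R e else 0))
        = (\<Sum>i<n. if i = l then s * (p (empirical n z) (z l) \<bullet> e) else 0)"
      by (rule sum.cong) auto
    also have "\<dots> = s * (p (empirical n z) (z l) \<bullet> e)" using l by (simp add: sum.delta)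
    finally show ?thesis by simp
  qed
  have lift: "lifting P u (\<lambda>\<omega>. ?\<xi> \<omega> + ?\<eta> s \<omega>) = u (empirical n (z(l := z l + s *\<^sub>R e)))" for s
  proof -
    have "(\<lambda>\<omega>. ?\<xi> \<omega> + ?\<eta> s \<omega>) = (\<lambda>\<omega>. (z(l := z l + s *\<^sub>R e)) (N \<omega>))" by (rule ext) simp
    then show ?thesis unfolding lifting_def using emp[of "z(l := z l + s *\<^sub>R e)"] by simp
  qed
  have lift0: "lifting P u ?\<xi> = u (empirical n z)" unfolding lifting_def emp ..
  show ?thesis
    unfolding DERIV_def LIM_eq
  proof (intro allI impI)
    fix r :: real assume r: "0 < r"
    have K1: "0 < ?K + 1" by (simp add: add_nonneg_pos)
    define \<epsilon> where "\<epsilon> = r / (2 * (?K + 1))"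
    have \<epsilon>: "0 < \<epsilon>" using r K1 by (simp add: \<epsilon>_def)
    have \<epsilon>K: "\<epsilon> * ?K < r"
    proof -
      have aux: "r / (2 * x) * x = r / 2" if "0 < x" for x using that by simp
      have "\<epsilon> * ?K \<le> \<epsilon> * (?K + 1)" using \<epsilon> by (intro mult_left_mono) auto
      also have "\<dots> = r / 2" unfolding \<epsilon>_def by (rule aux[OF K1])
      also have "\<dots> < r" using r by simp
      finally show ?thesis .
    qed
    obtain \<delta> where \<delta>: "0 < \<delta>" "\<And>\<eta>. \<eta> \<in> L2 P \<Longrightarrow> L2_norm P \<eta> < \<delta> \<Longrightarrow>
        \<bar>lifting P u (\<lambda>\<omega>. ?\<xi> \<omega> + \<eta> \<omega>) - lifting P u ?\<xi> - (\<integral>\<omega>. D ?\<xi> \<omega> \<bullet> \<eta> \<omega> \<partial>P)\<bar> \<le> \<epsilon> * L2_norm P \<eta>"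
      using D(1)[OF L[of z]] \<epsilon> unfolding has_gradient_def by blast
    show "\<exists>t>0. \<forall>s. s \<noteq> 0 \<and> norm (s - 0) < t \<longrightarrow>
      norm ((u (empirical n (z(l := z l + (0 + s) *\<^sub>R e))) - u (empirical n (z(l := z l + 0 *\<^sub>R e)))) / s - ?c) < r"
    proof (intro exI[of _ "\<delta> / (?K + 1)"] conjI allI impI)
      show "0 < \<delta> / (?K + 1)" using \<delta>(1) K1 by simp
      fix s :: real assume s: "s \<noteq> 0 \<and> norm (s - 0) < \<delta> / (?K + 1)"
      have "\<bar>s\<bar> * (?K + 1) < \<delta>" using s K1 by (simp add: less_divide_eq)
      moreover have "\<bar>s\<bar> * ?K \<le> \<bar>s\<bar> * (?K + 1)" by (intro mult_left_mono) auto
      ultimately have sK: "L2_norm P (?\<eta> s) < \<delta>" unfolding \<eta>n by linarith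
      from \<delta>(2)[OF \<eta>L sK] have b: "\<bar>u (empirical n (z(l := z l + s *\<^sub>R e))) - u (empirical n z) - s * ?c\<bar> \<le> \<epsilon> * (\<bar>s\<bar> * ?K)"
        unfolding lift lift0 G \<eta>n .
      have "\<bar>(u (empirical n (z(l := z l + s *\<^sub>R e))) - u (empirical n z)) / s - ?c\<bar>
          = \<bar>u (empirical n (z(l := z l + s *\<^sub>R e))) - u (empirical n z) - s * ?c\<bar> / \<bar>s\<bar>"
        using s by (simp add: abs_divide[symmetric] diff_divide_distrib)
      also have "\<dots> \<le> \<epsilon> * (\<bar>s\<bar> * ?K) / \<bar>s\<bar>" by (rule divide_right_mono[OF b]) simp
      also have "\<dots> = \<epsilon> * ?K" using s by simp
      also have "\<dots> < r" by (rule \<epsilon>K)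
      finally show "norm ((u (empirical n (z(l := z l + (0 + s) *\<^sub>R e))) - u (empirical n (z(l := z l + 0 *\<^sub>R e)))) / s - ?c) < r"
        by simp
    qed
  qed
qed

lemma has_L_deriv_empirical:
  fixes u :: "'a::euclidean_space measure \<Rightarrow> real"
  assumes P: "prob_space P" and U: "has_uniform_variable P"
    and u: "has_L_deriv P u p" and l: "l < n"
  shows "((\<lambda>s. u (empirical n (z(l := z l + s *\<^sub>R e)))) has_real_derivative
    (p (empirical n (z(l := z l + s *\<^sub>R e))) (z l + s *\<^sub>R e) \<bullet> e) / real n) (at s)"
proof -
  let ?z = "z(l := z l + s *\<^sub>R e)"
  have "?z(l := ?z l + h *\<^sub>R e) = z(l := z l + (s + h) *\<^sub>R e)" for h
    by (simp add: scaleR_add_left add.assoc)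
  then show ?thesis
    using has_L_deriv_empirical_at_0[OF P U u l, of ?z e] unfolding DERIV_def by simp
qed

lemma has_L_deriv_cont:
  "has_L_deriv P u p \<Longrightarrow> continuous_map (prod_topology W2_top euclidean) euclidean (\<lambda>(\<mu>, x). p \<mu> x)"
  unfolding has_L_deriv_def by blast

lemma continuous_map_W2_prodD:
  assumes "continuous_map (prod_topology W2_top euclidean) euclidean f" "\<mu> \<in> P2" "0 < \<epsilon>"
  shows "\<exists>\<delta>>0. \<forall>\<nu>\<in>P2. \<forall>y. W2 \<mu> \<nu> < \<delta> \<longrightarrow> dist x y < \<delta> \<longrightarrow> dist (f (\<mu>, x)) (f (\<nu>, y)) < \<epsilon>"
  using assms unfolding continuous_map_W2_prod_iff by blast

text \<open>Two L-derivatives agree at the atoms of empirical measures, hence everywhere by density and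
  continuity.\<close>

lemma has_L_deriv_unique:
  fixes u :: "(real^'n::finite) measure \<Rightarrow> real"
  assumes P: "prob_space P" and U: "has_uniform_variable P"
    and u: "has_L_deriv P u p" "has_L_deriv P u q" and \<mu>: "\<mu> \<in> P2"
  shows "p \<mu> x = q \<mu> x"
proof (rule ccontr)
  assume "p \<mu> x \<noteq> q \<mu> x"
  then have e: "0 < dist (p \<mu> x) (q \<mu> x) / 2" by simp
  let ?e = "dist (p \<mu> x) (q \<mu> x) / 2"
  have eq: "p (empirical n z) (z l) = q (empirical n z) (z l)" if "l < n" for n z l
  proof (rule vector_eq_rdot[THEN iffD1], rule allI)
    fix v :: "real^'n"
    have "(p (empirical n z) (z l) \<bullet> v) / real n = (q (empirical n z) (z l) \<bullet> v) / real n"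
      by (rule DERIV_unique[OF has_L_deriv_empirical_at_0[OF P U u(1) that] has_L_deriv_empirical_at_0[OF P U u(2) that]])
    then show "p (empirical n z) (z l) \<bullet> v = q (empirical n z) (z l) \<bullet> v" using that by simp
  qed
  obtain d1 where d1: "0 < d1" "\<And>\<nu> y. \<nu> \<in> P2 \<Longrightarrow> W2 \<mu> \<nu> < d1 \<Longrightarrow> dist x y < d1 \<Longrightarrow> dist (p \<mu> x) (p \<nu> y) < ?e"
    using continuous_map_W2_prodD[OF has_L_deriv_cont[OF u(1)] \<mu> e, of x] unfolding split_conv by blast
  obtain d2 where d2: "0 < d2" "\<And>\<nu> y. \<nu> \<in> P2 \<Longrightarrow> W2 \<mu> \<nu> < d2 \<Longrightarrow> dist x y < d2 \<Longrightarrow> dist (q \<mu> x) (q \<nu> y) < ?e"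
    using continuous_map_W2_prodD[OF has_L_deriv_cont[OF u(2)] \<mu> e, of x] unfolding split_conv by blast
  have d12: "0 < min d1 d2" using d1(1) d2(1) by simp
  obtain n z l where z: "0 < n" "l < n" "z l = x" "W2 (empirical n z) \<mu> < min d1 d2"
    by (rule empirical_dense[OF \<mu> d12])
  have W: "W2 \<mu> (empirical n z) < d1" "W2 \<mu> (empirical n z) < d2"
    using z(4) W2_commute[of \<mu> "empirical n z"] by auto
  have "dist (p \<mu> x) (p (empirical n z) x) < ?e" by (rule d1(2)[OF empirical_P2[OF z(1)] W(1)]) (simp add: d1)
  moreover have "dist (q \<mu> x) (q (empirical n z) x) < ?e" by (rule d2(2)[OF empirical_P2[OF z(1)] W(2)]) (simp add: d2)
  moreover have "p (empirical n z) x = q (empirical n z) x" using eq[OF z(2), of z] z(3) by simp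
  ultimately show False
    using dist_triangle2[of "p \<mu> x" "q \<mu> x" "p (empirical n z) x"] by (simp add: dist_commute)
qed

lemma has_L_deriv_L_deriv: "has_L_deriv P u p \<Longrightarrow> has_L_deriv P u (L_deriv P u)"
  unfolding L_deriv_def by (rule someI[of "has_L_deriv P u" p])

lemma L_deriv_eq:
  fixes u :: "(real^'n::finite) measure \<Rightarrow> real"
  assumes "prob_space P" "has_uniform_variable P"
    and u: "has_L_deriv P u p" and "\<mu> \<in> P2"
  shows "L_deriv P u \<mu> x = p \<mu> x"
  by (rule has_L_deriv_unique[OF assms(1,2) has_L_deriv_L_deriv[OF u] u assms(4)])

lemma has_L_deriv_cong:
  assumes P: "prob_space P" and eq: "\<And>\<mu>. \<mu> \<in> P2 \<Longrightarrow> u \<mu> = v \<mu>"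
  shows "has_L_deriv P u = has_L_deriv P v"
proof -
  have l: "lifting P u \<xi> = lifting P v \<xi>" if "\<xi> \<in> L2 P" for \<xi>
    unfolding lifting_def by (rule eq[OF distr_P2[OF P that]])
  have g: "has_gradient P (lifting P u) \<xi> G = has_gradient P (lifting P v) \<xi> G" if "\<xi> \<in> L2 P" for \<xi> G
    unfolding has_gradient_def using l[OF that] l[OF L2_add[OF that]] by (simp cong: conj_cong ball_cong)
  show ?thesis unfolding has_L_deriv_def fun_eq_iff using g by (simp cong: ball_cong)
qed

lemma L_deriv_cong:
  assumes "prob_space P" "\<And>\<mu>. \<mu> \<in> P2 \<Longrightarrow> u \<mu> = v \<mu>"
  shows "L_deriv P u = L_deriv P v"
proof -
  have "has_L_deriv P u = has_L_deriv P v" by (rule has_L_deriv_cong[OF assms(1)]) (rule assms(2))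
  then show ?thesis by (simp add: L_deriv_def)
qed

section \<open>Functions with a quadratic remainder\<close>

text \<open>A quantitative form of L-differentiability with a quadratic remainder. It is stable under sums and
  products, and holds for integrals of smooth functions with bounded derivatives.\<close>

definition regular_L ::
  "'w measure \<Rightarrow> real \<Rightarrow> ('a::euclidean_space measure \<Rightarrow> real) \<Rightarrow> ('a measure \<Rightarrow> 'a \<Rightarrow> 'a) \<Rightarrow> bool" where
  "regular_L P C u p \<longleftrightarrow> 0 \<le> C \<and>
     (\<forall>\<mu>\<in>P2. \<bar>u \<mu>\<bar> \<le> C) \<and>
     (\<forall>\<mu>\<in>P2. \<forall>\<nu>\<in>P2. \<bar>u \<mu> - u \<nu>\<bar> \<le> C * W2 \<mu> \<nu>) \<and>
     (\<forall>\<mu>\<in>P2. \<forall>x. norm (p \<mu> x) \<le> C) \<and>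
     (\<forall>\<mu>\<in>P2. \<forall>\<nu>\<in>P2. \<forall>x y. norm (p \<mu> x - p \<nu> y) \<le> C * (W2 \<mu> \<nu> + norm (x - y))) \<and>
     (\<forall>\<xi>\<in>L2 P. \<forall>\<eta>\<in>L2 P. \<bar>u (distr P borel (\<lambda>\<omega>. \<xi> \<omega> + \<eta> \<omega>)) - u (distr P borel \<xi>)
        - (\<integral>\<omega>. p (distr P borel \<xi>) (\<xi> \<omega>) \<bullet> \<eta> \<omega> \<partial>P)\<bar> \<le> C * (L2_norm P \<eta>)\<^sup>2)"

lemma regular_LI:
  assumes "0 \<le> C" "\<And>\<mu>. \<mu> \<in> P2 \<Longrightarrow> \<bar>u \<mu>\<bar> \<le> C"
    "\<And>\<mu> \<nu>. \<mu> \<in> P2 \<Longrightarrow> \<nu> \<in> P2 \<Longrightarrow> \<bar>u \<mu> - u \<nu>\<bar> \<le> C * W2 \<mu> \<nu>"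
    "\<And>\<mu> x. \<mu> \<in> P2 \<Longrightarrow> norm (p \<mu> x) \<le> C"
    "\<And>\<mu> \<nu> x y. \<mu> \<in> P2 \<Longrightarrow> \<nu> \<in> P2 \<Longrightarrow> norm (p \<mu> x - p \<nu> y) \<le> C * (W2 \<mu> \<nu> + norm (x - y))"
    "\<And>\<xi> \<eta>. \<xi> \<in> L2 P \<Longrightarrow> \<eta> \<in> L2 P \<Longrightarrow> \<bar>u (distr P borel (\<lambda>\<omega>. \<xi> \<omega> + \<eta> \<omega>)) - u (distr P borel \<xi>)
        - (\<integral>\<omega>. p (distr P borel \<xi>) (\<xi> \<omega>) \<bullet> \<eta> \<omega> \<partial>P)\<bar> \<le> C * (L2_norm P \<eta>)\<^sup>2"
  shows "regular_L P C u p"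
  unfolding regular_L_def using assms by blast

lemma regular_LD:
  assumes "regular_L P C u p"
  shows "0 \<le> C" "\<And>\<mu>. \<mu> \<in> P2 \<Longrightarrow> \<bar>u \<mu>\<bar> \<le> C"
    "\<And>\<mu> \<nu>. \<mu> \<in> P2 \<Longrightarrow> \<nu> \<in> P2 \<Longrightarrow> \<bar>u \<mu> - u \<nu>\<bar> \<le> C * W2 \<mu> \<nu>"
    "\<And>\<mu> x. \<mu> \<in> P2 \<Longrightarrow> norm (p \<mu> x) \<le> C"
    "\<And>\<mu> \<nu> x y. \<mu> \<in> P2 \<Longrightarrow> \<nu> \<in> P2 \<Longrightarrow> norm (p \<mu> x - p \<nu> y) \<le> C * (W2 \<mu> \<nu> + norm (x - y))"
    "\<And>\<xi> \<eta>. \<xi> \<in> L2 P \<Longrightarrow> \<eta> \<in> L2 P \<Longrightarrow> \<bar>u (distr P borel (\<lambda>\<omega>. \<xi> \<omega> + \<eta> \<omega>)) - u (distr P borel \<xi>)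
        - (\<integral>\<omega>. p (distr P borel \<xi>) (\<xi> \<omega>) \<bullet> \<eta> \<omega> \<partial>P)\<bar> \<le> C * (L2_norm P \<eta>)\<^sup>2"
  using assms unfolding regular_L_def by blast+

lemma L2_norm_nonneg [simp]: "0 \<le> L2_norm P \<eta>"
  unfolding L2_norm_def by simp

lemma W2_shift_le:
  assumes P: "prob_space P" and "\<xi> \<in> L2 P" "\<eta> \<in> L2 P"
  shows "W2 (distr P borel (\<lambda>\<omega>. \<xi> \<omega> + \<eta> \<omega>)) (distr P borel \<xi>) \<le> L2_norm P \<eta>"
  using W2_distr_le[OF P L2_add[OF assms(2,3)] assms(2)] by simp

lemma Lipschitz_measurable:
  fixes g :: "'a::euclidean_space \<Rightarrow> 'b::euclidean_space"
  assumes "\<And>x y. norm (g x - g y) \<le> C * norm (x - y)"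
  shows "g \<in> borel_measurable borel"
proof (rule borel_measurable_continuous_onI, rule continuous_on_subset[OF _ subset_UNIV], rule continuous_at_imp_continuous_on, rule ballI)
  fix x
  have "((\<lambda>y. g y - g x) \<longlongrightarrow> 0) (at x)"
  proof (rule Lim_null_comparison)
    show "\<forall>\<^sub>F y in at x. norm (g y - g x) \<le> C * norm (y - x)" using assms by simp
    have "((\<lambda>y. C * norm (y - x)) \<longlongrightarrow> C * norm (x - x)) (at x)" by (intro tendsto_intros)
    then show "((\<lambda>y. C * norm (y - x)) \<longlongrightarrow> 0) (at x)" by simp
  qed
  then show "isCont g x" unfolding isCont_def by (rule LIM_zero_cancel)
qed

lemma regular_L_measurable:
  assumes r: "regular_L P C u p" and \<mu>: "\<mu> \<in> P2"
  shows "p \<mu> \<in> borel_measurable borel"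
  by (rule Lipschitz_measurable[of _ C]) (use regular_LD(5)[OF r \<mu> \<mu>] W2_self[OF \<mu>] in simp)

lemma L2_norm_integrable:
  assumes P: "prob_space P" and \<eta>: "\<eta> \<in> L2 P"
  shows "integrable P (\<lambda>\<omega>. norm (\<eta> \<omega>))"
proof -
  interpret prob_space P by fact
  note [measurable] = L2D(1)[OF \<eta>]
  have "integrable P (\<lambda>\<omega>. norm (\<eta> \<omega>) * 1)"
    by (rule integrable_mult_square) (use L2D[OF \<eta>] in auto)
  then show ?thesis by simp
qed

lemma bounded_inner_integrable:
  assumes P: "prob_space P" and G: "G \<in> borel_measurable P" "\<And>\<omega>. norm (G \<omega>) \<le> C" and \<eta>: "\<eta> \<in> L2 P"
  shows "integrable P (\<lambda>\<omega>. G \<omega> \<bullet> \<eta> \<omega>)"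
proof (rule Bochner_Integration.integrable_bound)
  show "integrable P (\<lambda>\<omega>. C * norm (\<eta> \<omega>))" using L2_norm_integrable[OF P \<eta>] by simp
  show "(\<lambda>\<omega>. G \<omega> \<bullet> \<eta> \<omega>) \<in> borel_measurable P" by (rule borel_measurable_inner[OF G(1) L2D(1)[OF \<eta>]])
  show "AE \<omega> in P. norm (G \<omega> \<bullet> \<eta> \<omega>) \<le> norm (C * norm (\<eta> \<omega>))"
  proof (rule AE_I2)
    fix \<omega>
    have "\<bar>G \<omega> \<bullet> \<eta> \<omega>\<bar> \<le> norm (G \<omega>) * norm (\<eta> \<omega>)" by (rule Cauchy_Schwarz_ineq2)
    also have "\<dots> \<le> C * norm (\<eta> \<omega>)" by (rule mult_right_mono[OF G(2)]) simp
    finally show "norm (G \<omega> \<bullet> \<eta> \<omega>) \<le> norm (C * norm (\<eta> \<omega>))" by simp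
  qed
qed

lemma regular_L_inner_integrable:
  assumes P: "prob_space P" and r: "regular_L P C u p" and \<xi>: "\<xi> \<in> L2 P" and \<eta>: "\<eta> \<in> L2 P"
  shows "integrable P (\<lambda>\<omega>. p (distr P borel \<xi>) (\<xi> \<omega>) \<bullet> \<eta> \<omega>)"
  by (rule bounded_inner_integrable[OF P _ regular_LD(4)[OF r distr_P2[OF P \<xi>]] \<eta>])
     (rule measurable_compose[OF L2D(1)[OF \<xi>] regular_L_measurable[OF r distr_P2[OF P \<xi>]]])

lemma regular_L_const: "regular_L P \<bar>c\<bar> (\<lambda>_. c) (\<lambda>_ _. 0)"
  by (rule regular_LI) (auto intro!: mult_nonneg_nonneg add_nonneg_nonneg)

lemma regular_L_add:
  assumes P: "prob_space P" and u: "regular_L P A u p" and v: "regular_L P B v q"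
  shows "regular_L P (A + B) (\<lambda>\<mu>. u \<mu> + v \<mu>) (\<lambda>\<mu> x. p \<mu> x + q \<mu> x)"
proof (rule regular_LI)
  note U = regular_LD[OF u] and V = regular_LD[OF v]
  show "0 \<le> A + B" using U(1) V(1) by simp
  show "\<bar>u \<mu> + v \<mu>\<bar> \<le> A + B" if "\<mu> \<in> P2" for \<mu> using U(2)[OF that] V(2)[OF that] by linarith
  show "\<bar>u \<mu> + v \<mu> - (u \<nu> + v \<nu>)\<bar> \<le> (A + B) * W2 \<mu> \<nu>" if "\<mu> \<in> P2" "\<nu> \<in> P2" for \<mu> \<nu>
    using U(3)[OF that] V(3)[OF that] unfolding distrib_right by linarith
  show "norm (p \<mu> x + q \<mu> x) \<le> A + B" if "\<mu> \<in> P2" for \<mu> x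
    using U(4)[OF that] V(4)[OF that] by (intro norm_triangle_mono)
  show "norm (p \<mu> x + q \<mu> x - (p \<nu> y + q \<nu> y)) \<le> (A + B) * (W2 \<mu> \<nu> + norm (x - y))" if "\<mu> \<in> P2" "\<nu> \<in> P2" for \<mu> \<nu> x y
  proof -
    have "norm ((p \<mu> x - p \<nu> y) + (q \<mu> x - q \<nu> y)) \<le> A * (W2 \<mu> \<nu> + norm (x - y)) + B * (W2 \<mu> \<nu> + norm (x - y))"
      using U(5)[OF that] V(5)[OF that] by (intro norm_triangle_mono)
    then show ?thesis by (simp add: distrib_right algebra_simps)
  qed
  fix \<xi> \<eta> :: "'a \<Rightarrow> 'b" assume L: "\<xi> \<in> L2 P" "\<eta> \<in> L2 P"
  have "(\<integral>\<omega>. (p (distr P borel \<xi>) (\<xi> \<omega>) + q (distr P borel \<xi>) (\<xi> \<omega>)) \<bullet> \<eta> \<omega> \<partial>P)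
      = (\<integral>\<omega>. p (distr P borel \<xi>) (\<xi> \<omega>) \<bullet> \<eta> \<omega> \<partial>P) + (\<integral>\<omega>. q (distr P borel \<xi>) (\<xi> \<omega>) \<bullet> \<eta> \<omega> \<partial>P)"
    unfolding inner_add_left
    by (rule Bochner_Integration.integral_add[OF regular_L_inner_integrable[OF P u L] regular_L_inner_integrable[OF P v L]])
  then show "\<bar>u (distr P borel (\<lambda>\<omega>. \<xi> \<omega> + \<eta> \<omega>)) + v (distr P borel (\<lambda>\<omega>. \<xi> \<omega> + \<eta> \<omega>)) - (u (distr P borel \<xi>) + v (distr P borel \<xi>))
      - (\<integral>\<omega>. (p (distr P borel \<xi>) (\<xi> \<omega>) + q (distr P borel \<xi>) (\<xi> \<omega>)) \<bullet> \<eta> \<omega> \<partial>P)\<bar> \<le> (A + B) * (L2_norm P \<eta>)\<^sup>2"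
    using U(6)[OF L] V(6)[OF L] unfolding distrib_right by linarith
qed

lemma abs_mult_le: "\<bar>a\<bar> \<le> A \<Longrightarrow> \<bar>b\<bar> \<le> B \<Longrightarrow> \<bar>a * b\<bar> \<le> A * B" for a b A B :: real
  unfolding abs_mult by (rule mult_mono) auto

lemma regular_L_mult:
  assumes P: "prob_space P" and u: "regular_L P A u p" and v: "regular_L P B v q"
  shows "regular_L P (4 * (A * B)) (\<lambda>\<mu>. u \<mu> * v \<mu>) (\<lambda>\<mu> x. u \<mu> *\<^sub>R q \<mu> x + v \<mu> *\<^sub>R p \<mu> x)"
proof (rule regular_LI)
  note U = regular_LD[OF u] and V = regular_LD[OF v]
  have AB: "0 \<le> A * B" using U(1) V(1) by simp
  show "0 \<le> 4 * (A * B)" using AB by simp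
  show "\<bar>u \<mu> * v \<mu>\<bar> \<le> 4 * (A * B)" if "\<mu> \<in> P2" for \<mu>
    using abs_mult_le[OF U(2)[OF that] V(2)[OF that]] AB by linarith
  show "\<bar>u \<mu> * v \<mu> - u \<nu> * v \<nu>\<bar> \<le> 4 * (A * B) * W2 \<mu> \<nu>" if m: "\<mu> \<in> P2" "\<nu> \<in> P2" for \<mu> \<nu>
  proof -
    have "u \<mu> * v \<mu> - u \<nu> * v \<nu> = u \<mu> * (v \<mu> - v \<nu>) + (u \<mu> - u \<nu>) * v \<nu>" by (simp add: algebra_simps)
    moreover have "\<bar>u \<mu> * (v \<mu> - v \<nu>)\<bar> \<le> A * (B * W2 \<mu> \<nu>)" by (rule abs_mult_le[OF U(2)[OF m(1)] V(3)[OF m]])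
    moreover have "\<bar>(u \<mu> - u \<nu>) * v \<nu>\<bar> \<le> A * W2 \<mu> \<nu> * B" by (rule abs_mult_le[OF U(3)[OF m] V(2)[OF m(2)]])
    moreover have "A * (B * W2 \<mu> \<nu>) = A * B * W2 \<mu> \<nu>" "A * W2 \<mu> \<nu> * B = A * B * W2 \<mu> \<nu>" by simp_all
    moreover have "0 \<le> A * B * W2 \<mu> \<nu>" using AB by simp
    moreover have "4 * (A * B) * W2 \<mu> \<nu> = 4 * (A * B * W2 \<mu> \<nu>)" by simp
    ultimately show ?thesis by linarith
  qed
  have sc: "norm (a *\<^sub>R w) \<le> X * Y" if "\<bar>a\<bar> \<le> X" "norm w \<le> Y" for a X Y and w :: 'b
    unfolding norm_scaleR by (rule mult_mono[OF that]) (use that in auto)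
  show "norm (u \<mu> *\<^sub>R q \<mu> x + v \<mu> *\<^sub>R p \<mu> x) \<le> 4 * (A * B)" if m: "\<mu> \<in> P2" for \<mu> x
  proof -
    have "norm (u \<mu> *\<^sub>R q \<mu> x + v \<mu> *\<^sub>R p \<mu> x) \<le> A * B + B * A"
      by (intro norm_triangle_mono sc U V m)
    then show ?thesis using AB by (simp add: mult.commute)
  qed
  show "norm (u \<mu> *\<^sub>R q \<mu> x + v \<mu> *\<^sub>R p \<mu> x - (u \<nu> *\<^sub>R q \<nu> y + v \<nu> *\<^sub>R p \<nu> y)) \<le> 4 * (A * B) * (W2 \<mu> \<nu> + norm (x - y))"
    if m: "\<mu> \<in> P2" "\<nu> \<in> P2" for \<mu> \<nu> x y
  proof -
    let ?d = "W2 \<mu> \<nu> + norm (x - y)"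
    have W: "W2 \<mu> \<nu> \<le> ?d" by simp
    have eq: "u \<mu> *\<^sub>R q \<mu> x + v \<mu> *\<^sub>R p \<mu> x - (u \<nu> *\<^sub>R q \<nu> y + v \<nu> *\<^sub>R p \<nu> y)
       = (u \<mu> *\<^sub>R (q \<mu> x - q \<nu> y) + (u \<mu> - u \<nu>) *\<^sub>R q \<nu> y) + (v \<mu> *\<^sub>R (p \<mu> x - p \<nu> y) + (v \<mu> - v \<nu>) *\<^sub>R p \<nu> y)"
      by (simp add: scaleR_diff_left scaleR_diff_right)
    have "norm ((u \<mu> *\<^sub>R (q \<mu> x - q \<nu> y) + (u \<mu> - u \<nu>) *\<^sub>R q \<nu> y) + (v \<mu> *\<^sub>R (p \<mu> x - p \<nu> y) + (v \<mu> - v \<nu>) *\<^sub>R p \<nu> y))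
        \<le> (A * (B * ?d) + (A * W2 \<mu> \<nu>) * B) + (B * (A * ?d) + (B * W2 \<mu> \<nu>) * A)"
      by (intro norm_triangle_mono sc U V m)
    moreover have "(A * (B * ?d) + (A * W2 \<mu> \<nu>) * B) + (B * (A * ?d) + (B * W2 \<mu> \<nu>) * A) = 2 * (A * B * ?d) + 2 * (A * B * W2 \<mu> \<nu>)"
      by (simp add: algebra_simps)
    moreover have "A * B * W2 \<mu> \<nu> \<le> A * B * ?d" by (rule mult_left_mono[OF W AB])
    moreover have "4 * (A * B) * ?d = 4 * (A * B * ?d)" by simp
    ultimately show ?thesis unfolding eq by linarith
  qed
  fix \<xi> \<eta> :: "'a \<Rightarrow> 'b" assume L: "\<xi> \<in> L2 P" "\<eta> \<in> L2 P"
  let ?\<mu> = "distr P borel \<xi>" and ?\<nu> = "distr P borel (\<lambda>\<omega>. \<xi> \<omega> + \<eta> \<omega>)" and ?N = "L2_norm P \<eta>"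
  let ?I = "\<integral>\<omega>. p ?\<mu> (\<xi> \<omega>) \<bullet> \<eta> \<omega> \<partial>P" and ?J = "\<integral>\<omega>. q ?\<mu> (\<xi> \<omega>) \<bullet> \<eta> \<omega> \<partial>P"
  have m: "?\<mu> \<in> P2" "?\<nu> \<in> P2" by (rule distr_P2[OF P L(1)], rule distr_P2[OF P L2_add[OF L]])
  have W: "W2 ?\<nu> ?\<mu> \<le> ?N" by (rule W2_shift_le[OF P L])
  have i: "(\<integral>\<omega>. (u ?\<mu> *\<^sub>R q ?\<mu> (\<xi> \<omega>) + v ?\<mu> *\<^sub>R p ?\<mu> (\<xi> \<omega>)) \<bullet> \<eta> \<omega> \<partial>P) = u ?\<mu> * ?J + v ?\<mu> * ?I"
    unfolding inner_add_left inner_scaleR_left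
    using regular_L_inner_integrable[OF P u L] regular_L_inner_integrable[OF P v L] by simp
  have uW: "\<bar>u ?\<nu> - u ?\<mu>\<bar> \<le> A * ?N"
    using U(3)[OF m(2,1)] mult_left_mono[OF W U(1)] by linarith
  have vW: "\<bar>v ?\<nu> - v ?\<mu>\<bar> \<le> B * ?N"
    using V(3)[OF m(2,1)] mult_left_mono[OF W V(1)] by linarith
  have "u ?\<nu> * v ?\<nu> - u ?\<mu> * v ?\<mu> - (u ?\<mu> * ?J + v ?\<mu> * ?I)
      = u ?\<mu> * (v ?\<nu> - v ?\<mu> - ?J) + v ?\<mu> * (u ?\<nu> - u ?\<mu> - ?I) + (u ?\<nu> - u ?\<mu>) * (v ?\<nu> - v ?\<mu>)"
    by (simp add: algebra_simps)
  moreover have "\<bar>u ?\<mu> * (v ?\<nu> - v ?\<mu> - ?J)\<bar> \<le> A * (B * ?N\<^sup>2)" by (rule abs_mult_le[OF U(2)[OF m(1)] V(6)[OF L]])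
  moreover have "\<bar>v ?\<mu> * (u ?\<nu> - u ?\<mu> - ?I)\<bar> \<le> B * (A * ?N\<^sup>2)" by (rule abs_mult_le[OF V(2)[OF m(1)] U(6)[OF L]])
  moreover have "\<bar>(u ?\<nu> - u ?\<mu>) * (v ?\<nu> - v ?\<mu>)\<bar> \<le> (A * ?N) * (B * ?N)" by (rule abs_mult_le[OF uW vW])
  moreover have "(A * ?N) * (B * ?N) = A * B * ?N\<^sup>2" "A * (B * ?N\<^sup>2) = A * B * ?N\<^sup>2" "B * (A * ?N\<^sup>2) = A * B * ?N\<^sup>2"
    by (simp_all add: power2_eq_square)
  moreover have "0 \<le> A * B * ?N\<^sup>2" using AB by simp
  moreover have "4 * (A * B) * ?N\<^sup>2 = 4 * (A * B * ?N\<^sup>2)" by simp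
  ultimately show "\<bar>u ?\<nu> * v ?\<nu> - u ?\<mu> * v ?\<mu> - (\<integral>\<omega>. (u ?\<mu> *\<^sub>R q ?\<mu> (\<xi> \<omega>) + v ?\<mu> *\<^sub>R p ?\<mu> (\<xi> \<omega>)) \<bullet> \<eta> \<omega> \<partial>P)\<bar>
      \<le> 4 * (A * B) * ?N\<^sup>2"
    unfolding i by linarith
qed

lemma gradient_mean_value:
  fixes \<phi> :: "'a::euclidean_space \<Rightarrow> real"
  assumes d: "\<And>x. (\<phi> has_derivative (\<lambda>h. g x \<bullet> h)) (at x)"
  obtains \<theta> where "0 < \<theta>" "\<theta> < 1" "\<phi> (x + h) - \<phi> x = g (x + \<theta> *\<^sub>R h) \<bullet> h"
proof -
  have D: "((\<lambda>s. \<phi> (x + s *\<^sub>R h)) has_real_derivative g (x + s *\<^sub>R h) \<bullet> h) (at s)" for s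
  proof -
    have "((\<lambda>s. x + s *\<^sub>R h) has_derivative (\<lambda>t. 0 + t *\<^sub>R h)) (at s)"
      by (intro has_derivative_add has_derivative_const has_derivative_scaleR_left has_derivative_ident)
    then have "((\<lambda>s. \<phi> (x + s *\<^sub>R h)) has_derivative (\<lambda>t. g (x + s *\<^sub>R h) \<bullet> (0 + t *\<^sub>R h))) (at s)"
      using d by (rule has_derivative_compose)
    then show ?thesis unfolding has_field_derivative_def by (simp add: mult.commute[of _ "g _ \<bullet> h"])
  qed
  obtain \<theta> where "0 < \<theta>" "\<theta> < 1" "\<phi> (x + 1 *\<^sub>R h) - \<phi> (x + 0 *\<^sub>R h) = (1 - 0) * (g (x + \<theta> *\<^sub>R h) \<bullet> h)"
    using MVT2[of 0 1 "\<lambda>s. \<phi> (x + s *\<^sub>R h)" "\<lambda>s. g (x + s *\<^sub>R h) \<bullet> h"] D by auto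
  then show ?thesis using that[of \<theta>] by simp
qed

text \<open>The remainder is the mean value theorem applied at each point of the probability space.\<close>

lemma regular_L_integral:
  fixes \<phi> :: "'a::euclidean_space \<Rightarrow> real"
  assumes P: "prob_space P" and d: "\<And>x. (\<phi> has_derivative (\<lambda>h. g x \<bullet> h)) (at x)" and C: "0 \<le> C"
    and \<phi>: "\<And>x. \<bar>\<phi> x\<bar> \<le> C" and g: "\<And>x. norm (g x) \<le> C" and g': "\<And>x y. norm (g x - g y) \<le> C * norm (x - y)"
  shows "regular_L P C (\<lambda>\<mu>. \<integral>x. \<phi> x \<partial>\<mu>) (\<lambda>_. g)"
proof (rule regular_LI[OF C])
  interpret P: prob_space P by fact
  have lip: "\<bar>\<phi> x - \<phi> y\<bar> \<le> C * norm (x - y)" for x y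
  proof -
    obtain \<theta> where "\<phi> (y + (x - y)) - \<phi> y = g (y + \<theta> *\<^sub>R (x - y)) \<bullet> (x - y)"
      by (rule gradient_mean_value[OF d])
    then have "\<bar>\<phi> x - \<phi> y\<bar> \<le> norm (g (y + \<theta> *\<^sub>R (x - y))) * norm (x - y)"
      using Cauchy_Schwarz_ineq2[of "g (y + \<theta> *\<^sub>R (x - y))" "x - y"] by simp
    also have "\<dots> \<le> C * norm (x - y)" by (rule mult_right_mono[OF g]) simp
    finally show ?thesis .
  qed
  have \<phi>m [measurable]: "\<phi> \<in> borel_measurable borel" by (rule Lipschitz_measurable[of _ C]) (use lip in simp)
  have gm: "g \<in> borel_measurable borel" by (rule Lipschitz_measurable[OF g'])
  show "\<bar>\<integral>x. \<phi> x \<partial>\<mu>\<bar> \<le> C" if \<mu>: "\<mu> \<in> P2" for \<mu>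
  proof -
    interpret prob_space \<mu> by (rule P2D(1)[OF \<mu>])
    have m: "\<phi> \<in> borel_measurable \<mu>" unfolding measurable_cong_sets[OF P2D(2)[OF \<mu>] refl] by (rule \<phi>m)
    have i: "integrable \<mu> \<phi>" by (rule integrable_const_bound[where B=C]) (use \<phi> m in auto)
    have "\<bar>\<integral>x. \<phi> x \<partial>\<mu>\<bar> \<le> (\<integral>x. \<bar>\<phi> x\<bar> \<partial>\<mu>)" by (rule integral_abs_bound)
    also have "\<dots> \<le> (\<integral>x. C \<partial>\<mu>)" by (rule integral_mono) (use i \<phi> in auto)
    finally show ?thesis by (simp add: prob_space)
  qed
  show "\<bar>(\<integral>x. \<phi> x \<partial>\<mu>) - (\<integral>x. \<phi> x \<partial>\<nu>)\<bar> \<le> C * W2 \<mu> \<nu>" if "\<mu> \<in> P2" "\<nu> \<in> P2" for \<mu> \<nu>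
    by (rule Lipschitz_integral_diff_le[OF that \<phi>m \<phi> lip C])
  show "norm (g x) \<le> C" for x by (rule g)
  show "norm (g x - g y) \<le> C * (W2 \<mu> \<nu> + norm (x - y))" for \<mu> \<nu> x y
    using g'[of x y] mult_nonneg_nonneg[OF C W2_nonneg[of \<mu> \<nu>]] by (simp add: distrib_left)
  fix \<xi> \<eta> :: "'b \<Rightarrow> 'a" assume L: "\<xi> \<in> L2 P" "\<eta> \<in> L2 P"
  note mx = L2D(1)[OF L(1)] and me = L2D(1)[OF L(2)]
  have ms: "(\<lambda>\<omega>. \<xi> \<omega> + \<eta> \<omega>) \<in> borel_measurable P" by (rule borel_measurable_add[OF mx me])
  have ib: "integrable P (\<lambda>\<omega>. \<phi> (f \<omega>))" if "f \<in> borel_measurable P" for f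
    by (rule P.integrable_const_bound[where B=C]) (use \<phi> measurable_compose[OF that \<phi>m] in auto)
  have ii: "integrable P (\<lambda>\<omega>. g (\<xi> \<omega>) \<bullet> \<eta> \<omega>)"
    by (rule bounded_inner_integrable[OF P measurable_compose[OF mx gm] g L(2)])
  have "\<bar>(\<integral>x. \<phi> x \<partial>distr P borel (\<lambda>\<omega>. \<xi> \<omega> + \<eta> \<omega>)) - (\<integral>x. \<phi> x \<partial>distr P borel \<xi>) - (\<integral>\<omega>. g (\<xi> \<omega>) \<bullet> \<eta> \<omega> \<partial>P)\<bar>
      = \<bar>\<integral>\<omega>. \<phi> (\<xi> \<omega> + \<eta> \<omega>) - \<phi> (\<xi> \<omega>) - g (\<xi> \<omega>) \<bullet> \<eta> \<omega> \<partial>P\<bar>"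
    using ib[OF ms] ib[OF mx] ii by (simp add: integral_distr[OF ms \<phi>m] integral_distr[OF mx \<phi>m])
  also have "\<dots> \<le> (\<integral>\<omega>. \<bar>\<phi> (\<xi> \<omega> + \<eta> \<omega>) - \<phi> (\<xi> \<omega>) - g (\<xi> \<omega>) \<bullet> \<eta> \<omega>\<bar> \<partial>P)" by (rule integral_abs_bound)
  also have "\<dots> \<le> (\<integral>\<omega>. C * (norm (\<eta> \<omega>))\<^sup>2 \<partial>P)"
  proof (rule integral_mono)
    show "integrable P (\<lambda>\<omega>. \<bar>\<phi> (\<xi> \<omega> + \<eta> \<omega>) - \<phi> (\<xi> \<omega>) - g (\<xi> \<omega>) \<bullet> \<eta> \<omega>\<bar>)"
      using ib[OF ms] ib[OF mx] ii by simp
    show "integrable P (\<lambda>\<omega>. C * (norm (\<eta> \<omega>))\<^sup>2)" using L2D(2)[OF L(2)] by simp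
    fix \<omega>
    let ?x = "\<xi> \<omega>" and ?h = "\<eta> \<omega>"
    obtain \<theta> where \<theta>: "0 < \<theta>" "\<theta> < 1" "\<phi> (?x + ?h) - \<phi> ?x = g (?x + \<theta> *\<^sub>R ?h) \<bullet> ?h"
      by (rule gradient_mean_value[OF d])
    have "\<bar>\<phi> (?x + ?h) - \<phi> ?x - g ?x \<bullet> ?h\<bar> = \<bar>(g (?x + \<theta> *\<^sub>R ?h) - g ?x) \<bullet> ?h\<bar>"
      unfolding \<theta>(3) by (simp add: inner_diff_left)
    also have "\<dots> \<le> norm (g (?x + \<theta> *\<^sub>R ?h) - g ?x) * norm ?h" by (rule Cauchy_Schwarz_ineq2)
    also have "\<dots> \<le> (C * norm ?h) * norm ?h"
    proof (rule mult_right_mono)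
      have "norm (g (?x + \<theta> *\<^sub>R ?h) - g ?x) \<le> C * norm (?x + \<theta> *\<^sub>R ?h - ?x)" by (rule g')
      also have "\<dots> = C * (\<theta> * norm ?h)" using \<theta> by simp
      also have "\<dots> \<le> C * (1 * norm ?h)" using \<theta> C by (intro mult_left_mono mult_right_mono) auto
      finally show "norm (g (?x + \<theta> *\<^sub>R ?h) - g ?x) \<le> C * norm ?h" by simp
    qed simp
    finally show "\<bar>\<phi> (?x + ?h) - \<phi> ?x - g ?x \<bullet> ?h\<bar> \<le> C * (norm ?h)\<^sup>2" by (simp add: power2_eq_square)
  qed
  also have "\<dots> = C * (L2_norm P \<eta>)\<^sup>2" unfolding L2_norm_def by simp
  finally show "\<bar>(\<integral>x. \<phi> x \<partial>distr P borel (\<lambda>\<omega>. \<xi> \<omega> + \<eta> \<omega>)) - (\<integral>x. \<phi> x \<partial>distr P borel \<xi>) - (\<integral>\<omega>. g (\<xi> \<omega>) \<bullet> \<eta> \<omega> \<partial>P)\<bar>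
      \<le> C * (L2_norm P \<eta>)\<^sup>2" .
qed

lemma regular_L_continuous:
  assumes r: "regular_L P C u p"
  shows "continuous_map W2_top euclideanreal u"
    "continuous_map (prod_topology W2_top euclidean) euclidean (\<lambda>(\<mu>, x). p \<mu> x)"
proof -
  note R = regular_LD[OF r]
  have C1: "0 < C + 1" using R(1) by simp
  show "continuous_map W2_top euclideanreal u"
    unfolding continuous_map_W2_iff
  proof (intro ballI allI impI)
    fix \<mu> :: "'b measure" and \<epsilon> :: real assume \<mu>: "\<mu> \<in> P2" and \<epsilon>: "0 < \<epsilon>"
    show "\<exists>\<delta>>0. \<forall>\<nu>\<in>P2. W2 \<mu> \<nu> < \<delta> \<longrightarrow> dist (u \<mu>) (u \<nu>) < \<epsilon>"
    proof (intro exI[of _ "\<epsilon> / (C + 1)"] conjI ballI impI)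
      fix \<nu> :: "'b measure" assume \<nu>: "\<nu> \<in> P2" and W: "W2 \<mu> \<nu> < \<epsilon> / (C + 1)"
      have "\<bar>u \<mu> - u \<nu>\<bar> \<le> C * W2 \<mu> \<nu>" by (rule R(3)[OF \<mu> \<nu>])
      also have "\<dots> \<le> (C + 1) * W2 \<mu> \<nu>" by (intro mult_right_mono) auto
      also have "\<dots> < \<epsilon>" using W C1 by (simp add: less_divide_eq mult.commute)
      finally show "dist (u \<mu>) (u \<nu>) < \<epsilon>" by (simp add: dist_real_def)
    qed (use \<epsilon> C1 in simp)
  qed
  show "continuous_map (prod_topology W2_top euclidean) euclidean (\<lambda>(\<mu>, x). p \<mu> x)"
    unfolding continuous_map_W2_prod_iff split_conv
  proof (intro ballI allI impI)
    fix \<mu> :: "'b measure" and \<epsilon> :: real and x :: 'b assume \<mu>: "\<mu> \<in> P2" and \<epsilon>: "0 < \<epsilon>"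
    have aux: "D * (\<epsilon> / (2 * D) + \<epsilon> / (2 * D)) = \<epsilon>" if "0 < D" for D
      using that by (simp add: distrib_left)
    show "\<exists>\<delta>>0. \<forall>\<nu>\<in>P2. \<forall>y. W2 \<mu> \<nu> < \<delta> \<longrightarrow> dist x y < \<delta> \<longrightarrow> dist (p \<mu> x) (p \<nu> y) < \<epsilon>"
    proof (intro exI[of _ "\<epsilon> / (2 * (C + 1))"] conjI ballI allI impI)
      fix \<nu> :: "'b measure" and y assume \<nu>: "\<nu> \<in> P2" and W: "W2 \<mu> \<nu> < \<epsilon> / (2 * (C + 1))" "dist x y < \<epsilon> / (2 * (C + 1))"
      have "norm (p \<mu> x - p \<nu> y) \<le> C * (W2 \<mu> \<nu> + norm (x - y))" by (rule R(5)[OF \<mu> \<nu>])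
      also have "\<dots> \<le> (C + 1) * (W2 \<mu> \<nu> + norm (x - y))" by (intro mult_right_mono) auto
      also have "\<dots> < (C + 1) * (\<epsilon> / (2 * (C + 1)) + \<epsilon> / (2 * (C + 1)))"
        using W C1 by (intro mult_strict_left_mono add_strict_mono) (auto simp: dist_norm)
      also have "\<dots> = \<epsilon>" by (rule aux[OF C1])
      finally show "dist (p \<mu> x) (p \<nu> y) < \<epsilon>" by (simp add: dist_norm)
    qed (use \<epsilon> C1 in simp)
  qed
qed

text \<open>The gradient at \<open>\<xi>\<close> is \<open>p (law of \<xi>) (\<xi>)\<close>. It is Lipschitz in \<open>L2\<close> because \<open>p\<close> is Lipschitz in both arguments
  and laws are closer in \<^const>\<open>W2\<close> than random variables in \<open>L2\<close>.\<close>

lemma regular_L_has_L_deriv: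
  assumes P: "prob_space P" and r: "regular_L P C u p"
  shows "has_L_deriv P u p"
proof -
  interpret P: prob_space P by fact
  note R = regular_LD[OF r]
  define D where "D \<xi> \<omega> = p (distr P borel \<xi>) (\<xi> \<omega>)" for \<xi> and \<omega>
  have Dm: "D \<xi> \<in> borel_measurable P" if "\<xi> \<in> L2 P" for \<xi>
    unfolding D_def by (rule measurable_compose[OF L2D(1)[OF that] regular_L_measurable[OF r distr_P2[OF P that]]])
  have Db: "norm (D \<xi> \<omega>) \<le> C" if "\<xi> \<in> L2 P" for \<xi> \<omega>
    unfolding D_def by (rule R(4)[OF distr_P2[OF P that]])
  have DL: "D \<xi> \<in> L2 P" if "\<xi> \<in> L2 P" for \<xi>
    by (rule bounded_L2[OF P Dm[OF that] Db[OF that]])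
  have grad: "has_gradient P (lifting P u) \<xi> (D \<xi>)" if \<xi>: "\<xi> \<in> L2 P" for \<xi>
    unfolding has_gradient_def
  proof (intro conjI allI impI)
    show "D \<xi> \<in> L2 P" by (rule DL[OF \<xi>])
    fix \<epsilon> :: real assume \<epsilon>: "0 < \<epsilon>"
    have C1: "0 < C + 1" using R(1) by simp
    show "\<exists>\<delta>>0. \<forall>\<eta>\<in>L2 P. L2_norm P \<eta> < \<delta> \<longrightarrow>
        \<bar>lifting P u (\<lambda>\<omega>. \<xi> \<omega> + \<eta> \<omega>) - lifting P u \<xi> - (\<integral>\<omega>. D \<xi> \<omega> \<bullet> \<eta> \<omega> \<partial>P)\<bar> \<le> \<epsilon> * L2_norm P \<eta>"
    proof (intro exI[of _ "\<epsilon> / (C + 1)"] conjI ballI impI)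
      fix \<eta> :: "'a \<Rightarrow> 'b" assume \<eta>: "\<eta> \<in> L2 P" and small: "L2_norm P \<eta> < \<epsilon> / (C + 1)"
      have "\<bar>lifting P u (\<lambda>\<omega>. \<xi> \<omega> + \<eta> \<omega>) - lifting P u \<xi> - (\<integral>\<omega>. D \<xi> \<omega> \<bullet> \<eta> \<omega> \<partial>P)\<bar> \<le> C * (L2_norm P \<eta>)\<^sup>2"
        unfolding lifting_def D_def by (rule R(6)[OF \<xi> \<eta>])
      also have "\<dots> = C * L2_norm P \<eta> * L2_norm P \<eta>" by (simp add: power2_eq_square)
      also have "\<dots> \<le> \<epsilon> * L2_norm P \<eta>"
      proof (rule mult_right_mono)
        have "C * L2_norm P \<eta> \<le> (C + 1) * L2_norm P \<eta>" by (intro mult_right_mono) auto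
        also have "\<dots> \<le> \<epsilon>" using small C1 by (simp add: less_divide_eq mult.commute)
        finally show "C * L2_norm P \<eta> \<le> \<epsilon>" .
      qed simp
      finally show "\<bar>lifting P u (\<lambda>\<omega>. \<xi> \<omega> + \<eta> \<omega>) - lifting P u \<xi> - (\<integral>\<omega>. D \<xi> \<omega> \<bullet> \<eta> \<omega> \<partial>P)\<bar> \<le> \<epsilon> * L2_norm P \<eta>" .
    qed (use \<epsilon> C1 in simp)
  qed
  have lip: "L2_norm P (\<lambda>\<omega>. D \<eta> \<omega> - D \<xi> \<omega>) \<le> 2 * C * L2_norm P (\<lambda>\<omega>. \<eta> \<omega> - \<xi> \<omega>)"
    if \<xi>: "\<xi> \<in> L2 P" and \<eta>: "\<eta> \<in> L2 P" for \<xi> \<eta>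
  proof -
    let ?N = "L2_norm P (\<lambda>\<omega>. \<eta> \<omega> - \<xi> \<omega>)"
    have iN: "integrable P (\<lambda>\<omega>. (norm (\<eta> \<omega> - \<xi> \<omega>))\<^sup>2)" by (rule L2D(2)[OF L2_diff[OF \<eta> \<xi>]])
    have N2: "?N\<^sup>2 = (\<integral>\<omega>. (norm (\<eta> \<omega> - \<xi> \<omega>))\<^sup>2 \<partial>P)" unfolding L2_norm_def by simp
    have "(\<integral>\<omega>. (norm (D \<eta> \<omega> - D \<xi> \<omega>))\<^sup>2 \<partial>P) \<le> (\<integral>\<omega>. 2 * C\<^sup>2 * ?N\<^sup>2 + 2 * C\<^sup>2 * (norm (\<eta> \<omega> - \<xi> \<omega>))\<^sup>2 \<partial>P)"
    proof (rule integral_mono)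
      show "integrable P (\<lambda>\<omega>. (norm (D \<eta> \<omega> - D \<xi> \<omega>))\<^sup>2)" by (rule L2D(2)[OF L2_diff[OF DL[OF \<eta>] DL[OF \<xi>]]])
      show "integrable P (\<lambda>\<omega>. 2 * C\<^sup>2 * ?N\<^sup>2 + 2 * C\<^sup>2 * (norm (\<eta> \<omega> - \<xi> \<omega>))\<^sup>2)" using iN by simp
      fix \<omega>
      have "norm (D \<eta> \<omega> - D \<xi> \<omega>) \<le> C * (W2 (distr P borel \<eta>) (distr P borel \<xi>) + norm (\<eta> \<omega> - \<xi> \<omega>))"
        unfolding D_def by (rule R(5)[OF distr_P2[OF P \<eta>] distr_P2[OF P \<xi>]])
      also have "\<dots> \<le> C * (?N + norm (\<eta> \<omega> - \<xi> \<omega>))"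
        using W2_distr_le[OF P \<eta> \<xi>] R(1) by (intro mult_left_mono add_right_mono)
      finally have "(norm (D \<eta> \<omega> - D \<xi> \<omega>))\<^sup>2 \<le> (C * (?N + norm (\<eta> \<omega> - \<xi> \<omega>)))\<^sup>2" by (rule power_mono) simp
      also have "\<dots> = C\<^sup>2 * (?N + norm (\<eta> \<omega> - \<xi> \<omega>))\<^sup>2" by (rule power_mult_distrib)
      also have "\<dots> \<le> C\<^sup>2 * (2 * ?N\<^sup>2 + 2 * (norm (\<eta> \<omega> - \<xi> \<omega>))\<^sup>2)"
      proof (rule mult_left_mono)
        show "(?N + norm (\<eta> \<omega> - \<xi> \<omega>))\<^sup>2 \<le> 2 * ?N\<^sup>2 + 2 * (norm (\<eta> \<omega> - \<xi> \<omega>))\<^sup>2"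
          using zero_le_power2[of "?N - norm (\<eta> \<omega> - \<xi> \<omega>)"] by (simp add: power2_sum power2_diff)
      qed simp
      finally show "(norm (D \<eta> \<omega> - D \<xi> \<omega>))\<^sup>2 \<le> 2 * C\<^sup>2 * ?N\<^sup>2 + 2 * C\<^sup>2 * (norm (\<eta> \<omega> - \<xi> \<omega>))\<^sup>2"
        by (simp add: distrib_left)
    qed
    also have "\<dots> = 2 * C\<^sup>2 * ?N\<^sup>2 + 2 * C\<^sup>2 * ?N\<^sup>2"
      unfolding N2 using iN by (simp add: P.prob_space)
    also have "\<dots> = (2 * C * ?N)\<^sup>2" by (simp add: power2_eq_square)
    finally have "sqrt (\<integral>\<omega>. (norm (D \<eta> \<omega> - D \<xi> \<omega>))\<^sup>2 \<partial>P) \<le> sqrt ((2 * C * ?N)\<^sup>2)" by (rule real_sqrt_le_mono)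
    also have "\<dots> = 2 * C * ?N" using R(1) by simp
    finally show ?thesis unfolding L2_norm_def[of P "\<lambda>\<omega>. D \<eta> \<omega> - D \<xi> \<omega>"] .
  qed
  have "continuous_L2 P D"
    unfolding continuous_L2_def
  proof (intro ballI allI impI)
    fix \<xi> :: "'a \<Rightarrow> 'b" and \<epsilon> :: real assume \<xi>: "\<xi> \<in> L2 P" and \<epsilon>: "0 < \<epsilon>"
    have C1: "0 < 2 * C + 1" using R(1) by simp
    show "\<exists>\<delta>>0. \<forall>\<eta>\<in>L2 P. L2_norm P (\<lambda>\<omega>. \<eta> \<omega> - \<xi> \<omega>) < \<delta> \<longrightarrow> L2_norm P (\<lambda>\<omega>. D \<eta> \<omega> - D \<xi> \<omega>) < \<epsilon>"
    proof (intro exI[of _ "\<epsilon> / (2 * C + 1)"] conjI ballI impI)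
      fix \<eta> :: "'a \<Rightarrow> 'b" assume \<eta>: "\<eta> \<in> L2 P" and small: "L2_norm P (\<lambda>\<omega>. \<eta> \<omega> - \<xi> \<omega>) < \<epsilon> / (2 * C + 1)"
      have "L2_norm P (\<lambda>\<omega>. D \<eta> \<omega> - D \<xi> \<omega>) \<le> 2 * C * L2_norm P (\<lambda>\<omega>. \<eta> \<omega> - \<xi> \<omega>)" by (rule lip[OF \<xi> \<eta>])
      also have "\<dots> \<le> (2 * C + 1) * L2_norm P (\<lambda>\<omega>. \<eta> \<omega> - \<xi> \<omega>)" by (intro mult_right_mono) auto
      also have "\<dots> < \<epsilon>" using small C1 by (simp add: less_divide_eq mult.commute)
      finally show "L2_norm P (\<lambda>\<omega>. D \<eta> \<omega> - D \<xi> \<omega>) < \<epsilon>" .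
    qed (use \<epsilon> C1 in simp)
  qed
  moreover have "AE \<omega> in P. D \<xi> \<omega> = p (distr P borel \<xi>) (\<xi> \<omega>)" for \<xi> unfolding D_def by simp
  ultimately show ?thesis
    unfolding has_L_deriv_def using grad regular_L_continuous(2)[OF r] by blast
qed

definition Lsmooth :: "'w measure \<Rightarrow> ('a::euclidean_space measure \<Rightarrow> real) \<Rightarrow> ('a measure \<Rightarrow> 'a \<Rightarrow> 'a) \<Rightarrow> bool" where
  "Lsmooth P u p \<longleftrightarrow> (\<exists>C. regular_L P C u p)"

lemma Lsmooth_const: "Lsmooth P (\<lambda>_. c) (\<lambda>_ _. 0)"
  unfolding Lsmooth_def using regular_L_const by blast

lemma Lsmooth_add: "prob_space P \<Longrightarrow> Lsmooth P u p \<Longrightarrow> Lsmooth P v q \<Longrightarrow> Lsmooth P (\<lambda>\<mu>. u \<mu> + v \<mu>) (\<lambda>\<mu> x. p \<mu> x + q \<mu> x)"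
  unfolding Lsmooth_def using regular_L_add by blast

lemma Lsmooth_mult: "prob_space P \<Longrightarrow> Lsmooth P u p \<Longrightarrow> Lsmooth P v q \<Longrightarrow>
    Lsmooth P (\<lambda>\<mu>. u \<mu> * v \<mu>) (\<lambda>\<mu> x. u \<mu> *\<^sub>R q \<mu> x + v \<mu> *\<^sub>R p \<mu> x)"
  unfolding Lsmooth_def using regular_L_mult by blast

lemma Lsmooth_cmult:
  assumes "prob_space P" "Lsmooth P u p"
  shows "Lsmooth P (\<lambda>\<mu>. c * u \<mu>) (\<lambda>\<mu> x. c *\<^sub>R p \<mu> x)"
  using Lsmooth_mult[OF assms(1) Lsmooth_const[of P c] assms(2)] by simp

lemma Lsmooth_sum:
  assumes P: "prob_space P" and "finite A" "\<And>a. a \<in> A \<Longrightarrow> Lsmooth P (u a) (p a)"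
  shows "Lsmooth P (\<lambda>\<mu>. \<Sum>a\<in>A. u a \<mu>) (\<lambda>\<mu> x. \<Sum>a\<in>A. p a \<mu> x)"
  using assms(2,3)
proof (induction A rule: finite_induct)
  case empty then show ?case using Lsmooth_const[of P 0] by simp
next
  case (insert a A)
  then have "Lsmooth P (\<lambda>\<mu>. u a \<mu> + (\<Sum>a\<in>A. u a \<mu>)) (\<lambda>\<mu> x. p a \<mu> x + (\<Sum>a\<in>A. p a \<mu> x))"
    by (intro Lsmooth_add[OF P]) auto
  then show ?case using insert.hyps by simp
qed

lemma Lsmooth_prod:
  assumes P: "prob_space P" and "finite A" "\<And>a. a \<in> A \<Longrightarrow> Lsmooth P (u a) (p a)"
  shows "Lsmooth P (\<lambda>\<mu>. \<Prod>a\<in>A. u a \<mu>) (\<lambda>\<mu> x. \<Sum>a\<in>A. (\<Prod>b\<in>A - {a}. u b \<mu>) *\<^sub>R p a \<mu> x)"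
  using assms(2,3)
proof (induction A rule: finite_induct)
  case empty then show ?case using Lsmooth_const[of P 1] by simp
next
  case (insert a A)
  then have "Lsmooth P (\<lambda>\<mu>. u a \<mu> * (\<Prod>a\<in>A. u a \<mu>))
      (\<lambda>\<mu> x. u a \<mu> *\<^sub>R (\<Sum>c\<in>A. (\<Prod>b\<in>A - {c}. u b \<mu>) *\<^sub>R p c \<mu> x) + (\<Prod>a\<in>A. u a \<mu>) *\<^sub>R p a \<mu> x)"
    by (intro Lsmooth_mult[OF P]) auto
  moreover have "u a \<mu> *\<^sub>R (\<Sum>c\<in>A. (\<Prod>b\<in>A - {c}. u b \<mu>) *\<^sub>R p c \<mu> x) + (\<Prod>a\<in>A. u a \<mu>) *\<^sub>R p a \<mu> x
      = (\<Sum>c\<in>insert a A. (\<Prod>b\<in>insert a A - {c}. u b \<mu>) *\<^sub>R p c \<mu> x)" for \<mu> x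
  proof -
    have "(\<Prod>b\<in>insert a A - {c}. u b \<mu>) = u a \<mu> * (\<Prod>b\<in>A - {c}. u b \<mu>)" if c: "c \<in> A" for c
    proof -
      have "insert a A - {c} = insert a (A - {c})" using c insert.hyps(2) by auto
      then show ?thesis using insert.hyps by simp
    qed
    then have "(\<Sum>c\<in>A. (\<Prod>b\<in>insert a A - {c}. u b \<mu>) *\<^sub>R p c \<mu> x) = u a \<mu> *\<^sub>R (\<Sum>c\<in>A. (\<Prod>b\<in>A - {c}. u b \<mu>) *\<^sub>R p c \<mu> x)"
      unfolding scaleR_sum_right by (intro sum.cong) auto
    moreover have "insert a A - {a} = A" using insert.hyps(2) by auto
    ultimately show ?thesis using insert.hyps by (simp add: add.commute)
  qed
  ultimately show ?case using insert.hyps by simp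
qed

lemma Lsmooth_has_L_deriv: "prob_space P \<Longrightarrow> Lsmooth P u p \<Longrightarrow> has_L_deriv P u p"
  unfolding Lsmooth_def using regular_L_has_L_deriv by blast

lemma Lsmooth_C1: "prob_space P \<Longrightarrow> Lsmooth P u p \<Longrightarrow> u \<in> C1 P"
  unfolding C1_def using Lsmooth_has_L_deriv regular_L_continuous(1) unfolding Lsmooth_def by blast

section \<open>Trigonometric polynomials\<close>

text \<open>Cosines are included as sines with a phase.\<close>

inductive trig :: "(real^'n::finite \<Rightarrow> real) \<Rightarrow> bool" where
  trig_const: "trig (\<lambda>_. c)"
| trig_sin: "trig (\<lambda>x. sin (c * x $ a + b))"
| trig_add: "trig f \<Longrightarrow> trig g \<Longrightarrow> trig (\<lambda>x. f x + g x)"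
| trig_mult: "trig f \<Longrightarrow> trig g \<Longrightarrow> trig (\<lambda>x. f x * g x)"

definition partial :: "'n \<Rightarrow> (real^'n::finite \<Rightarrow> real) \<Rightarrow> real^'n \<Rightarrow> real" where
  "partial a f x = frechet_derivative f (at x) (axis a 1)"

lemma sum_axis: "(\<Sum>b\<in>UNIV. f b * axis a (1::real) $ b) = f (a :: 'n::finite)"
proof -
  have "(\<Sum>b\<in>UNIV. f b * axis a (1::real) $ b) = (\<Sum>b\<in>UNIV. if b = a then f b else 0)"
    by (rule sum.cong) (auto simp: axis_def)
  then show ?thesis by (simp add: sum.delta)
qed

lemma partial_eq:
  assumes "(f has_derivative (\<lambda>h. \<Sum>b\<in>UNIV. d b * h $ b)) (at x)"
  shows "partial a f x = d a"
  unfolding partial_def frechet_derivative_at[OF assms, symmetric] by (rule sum_axis)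

lemma trig_derivative_ex:
  fixes f :: "real^'n::finite \<Rightarrow> real"
  assumes "trig f"
  shows "\<exists>d. (\<forall>a. trig (d a)) \<and> (\<forall>x. (f has_derivative (\<lambda>h. \<Sum>a\<in>UNIV. d a x * h $ a)) (at x))"
  using assms
proof induction
  case (trig_const c)
  have "((\<lambda>_. c) has_derivative (\<lambda>h. \<Sum>a\<in>UNIV. 0 * h $ a)) (at x)" for x :: "real^'n" by simp
  then show ?case using trig.trig_const[of 0] by (intro exI[of _ "\<lambda>_ _. 0"]) auto
next
  case (trig_sin c a b)
  let ?d = "\<lambda>a' x. (if a' = a then c else 0) * sin (c * x $ a + (b + pi / 2))"
  have "((\<lambda>x. sin (c * x $ a + b)) has_derivative (\<lambda>h. \<Sum>a'\<in>UNIV. ?d a' x * h $ a')) (at x)" for x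
  proof -
    have "((\<lambda>x :: real^'n. c * x $ a + b) has_derivative (\<lambda>h. c * h $ a + 0)) (at x)"
      by (intro has_derivative_add has_derivative_const has_derivative_mult_right
          bounded_linear_imp_has_derivative[OF bounded_linear_vec_nth])
    then have D: "((\<lambda>x. sin (c * x $ a + b)) has_derivative (\<lambda>h. (c * h $ a + 0) * cos (c * x $ a + b))) (at x)"
      by (rule has_derivative_sin)
    have "sin (c * x $ a + (b + pi / 2)) = cos (c * x $ a + b)"
      using sin_cos_eq[of "c * x $ a + (b + pi / 2)"] cos_minus[of "c * x $ a + b"] by (simp add: algebra_simps)
    then have "(\<Sum>a'\<in>UNIV. ?d a' x * h $ a') = (c * h $ a + 0) * cos (c * x $ a + b)" for h
    proof -
      have "(\<Sum>a'\<in>UNIV. ?d a' x * h $ a') = (\<Sum>a'\<in>UNIV. if a' = a then c * h $ a' * sin (c * x $ a + (b + pi / 2)) else 0)"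
        by (rule sum.cong) auto
      then show ?thesis
        using \<open>sin (c * x $ a + (b + pi / 2)) = cos (c * x $ a + b)\<close> by (simp add: sum.delta)
    qed
    then show ?thesis using D by simp
  qed
  moreover have "trig (?d a')" for a' by (intro trig.intros)
  ultimately show ?case by (intro exI[of _ ?d]) blast
next
  case (trig_add f g)
  then obtain d e where d: "\<And>a. trig (d a)" "\<And>x. (f has_derivative (\<lambda>h. \<Sum>a\<in>UNIV. d a x * h $ a)) (at x)"
    and e: "\<And>a. trig (e a)" "\<And>x. (g has_derivative (\<lambda>h. \<Sum>a\<in>UNIV. e a x * h $ a)) (at x)"
    by blast
  have "((\<lambda>x. f x + g x) has_derivative (\<lambda>h. \<Sum>a\<in>UNIV. (d a x + e a x) * h $ a)) (at x)" for x
    using has_derivative_add[OF d(2) e(2), of x] by (simp add: distrib_right sum.distrib)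
  moreover have "trig (\<lambda>x. d a x + e a x)" for a by (intro trig.intros d e)
  ultimately show ?case by (intro exI[of _ "\<lambda>a x. d a x + e a x"]) blast
next
  case (trig_mult f g)
  then obtain d e where d: "\<And>a. trig (d a)" "\<And>x. (f has_derivative (\<lambda>h. \<Sum>a\<in>UNIV. d a x * h $ a)) (at x)"
    and e: "\<And>a. trig (e a)" "\<And>x. (g has_derivative (\<lambda>h. \<Sum>a\<in>UNIV. e a x * h $ a)) (at x)"
    by blast
  have "((\<lambda>x. f x * g x) has_derivative (\<lambda>h. \<Sum>a\<in>UNIV. (f x * e a x + g x * d a x) * h $ a)) (at x)" for x
  proof -
    have "(\<Sum>a\<in>UNIV. (f x * e a x + g x * d a x) * h $ a)
        = f x * (\<Sum>a\<in>UNIV. e a x * h $ a) + (\<Sum>a\<in>UNIV. d a x * h $ a) * g x" for h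
      unfolding sum_distrib_left sum_distrib_right sum.distrib[symmetric]
      by (rule sum.cong) (simp_all add: algebra_simps)
    then show ?thesis using has_derivative_mult[OF d(2) e(2), of x] by simp
  qed
  moreover have "trig (\<lambda>x. f x * e a x + g x * d a x)" for a by (intro trig.intros d e trig_mult)
  ultimately show ?case by (intro exI[of _ "\<lambda>a x. f x * e a x + g x * d a x"]) blast
qed

lemma
  assumes f: "trig f"
  shows trig_partial: "trig (partial a f)"
    and trig_has_derivative: "(f has_derivative (\<lambda>h. \<Sum>a\<in>UNIV. partial a f x * h $ a)) (at x)"
proof -
  obtain d where d: "\<And>a. trig (d a)" "\<And>x. (f has_derivative (\<lambda>h. \<Sum>a\<in>UNIV. d a x * h $ a)) (at x)"
    using trig_derivative_ex[OF f] by blast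
  have eq: "partial a f = d a" for a by (rule ext, rule partial_eq[OF d(2)])
  show "trig (partial a f)" unfolding eq by (rule d(1))
  show "(f has_derivative (\<lambda>h. \<Sum>a\<in>UNIV. partial a f x * h $ a)) (at x)" unfolding eq by (rule d(2))
qed

lemma trig_bounded: "trig f \<Longrightarrow> \<exists>B\<ge>0. \<forall>x. \<bar>f x\<bar> \<le> B"
proof (induction rule: trig.induct)
  case (trig_const c) then show ?case by (intro exI[of _ "\<bar>c\<bar>"]) simp
next
  case (trig_sin c a b) then show ?case by (intro exI[of _ 1]) simp
next
  case (trig_add f g)
  then obtain A B where "A \<ge> 0" "\<And>x. \<bar>f x\<bar> \<le> A" "B \<ge> 0" "\<And>x. \<bar>g x\<bar> \<le> B" by blast
  then show ?case by (intro exI[of _ "A + B"]) (auto intro: abs_triangle_ineq[THEN order_trans] add_mono)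
next
  case (trig_mult f g)
  then obtain A B where "A \<ge> 0" "\<And>x. \<bar>f x\<bar> \<le> A" "B \<ge> 0" "\<And>x. \<bar>g x\<bar> \<le> B" by blast
  then show ?case by (intro exI[of _ "A * B"]) (auto intro: abs_mult_le)
qed

definition grad :: "(real^'n::finite \<Rightarrow> real) \<Rightarrow> real^'n \<Rightarrow> real^'n" where
  "grad f x = (\<chi> a. partial a f x)"

lemma trig_grad: "trig f \<Longrightarrow> (f has_derivative (\<lambda>h. grad f x \<bullet> h)) (at x)"
  using trig_has_derivative[of f x] by (simp add: grad_def inner_vec_def)

lemma trig_grad_bounded:
  assumes f: "trig f"
  shows "\<exists>B\<ge>0. \<forall>x. norm (grad f x) \<le> B"
proof -
  have "\<forall>a. \<exists>B\<ge>0. \<forall>x. \<bar>partial a f x\<bar> \<le> B" using trig_bounded[OF trig_partial[OF f]] by blast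
  then obtain B where B: "\<And>a. 0 \<le> B a" "\<And>a x. \<bar>partial a f x\<bar> \<le> B a" by metis
  have "norm (grad f x) \<le> (\<Sum>a\<in>UNIV. B a)" for x
  proof -
    have "norm (grad f x) \<le> (\<Sum>a\<in>UNIV. \<bar>grad f x $ a\<bar>)" by (rule norm_le_l1_cart)
    also have "\<dots> \<le> (\<Sum>a\<in>UNIV. B a)" by (rule sum_mono) (simp add: grad_def B)
    finally show ?thesis .
  qed
  then show ?thesis using B(1) by (intro exI[of _ "\<Sum>a\<in>UNIV. B a"]) (simp add: sum_nonneg)
qed

lemma trig_Lipschitz:
  assumes f: "trig f"
  shows "\<exists>L\<ge>0. \<forall>x y. \<bar>f x - f y\<bar> \<le> L * norm (x - y)"
proof -
  obtain B where B: "0 \<le> B" "\<And>x. norm (grad f x) \<le> B" using trig_grad_bounded[OF f] by blast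
  have "\<bar>f x - f y\<bar> \<le> B * norm (x - y)" for x y
  proof -
    obtain \<theta> where "f (y + (x - y)) - f y = grad f (y + \<theta> *\<^sub>R (x - y)) \<bullet> (x - y)"
      by (rule gradient_mean_value[OF trig_grad[OF f]])
    then have "\<bar>f x - f y\<bar> \<le> norm (grad f (y + \<theta> *\<^sub>R (x - y))) * norm (x - y)"
      using Cauchy_Schwarz_ineq2[of "grad f (y + \<theta> *\<^sub>R (x - y))" "x - y"] by simp
    also have "\<dots> \<le> B * norm (x - y)" by (rule mult_right_mono[OF B(2)]) simp
    finally show ?thesis .
  qed
  with B(1) show ?thesis by blast
qed

lemma trig_grad_Lipschitz:
  assumes f: "trig f"
  shows "\<exists>L\<ge>0. \<forall>x y. norm (grad f x - grad f y) \<le> L * norm (x - y)"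
proof -
  have "\<forall>a. \<exists>L\<ge>0. \<forall>x y. \<bar>partial a f x - partial a f y\<bar> \<le> L * norm (x - y)"
    using trig_Lipschitz[OF trig_partial[OF f]] by blast
  then obtain L where L: "\<And>a. 0 \<le> L a" "\<And>a x y. \<bar>partial a f x - partial a f y\<bar> \<le> L a * norm (x - y)" by metis
  have "norm (grad f x - grad f y) \<le> (\<Sum>a\<in>UNIV. L a) * norm (x - y)" for x y
  proof -
    have "norm (grad f x - grad f y) \<le> (\<Sum>a\<in>UNIV. \<bar>(grad f x - grad f y) $ a\<bar>)" by (rule norm_le_l1_cart)
    also have "\<dots> \<le> (\<Sum>a\<in>UNIV. L a * norm (x - y))" by (rule sum_mono) (simp add: grad_def L)
    finally show ?thesis by (simp add: sum_distrib_right)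
  qed
  then show ?thesis using L(1) by (intro exI[of _ "\<Sum>a\<in>UNIV. L a"]) (simp add: sum_nonneg)
qed

lemma trig_Lsmooth:
  assumes P: "prob_space P" and f: "trig f"
  shows "Lsmooth P (\<lambda>\<mu>. \<integral>x. f x \<partial>\<mu>) (\<lambda>_. grad f)"
proof -
  obtain A where A: "0 \<le> A" "\<And>x. \<bar>f x\<bar> \<le> A" using trig_bounded[OF f] by blast
  obtain B where B: "0 \<le> B" "\<And>x. norm (grad f x) \<le> B" using trig_grad_bounded[OF f] by blast
  obtain L where L: "0 \<le> L" "\<And>x y. norm (grad f x - grad f y) \<le> L * norm (x - y)" using trig_grad_Lipschitz[OF f] by blast
  have "regular_L P (A + B + L) (\<lambda>\<mu>. \<integral>x. f x \<partial>\<mu>) (\<lambda>_. grad f)"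
  proof (rule regular_L_integral[OF P trig_grad[OF f]])
    show "\<bar>f x\<bar> \<le> A + B + L" for x using A(2)[of x] B(1) L(1) by linarith
    show "norm (grad f x) \<le> A + B + L" for x using A(1) B(2)[of x] L(1) by linarith
    show "norm (grad f x - grad f y) \<le> (A + B + L) * norm (x - y)" for x y
      using L(2)[of x y] A(1) B(1) by (simp add: distrib_right add_increasing)
  qed (use A B L in simp)
  then show ?thesis unfolding Lsmooth_def by blast
qed

lemma trig_continuous: "trig f \<Longrightarrow> continuous_on UNIV f"
  by (rule continuous_at_imp_continuous_on, rule ballI, rule has_derivative_continuous[OF trig_grad])

lemma trig_prod: "finite A \<Longrightarrow> (\<And>a. a \<in> A \<Longrightarrow> trig (f a)) \<Longrightarrow> trig (\<lambda>x. \<Prod>a\<in>A. f a x)"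
  by (induction A rule: finite_induct) (auto intro: trig.intros)

lemma trig_pattern_weight: "trig (pattern_weight k m \<zeta>)"
proof -
  have s: "trig (\<lambda>y. bias k y a)" for a
  proof -
    have "trig (\<lambda>y. 1 / 2 + 1 / 2 * sin (1 / k * y $ a + 0))" by (intro trig.intros)
    then show ?thesis unfolding bias_def by (simp add: add_divide_distrib)
  qed
  have "trig (\<lambda>y. 1 + (- 1) * bias k y a)" for a by (intro trig.intros s)
  then have "trig (\<lambda>y. coin_weight k y e b)" for e b
    using s by (cases b) (simp_all add: coin_weight_def)
  then show ?thesis unfolding pattern_weight_def[abs_def] by (intro trig_prod) auto
qed

section \<open>Cylinder functions\<close>

text \<open>Polynomials in integrals of trigonometric polynomials against \<open>\<mu>\<close> and in trigonometric polynomials of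
  the spatial variables \<open>x 0, \<dots>, x (j - 1)\<close>.\<close>

inductive cylinder :: "nat \<Rightarrow> ((real^'n::finite) measure \<Rightarrow> (nat \<Rightarrow> real^'n) \<Rightarrow> real) \<Rightarrow> bool" for j where
  cyl_const: "cylinder j (\<lambda>_ _. c)"
| cyl_integral: "trig \<phi> \<Longrightarrow> cylinder j (\<lambda>\<mu> _. \<integral>y. \<phi> y \<partial>\<mu>)"
| cyl_point: "trig \<psi> \<Longrightarrow> b < j \<Longrightarrow> cylinder j (\<lambda>_ x. \<psi> (x b))"
| cyl_add: "cylinder j f \<Longrightarrow> cylinder j g \<Longrightarrow> cylinder j (\<lambda>\<mu> x. f \<mu> x + g \<mu> x)"
| cyl_mult: "cylinder j f \<Longrightarrow> cylinder j g \<Longrightarrow> cylinder j (\<lambda>\<mu> x. f \<mu> x * g \<mu> x)"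

lemma cylinder_Suc: "cylinder j f \<Longrightarrow> cylinder (Suc j) f"
  by (induction rule: cylinder.induct) (auto intro: cylinder.intros)

lemma cylinder_upd: "cylinder j f \<Longrightarrow> f \<mu> (x(j := y)) = f \<mu> x"
  by (induction rule: cylinder.induct) auto

lemma cylinder_sum: "finite A \<Longrightarrow> (\<And>a. a \<in> A \<Longrightarrow> cylinder j (f a)) \<Longrightarrow> cylinder j (\<lambda>\<mu> x. \<Sum>a\<in>A. f a \<mu> x)"
  by (induction A rule: finite_induct) (auto intro: cylinder.intros)

lemma cylinder_prod: "finite A \<Longrightarrow> (\<And>a. a \<in> A \<Longrightarrow> cylinder j (f a)) \<Longrightarrow> cylinder j (\<lambda>\<mu> x. \<Prod>a\<in>A. f a \<mu> x)"
  by (induction A rule: finite_induct) (auto intro: cylinder.intros)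

lemma cylinder_continuous:
  assumes P: "prob_space P" and f: "cylinder j f"
  shows "continuous_map (prod_topology W2_top (product_topology (\<lambda>_. euclidean) {..<j})) euclideanreal (\<lambda>(\<mu>, x). f \<mu> x)"
    (is "continuous_map ?T _ _")
  using f
proof (induction rule: cylinder.induct)
  case (cyl_const c)
  then show ?case by (simp add: case_prod_unfold)
next
  case (cyl_integral \<phi>)
  obtain C where "regular_L P C (\<lambda>\<mu>. \<integral>x. \<phi> x \<partial>\<mu>) (\<lambda>_. grad \<phi>)"
    using trig_Lsmooth[OF P cyl_integral] unfolding Lsmooth_def by blast
  from continuous_map_compose[OF continuous_map_fst regular_L_continuous(1)[OF this]]
  show ?case by (simp add: case_prod_unfold o_def)
next
  case (cyl_point \<psi> b)
  have "continuous_map (product_topology (\<lambda>_. euclidean) {..<j}) euclidean (\<lambda>x. x b)"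
    using continuous_map_product_projection[of b "{..<j}" "\<lambda>_. euclidean"] cyl_point by simp
  from continuous_map_compose[OF continuous_map_snd this]
  have c: "continuous_map ?T euclidean ((\<lambda>x. x b) \<circ> snd)" .
  have "continuous_map euclidean euclidean \<psi>" using trig_continuous[OF cyl_point(1)] by simp
  from continuous_map_compose[OF c this] show ?case by (simp add: case_prod_unfold o_def)
next
  case (cyl_add f g)
  from continuous_map_add[OF cyl_add.IH] show ?case by (simp add: case_prod_unfold)
next
  case (cyl_mult f g)
  from continuous_map_real_mult[OF cyl_mult.IH] show ?case by (simp add: case_prod_unfold)
qed

lemma cylinder_dx:
  fixes f :: "(real^'n::finite) measure \<Rightarrow> (nat \<Rightarrow> real^'n) \<Rightarrow> real"
  assumes f: "cylinder j f" and i: "i < j"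
  shows "\<exists>d. (\<forall>a. cylinder j (d a)) \<and> (\<forall>\<mu> x z. ((\<lambda>z. f \<mu> (x(i := z))) has_derivative
    (\<lambda>h. \<Sum>a\<in>UNIV. d a \<mu> (x(i := z)) * h $ a)) (at z))"
  using f
proof (induction rule: cylinder.induct)
  case (cyl_const c)
  show ?case by (intro exI[of _ "\<lambda>_ _ _. 0"]) (auto intro: cylinder.intros)
next
  case (cyl_integral \<phi>)
  show ?case by (intro exI[of _ "\<lambda>_ _ _. 0"]) (auto intro: cylinder.intros)
next
  case (cyl_point \<psi> b)
  show ?case
  proof (cases "b = i")
    case True
    have "cylinder j (\<lambda>_ x. partial a \<psi> (x b))" for a
      by (intro cylinder.intros trig_partial cyl_point)
    moreover have "((\<lambda>z. \<psi> ((x(i := z)) b)) has_derivative (\<lambda>h. \<Sum>a\<in>UNIV. partial a \<psi> ((x(i := z)) b) * h $ a)) (at z)" for x z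
      using trig_has_derivative[OF cyl_point(1), of z] True by simp
    ultimately show ?thesis by (intro exI[of _ "\<lambda>a _ x. partial a \<psi> (x b)"]) blast
  next
    case False
    then show ?thesis by (intro exI[of _ "\<lambda>_ _ _. 0"]) (auto intro: cylinder.intros)
  qed
next
  case (cyl_add f g)
  then obtain d e where d: "\<And>a. cylinder j (d a)"
      "\<And>\<mu> x z. ((\<lambda>z. f \<mu> (x(i := z))) has_derivative (\<lambda>h. \<Sum>a\<in>UNIV. d a \<mu> (x(i := z)) * h $ a)) (at z)"
    and e: "\<And>a. cylinder j (e a)"
      "\<And>\<mu> x z. ((\<lambda>z. g \<mu> (x(i := z))) has_derivative (\<lambda>h. \<Sum>a\<in>UNIV. e a \<mu> (x(i := z)) * h $ a)) (at z)"
    by blast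
  have "((\<lambda>z. f \<mu> (x(i := z)) + g \<mu> (x(i := z))) has_derivative
      (\<lambda>h. \<Sum>a\<in>UNIV. (d a \<mu> (x(i := z)) + e a \<mu> (x(i := z))) * h $ a)) (at z)" for \<mu> x z
    using has_derivative_add[OF d(2)[of \<mu> x z] e(2)[of \<mu> x z]] by (simp add: distrib_right sum.distrib)
  moreover have "cylinder j (\<lambda>\<mu> x. d a \<mu> x + e a \<mu> x)" for a by (intro cylinder.intros d e)
  ultimately show ?case by (intro exI[of _ "\<lambda>a \<mu> x. d a \<mu> x + e a \<mu> x"]) blast
next
  case (cyl_mult f g)
  then obtain d e where d: "\<And>a. cylinder j (d a)"
      "\<And>\<mu> x z. ((\<lambda>z. f \<mu> (x(i := z))) has_derivative (\<lambda>h. \<Sum>a\<in>UNIV. d a \<mu> (x(i := z)) * h $ a)) (at z)"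
    and e: "\<And>a. cylinder j (e a)"
      "\<And>\<mu> x z. ((\<lambda>z. g \<mu> (x(i := z))) has_derivative (\<lambda>h. \<Sum>a\<in>UNIV. e a \<mu> (x(i := z)) * h $ a)) (at z)"
    by blast
  let ?D = "\<lambda>a \<mu> x. f \<mu> x * e a \<mu> x + g \<mu> x * d a \<mu> x"
  have "((\<lambda>z. f \<mu> (x(i := z)) * g \<mu> (x(i := z))) has_derivative (\<lambda>h. \<Sum>a\<in>UNIV. ?D a \<mu> (x(i := z)) * h $ a)) (at z)" for \<mu> x z
  proof -
    have "(\<Sum>a\<in>UNIV. ?D a \<mu> (x(i := z)) * h $ a)
        = f \<mu> (x(i := z)) * (\<Sum>a\<in>UNIV. e a \<mu> (x(i := z)) * h $ a) + (\<Sum>a\<in>UNIV. d a \<mu> (x(i := z)) * h $ a) * g \<mu> (x(i := z))" for h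
      unfolding sum_distrib_left sum_distrib_right sum.distrib[symmetric]
      by (rule sum.cong) (simp_all add: algebra_simps)
    then show ?thesis using has_derivative_mult[OF d(2)[of \<mu> x z] e(2)[of \<mu> x z]] by simp
  qed
  moreover have "cylinder j (?D a)" for a by (intro cylinder.intros d e cyl_mult)
  ultimately show ?case by (intro exI[of _ ?D]) blast
qed

text \<open>An integral \<open>\<integral> \<phi> d\<mu>\<close> has the L-derivative \<open>grad \<phi>\<close>, which brings in the new variable \<open>x j\<close>.\<close>

lemma cylinder_L:
  fixes f :: "(real^'n::finite) measure \<Rightarrow> (nat \<Rightarrow> real^'n) \<Rightarrow> real"
  assumes P: "prob_space P" and f: "cylinder j f"
  shows "\<exists>g. (\<forall>a. cylinder (Suc j) (g a)) \<and> (\<forall>x. Lsmooth P (\<lambda>\<mu>. f \<mu> x) (\<lambda>\<mu> y. \<chi> a. g a \<mu> (x(j := y))))"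
  using f
proof (induction rule: cylinder.induct)
  case (cyl_const c)
  have "(\<chi> a. 0) = (0 :: real^'n)" by (simp add: vec_eq_iff)
  then show ?case using Lsmooth_const[of P c] by (intro exI[of _ "\<lambda>_ _ _. 0"]) (auto intro: cylinder.intros)
next
  case (cyl_integral \<phi>)
  have "cylinder (Suc j) (\<lambda>_ x. partial a \<phi> (x j))" for a by (intro cylinder.intros trig_partial cyl_integral) simp
  moreover have "Lsmooth P (\<lambda>\<mu>. \<integral>y. \<phi> y \<partial>\<mu>) (\<lambda>\<mu> y. \<chi> a. partial a \<phi> ((x(j := y)) j))" for x
    using trig_Lsmooth[OF P cyl_integral] by (simp add: grad_def[abs_def])
  ultimately show ?case by (intro exI[of _ "\<lambda>a _ x. partial a \<phi> (x j)"]) blast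
next
  case (cyl_point \<psi> b)
  have "(\<chi> a. 0) = (0 :: real^'n)" by (simp add: vec_eq_iff)
  then show ?case using Lsmooth_const[of P] by (intro exI[of _ "\<lambda>_ _ _. 0"]) (auto intro: cylinder.intros)
next
  case (cyl_add f g)
  then obtain p q where p: "\<And>a. cylinder (Suc j) (p a)" "\<And>x. Lsmooth P (\<lambda>\<mu>. f \<mu> x) (\<lambda>\<mu> y. \<chi> a. p a \<mu> (x(j := y)))"
    and q: "\<And>a. cylinder (Suc j) (q a)" "\<And>x. Lsmooth P (\<lambda>\<mu>. g \<mu> x) (\<lambda>\<mu> y. \<chi> a. q a \<mu> (x(j := y)))"
    by blast
  let ?D = "\<lambda>a \<mu> x. p a \<mu> x + q a \<mu> x"
  have "(\<lambda>\<mu> y. (\<chi> a. p a \<mu> (x(j := y))) + (\<chi> a. q a \<mu> (x(j := y)))) = (\<lambda>\<mu> y. \<chi> a. ?D a \<mu> (x(j := y)))" for x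
    by (simp add: vec_eq_iff fun_eq_iff)
  then have "Lsmooth P (\<lambda>\<mu>. f \<mu> x + g \<mu> x) (\<lambda>\<mu> y. \<chi> a. ?D a \<mu> (x(j := y)))" for x
    using Lsmooth_add[OF P p(2) q(2), of x x] by simp
  moreover have "cylinder (Suc j) (?D a)" for a by (intro cylinder.intros p q)
  ultimately show ?case by (intro exI[of _ ?D]) blast
next
  case (cyl_mult f g)
  then obtain p q where p: "\<And>a. cylinder (Suc j) (p a)" "\<And>x. Lsmooth P (\<lambda>\<mu>. f \<mu> x) (\<lambda>\<mu> y. \<chi> a. p a \<mu> (x(j := y)))"
    and q: "\<And>a. cylinder (Suc j) (q a)" "\<And>x. Lsmooth P (\<lambda>\<mu>. g \<mu> x) (\<lambda>\<mu> y. \<chi> a. q a \<mu> (x(j := y)))"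
    by blast
  let ?D = "\<lambda>a \<mu> x. f \<mu> x * q a \<mu> x + g \<mu> x * p a \<mu> x"
  have "(\<lambda>\<mu> y. f \<mu> x *\<^sub>R (\<chi> a. q a \<mu> (x(j := y))) + g \<mu> x *\<^sub>R (\<chi> a. p a \<mu> (x(j := y)))) = (\<lambda>\<mu> y. \<chi> a. ?D a \<mu> (x(j := y)))" for x
    by (simp add: vec_eq_iff fun_eq_iff cylinder_upd[OF cyl_mult.hyps(1)] cylinder_upd[OF cyl_mult.hyps(2)])
  then have "Lsmooth P (\<lambda>\<mu>. f \<mu> x * g \<mu> x) (\<lambda>\<mu> y. \<chi> a. ?D a \<mu> (x(j := y)))" for x
    using Lsmooth_mult[OF P p(2) q(2), of x x] by simp
  moreover have "cylinder (Suc j) (?D a)" for a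
    by (intro cylinder.intros p q cylinder_Suc cyl_mult.hyps)
  ultimately show ?case by (intro exI[of _ ?D]) blast
qed

text \<open>L-derivatives are determined on \<^const>\<open>P2\<close> only, so formulas for them hold there and not as equations of functions.\<close>

lemma Cn_cong:
  fixes f :: "(real^'n::finite) measure \<Rightarrow> (nat \<Rightarrow> real^'n) \<Rightarrow> real"
  assumes P: "prob_space P" and eq: "\<And>\<mu> x. \<mu> \<in> P2 \<Longrightarrow> x \<in> {..<j} \<rightarrow>\<^sub>E UNIV \<Longrightarrow> f \<mu> x = g \<mu> x"
    and f: "Cn P n j f"
  shows "Cn P n j g"
  using eq f
proof (induction n arbitrary: j f g)
  case 0
  show ?case
    using 0(2) unfolding Cn.simps
    by (rule continuous_map_eq) (use 0(1) in \<open>auto simp: topspace_product_topology\<close>)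
next
  case (Suc n)
  have eqd: "(\<lambda>z. f \<mu> (x(i := z))) = (\<lambda>z. g \<mu> (x(i := z)))" if "\<mu> \<in> P2" "x \<in> {..<j} \<rightarrow>\<^sub>E UNIV" "i < j" for \<mu> x i
    using that by (intro ext Suc.prems(1)) (auto simp: PiE_iff extensional_def)
  have c: "continuous_map (prod_topology W2_top (product_topology (\<lambda>_. euclidean) {..<j})) euclideanreal (\<lambda>(\<mu>, x). g \<mu> x)"
  proof (rule continuous_map_eq)
    show "continuous_map (prod_topology W2_top (product_topology (\<lambda>_. euclidean) {..<j})) euclideanreal (\<lambda>(\<mu>, x). f \<mu> x)"
      using Suc.prems(2) by simp
  qed (use Suc.prems(1) in \<open>auto simp: topspace_product_topology\<close>)
  have dx: "Cn P n j (dx_comp i k g)" if i: "i < j" for i k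
  proof (rule Suc.IH)
    show "Cn P n j (dx_comp i k f)" using Suc.prems(2) i by simp
    show "dx_comp i k f \<mu> x = dx_comp i k g \<mu> x" if "\<mu> \<in> P2" "x \<in> {..<j} \<rightarrow>\<^sub>E UNIV" for \<mu> x
      unfolding dx_comp_def eqd[OF that i] ..
  qed
  have df: "(\<lambda>z. g \<mu> (x(i := z))) differentiable (at (x i))" if "\<mu> \<in> P2" "x \<in> {..<j} \<rightarrow>\<^sub>E UNIV" "i < j" for \<mu> x i
    using Suc.prems(2) that unfolding eqd[OF that, symmetric] by simp
  have C: "(\<lambda>\<mu>. g \<mu> x) \<in> C1 P" if x: "x \<in> {..<j} \<rightarrow>\<^sub>E UNIV" for x
  proof -
    have f1: "(\<lambda>\<mu>. f \<mu> x) \<in> C1 P" using Suc.prems(2) x by simp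
    have "has_L_deriv P (\<lambda>\<mu>. f \<mu> x) = has_L_deriv P (\<lambda>\<mu>. g \<mu> x)"
      by (rule has_L_deriv_cong[OF P]) (rule Suc.prems(1)[OF _ x])
    moreover have "continuous_map W2_top euclideanreal (\<lambda>\<mu>. g \<mu> x)"
      by (rule continuous_map_eq[of _ _ "\<lambda>\<mu>. f \<mu> x"]) (use f1 Suc.prems(1)[OF _ x] in \<open>auto simp: C1_def\<close>)
    ultimately show ?thesis using f1 unfolding C1_def by simp
  qed
  have L: "Cn P n (Suc j) (L_comp P j k g)" for k
  proof (rule Suc.IH)
    show "Cn P n (Suc j) (L_comp P j k f)" using Suc.prems(2) by simp
    fix \<mu> :: "(real^'n) measure" and x :: "nat \<Rightarrow> real^'n"
    have r: "restrict x {..<j} \<in> {..<j} \<rightarrow>\<^sub>E UNIV" unfolding restrict_PiE_iff by blast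
    have "L_deriv P (\<lambda>\<nu>. f \<nu> (restrict x {..<j})) = L_deriv P (\<lambda>\<nu>. g \<nu> (restrict x {..<j}))"
      by (rule L_deriv_cong[OF P], rule Suc.prems(1)[OF _ r])
    then show "L_comp P j k f \<mu> x = L_comp P j k g \<mu> x" unfolding L_comp_def by simp
  qed
  show ?case unfolding Cn.simps using c dx df C L by blast
qed

text \<open>Both kinds of derivatives of a cylinder function are cylinder functions again.\<close>

lemma cylinder_Cn:
  fixes f :: "(real^'n::finite) measure \<Rightarrow> (nat \<Rightarrow> real^'n) \<Rightarrow> real"
  assumes P: "prob_space P" and U: "has_uniform_variable P"
    and f: "cylinder j f"
  shows "Cn P n j f"
  using f
proof (induction n arbitrary: j f)
  case 0
  then show ?case using cylinder_continuous[OF P] by simp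
next
  case (Suc n)
  have df: "(\<lambda>z. f \<mu> (x(i := z))) differentiable (at (x i))" if i: "i < j" for \<mu> x i
    using cylinder_dx[OF Suc.prems i] unfolding differentiable_def by blast
  have dx: "Cn P n j (dx_comp i k f)" if i: "i < j" for i k
  proof -
    obtain d where d: "\<And>a. cylinder j (d a)"
      "\<And>\<mu> x z. ((\<lambda>z. f \<mu> (x(i := z))) has_derivative (\<lambda>h. \<Sum>a\<in>UNIV. d a \<mu> (x(i := z)) * h $ a)) (at z)"
      using cylinder_dx[OF Suc.prems i] by blast
    have "dx_comp i k f \<mu> x = d k \<mu> x" for \<mu> x
      using partial_eq[OF d(2)[of \<mu> x "x i"], of k] unfolding dx_comp_def partial_def by simp
    then have "dx_comp i k f = d k" by blast
    then show ?thesis using Suc.IH[OF d(1)] by simp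
  qed
  obtain g where g: "\<And>a. cylinder (Suc j) (g a)" "\<And>x. Lsmooth P (\<lambda>\<mu>. f \<mu> x) (\<lambda>\<mu> y. \<chi> a. g a \<mu> (x(j := y)))"
    using cylinder_L[OF P Suc.prems] by blast
  have L: "Cn P n (Suc j) (L_comp P j k f)" for k
  proof (rule Cn_cong[OF P _ Suc.IH[OF g(1)]])
    fix \<mu> :: "(real^'n) measure" and x :: "nat \<Rightarrow> real^'n" assume \<mu>: "\<mu> \<in> P2" and x: "x \<in> {..<Suc j} \<rightarrow>\<^sub>E UNIV"
    have "(restrict x {..<j})(j := x j) = x"
      using x by (auto simp: fun_eq_iff PiE_iff extensional_def less_Suc_eq)
    then have "L_deriv P (\<lambda>\<nu>. f \<nu> (restrict x {..<j})) \<mu> (x j) = (\<chi> a. g a \<mu> x)"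
      using L_deriv_eq[OF P U Lsmooth_has_L_deriv[OF P g(2)] \<mu>, of "restrict x {..<j}" "x j"] by simp
    then show "g k \<mu> x = L_comp P j k f \<mu> x" unfolding L_comp_def by simp
  qed
  have C: "(\<lambda>\<mu>. f \<mu> x) \<in> C1 P" for x by (rule Lsmooth_C1[OF P g(2)])
  show ?case unfolding Cn.simps using cylinder_continuous[OF P Suc.prems] dx df C L by blast
qed

section \<open>Derivatives of expectations over samples\<close>

abbreviation sampled ::
  "nat \<Rightarrow> nat \<Rightarrow> (nat \<Rightarrow> ('n::finite \<times> nat \<Rightarrow> bool) \<Rightarrow> real) \<Rightarrow> ((nat \<Rightarrow> 'n pattern) \<Rightarrow> real) \<Rightarrow> real" where
  "sampled m n w F \<equiv> product_sum {..<n} (patterns m) w F"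

lemma partial_pattern_weight: "partial a (pattern_weight k m \<zeta>) x = pattern_weight_partial k m a \<zeta> x"
  by (rule partial_eq[OF pattern_weight_has_derivative])

lemma prod_fun_upd:
  assumes "finite I" "l \<in> I"
  shows "(\<Prod>i\<in>I. (w(l := v)) i (\<alpha> i)) = v (\<alpha> l) * (\<Prod>i\<in>I - {l}. w i (\<alpha> i) :: real)"
proof -
  have "(\<Prod>i\<in>I. (w(l := v)) i (\<alpha> i)) = (w(l := v)) l (\<alpha> l) * (\<Prod>i\<in>I - {l}. (w(l := v)) i (\<alpha> i))"
    by (rule prod.remove[OF assms])
  also have "(\<Prod>i\<in>I - {l}. (w(l := v)) i (\<alpha> i)) = (\<Prod>i\<in>I - {l}. w i (\<alpha> i))"
    by (rule prod.cong) auto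
  finally show ?thesis by simp
qed

text \<open>The factors in \<open>R\<close> have weights that do not depend on \<open>\<mu>\<close>; each of the others contributes one term to the product rule.\<close>

lemma Lsmooth_product_sum:
  fixes v :: "'i \<Rightarrow> ('n::finite \<times> nat \<Rightarrow> bool) \<Rightarrow> real" and R :: "'i set" and k :: real and m :: nat
  assumes P: "prob_space P" and I: "finite I"
  defines "w \<mu> i \<equiv> (if i \<in> R then v i else mass k m \<mu>)"
  shows "Lsmooth P (\<lambda>\<mu>. product_sum I (patterns m) (w \<mu>) F)
    (\<lambda>\<mu> y. \<chi> b. \<Sum>l\<in>I - R. product_sum I (patterns m) ((w \<mu>)(l := (\<lambda>\<zeta>. pattern_weight_partial k m b \<zeta> y))) F)"
proof -
  let ?Z = "PiE I (\<lambda>_. patterns m :: 'n pattern set)" and ?A = "I - R"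
  define c where "c \<alpha> = (\<Prod>i\<in>I \<inter> R. v i (\<alpha> i)) * F \<alpha>" for \<alpha>
  have finZ: "finite ?Z" using I by (intro finite_PiE) auto
  have split: "(\<Prod>i\<in>I. w \<mu> i (\<alpha> i)) * F \<alpha> = c \<alpha> * (\<Prod>i\<in>?A. mass k m \<mu> (\<alpha> i))" for \<mu> \<alpha>
  proof -
    have "(\<Prod>i\<in>I. w \<mu> i (\<alpha> i)) = (\<Prod>i\<in>I \<inter> R. w \<mu> i (\<alpha> i)) * (\<Prod>i\<in>?A. w \<mu> i (\<alpha> i))"
      by (rule prod.Int_Diff[OF I])
    also have "(\<Prod>i\<in>I \<inter> R. w \<mu> i (\<alpha> i)) = (\<Prod>i\<in>I \<inter> R. v i (\<alpha> i))" by (rule prod.cong) (auto simp: w_def)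
    also have "(\<Prod>i\<in>?A. w \<mu> i (\<alpha> i)) = (\<Prod>i\<in>?A. mass k m \<mu> (\<alpha> i))" by (rule prod.cong) (auto simp: w_def)
    finally show ?thesis by (simp add: c_def)
  qed
  have mL: "Lsmooth P (\<lambda>\<mu>. mass k m \<mu> \<zeta>) (\<lambda>_. grad (pattern_weight k m \<zeta>))" for \<zeta> :: "'n \<times> nat \<Rightarrow> bool"
    unfolding mass_def by (rule trig_Lsmooth[OF P trig_pattern_weight])
  have S: "Lsmooth P (\<lambda>\<mu>. \<Sum>\<alpha>\<in>?Z. c \<alpha> * (\<Prod>i\<in>?A. mass k m \<mu> (\<alpha> i)))
    (\<lambda>\<mu> y. \<Sum>\<alpha>\<in>?Z. c \<alpha> *\<^sub>R (\<Sum>l\<in>?A. (\<Prod>i\<in>?A - {l}. mass k m \<mu> (\<alpha> i)) *\<^sub>R grad (pattern_weight k m (\<alpha> l)) y))"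
    by (intro Lsmooth_sum[OF P finZ] Lsmooth_cmult[OF P] Lsmooth_prod[OF P] mL) (use I in simp)
  have e1: "(\<lambda>\<mu>. \<Sum>\<alpha>\<in>?Z. c \<alpha> * (\<Prod>i\<in>?A. mass k m \<mu> (\<alpha> i))) = (\<lambda>\<mu>. product_sum I (patterns m) (w \<mu>) F)"
    unfolding product_sum_def split ..
  have comp: "(\<Sum>\<alpha>\<in>?Z. c \<alpha> * (\<Sum>l\<in>?A. (\<Prod>i\<in>?A - {l}. mass k m \<mu> (\<alpha> i)) * pattern_weight_partial k m b (\<alpha> l) y))
      = (\<Sum>l\<in>?A. product_sum I (patterns m) ((w \<mu>)(l := (\<lambda>\<zeta>. pattern_weight_partial k m b \<zeta> y))) F)" for \<mu> b y
    unfolding product_sum_def sum_distrib_left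
  proof (subst sum.swap, intro sum.cong refl)
    fix l \<alpha> assume l: "l \<in> ?A"
    have "(\<Prod>i\<in>I. ((w \<mu>)(l := (\<lambda>\<zeta>. pattern_weight_partial k m b \<zeta> y))) i (\<alpha> i))
        = pattern_weight_partial k m b (\<alpha> l) y * (\<Prod>i\<in>I - {l}. w \<mu> i (\<alpha> i))"
      by (rule prod_fun_upd[OF I]) (use l in simp)
    also have "(\<Prod>i\<in>I - {l}. w \<mu> i (\<alpha> i)) = (\<Prod>i\<in>(I - {l}) \<inter> R. w \<mu> i (\<alpha> i)) * (\<Prod>i\<in>(I - {l}) - R. w \<mu> i (\<alpha> i))"
      by (rule prod.Int_Diff) (use I in simp)
    also have "(\<Prod>i\<in>(I - {l}) \<inter> R. w \<mu> i (\<alpha> i)) = (\<Prod>i\<in>I \<inter> R. v i (\<alpha> i))"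
      by (rule prod.cong) (use l in \<open>auto simp: w_def\<close>)
    also have "(\<Prod>i\<in>(I - {l}) - R. w \<mu> i (\<alpha> i)) = (\<Prod>i\<in>?A - {l}. mass k m \<mu> (\<alpha> i))"
      by (rule prod.cong) (auto simp: w_def)
    finally show "c \<alpha> * ((\<Prod>i\<in>?A - {l}. mass k m \<mu> (\<alpha> i)) * pattern_weight_partial k m b (\<alpha> l) y)
        = (\<Prod>i\<in>I. ((w \<mu>)(l := (\<lambda>\<zeta>. pattern_weight_partial k m b \<zeta> y))) i (\<alpha> i)) * F \<alpha>"
      by (simp add: c_def)
  qed
  have e2: "(\<lambda>\<mu> y. \<Sum>\<alpha>\<in>?Z. c \<alpha> *\<^sub>R (\<Sum>l\<in>?A. (\<Prod>i\<in>?A - {l}. mass k m \<mu> (\<alpha> i)) *\<^sub>R grad (pattern_weight k m (\<alpha> l)) y))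
     = (\<lambda>\<mu> y. \<chi> b. \<Sum>l\<in>?A. product_sum I (patterns m) ((w \<mu>)(l := (\<lambda>\<zeta>. pattern_weight_partial k m b \<zeta> y))) F)"
    by (intro ext, simp only: vec_eq_iff vec_lambda_beta sum_component vector_scaleR_component grad_def partial_pattern_weight real_scaleR_def)
       (intro allI, rule comp)
  show ?thesis using S unfolding e1 e2 .
qed

definition coin_diff ::
  "nat \<Rightarrow> 'n \<times> nat \<Rightarrow> ((nat \<Rightarrow> 'n pattern) \<Rightarrow> real) \<Rightarrow> (nat \<Rightarrow> 'n pattern) \<Rightarrow> real" where
  "coin_diff l e F \<alpha> = F (\<alpha>(l := (\<alpha> l)(e := True))) - F (\<alpha>(l := (\<alpha> l)(e := False)))"

text \<open>The derivative of the weight of one sample is converted into differences of \<open>F\<close> between the outcomes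
  of each of its coins for coordinate \<open>a\<close>.\<close>

lemma sampled_partial:
  fixes x :: "real^'n::finite"
  assumes l: "l < n"
  shows "sampled m n (w(l := (\<lambda>\<zeta>. pattern_weight_partial k m a \<zeta> x))) F =
    cos (x $ a / k) / (2 * k) * (\<Sum>r<m. sampled m n (w(l := (\<lambda>\<zeta>. pattern_weight k m \<zeta> x))) (coin_diff l (a, r) F))"
proof -
  let ?I = "{..<n}" and ?c = "cos (x $ a / k) / (2 * k)" and ?J = "{..<n} - {l}"
  have lI: "l \<in> ?I" using l by simp
  have "sampled m n (w(l := (\<lambda>\<zeta>. pattern_weight_partial k m a \<zeta> x))) F
      = product_sum ?J (patterns m) (w(l := (\<lambda>\<zeta>. pattern_weight_partial k m a \<zeta> x)))
          (\<lambda>\<alpha>. \<Sum>\<zeta>\<in>patterns m. pattern_weight_partial k m a \<zeta> x * F (\<alpha>(l := \<zeta>)))"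
    unfolding product_sum_split[OF finite_lessThan lI finite_patterns] by simp
  also have "\<dots> = product_sum ?J (patterns m) w
      (\<lambda>\<alpha>. ?c * (\<Sum>r<m. \<Sum>\<zeta>\<in>patterns m. pattern_weight k m \<zeta> x * (F (\<alpha>(l := \<zeta>((a, r) := True))) - F (\<alpha>(l := \<zeta>((a, r) := False))))))"
    unfolding sum_pattern_weight_partial by (rule product_sum_cong) auto
  also have "\<dots> = ?c * (\<Sum>r<m. product_sum ?J (patterns m) w
      (\<lambda>\<alpha>. \<Sum>\<zeta>\<in>patterns m. pattern_weight k m \<zeta> x * (F (\<alpha>(l := \<zeta>((a, r) := True))) - F (\<alpha>(l := \<zeta>((a, r) := False))))))"
    unfolding product_sum_cmult product_sum_sum ..
  also have "(\<lambda>r. product_sum ?J (patterns m) w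
      (\<lambda>\<alpha>. \<Sum>\<zeta>\<in>patterns m. pattern_weight k m \<zeta> x * (F (\<alpha>(l := \<zeta>((a, r) := True))) - F (\<alpha>(l := \<zeta>((a, r) := False))))))
      = (\<lambda>r. sampled m n (w(l := (\<lambda>\<zeta>. pattern_weight k m \<zeta> x))) (coin_diff l (a, r) F))"
  proof
    fix r
    have "sampled m n (w(l := (\<lambda>\<zeta>. pattern_weight k m \<zeta> x))) (coin_diff l (a, r) F)
        = product_sum ?J (patterns m) (w(l := (\<lambda>\<zeta>. pattern_weight k m \<zeta> x)))
          (\<lambda>\<alpha>. \<Sum>\<zeta>\<in>patterns m. pattern_weight k m \<zeta> x * coin_diff l (a, r) F (\<alpha>(l := \<zeta>)))"
      unfolding product_sum_split[OF finite_lessThan lI finite_patterns] by simp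
    also have "\<dots> = product_sum ?J (patterns m) w
      (\<lambda>\<alpha>. \<Sum>\<zeta>\<in>patterns m. pattern_weight k m \<zeta> x * (F (\<alpha>(l := \<zeta>((a, r) := True))) - F (\<alpha>(l := \<zeta>((a, r) := False)))))"
      by (rule product_sum_cong) (auto simp: coin_diff_def)
    finally show "product_sum ?J (patterns m) w
      (\<lambda>\<alpha>. \<Sum>\<zeta>\<in>patterns m. pattern_weight k m \<zeta> x * (F (\<alpha>(l := \<zeta>((a, r) := True))) - F (\<alpha>(l := \<zeta>((a, r) := False)))))
      = sampled m n (w(l := (\<lambda>\<zeta>. pattern_weight k m \<zeta> x))) (coin_diff l (a, r) F)" by simp
  qed
  finally show ?thesis .
qed

lemma sampled_has_derivative:
  fixes x :: "real^'n::finite"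
  assumes l: "l < n"
  shows "((\<lambda>x. sampled m n (w(l := (\<lambda>\<zeta>. pattern_weight k m \<zeta> x))) G) has_derivative
    (\<lambda>h. \<Sum>b\<in>UNIV. sampled m n (w(l := (\<lambda>\<zeta>. pattern_weight_partial k m b \<zeta> x))) G * h $ b)) (at x)"
proof -
  have lI: "l \<in> {..<n}" using l by simp
  let ?Z = "PiE {..<n} (\<lambda>_. patterns m :: 'n pattern set)"
  define c where "c \<alpha> = (\<Prod>i\<in>{..<n} - {l}. w i (\<alpha> i)) * G \<alpha>" for \<alpha>
  have e: "sampled m n (w(l := v)) G = (\<Sum>\<alpha>\<in>?Z. c \<alpha> * v (\<alpha> l))" for v
    unfolding product_sum_def prod_fun_upd[OF finite_lessThan lI] c_def by (simp add: ac_simps)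
  have "((\<lambda>x. \<Sum>\<alpha>\<in>?Z. c \<alpha> * pattern_weight k m (\<alpha> l) x) has_derivative
      (\<lambda>h. \<Sum>\<alpha>\<in>?Z. c \<alpha> * (\<Sum>b\<in>UNIV. pattern_weight_partial k m b (\<alpha> l) x * h $ b))) (at x)"
    by (intro has_derivative_sum has_derivative_mult_right pattern_weight_has_derivative)
  moreover have "(\<Sum>\<alpha>\<in>?Z. c \<alpha> * (\<Sum>b\<in>UNIV. pattern_weight_partial k m b (\<alpha> l) x * h $ b))
      = (\<Sum>b\<in>UNIV. (\<Sum>\<alpha>\<in>?Z. c \<alpha> * pattern_weight_partial k m b (\<alpha> l) x) * h $ b)" for h
    unfolding sum_distrib_left sum_distrib_right by (subst sum.swap) (simp add: mult.assoc)
  ultimately show ?thesis unfolding e by simp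
qed

section \<open>Mean value theorems for coin differences\<close>

lemma mixed_difference_mean_value:
  fixes F :: "real \<Rightarrow> real \<Rightarrow> real"
  assumes h: "0 < h" and Fs: "\<And>s t. ((\<lambda>s. F s t) has_real_derivative G s t) (at s)"
    and Gt: "\<And>s t. ((\<lambda>t. G s t) has_real_derivative H s t) (at t)"
  obtains \<theta> \<tau> where "0 \<le> \<theta>" "\<theta> \<le> h" "0 \<le> \<tau>" "\<tau> \<le> h"
    "F h h - F h 0 - (F 0 h - F 0 0) = h\<^sup>2 * H \<theta> \<tau>"
proof -
  obtain \<theta> where \<theta>: "0 < \<theta>" "\<theta> < h" "(F h h - F h 0) - (F 0 h - F 0 0) = (h - 0) * (G \<theta> h - G \<theta> 0)"
    using MVT2[of 0 h "\<lambda>s. F s h - F s 0" "\<lambda>s. G s h - G s 0"] h DERIV_diff[OF Fs Fs] by blast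
  obtain \<tau> where \<tau>: "0 < \<tau>" "\<tau> < h" "G \<theta> h - G \<theta> 0 = (h - 0) * H \<theta> \<tau>"
    using MVT2[of 0 h "\<lambda>t. G \<theta> t" "\<lambda>t. H \<theta> t"] h Gt by blast
  show ?thesis
    by (rule that[of \<theta> \<tau>]) (use \<theta> \<tau> in \<open>auto simp: power2_eq_square\<close>)
qed

text \<open>The chain rule for \<open>t \<mapsto> A t t\<close> when only one partial derivative is continuous in both variables: the
  increment is split at \<open>A (t0 + h) t0\<close>, and the mean value theorem is applied to the continuous one.\<close>

lemma diagonal_derivative:
  fixes A B :: "real \<Rightarrow> real \<Rightarrow> real"
  assumes A2: "\<And>s t. ((\<lambda>t. A s t) has_real_derivative B s t) (at t)"
    and Bc: "\<And>\<epsilon>. 0 < \<epsilon> \<Longrightarrow> \<exists>\<delta>>0. \<forall>s t. \<bar>s - t0\<bar> < \<delta> \<longrightarrow> \<bar>t - t0\<bar> < \<delta> \<longrightarrow> \<bar>B s t - B t0 t0\<bar> < \<epsilon>"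
    and A1: "((\<lambda>s. A s t0) has_real_derivative C) (at t0)"
  shows "((\<lambda>t. A t t) has_real_derivative B t0 t0 + C) (at t0)"
proof -
  have "(\<lambda>h. (A (t0 + h) (t0 + h) - A (t0 + h) t0) / h) \<midarrow>0\<rightarrow> B t0 t0"
    unfolding LIM_eq
  proof (intro allI impI)
    fix \<epsilon> :: real assume "0 < \<epsilon>"
    then obtain \<delta> where \<delta>: "0 < \<delta>" "\<And>s t. \<bar>s - t0\<bar> < \<delta> \<Longrightarrow> \<bar>t - t0\<bar> < \<delta> \<Longrightarrow> \<bar>B s t - B t0 t0\<bar> < \<epsilon>"
      using Bc by blast
    show "\<exists>\<delta>>0. \<forall>h. h \<noteq> 0 \<and> norm (h - 0) < \<delta> \<longrightarrow> norm ((A (t0 + h) (t0 + h) - A (t0 + h) t0) / h - B t0 t0) < \<epsilon>"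
    proof (intro exI[of _ \<delta>] conjI allI impI)
      fix h :: real assume h: "h \<noteq> 0 \<and> norm (h - 0) < \<delta>"
      have "\<exists>\<theta>. \<bar>\<theta> - t0\<bar> < \<delta> \<and> A (t0 + h) (t0 + h) - A (t0 + h) t0 = h * B (t0 + h) \<theta>"
      proof (cases "0 < h")
        case True
        then obtain \<theta> where "t0 < \<theta>" "\<theta> < t0 + h" "A (t0 + h) (t0 + h) - A (t0 + h) t0 = (t0 + h - t0) * B (t0 + h) \<theta>"
          using MVT2[of t0 "t0 + h" "A (t0 + h)" "B (t0 + h)"] A2 by auto
        then show ?thesis using h by (intro exI[of _ \<theta>]) auto
      next
        case False
        then have h0: "h < 0" using h by simp
        then obtain \<theta> where "t0 + h < \<theta>" "\<theta> < t0" "A (t0 + h) t0 - A (t0 + h) (t0 + h) = (t0 - (t0 + h)) * B (t0 + h) \<theta>"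
          using MVT2[of "t0 + h" t0 "A (t0 + h)" "B (t0 + h)"] A2 by auto
        then show ?thesis using h by (intro exI[of _ \<theta>]) auto
      qed
      then obtain \<theta> where \<theta>: "\<bar>\<theta> - t0\<bar> < \<delta>" "A (t0 + h) (t0 + h) - A (t0 + h) t0 = h * B (t0 + h) \<theta>" by blast
      have "\<bar>B (t0 + h) \<theta> - B t0 t0\<bar> < \<epsilon>" by (rule \<delta>(2)) (use h \<theta>(1) in auto)
      then show "norm ((A (t0 + h) (t0 + h) - A (t0 + h) t0) / h - B t0 t0) < \<epsilon>"
        unfolding \<theta>(2) using h by simp
    qed (use \<delta> in simp)
  qed
  moreover have "(\<lambda>h. (A (t0 + h) t0 - A t0 t0) / h) \<midarrow>0\<rightarrow> C" using A1 unfolding DERIV_def .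
  ultimately have "(\<lambda>h. (A (t0 + h) (t0 + h) - A (t0 + h) t0) / h + (A (t0 + h) t0 - A t0 t0) / h) \<midarrow>0\<rightarrow> B t0 t0 + C"
    by (rule tendsto_add)
  then show ?thesis unfolding DERIV_def by (simp add: add_divide_distrib[symmetric])
qed


lemma node_True:
  assumes m: "0 < m" and r: "r < m"
  shows "node k m (\<zeta>((a, r) := True)) = node k m (\<zeta>((a, r) := False)) + (2 * k / real m) *\<^sub>R axis a (1::real)"
proof -
  have "k * (2 / real m * (\<Sum>r'<m. of_bool ((\<zeta>((a, r) := True)) (b, r'))) - 1)
      = k * (2 / real m * (\<Sum>r'<m. of_bool ((\<zeta>((a, r) := False)) (b, r'))) - 1) + 2 * k / real m * axis a (1::real) $ b" for b
  proof -
    let ?J = "{..<m} - {r}"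
    have s: "(\<Sum>r'<m. of_bool ((\<zeta>((a, r) := v)) (b, r'))) = of_bool ((\<zeta>((a, r) := v)) (b, r)) + (\<Sum>r'\<in>?J. of_bool (\<zeta> (b, r')) :: real)" for v
    proof -
      have "(\<Sum>r'<m. of_bool ((\<zeta>((a, r) := v)) (b, r')) :: real)
          = of_bool ((\<zeta>((a, r) := v)) (b, r)) + (\<Sum>r'\<in>?J. of_bool ((\<zeta>((a, r) := v)) (b, r')))"
        by (rule sum.remove) (use r in auto)
      also have "(\<Sum>r'\<in>?J. of_bool ((\<zeta>((a, r) := v)) (b, r')) :: real) = (\<Sum>r'\<in>?J. of_bool (\<zeta> (b, r')))"
        by (rule sum.cong) auto
      finally show ?thesis .
    qed
    have alg: "k * (2 / M * (x + S) - 1) = k * (2 / M * (y + S) - 1) + 2 * k / M * (x - y)" for x y S M :: real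
      by (simp add: algebra_simps add_divide_distrib diff_divide_distrib)
    have "of_bool ((\<zeta>((a, r) := True)) (b, r)) - of_bool ((\<zeta>((a, r) := False)) (b, r)) = axis a (1::real) $ b"
      by (auto simp: axis_def)
    then show ?thesis unfolding s alg[of _ "of_bool ((\<zeta>((a, r) := True)) (b, r))" _ "of_bool ((\<zeta>((a, r) := False)) (b, r))"] by simp
  qed
  then show ?thesis by (simp only: vec_eq_iff node_def vec_lambda_beta vector_add_component vector_scaleR_component real_scaleR_def simp_thms)
qed

lemma node_upd_close:
  assumes m: "0 < m" and r: "r < m" and k: "0 \<le> k"
  shows "norm (node k m (\<zeta>((a, r) := b)) - node k m \<zeta> :: real^'n::finite) \<le> 2 * k / real m"
proof -
  have n: "norm ((2 * k / real m) *\<^sub>R (axis a 1 :: real^'n)) = 2 * k / real m" using k by simp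
  show ?thesis
  proof (cases "b = \<zeta> (a, r)")
    case True
    then have "\<zeta>((a, r) := b) = \<zeta>" by auto
    then show ?thesis using k by simp
  next
    case False
    show ?thesis
    proof (cases b)
      case True
      with False have "\<zeta>((a, r) := False) = \<zeta>" by (intro fun_upd_idem) auto
      then have "node k m (\<zeta>((a, r) := b)) - node k m \<zeta> = (2 * k / real m) *\<^sub>R (axis a 1 :: real^'n)"
        using node_True[OF m r, of k \<zeta> a] True by simp
      then show ?thesis using n by (simp only: order_refl)
    next
      case b: False
      with False have "\<zeta>((a, r) := True) = \<zeta>" by (intro fun_upd_idem) auto
      then have "node k m (\<zeta>((a, r) := b)) - node k m \<zeta> = - ((2 * k / real m) *\<^sub>R (axis a 1 :: real^'n))"
        using node_True[OF m r, of k \<zeta> a] b by simp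
      then show ?thesis using n by (simp only: norm_minus_cancel order_refl)
    qed
  qed
qed

lemma segment_in_box:
  assumes "\<bar>x\<bar> \<le> K" "\<bar>x + h\<bar> \<le> K" "0 \<le> s" "s \<le> (h::real)"
  shows "\<bar>x + s\<bar> \<le> K"
  using assms by linarith

definition sample_value ::
  "real \<Rightarrow> nat \<Rightarrow> nat \<Rightarrow> ((real^'n::finite) measure \<Rightarrow> real) \<Rightarrow> (nat \<Rightarrow> 'n pattern) \<Rightarrow> real" where
  "sample_value k m n u \<alpha> = u (empirical n (\<lambda>j. node k m (\<alpha> j)))"

text \<open>The points \<open>z\<close> stay in the box and close to the grid points of the sample \<open>\<alpha>\<close>. The constant \<open>8 = 4 * 2\<close>
  accounts for four moves by a grid step \<open>2 * k / m\<close>, which is what two coins require: two resets and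
  two intermediate positions.\<close>

definition near_sample :: "real \<Rightarrow> nat \<Rightarrow> nat \<Rightarrow> (nat \<Rightarrow> 'n pattern) \<Rightarrow> (nat \<Rightarrow> real^'n::finite) \<Rightarrow> bool" where
  "near_sample k m n \<alpha> z \<longleftrightarrow> (\<forall>j<n. (\<forall>a. \<bar>z j $ a\<bar> \<le> k) \<and> norm (z j - node k m (\<alpha> j)) \<le> 8 * k / real m)"

text \<open>The two outcomes move one atom along a grid edge, and the derivative along that edge is the
  component \<open>a\<close> of the L-derivative at the atom divided by \<open>n\<close>.\<close>

lemma coin_diff_mean_value:
  fixes u :: "(real^'n::finite) measure \<Rightarrow> real"
  assumes P: "prob_space P" and U: "has_uniform_variable P"
    and u: "has_L_deriv P u p" and k: "0 < k" and m: "0 < m" and l: "l < n" and r: "r < m"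
  obtains z where "near_sample k m n \<alpha> z"
    "coin_diff l (a, r) (sample_value k m n u) \<alpha> = 2 * k / real m * (p (empirical n z) (z l) $ a / real n)"
proof -
  let ?h = "2 * k / real m" and ?e = "axis a (1::real)"
  have h: "0 < ?h" using k m by simp
  define \<beta> where "\<beta> = \<alpha>(l := (\<alpha> l)((a, r) := False))"
  define z0 where "z0 j = node k m (\<beta> j)" for j
  have F: "sample_value k m n u (\<alpha>(l := (\<alpha> l)((a, r) := False))) = u (empirical n (z0(l := z0 l + 0 *\<^sub>R ?e)))"
  proof -
    have e: "z0(l := z0 l + 0 *\<^sub>R ?e) = (\<lambda>j. node k m (\<beta> j))" unfolding z0_def by (rule ext) simp
    show ?thesis unfolding e sample_value_def \<beta>_def ..
  qed
  have "(\<lambda>j. node k m ((\<alpha>(l := (\<alpha> l)((a, r) := True))) j)) = z0(l := z0 l + ?h *\<^sub>R ?e)"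
    unfolding z0_def \<beta>_def by (rule ext) (simp add: node_True[OF m r])
  then have T: "sample_value k m n u (\<alpha>(l := (\<alpha> l)((a, r) := True))) = u (empirical n (z0(l := z0 l + ?h *\<^sub>R ?e)))"
    unfolding sample_value_def by simp
  obtain \<theta> where \<theta>: "0 < \<theta>" "\<theta> < ?h"
    "u (empirical n (z0(l := z0 l + ?h *\<^sub>R ?e))) - u (empirical n (z0(l := z0 l + 0 *\<^sub>R ?e)))
      = (?h - 0) * ((p (empirical n (z0(l := z0 l + \<theta> *\<^sub>R ?e))) (z0 l + \<theta> *\<^sub>R ?e) \<bullet> ?e) / real n)"
    using MVT2[OF h, of "\<lambda>s. u (empirical n (z0(l := z0 l + s *\<^sub>R ?e)))"
        "\<lambda>s. (p (empirical n (z0(l := z0 l + s *\<^sub>R ?e))) (z0 l + s *\<^sub>R ?e) \<bullet> ?e) / real n"]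
      has_L_deriv_empirical[OF P U u l] by blast
  define z where "z = z0(l := z0 l + \<theta> *\<^sub>R ?e)"
  have zb: "\<bar>z j $ b\<bar> \<le> k" for j b
  proof (cases "j = l \<and> b = a")
    case True
    have "\<bar>node k m ((\<alpha> l)((a, r) := True)) $ a\<bar> \<le> k" by (rule node_bound) (use k in simp)
    then have 1: "\<bar>z0 l $ a + ?h\<bar> \<le> k" unfolding z0_def \<beta>_def node_True[OF m r] by simp
    have 2: "\<bar>z0 l $ a\<bar> \<le> k" unfolding z0_def by (rule node_bound) (use k in simp)
    have "\<bar>z0 l $ a + \<theta>\<bar> \<le> k" by (rule segment_in_box[OF 2 1]) (use \<theta> in auto)
    then show ?thesis using True by (simp add: z_def)
  next
    case False
    then have "z j $ b = z0 j $ b" by (auto simp: z_def axis_def)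
    then show ?thesis using node_bound[of k m "\<beta> j" b] k by (simp add: z0_def)
  qed
  have zc: "norm (z j - node k m (\<alpha> j)) \<le> 8 * k / real m" for j
  proof -
    have z1: "norm (z0 j - node k m (\<alpha> j)) \<le> ?h"
      using node_upd_close[OF m r, of k "\<alpha> l" a False] k by (cases "j = l") (simp_all add: z0_def \<beta>_def)
    have z2: "norm (z j - z0 j) \<le> ?h" using \<theta> h by (simp add: z_def)
    have "norm (z j - node k m (\<alpha> j)) \<le> norm (z j - z0 j) + norm (z0 j - node k m (\<alpha> j))"
      using norm_triangle_ineq[of "z j - z0 j" "z0 j - node k m (\<alpha> j)"] by simp
    also have "\<dots> \<le> ?h + ?h" by (rule add_mono[OF z2 z1])
    also have "?h + ?h \<le> 8 * k / real m" using k m by (simp add: add_divide_distrib[symmetric] divide_right_mono)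
    finally show ?thesis .
  qed
  show ?thesis
  proof (rule that[of z])
    show "near_sample k m n \<alpha> z" unfolding near_sample_def using zb zc by blast
    have "p (empirical n z) (z l) \<bullet> ?e = p (empirical n z) (z l) $ a" by (simp add: inner_axis)
    then show "coin_diff l (a, r) (sample_value k m n u) \<alpha> = ?h * (p (empirical n z) (z l) $ a / real n)"
      unfolding coin_diff_def F T \<theta>(3) by (simp add: z_def)
  qed
qed


lemma C2D:
  assumes u: "u \<in> C2 P"
  shows "u \<in> C1 P" "\<And>\<mu> x. \<mu> \<in> P2 \<Longrightarrow> L_deriv P u \<mu> differentiable (at x)"
    "continuous_map (prod_topology W2_top euclidean) euclidean (\<lambda>(\<mu>, x). dx_L_deriv P u \<mu> x)"
    "\<And>x i. has_L_deriv P (\<lambda>\<nu>. L_deriv P u \<nu> x $ i) (L_deriv P (\<lambda>\<nu>. L_deriv P u \<nu> x $ i))"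
    "continuous_map (prod_topology W2_top euclidean) euclidean (\<lambda>(\<mu>, x, y). L_deriv2 P u \<mu> x y)"
proof -
  show "u \<in> C1 P" "\<And>\<mu> x. \<mu> \<in> P2 \<Longrightarrow> L_deriv P u \<mu> differentiable (at x)"
    "continuous_map (prod_topology W2_top euclidean) euclidean (\<lambda>(\<mu>, x). dx_L_deriv P u \<mu> x)"
    "continuous_map (prod_topology W2_top euclidean) euclidean (\<lambda>(\<mu>, x, y). L_deriv2 P u \<mu> x y)"
    using u unfolding C2_def prod_topology_euclidean by blast+
  fix x i
  have "(\<lambda>\<nu>. L_deriv P u \<nu> x $ i) \<in> C1 P" using u unfolding C2_def by blast
  then show "has_L_deriv P (\<lambda>\<nu>. L_deriv P u \<nu> x $ i) (L_deriv P (\<lambda>\<nu>. L_deriv P u \<nu> x $ i))"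
    unfolding C1_def using has_L_deriv_L_deriv by blast
qed

lemma abs_matrix_component_le: "\<bar>A $ a $ b\<bar> \<le> norm (A :: real^'n::finite^'m::finite)"
  using component_le_norm_cart[of "A $ a" b] Finite_Cartesian_Product.norm_nth_le[of A a] by linarith

text \<open>Moving the atom \<open>l'\<close> changes the measure, which contributes the second L-derivative with weight
  \<open>1 / n\<close>; for \<open>l = l'\<close> it also moves the point at which the L-derivative is taken.\<close>

lemma gradient_along_moving_sample:
  fixes u :: "(real^'n::finite) measure \<Rightarrow> real" and z0 :: "nat \<Rightarrow> real^'n" and b :: 'n and l' :: nat
  assumes P: "prob_space P" and U: "has_uniform_variable P"
    and u: "u \<in> C2 P" and l': "l' < n"
  defines "z t \<equiv> z0(l' := z0 l' + t *\<^sub>R axis b (1::real))"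
  shows "((\<lambda>t. L_deriv P u (empirical n (z t)) (z t l) $ a) has_real_derivative
      (of_bool (l = l') * dx_L_deriv P u (empirical n (z t)) (z t l) $ a $ b
        + L_deriv2 P u (empirical n (z t)) (z t l) (z t l') $ a $ b / real n)) (at t)"
proof -
  note C = C2D[OF u]
  let ?e = "axis b (1::real) :: real^'n" and ?p = "L_deriv P u"
  have n: "0 < n" using l' by simp
  define c where "c = (of_bool (l = l') :: real)"
  have c01: "\<bar>c\<bar> \<le> 1" by (simp add: c_def)
  define x where "x t = z0 l + (t * c) *\<^sub>R ?e" for t
  have zl: "z t l = x t" for t by (simp add: z_def x_def c_def)
  define A where "A s t = ?p (empirical n (z s)) (x t) $ a" for s t
  define B where "B s t = c * dx_L_deriv P u (empirical n (z s)) (x t) $ a $ b" for s t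
  have E: "empirical n (z s) \<in> P2" for s by (rule empirical_P2[OF n])
  have "((\<lambda>t. A s t) has_real_derivative B s t) (at t)" for s t
  proof -
    let ?D = "frechet_derivative (?p (empirical n (z s))) (at (x t))"
    have D: "(?p (empirical n (z s)) has_derivative ?D) (at (x t))"
      using C(2)[OF E] by (simp add: frechet_derivative_works[symmetric])
    have "((\<lambda>t. x t) has_derivative (\<lambda>h. 0 + (h * c) *\<^sub>R ?e)) (at t)"
      unfolding x_def by (intro has_derivative_add has_derivative_const has_derivative_scaleR_left has_derivative_mult_left has_derivative_ident)
    from has_derivative_compose[OF this D]
    have "((\<lambda>t. ?p (empirical n (z s)) (x t)) has_derivative (\<lambda>h. ?D (0 + (h * c) *\<^sub>R ?e))) (at t)" .
    then have "((\<lambda>t. ?p (empirical n (z s)) (x t) $ a) has_derivative (\<lambda>h. ?D (0 + (h * c) *\<^sub>R ?e) $ a)) (at t)"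
      by (rule bounded_linear.has_derivative[OF bounded_linear_vec_nth])
    moreover have "?D (0 + (h * c) *\<^sub>R ?e) $ a = B s t * h" for h
    proof -
      have "?D ((h * c) *\<^sub>R ?e) = (h * c) *\<^sub>R ?D ?e"
        by (rule linear_scale[OF has_derivative_linear[OF D]])
      then show ?thesis unfolding B_def dx_L_deriv_def matrix_def by simp
    qed
    ultimately show ?thesis unfolding A_def has_field_derivative_def by simp
  qed
  moreover have "\<exists>\<delta>>0. \<forall>s t'. \<bar>s - t\<bar> < \<delta> \<longrightarrow> \<bar>t' - t\<bar> < \<delta> \<longrightarrow> \<bar>B s t' - B t t\<bar> < \<epsilon>" if \<epsilon>: "0 < \<epsilon>" for \<epsilon>
  proof -
    obtain \<delta> where \<delta>: "0 < \<delta>" "\<And>\<nu> y. \<nu> \<in> P2 \<Longrightarrow> W2 (empirical n (z t)) \<nu> < \<delta> \<Longrightarrow> dist (x t) y < \<delta> \<Longrightarrow>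
        dist (dx_L_deriv P u (empirical n (z t)) (x t)) (dx_L_deriv P u \<nu> y) < \<epsilon>"
      using continuous_map_W2_prodD[OF C(3) E \<epsilon>, of t "x t"] unfolding split_conv by blast
    show ?thesis
    proof (intro exI[of _ \<delta>] conjI allI impI)
      fix s t' assume st: "\<bar>s - t\<bar> < \<delta>" "\<bar>t' - t\<bar> < \<delta>"
      have "W2 (empirical n (z t)) (empirical n (z s)) \<le> \<bar>s - t\<bar>"
      proof (rule W2_empirical_le[OF n])
        fix j
        have "norm ((t - s) *\<^sub>R ?e) = \<bar>s - t\<bar>" by simp
        then show "norm (z t j - z s j) \<le> \<bar>s - t\<bar>"
          by (cases "j = l'") (simp_all add: z_def scaleR_diff_left)
      qed
      moreover have "dist (x t) (x t') \<le> \<bar>t' - t\<bar>"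
      proof -
        have "x t - x t' = ((t - t') * c) *\<^sub>R ?e" by (simp add: x_def algebra_simps)
        then have "dist (x t) (x t') = \<bar>t - t'\<bar> * \<bar>c\<bar>" by (simp add: dist_norm abs_mult)
        also have "\<dots> \<le> \<bar>t - t'\<bar> * 1" by (rule mult_left_mono[OF c01]) simp
        finally show ?thesis by (simp add: abs_minus_commute)
      qed
      ultimately have d: "dist (dx_L_deriv P u (empirical n (z t)) (x t)) (dx_L_deriv P u (empirical n (z s)) (x t')) < \<epsilon>"
        using st by (intro \<delta>(2)[OF E]) auto
      have "\<bar>B s t' - B t t\<bar> = \<bar>c\<bar> * \<bar>(dx_L_deriv P u (empirical n (z s)) (x t') - dx_L_deriv P u (empirical n (z t)) (x t)) $ a $ b\<bar>"
        unfolding B_def by (simp add: right_diff_distrib[symmetric] abs_mult)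
      also have "\<dots> \<le> 1 * norm (dx_L_deriv P u (empirical n (z s)) (x t') - dx_L_deriv P u (empirical n (z t)) (x t))"
        by (intro mult_mono c01 abs_matrix_component_le) auto
      also have "\<dots> < \<epsilon>" using d by (simp add: dist_norm norm_minus_commute)
      finally show "\<bar>B s t' - B t t\<bar> < \<epsilon>" .
    qed (use \<delta> in simp)
  qed
  moreover have "((\<lambda>s. A s t) has_real_derivative L_deriv2 P u (empirical n (z t)) (x t) (z t l') $ a $ b / real n) (at t)"
  proof -
    have "((\<lambda>s. ?p (empirical n (z s)) (x t) $ a) has_real_derivative
        (L_deriv P (\<lambda>\<nu>. ?p \<nu> (x t) $ a) (empirical n (z t)) (z0 l' + t *\<^sub>R ?e) \<bullet> ?e) / real n) (at t)"
      unfolding z_def by (rule has_L_deriv_empirical[OF P U C(4) l'])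
    then show ?thesis unfolding A_def L_deriv2_def by (simp add: inner_axis z_def)
  qed
  ultimately have "((\<lambda>t. A t t) has_real_derivative B t t + L_deriv2 P u (empirical n (z t)) (x t) (z t l') $ a $ b / real n) (at t)"
    by (rule diagonal_derivative)
  then show ?thesis unfolding A_def B_def c_def zl .
qed

lemma coin_diff_commute:
  fixes F :: "(nat \<Rightarrow> 'n pattern) \<Rightarrow> real"
  assumes "(l, e) \<noteq> (l', e')"
  shows "coin_diff l e (coin_diff l' e' F) = coin_diff l' e' (coin_diff l e F)"
proof
  fix \<alpha> :: "nat \<Rightarrow> 'n pattern"
  let ?f = "\<lambda>l e b \<alpha>. \<alpha>(l := (\<alpha> l)(e := b))"
  have "?f l' e' b' (?f l e b \<alpha>) = ?f l e b (?f l' e' b' \<alpha>)" for b b'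
    using assms by (cases "l = l'") (auto simp: fun_upd_twist)
  then show "coin_diff l e (coin_diff l' e' F) \<alpha> = coin_diff l' e' (coin_diff l e F) \<alpha>"
    unfolding coin_diff_def by simp
qed

lemma node_upd:
  assumes m: "0 < m" and r: "r < m"
  shows "node k m (\<zeta>((a, r) := b)) = node k m (\<zeta>((a, r) := False)) + (of_bool b * (2 * k / real m)) *\<^sub>R axis a (1::real)"
  using node_True[OF m r, of k \<zeta> a] by (cases b) simp_all

text \<open>A difference of two distinct coins is a mixed difference over a rectangle of atom positions, to
  which the mean value theorem is applied once in each direction.\<close>

lemma coin_diff_coin_diff_mean_value:
  fixes u :: "(real^'n::finite) measure \<Rightarrow> real"
  assumes P: "prob_space P" and U: "has_uniform_variable P"
    and u: "u \<in> C2 P" and k: "0 < k" and m: "0 < m" and l: "l < n" "l' < n" and r: "r < m" "r' < m"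
    and ne: "(l, a, r) \<noteq> (l', b, r')"
  obtains z where "near_sample k m n \<alpha> z"
    "coin_diff l (a, r) (coin_diff l' (b, r') (sample_value k m n u)) \<alpha> = (2 * k / real m)\<^sup>2 *
      ((of_bool (l = l') * dx_L_deriv P u (empirical n z) (z l) $ a $ b
        + L_deriv2 P u (empirical n z) (z l) (z l') $ a $ b / real n) / real n)"
proof -
  let ?h = "2 * k / real m" and ?ea = "axis a (1::real) :: real^'n" and ?eb = "axis b (1::real) :: real^'n"
  let ?p = "L_deriv P u"
  have h: "0 < ?h" using k m by simp
  have up: "has_L_deriv P u ?p" using C2D(1)[OF u] has_L_deriv_L_deriv unfolding C1_def by blast
  define fl where "fl l e b \<alpha> = \<alpha>(l := (\<alpha> l)(e := b))" for l :: nat and e :: "'n \<times> nat" and b :: bool and \<alpha> :: "nat \<Rightarrow> 'n pattern"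
  define z0 where "z0 j = node k m (fl l' (b, r') False (fl l (a, r) False \<alpha>) j)" for j
  define zz where "zz s t = (z0(l' := z0 l' + t *\<^sub>R ?eb))(l := (z0(l' := z0 l' + t *\<^sub>R ?eb)) l + s *\<^sub>R ?ea)" for s t
  have zz: "zz s t j = z0 j + (of_bool (j = l) * s) *\<^sub>R ?ea + (of_bool (j = l') * t) *\<^sub>R ?eb" for s t j
    by (simp add: zz_def)
  have node_fl: "node k m (fl l' (b, r') v' (fl l (a, r) v \<alpha>) j) = zz (of_bool v * ?h) (of_bool v' * ?h) j" for v v' j
  proof (cases "l = l'")
    case False
    then show ?thesis
      unfolding zz z0_def fl_def
      using node_upd[OF m r(1), of k "\<alpha> l" a v] node_upd[OF m r(2), of k "\<alpha> l'" b v']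
      by (cases "j = l"; cases "j = l'") simp_all
  next
    case True
    then have ee: "(a, r) \<noteq> (b, r')" using ne by auto
    show ?thesis
    proof (cases "j = l")
      case False then show ?thesis using True by (simp add: zz z0_def fl_def)
    next
      case j: True
      let ?\<zeta> = "\<alpha> l"
      have "node k m ((?\<zeta>((a, r) := v))((b, r') := v'))
          = node k m ((?\<zeta>((a, r) := v))((b, r') := False)) + (of_bool v' * ?h) *\<^sub>R ?eb"
        by (rule node_upd[OF m r(2)])
      also have "(?\<zeta>((a, r) := v))((b, r') := False) = (?\<zeta>((b, r') := False))((a, r) := v)"
        by (rule fun_upd_twist[OF ee])
      also have "node k m \<dots> = node k m ((?\<zeta>((b, r') := False))((a, r) := False)) + (of_bool v * ?h) *\<^sub>R ?ea"
        by (rule node_upd[OF m r(1)])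
      also have "(?\<zeta>((b, r') := False))((a, r) := False) = (?\<zeta>((a, r) := False))((b, r') := False)"
        by (rule fun_upd_twist[OF ee[symmetric]])
      finally have eq: "node k m ((?\<zeta>((a, r) := v))((b, r') := v')) = node k m ((?\<zeta>((a, r) := False))((b, r') := False))
          + (of_bool v * ?h) *\<^sub>R ?ea + (of_bool v' * ?h) *\<^sub>R ?eb" .
      have e1: "fl l' (b, r') w' (fl l (a, r) w \<alpha>) j = (?\<zeta>((a, r) := w))((b, r') := w')" for w w'
        using True j by (simp add: fl_def)
      have z0j: "z0 j = node k m ((?\<zeta>((a, r) := False))((b, r') := False))" unfolding z0_def e1 ..
      have o: "of_bool (j = l) = (1::real)" "of_bool (j = l') = (1::real)" using True j by simp_all
      show ?thesis unfolding e1 zz z0j o mult_1 by (rule eq)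
    qed
  qed
  have val: "sample_value k m n u (fl l' (b, r') v' (fl l (a, r) v \<alpha>)) = u (empirical n (zz (of_bool v * ?h) (of_bool v' * ?h)))" for v v'
    unfolding sample_value_def node_fl ..
  have cd: "coin_diff l (a, r) (coin_diff l' (b, r') (sample_value k m n u)) \<alpha>
      = u (empirical n (zz ?h ?h)) - u (empirical n (zz ?h 0)) - (u (empirical n (zz 0 ?h)) - u (empirical n (zz 0 0)))"
    using val[of True True] val[of False True] val[of True False] val[of False False]
    unfolding coin_diff_def fl_def[symmetric] by simp
  have Ds: "((\<lambda>s. u (empirical n (zz s t))) has_real_derivative ?p (empirical n (zz s t)) (zz s t l) $ a / real n) (at s)" for s t
    using has_L_deriv_empirical[OF P U up l(1), of "z0(l' := z0 l' + t *\<^sub>R ?eb)" ?ea s]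
    by (simp add: zz_def inner_axis)
  have Dt: "((\<lambda>t. ?p (empirical n (zz s t)) (zz s t l) $ a / real n) has_real_derivative
      (of_bool (l = l') * dx_L_deriv P u (empirical n (zz s t)) (zz s t l) $ a $ b
        + L_deriv2 P u (empirical n (zz s t)) (zz s t l) (zz s t l') $ a $ b / real n) / real n) (at t)" for s t
  proof -
    define w where "w j = z0 j + (of_bool (j = l) * s) *\<^sub>R ?ea" for j
    have w: "w(l' := w l' + t *\<^sub>R ?eb) = zz s t" for t by (rule ext) (simp add: zz w_def)
    show ?thesis
      by (rule DERIV_cdivide, rule gradient_along_moving_sample[OF P U u l(2), of w b l a t, unfolded w])
  qed
  obtain \<theta> \<tau> where \<theta>: "0 \<le> \<theta>" "\<theta> \<le> ?h" and \<tau>: "0 \<le> \<tau>" "\<tau> \<le> ?h" and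
    eq: "u (empirical n (zz ?h ?h)) - u (empirical n (zz ?h 0)) - (u (empirical n (zz 0 ?h)) - u (empirical n (zz 0 0)))
      = ?h\<^sup>2 * ((of_bool (l = l') * dx_L_deriv P u (empirical n (zz \<theta> \<tau>)) (zz \<theta> \<tau> l) $ a $ b
        + L_deriv2 P u (empirical n (zz \<theta> \<tau>)) (zz \<theta> \<tau> l) (zz \<theta> \<tau> l') $ a $ b / real n) / real n)"
    by (rule mixed_difference_mean_value[OF h Ds Dt])
  have zb: "\<bar>zz \<theta> \<tau> j $ i\<bar> \<le> k" for j i
  proof -
    have corner: "\<bar>zz (of_bool v * ?h) (of_bool v' * ?h) j $ i\<bar> \<le> k" for v v'
      unfolding node_fl[symmetric] by (rule node_bound) (use k in simp)
    let ?A = "of_bool (j = l) * of_bool (i = a) :: real" and ?B = "of_bool (j = l') * of_bool (i = b) :: real"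
    have co: "zz s t j $ i = z0 j $ i + ?A * s + ?B * t" for s t by (simp add: zz axis_def)
    have AB: "0 \<le> ?A" "0 \<le> ?B" by simp_all
    have "\<bar>z0 j $ i\<bar> \<le> k" using corner[of False False] unfolding co by simp
    moreover have "\<bar>z0 j $ i + (?A * ?h + ?B * ?h)\<bar> \<le> k" using corner[of True True] unfolding co by (simp only: of_bool_eq mult_1 add.assoc)
    moreover have "0 \<le> ?A * \<theta> + ?B * \<tau>" by (rule add_nonneg_nonneg[OF mult_nonneg_nonneg[OF AB(1) \<theta>(1)] mult_nonneg_nonneg[OF AB(2) \<tau>(1)]])
    moreover have "?A * \<theta> + ?B * \<tau> \<le> ?A * ?h + ?B * ?h" by (rule add_mono[OF mult_left_mono[OF \<theta>(2) AB(1)] mult_left_mono[OF \<tau>(2) AB(2)]])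
    ultimately have "\<bar>z0 j $ i + (?A * \<theta> + ?B * \<tau>)\<bar> \<le> k" by (rule segment_in_box)
    then show ?thesis unfolding co by (simp only: add.assoc)
  qed
  have zc: "norm (zz \<theta> \<tau> j - node k m (\<alpha> j)) \<le> 8 * k / real m" for j
  proof -
    define v where "v = fl l (a, r) False \<alpha>"
    have 1: "norm (node k m (v j) - node k m (\<alpha> j)) \<le> ?h"
      using node_upd_close[OF m r(1), of k "\<alpha> l" a False] k by (cases "j = l") (simp_all add: v_def fl_def)
    have 2: "norm (z0 j - node k m (v j)) \<le> ?h"
      using node_upd_close[OF m r(2), of k "v l'" b False] k unfolding z0_def v_def[symmetric]
      by (cases "j = l'") (simp_all add: fl_def)
    have 3: "norm ((of_bool (j = l) * \<theta>) *\<^sub>R ?ea) \<le> ?h" using \<theta> h by simp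
    have 4: "norm ((of_bool (j = l') * \<tau>) *\<^sub>R ?eb) \<le> ?h" using \<tau> h by simp
    have "zz \<theta> \<tau> j - node k m (\<alpha> j) = ((z0 j - node k m (v j)) + (node k m (v j) - node k m (\<alpha> j)))
        + ((of_bool (j = l) * \<theta>) *\<^sub>R ?ea + (of_bool (j = l') * \<tau>) *\<^sub>R ?eb)"
      by (simp add: zz)
    also have "norm \<dots> \<le> (?h + ?h) + (?h + ?h)" by (intro norm_triangle_mono 1 2 3 4)
    also have "\<dots> = 8 * k / real m" by (simp add: add_divide_distrib[symmetric])
    finally show ?thesis .
  qed
  show ?thesis
    by (rule that[of "zz \<theta> \<tau>"]) (use zb zc cd eq in \<open>simp_all add: near_sample_def\<close>)
qed

section \<open>Concentration\<close>

text \<open>\<open>m\<close> is large in terms of \<open>K\<close> and the bound \<open>B\<close>, and \<open>n\<close> is large in terms of all three. The last two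
  conditions bound the expected defects of the sample, namely the noise in up to two prescribed
  samples and the deviation of the frequencies.\<close>

definition fine_sampling :: "'n::finite itself \<Rightarrow> real \<Rightarrow> real \<Rightarrow> nat \<Rightarrow> nat \<Rightarrow> bool" where
  "fine_sampling _ K B m n \<longleftrightarrow> 0 < m \<and> K \<le> real n \<and> K \<le> real m \<and> 8 * K\<^sup>2 / real m \<le> 1 \<and>
     real CARD('n) * K ^ 4 / real m \<le> 1 \<and>
     2 * K\<^sup>2 * (real CARD('n) * K\<^sup>2 / real m) \<le> 1 / (2 * K * (B + 1)) \<and>
     (\<exists>t>0. K\<^sup>2 * (2 * (real CARD('n) * K))\<^sup>2 *
        (real (card (patterns m :: 'n pattern set)) * (t + 10 / (real n * t))) \<le> 1 / (2 * K * (B + 1)))"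

lemma fine_sampling_ex:
  assumes K: "1 \<le> K" and B: "0 \<le> B"
  obtains m n where "fine_sampling TYPE('n::finite) K B m n"
proof -
  let ?d = "real CARD('n)"
  let ?\<eta> = "1 / (2 * K * (B + 1))"
  have \<eta>: "0 < ?\<eta>" using K B by simp
  have ev: "\<forall>\<^sub>F m in sequentially. c / real m < \<delta>" if "0 < \<delta>" for c \<delta> :: real
    using order_tendstoD(2)[OF lim_const_over_n that] .
  have "\<forall>\<^sub>F m in sequentially. 0 < m \<and> K \<le> real m \<and> 8 * K\<^sup>2 / real m < 1 \<and> ?d * K ^ 4 / real m < 1 \<and>
      2 * K\<^sup>2 * (?d * K\<^sup>2) / real m < ?\<eta>"
    using eventually_gt_at_top[of "0::nat"] ev[OF zero_less_one, of "8 * K\<^sup>2"] ev[OF zero_less_one, of "?d * K ^ 4"] ev[OF \<eta>, of "2 * K\<^sup>2 * (?d * K\<^sup>2)"]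
      eventually_ge_at_top[of "nat \<lceil>K\<rceil>"]
  proof eventually_elim
    case (elim m)
    then show ?case by (auto simp: nat_le_iff ceiling_le_iff)
  qed
  then obtain m where m: "0 < m" "K \<le> real m" "8 * K\<^sup>2 / real m < 1" "?d * K ^ 4 / real m < 1" "2 * K\<^sup>2 * (?d * K\<^sup>2) / real m < ?\<eta>"
    unfolding eventually_sequentially by blast
  let ?c = "K\<^sup>2 * (2 * (?d * K))\<^sup>2 * real (card (patterns m :: 'n pattern set))"
  obtain t where t: "0 < t" "\<forall>\<^sub>F n in sequentially. ?c * (t + 10 / (real n * t)) < ?\<eta>"
    using eventually_small_deviation_bound[of ?c ?\<eta>] \<eta> by auto
  from t(2) eventually_ge_at_top[of "nat \<lceil>K\<rceil>"]
  have "\<forall>\<^sub>F n in sequentially. ?c * (t + 10 / (real n * t)) < ?\<eta> \<and> K \<le> real n"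
  proof eventually_elim
    case (elim n)
    then show ?case by (auto simp: nat_le_iff ceiling_le_iff)
  qed
  then obtain n where n: "?c * (t + 10 / (real n * t)) < ?\<eta>" "K \<le> real n"
    unfolding eventually_sequentially by blast
  have "K\<^sup>2 * (2 * (?d * K))\<^sup>2 * (real (card (patterns m :: 'n pattern set)) * (t + 10 / (real n * t))) \<le> ?\<eta>"
    using n(1) by (simp only: mult.assoc less_imp_le)
  with t(1) have "\<exists>t>0. K\<^sup>2 * (2 * (?d * K))\<^sup>2 * (real (card (patterns m :: 'n pattern set)) * (t + 10 / (real n * t))) \<le> ?\<eta>"
    by blast
  moreover have "2 * K\<^sup>2 * (?d * K\<^sup>2 / real m) \<le> ?\<eta>" using m(5) by simp
  ultimately have "fine_sampling TYPE('n) K B m n"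
    unfolding fine_sampling_def using m n(2) by simp
  then show ?thesis by (rule that)
qed

text \<open>The samples in \<open>R\<close> are drawn at the points \<open>pt j\<close> and the others from \<open>\<mu>\<close>. A Markov inequality: the
  quantity \<open>br\<close> below is less than \<open>1\<close> only for samples to which the assumption \<open>close\<close> applies, and
  its expectation is at most \<open>1 / (K * (B + 1))\<close>, which beats the bound \<open>B\<close> for \<open>G\<close>.\<close>

lemma sampled_close:
  fixes \<mu> :: "(real^'n::finite) measure" and pt :: "nat \<Rightarrow> real^'n"
  assumes \<mu>: "\<mu> \<in> P2" and K: "1 \<le> K" and B: "0 \<le> B" and fine: "fine_sampling TYPE('n) K B m n"
    and R: "R \<subseteq> {..<n}" "card R \<le> 2"
    and wR: "\<And>j. j \<in> R \<Longrightarrow> w j = (\<lambda>\<zeta>. pattern_weight K m \<zeta> (pt j))"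
    and wN: "\<And>j. j < n \<Longrightarrow> j \<notin> R \<Longrightarrow> w j = mass K m \<mu>"
    and GB: "\<And>\<alpha>. \<alpha> \<in> PiE {..<n} (\<lambda>_. patterns m) \<Longrightarrow> \<bar>G \<alpha>\<bar> \<le> B"
    and \<epsilon>: "0 \<le> \<epsilon>"
    and close: "\<And>\<alpha>. \<alpha> \<in> PiE {..<n} (\<lambda>_. patterns m) \<Longrightarrow>
      W2 (empirical n (\<lambda>j. node K m (\<alpha> j))) \<mu> \<le> 3 / K + 2 * sqrt (truncation_error K \<mu>) \<Longrightarrow>
      (\<And>j. j \<in> R \<Longrightarrow> norm (node K m (\<alpha> j) - sine_map K (pt j)) \<le> 1 / K) \<Longrightarrow> \<bar>G \<alpha> - c\<bar> \<le> \<epsilon>"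
  shows "\<bar>sampled m n w G - c\<bar> \<le> \<epsilon> + (1 + \<bar>c\<bar>) / K"
proof -
  let ?d = "real CARD('n)" and ?Z = "patterns m :: 'n pattern set"
  let ?PS = "product_sum {..<n} ?Z w"
  have K0: "0 < K" using K by simp
  have m: "0 < m" and n: "0 < n" and Kn: "K \<le> real n" and d4: "?d * K ^ 4 / real m \<le> 1"
    and f1: "2 * K\<^sup>2 * (?d * K\<^sup>2 / real m) \<le> 1 / (2 * K * (B + 1))"
    using fine K unfolding fine_sampling_def by (auto intro: Nat.gr0I)
  obtain t where t: "0 < t" "K\<^sup>2 * (2 * (?d * K))\<^sup>2 * (real (card ?Z) * (t + 10 / (real n * t))) \<le> 1 / (2 * K * (B + 1))"
    using fine unfolding fine_sampling_def by blast
  have finR: "finite R" by (rule finite_subset[OF R(1)]) simp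
  have w0: "0 \<le> w j \<zeta>" if "j < n" for j \<zeta>
    using wR[of j] wN[OF that] by (cases "j \<in> R") (simp_all add: pattern_weight_nonneg mass_nonneg)
  have w1: "(\<Sum>\<zeta>\<in>?Z. w j \<zeta>) = 1" if "j < n" for j
    using wR[of j] wN[OF that] by (cases "j \<in> R") (simp_all add: sum_pattern_weight sum_mass[OF \<mu>])
  define b where "b \<alpha> = (\<Sum>\<zeta>\<in>?Z. \<bar>frequency n \<alpha> \<zeta> - mass K m \<mu> \<zeta>\<bar>)" for \<alpha>
  define q where "q j \<alpha> = (norm (node K m (\<alpha> j) - sine_map K (pt j)))\<^sup>2" for j and \<alpha> :: "nat \<Rightarrow> 'n pattern"
  \<comment> \<open>The defect of a sample; the factor \<open>K\<^sup>2\<close> makes \<open>br < 1\<close> imply errors of at most \<open>1 / K\<close>.\<close>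
  define br where "br \<alpha> = K\<^sup>2 * (2 * (?d * K))\<^sup>2 * b \<alpha> + (\<Sum>j\<in>R. K\<^sup>2 * q j \<alpha>)" for \<alpha>
  have b0: "0 \<le> b \<alpha>" for \<alpha> unfolding b_def by (rule sum_nonneg) simp
  have q0: "0 \<le> q j \<alpha>" for j \<alpha> unfolding q_def by simp
  have Kb0: "0 \<le> K\<^sup>2 * (2 * (?d * K))\<^sup>2 * b \<alpha>" for \<alpha> using b0 by simp
  have Kq0: "0 \<le> (\<Sum>j\<in>R. K\<^sup>2 * q j \<alpha>)" for \<alpha> by (rule sum_nonneg) (simp add: q0)
  have br0: "0 \<le> br \<alpha>" for \<alpha> unfolding br_def using Kb0 Kq0 by (rule add_nonneg_nonneg)
  have root: "x \<le> 1 / K" if "0 \<le> x" "K\<^sup>2 * x\<^sup>2 \<le> 1" for x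
  proof -
    have "(K * x)\<^sup>2 \<le> 1\<^sup>2" using that by (simp add: power_mult_distrib)
    then have "K * x \<le> 1" by (rule power2_le_imp_le) simp
    then show ?thesis using K0 by (simp add: le_divide_eq mult.commute)
  qed
  have pt: "\<bar>G \<alpha> - c\<bar> \<le> \<epsilon> + (B + \<bar>c\<bar>) * br \<alpha>" if \<alpha>: "\<alpha> \<in> PiE {..<n} (\<lambda>_. ?Z)" for \<alpha>
  proof (cases "br \<alpha> < 1")
    case False
    have "\<bar>G \<alpha> - c\<bar> \<le> B + \<bar>c\<bar>" using GB[OF \<alpha>] by linarith
    also have "\<dots> \<le> (B + \<bar>c\<bar>) * br \<alpha>" using False B mult_left_mono[of 1 "br \<alpha>" "B + \<bar>c\<bar>"] by simp
    finally show ?thesis using \<epsilon> by linarith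
  next
    case True
    have "K\<^sup>2 * (sqrt ((2 * (?d * K))\<^sup>2 * b \<alpha>))\<^sup>2 \<le> 1"
    proof -
      have "(sqrt ((2 * (?d * K))\<^sup>2 * b \<alpha>))\<^sup>2 = (2 * (?d * K))\<^sup>2 * b \<alpha>" using b0 by (intro real_sqrt_pow2 mult_nonneg_nonneg) auto
      then show ?thesis using True Kq0[of \<alpha>] unfolding br_def by (simp only: mult.assoc)
    qed
    then have s1: "sqrt ((2 * (?d * K))\<^sup>2 * b \<alpha>) \<le> 1 / K" by (intro root) (use b0 in auto)
    have s2: "sqrt (2 * (?d * K\<^sup>2 / real m) + 2 * truncation_error K \<mu>) \<le> 2 / K + 2 * sqrt (truncation_error K \<mu>)"
    proof (rule real_le_lsqrt)
      have "K\<^sup>2 * (?d * K\<^sup>2 / real m) \<le> 1" using d4 by (simp add: power4_eq_xxxx power2_eq_square ac_simps)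
      then have "?d * K\<^sup>2 / real m \<le> 1 / K\<^sup>2" using K0 by (simp add: le_divide_eq mult.commute)
      then have "2 * (?d * K\<^sup>2 / real m) + 2 * truncation_error K \<mu> \<le> 4 * (1 / K\<^sup>2) + 4 * truncation_error K \<mu>"
        using truncation_error_nonneg[of K \<mu>] zero_le_divide_1_iff[of "K\<^sup>2"] zero_le_power2[of K] by linarith
      also have "\<dots> = (2 / K)\<^sup>2 + (2 * sqrt (truncation_error K \<mu>))\<^sup>2"
        using truncation_error_nonneg[of K \<mu>] by (simp add: power_divide power_mult_distrib)
      also have "\<dots> \<le> (2 / K + 2 * sqrt (truncation_error K \<mu>))\<^sup>2"
        using K0 truncation_error_nonneg[of K \<mu>] by (simp add: power2_sum)
      finally show "2 * (?d * K\<^sup>2 / real m) + 2 * truncation_error K \<mu> \<le> (2 / K + 2 * sqrt (truncation_error K \<mu>))\<^sup>2" .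
    qed (use K0 truncation_error_nonneg[of K \<mu>] in simp)
    have W: "W2 (empirical n (\<lambda>j. node K m (\<alpha> j))) \<mu> \<le> 3 / K + 2 * sqrt (truncation_error K \<mu>)"
    proof -
      have "W2 (empirical n (\<lambda>j. node K m (\<alpha> j))) \<mu> \<le> 1 / K + (2 / K + 2 * sqrt (truncation_error K \<mu>))"
        using W2_empirical_nodes[OF \<mu> K0 m n \<alpha>] s1 s2 unfolding b_def by linarith
      also have "1 / K + (2 / K + 2 * sqrt (truncation_error K \<mu>)) = 3 / K + 2 * sqrt (truncation_error K \<mu>)"
        by (simp add: add_divide_distrib[symmetric])
      finally show ?thesis .
    qed
    have N: "norm (node K m (\<alpha> j) - sine_map K (pt j)) \<le> 1 / K" if j: "j \<in> R" for j
    proof (rule root)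
      have "K\<^sup>2 * q j \<alpha> \<le> (\<Sum>j\<in>R. K\<^sup>2 * q j \<alpha>)" by (rule member_le_sum[OF j]) (use finR q0 in auto)
      then show "K\<^sup>2 * (norm (node K m (\<alpha> j) - sine_map K (pt j)))\<^sup>2 \<le> 1"
        using True Kb0[of \<alpha>] unfolding br_def q_def by linarith
    qed simp
    have "\<bar>G \<alpha> - c\<bar> \<le> \<epsilon>" by (rule close[OF \<alpha> W N])
    moreover have "0 \<le> (B + \<bar>c\<bar>) * br \<alpha>" using B br0 by simp
    ultimately show ?thesis by linarith
  qed
  have PSb: "?PS b \<le> real (card ?Z) * (t + 10 / (real n * t))"
    unfolding b_def
  proof (rule frequency_deviation[OF n _ finR R(2)])
    show "w l \<zeta> = mass K m \<mu> \<zeta>" if "l < n" "l \<notin> R" for l \<zeta> using wN[OF that] by simp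
  qed (use w0 w1 t(1) in \<open>simp_all add: mass_nonneg mass_le_1[OF \<mu>]\<close>)
  have PSq: "?PS (q j) \<le> ?d * K\<^sup>2 / real m" if j: "j \<in> R" for j
  proof -
    have jn: "j \<in> {..<n}" using j R(1) by blast
    have "?PS (q j) = (\<Sum>\<zeta>\<in>?Z. w j \<zeta> * (norm (node K m \<zeta> - sine_map K (pt j)))\<^sup>2)"
      unfolding q_def
      by (rule product_sum_one_factor[OF finite_lessThan jn finite_patterns]) (use w1 in simp)
    also have "\<dots> \<le> ?d * K\<^sup>2 / real m" unfolding wR[OF j] by (rule node_variance[OF m])
    finally show ?thesis .
  qed
  have PSbr: "?PS br \<le> 1 / (K * (B + 1))"
  proof -
    have "?PS br = K\<^sup>2 * (2 * (?d * K))\<^sup>2 * ?PS b + (\<Sum>j\<in>R. K\<^sup>2 * ?PS (q j))"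
      unfolding br_def product_sum_add product_sum_sum product_sum_cmult ..
    also have "\<dots> \<le> K\<^sup>2 * (2 * (?d * K))\<^sup>2 * (real (card ?Z) * (t + 10 / (real n * t))) + (\<Sum>j\<in>R. K\<^sup>2 * (?d * K\<^sup>2 / real m))"
      by (intro add_mono mult_left_mono PSb sum_mono PSq) auto
    also have "(\<Sum>j\<in>R. K\<^sup>2 * (?d * K\<^sup>2 / real m)) = real (card R) * (K\<^sup>2 * (?d * K\<^sup>2 / real m))" by simp
    also have "\<dots> \<le> 2 * (K\<^sup>2 * (?d * K\<^sup>2 / real m))"
      using R(2) by (intro mult_right_mono) auto
    also have "2 * (K\<^sup>2 * (?d * K\<^sup>2 / real m)) = 2 * K\<^sup>2 * (?d * K\<^sup>2 / real m)" by simp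
    also note f1
    also have "K\<^sup>2 * (2 * (?d * K))\<^sup>2 * (real (card ?Z) * (t + 10 / (real n * t))) + 1 / (2 * K * (B + 1))
        \<le> 1 / (2 * K * (B + 1)) + 1 / (2 * K * (B + 1))" by (rule add_right_mono[OF t(2)])
    also have "1 / (2 * K * (B + 1)) + 1 / (2 * K * (B + 1)) = 1 / (K * (B + 1))"
    proof -
      have "1 / (2 * x) + 1 / (2 * x) = 1 / x" for x :: real by simp
      from this[of "K * (B + 1)"] show ?thesis by (simp only: mult.assoc)
    qed
    finally show ?thesis by simp
  qed
  have "\<bar>?PS G - c\<bar> = \<bar>?PS (\<lambda>\<alpha>. G \<alpha> - c)\<bar>"
    unfolding product_sum_diff using product_sum_const[of "{..<n}" ?Z w c] w1 by simp
  also have "\<dots> \<le> ?PS (\<lambda>\<alpha>. \<bar>G \<alpha> - c\<bar>)" by (rule product_sum_abs) (use w0 in simp)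
  also have "\<dots> \<le> ?PS (\<lambda>\<alpha>. \<epsilon> + (B + \<bar>c\<bar>) * br \<alpha>)" by (rule product_sum_mono) (use w0 pt in auto)
  also have "\<dots> = \<epsilon> + (B + \<bar>c\<bar>) * ?PS br"
    unfolding product_sum_add product_sum_cmult using product_sum_const[of "{..<n}" ?Z w \<epsilon>] w1 by simp
  also have "\<dots> \<le> \<epsilon> + (B + \<bar>c\<bar>) * (1 / (K * (B + 1)))"
    by (intro add_left_mono mult_left_mono PSbr) (use B in simp)
  also have "(B + \<bar>c\<bar>) * (1 / (K * (B + 1))) \<le> (1 + \<bar>c\<bar>) / K"
  proof -
    have "B + \<bar>c\<bar> \<le> (1 + \<bar>c\<bar>) * (B + 1)" using B by (simp add: algebra_simps)
    then have "(B + \<bar>c\<bar>) / (B + 1) \<le> 1 + \<bar>c\<bar>" using B by (simp add: divide_le_eq)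
    then have "(B + \<bar>c\<bar>) / (B + 1) / K \<le> (1 + \<bar>c\<bar>) / K" using K0 by (intro divide_right_mono) auto
    then show ?thesis by (simp add: mult.commute)
  qed
  finally show ?thesis by simp
qed

section \<open>The sampling scheme\<close>

text \<open>One choice of the numbers of coins and samples at the scales \<open>Suc k\<close> that serves finitely many
  functions \<open>\<Psi>\<close> at once. These stand for \<open>u\<close> and the components of its derivatives, the pair of points for
  their spatial variables.\<close>

locale sampling_scheme =
  fixes Fam :: "((real^'n::finite) measure \<times> ((real^'n) \<times> (real^'n)) \<Rightarrow> real) set"
    and B :: "nat \<Rightarrow> real" and m n :: "nat \<Rightarrow> nat"
  assumes cont: "\<Psi> \<in> Fam \<Longrightarrow> continuous_map (prod_topology W2_top euclidean) euclideanreal \<Psi>"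
    and B0: "0 \<le> B k"
    and bound: "\<Psi> \<in> Fam \<Longrightarrow> (\<And>j a. j < n k \<Longrightarrow> \<bar>z j $ a\<bar> \<le> real (Suc k)) \<Longrightarrow> l < n k \<Longrightarrow> l' < n k \<Longrightarrow>
      \<bar>\<Psi> (empirical (n k) z, (z l, z l'))\<bar> \<le> B k"
    and fine: "fine_sampling TYPE('n) (real (Suc k)) (B k) (m k) (n k)"

lemma box_bound:
  fixes Fam :: "((real^'n::finite) measure \<times> ((real^'n) \<times> (real^'n)) \<Rightarrow> real) set"
  assumes fin: "finite Fam" and cont: "\<And>\<Psi>. \<Psi> \<in> Fam \<Longrightarrow> continuous_map (prod_topology W2_top euclidean) euclideanreal \<Psi>"
    and R: "0 < R"
  shows "\<exists>B\<ge>0. \<forall>\<Psi>\<in>Fam. \<forall>n z l l'. (\<forall>j<n. \<forall>a. \<bar>z j $ a\<bar> \<le> R) \<longrightarrow> l < n \<longrightarrow> l' < n \<longrightarrow> \<bar>\<Psi> (empirical n z, (z l, z l'))\<bar> \<le> B"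
proof -
  obtain C :: "(real^'n) measure set" where C: "compactin W2_top C"
    "\<And>n z. 0 < n \<Longrightarrow> (\<And>l a. l < n \<Longrightarrow> \<bar>z l $ a\<bar> \<le> R) \<Longrightarrow> empirical n z \<in> C"
    using compact_superset_of_box_empiricals[OF R] by blast
  let ?Q = "cbox (\<chi> a. - R) (\<chi> a. R) :: (real^'n) set"
  have Q: "x \<in> ?Q \<longleftrightarrow> (\<forall>a. \<bar>x $ a\<bar> \<le> R)" for x
    unfolding mem_box_cart vec_lambda_beta abs_le_iff by (simp only: minus_le_iff conj_commute)
  have cQ: "compact (?Q \<times> ?Q)" by (intro compact_Times compact_cbox)
  have "\<forall>\<Psi>\<in>Fam. \<exists>b\<ge>0. \<forall>\<mu>\<in>C. \<forall>x\<in>?Q \<times> ?Q. \<bar>\<Psi> (\<mu>, x)\<bar> \<le> b"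
  proof
    fix \<Psi> assume "\<Psi> \<in> Fam"
    from cont[OF this] obtain b where "0 \<le> b" "\<And>\<mu> x. \<mu> \<in> C \<Longrightarrow> x \<in> ?Q \<times> ?Q \<Longrightarrow> \<bar>\<Psi> (\<mu>, x)\<bar> \<le> b"
      by (rule W2_prod_compact_bounded[OF _ C(1) cQ]) (rule that)
    then show "\<exists>b\<ge>0. \<forall>\<mu>\<in>C. \<forall>x\<in>?Q \<times> ?Q. \<bar>\<Psi> (\<mu>, x)\<bar> \<le> b" by blast
  qed
  from bchoice[OF this] obtain b where b: "\<And>\<Psi>. \<Psi> \<in> Fam \<Longrightarrow> 0 \<le> b \<Psi>"
    "\<And>\<Psi> \<mu> x. \<Psi> \<in> Fam \<Longrightarrow> \<mu> \<in> C \<Longrightarrow> x \<in> ?Q \<times> ?Q \<Longrightarrow> \<bar>\<Psi> (\<mu>, x)\<bar> \<le> b \<Psi>"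
    by blast
  show ?thesis
  proof (intro exI[of _ "\<Sum>\<Psi>\<in>Fam. b \<Psi>"] conjI ballI allI impI)
    show "0 \<le> (\<Sum>\<Psi>\<in>Fam. b \<Psi>)" by (rule sum_nonneg) (rule b(1))
    fix \<Psi> :: "(real^'n) measure \<times> ((real^'n) \<times> (real^'n)) \<Rightarrow> real" and n l l' :: nat and z :: "nat \<Rightarrow> real^'n"
    assume \<Psi>: "\<Psi> \<in> Fam" and z: "\<forall>j<n. \<forall>a. \<bar>z j $ a\<bar> \<le> R" and l: "l < n" "l' < n"
    have "empirical n z \<in> C" by (rule C(2)) (use l z in auto)
    moreover have "(z l, z l') \<in> ?Q \<times> ?Q" using z l by (simp only: mem_Times_iff fst_conv snd_conv Q) blast
    ultimately have "\<bar>\<Psi> (empirical n z, (z l, z l'))\<bar> \<le> b \<Psi>" by (rule b(2)[OF \<Psi>])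
    also have "b \<Psi> \<le> (\<Sum>\<Psi>\<in>Fam. b \<Psi>)" by (rule member_le_sum[OF \<Psi>]) (use fin b(1) in auto)
    finally show "\<bar>\<Psi> (empirical n z, (z l, z l'))\<bar> \<le> (\<Sum>\<Psi>\<in>Fam. b \<Psi>)" .
  qed
qed

lemma sampling_scheme_ex:
  fixes Fam :: "((real^'n::finite) measure \<times> ((real^'n) \<times> (real^'n)) \<Rightarrow> real) set"
  assumes fin: "finite Fam" and cont: "\<And>\<Psi>. \<Psi> \<in> Fam \<Longrightarrow> continuous_map (prod_topology W2_top euclidean) euclideanreal \<Psi>"
  shows "\<exists>B m n. sampling_scheme Fam B m n"
proof -
  have "\<forall>k. \<exists>b\<ge>0. \<forall>\<Psi>\<in>Fam. \<forall>n z l l'. (\<forall>j<n. \<forall>a. \<bar>z j $ a\<bar> \<le> real (Suc k)) \<longrightarrow> l < n \<longrightarrow> l' < n \<longrightarrow> \<bar>\<Psi> (empirical n z, (z l, z l'))\<bar> \<le> b"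
    by (intro allI box_bound[OF fin cont]) auto
  then obtain B where B: "\<And>k. 0 \<le> B k"
    "\<And>k \<Psi> n z l l'. \<Psi> \<in> Fam \<Longrightarrow> (\<forall>j<n. \<forall>a. \<bar>z j $ a\<bar> \<le> real (Suc k)) \<Longrightarrow> l < n \<Longrightarrow> l' < n \<Longrightarrow> \<bar>\<Psi> (empirical n z, (z l, z l'))\<bar> \<le> B k"
    by metis
  have "\<exists>mk nk. fine_sampling TYPE('n) (real (Suc k)) (B k) mk nk" for k
    by (rule fine_sampling_ex[of "real (Suc k)" "B k"]) (use B(1) in auto)
  then obtain m n where mn: "\<And>k. fine_sampling TYPE('n) (real (Suc k)) (B k) (m k) (n k)" by metis
  have "sampling_scheme Fam B m n"
    by (unfold_locales) (use cont B mn in auto)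
  then show ?thesis by blast
qed

lemma fine_samplingD:
  assumes "fine_sampling TYPE('n::finite) K B m n" "1 \<le> K"
  shows "0 < m" "0 < n" "K \<le> real n" "K \<le> real m" "8 * K / real m \<le> 1 / K"
proof -
  show "0 < m" "K \<le> real n" "K \<le> real m" using assms unfolding fine_sampling_def by simp_all
  then show "0 < n" using assms(2) by (cases n) auto
  have "8 * K\<^sup>2 / real m \<le> 1" using assms unfolding fine_sampling_def by simp
  then have "8 * K / real m * K \<le> 1" by (simp add: power2_eq_square)
  then show "8 * K / real m \<le> 1 / K" using assms(2) by (simp add: le_divide_eq)
qed

lemma eventually_div_Suc_less:
  assumes "0 < \<epsilon>"
  shows "\<forall>\<^sub>F k in sequentially. c / real (Suc k) < \<epsilon>"
proof -
  have "(\<lambda>k. c * (1 / real (Suc k))) \<longlonglongrightarrow> c * 0"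
    using LIMSEQ_inverse_real_of_nat by (intro tendsto_mult tendsto_const) (simp add: inverse_eq_divide)
  then show ?thesis using assms by (intro order_tendstoD(2)) auto
qed

context sampling_scheme
begin

abbreviation weights where
  "weights k \<mu> \<equiv> (\<lambda>_ :: nat. mass (real (Suc k)) (m k) (\<mu> :: (real^'n) measure))"

lemmas fineD = fine_samplingD[OF fine]

lemma close_value:
  fixes u :: "(real^'n) measure \<Rightarrow> real"
  assumes u: "(\<lambda>(\<mu>, _). u \<mu>) \<in> Fam" and M: "compactin W2_top M" and \<epsilon>: "0 < \<epsilon>"
  shows "\<forall>\<^sub>F k in sequentially. \<forall>\<mu>\<in>M.
    \<bar>sampled (m k) (n k) (weights k \<mu>) (sample_value (real (Suc k)) (m k) (n k) u) - u \<mu>\<bar> \<le> \<epsilon>"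
proof -
  have MP: "M \<subseteq> P2" using compactin_subset_topspace[OF M] by simp
  let ?K0 = "{0} :: ((real^'n) \<times> (real^'n)) set"
  have \<epsilon>2: "0 < \<epsilon> / 2" using \<epsilon> by simp
  obtain \<delta> where \<delta>: "0 < \<delta>" "\<forall>\<mu>\<in>M. \<forall>x\<in>?K0. \<forall>\<nu>\<in>P2. \<forall>y. W2 \<mu> \<nu> < \<delta> \<longrightarrow> dist x y < \<delta> \<longrightarrow> dist (u \<mu>) (u \<nu>) < \<epsilon> / 2"
    using W2_prod_compact_uniform[OF cont[OF u] M compact_sing \<epsilon>2, of 0] unfolding split_conv by (elim exE conjE) (rule that)
  obtain C where C0: "0 \<le> C" "\<And>\<mu> x. \<mu> \<in> M \<Longrightarrow> x \<in> ?K0 \<Longrightarrow> \<bar>u \<mu>\<bar> \<le> C"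
    by (rule W2_prod_compact_bounded[OF cont[OF u] M compact_sing[of 0], unfolded split_conv]) (rule that)
  have C: "\<bar>u \<mu>\<bar> \<le> C" if "\<mu> \<in> M" for \<mu> by (rule C0(2)[OF that singletonI])
  have \<delta>2: "0 < \<delta> / 2" and \<delta>4: "0 < \<delta> / 4" using \<delta>(1) by auto
  show ?thesis
    using eventually_div_Suc_less[OF \<epsilon>2, of "1 + C"] eventually_div_Suc_less[OF \<delta>2, of 3] truncation_error_uniform[OF M \<delta>4]
  proof eventually_elim
    case (elim k)
    let ?K = "real (Suc k)"
    have K1: "1 \<le> ?K" by simp
    show ?case
    proof
      fix \<mu> assume \<mu>: "\<mu> \<in> M"
      have "\<bar>sampled (m k) (n k) (weights k \<mu>) (sample_value ?K (m k) (n k) u) - u \<mu>\<bar> \<le> \<epsilon> / 2 + (1 + \<bar>u \<mu>\<bar>) / ?K"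
      proof (rule sampled_close[OF _ K1 B0 fine, where R="{}"])
        fix \<alpha> :: "nat \<Rightarrow> 'n pattern"
        show "\<bar>sample_value ?K (m k) (n k) u \<alpha>\<bar> \<le> B k"
          unfolding sample_value_def
          by (rule bound[OF u, where l=0 and l'=0, unfolded split_conv, OF _ fineD(2)[OF K1] fineD(2)[OF K1]])
             (rule node_bound, simp)
        assume W: "W2 (empirical (n k) (\<lambda>j. node ?K (m k) (\<alpha> j))) \<mu> \<le> 3 / ?K + 2 * sqrt (truncation_error ?K \<mu>)"
        have "sqrt (truncation_error ?K \<mu>) < \<delta> / 4" using elim(3) \<mu> by blast
        with W elim(2) have "W2 (empirical (n k) (\<lambda>j. node ?K (m k) (\<alpha> j))) \<mu> < \<delta>" by linarith
        then have W': "W2 \<mu> (empirical (n k) (\<lambda>j. node ?K (m k) (\<alpha> j))) < \<delta>" by (subst W2_commute)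
        have "dist (u \<mu>) (u (empirical (n k) (\<lambda>j. node ?K (m k) (\<alpha> j)))) < \<epsilon> / 2"
          by (rule \<delta>(2)[rule_format, OF \<mu> singletonI empirical_P2[OF fineD(2)[OF K1]] W', of 0]) (simp add: \<delta>(1))
        then show "\<bar>sample_value ?K (m k) (n k) u \<alpha> - u \<mu>\<bar> \<le> \<epsilon> / 2"
          by (simp add: sample_value_def dist_real_def abs_minus_commute)
      qed (use \<mu> MP \<epsilon> in auto)
      also have "(1 + \<bar>u \<mu>\<bar>) / ?K \<le> (1 + C) / ?K" using C[OF \<mu>] by (intro divide_right_mono) auto
      also have "\<dots> \<le> \<epsilon> / 2" using elim(1) by simp
      finally show "\<bar>sampled (m k) (n k) (weights k \<mu>) (sample_value ?K (m k) (n k) u) - u \<mu>\<bar> \<le> \<epsilon>" by simp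
    qed
  qed
qed

text \<open>The samples \<open>l\<close> and \<open>l'\<close> are drawn at \<open>x\<close> and \<open>y\<close>; they then end up near these points, and the empirical
  measure near \<open>\<mu>\<close>. The points \<open>z \<alpha>\<close> leave room for the intermediate positions of the mean value theorem.\<close>

lemma close_pair:
  assumes \<Psi>: "\<Psi> \<in> Fam" and M: "compactin W2_top M" and Q: "compact Q" and \<epsilon>: "0 < \<epsilon>"
  shows "\<forall>\<^sub>F k in sequentially. \<forall>\<mu>\<in>M. \<forall>x\<in>Q. \<forall>y\<in>Q. \<forall>l<n k. \<forall>l'<n k. \<forall>z. (l = l' \<longrightarrow> x = y) \<longrightarrow>
    (\<forall>\<alpha>. near_sample (real (Suc k)) (m k) (n k) \<alpha> (z \<alpha>)) \<longrightarrow>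
    \<bar>sampled (m k) (n k)
        ((weights k \<mu>)(l := (\<lambda>\<zeta>. pattern_weight (real (Suc k)) (m k) \<zeta> x), l' := (\<lambda>\<zeta>. pattern_weight (real (Suc k)) (m k) \<zeta> y)))
        (\<lambda>\<alpha>. \<Psi> (empirical (n k) (z \<alpha>), (z \<alpha> l, z \<alpha> l'))) - \<Psi> (\<mu>, (x, y))\<bar> \<le> \<epsilon>"
proof -
  have MP: "M \<subseteq> P2" using compactin_subset_topspace[OF M] by simp
  have QQ: "compact (Q \<times> Q)" by (rule compact_Times[OF Q Q])
  have \<epsilon>2: "0 < \<epsilon> / 2" using \<epsilon> by simp
  obtain \<delta> where \<delta>: "0 < \<delta>" "\<forall>\<mu>\<in>M. \<forall>x\<in>Q \<times> Q. \<forall>\<nu>\<in>P2. \<forall>y. W2 \<mu> \<nu> < \<delta> \<longrightarrow> dist x y < \<delta> \<longrightarrow> dist (\<Psi> (\<mu>, x)) (\<Psi> (\<nu>, y)) < \<epsilon> / 2"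
    using W2_prod_compact_uniform[OF cont[OF \<Psi>] M QQ \<epsilon>2] by (elim exE conjE) (rule that)
  obtain C where C: "0 \<le> C" "\<And>\<mu> x. \<mu> \<in> M \<Longrightarrow> x \<in> Q \<times> Q \<Longrightarrow> \<bar>\<Psi> (\<mu>, x)\<bar> \<le> C"
    by (rule W2_prod_compact_bounded[OF cont[OF \<Psi>] M QQ]) (rule that)
  obtain X where X: "\<And>x. x \<in> Q \<Longrightarrow> norm x \<le> X" "0 \<le> X"
    using compact_imp_bounded[OF Q] unfolding bounded_pos by (auto intro: less_imp_le)
  let ?d = "real CARD('n)"
  let ?D = "2 + ?d * X\<^sup>2"
  have \<delta>2: "0 < \<delta> / 2" and \<delta>4: "0 < \<delta> / 4" using \<delta>(1) by auto
  show ?thesis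
    using eventually_div_Suc_less[OF \<epsilon>2, of "1 + C"] eventually_div_Suc_less[OF \<delta>2, of 4]
      eventually_div_Suc_less[OF \<delta>2, of ?D] truncation_error_uniform[OF M \<delta>4]
  proof eventually_elim
    case (elim k)
    let ?K = "real (Suc k)"
    have K1: "1 \<le> ?K" and K0: "0 < ?K" by simp_all
    note f = fineD[OF K1]
    have sm: "norm (sine_map ?K x - x) \<le> ?d * X\<^sup>2 / ?K" if "x \<in> Q" for x
    proof -
      have "norm (sine_map ?K x - x) \<le> ?d * (norm x)\<^sup>2 / (2 * ?K)" by (rule sine_map_error_square[OF K0])
      also have "\<dots> \<le> ?d * X\<^sup>2 / ?K"
      proof (rule frac_le)
        show "?d * (norm x)\<^sup>2 \<le> ?d * X\<^sup>2" using X(1)[OF that] by (intro mult_left_mono power_mono) auto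
      qed auto
      finally show ?thesis .
    qed
    show ?case
    proof (intro ballI allI impI)
      fix \<mu> x y l l' and z :: "(nat \<Rightarrow> 'n pattern) \<Rightarrow> nat \<Rightarrow> real^'n"
      assume \<mu>: "\<mu> \<in> M" and x: "x \<in> Q" and y: "y \<in> Q" and l: "l < n k" "l' < n k" and ll: "l = l' \<longrightarrow> x = y"
        and near: "\<forall>\<alpha>. near_sample ?K (m k) (n k) \<alpha> (z \<alpha>)"
      let ?w = "(weights k \<mu>)(l := (\<lambda>\<zeta>. pattern_weight ?K (m k) \<zeta> x), l' := (\<lambda>\<zeta>. pattern_weight ?K (m k) \<zeta> y))"
      let ?pt = "\<lambda>j. if j = l then x else y"
      let ?c = "\<Psi> (\<mu>, (x, y))"
      have card2: "card {l, l'} \<le> 2" by (simp add: card_insert_if)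
      have "\<bar>sampled (m k) (n k) ?w (\<lambda>\<alpha>. \<Psi> (empirical (n k) (z \<alpha>), (z \<alpha> l, z \<alpha> l'))) - ?c\<bar> \<le> \<epsilon> / 2 + (1 + \<bar>?c\<bar>) / ?K"
      proof (rule sampled_close[OF _ K1 B0 fine, where R="{l, l'}" and pt="?pt"])
        show "?w j = (\<lambda>\<zeta>. pattern_weight ?K (m k) \<zeta> (?pt j))" if "j \<in> {l, l'}" for j
          using that ll by auto
        fix \<alpha> :: "nat \<Rightarrow> 'n pattern"
        have zb: "\<bar>z \<alpha> j $ a\<bar> \<le> ?K" and zc: "norm (z \<alpha> j - node ?K (m k) (\<alpha> j)) \<le> 1 / ?K" if "j < n k" for j a
          using near that f(5) unfolding near_sample_def by (blast, meson order_trans)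
        show "\<bar>\<Psi> (empirical (n k) (z \<alpha>), (z \<alpha> l, z \<alpha> l'))\<bar> \<le> B k" by (rule bound[OF \<Psi> zb l])
        assume W: "W2 (empirical (n k) (\<lambda>j. node ?K (m k) (\<alpha> j))) \<mu> \<le> 3 / ?K + 2 * sqrt (truncation_error ?K \<mu>)"
          and N: "\<And>j. j \<in> {l, l'} \<Longrightarrow> norm (node ?K (m k) (\<alpha> j) - sine_map ?K (?pt j)) \<le> 1 / ?K"
        have E: "empirical (n k) (z \<alpha>) \<in> P2" "empirical (n k) (\<lambda>j. node ?K (m k) (\<alpha> j)) \<in> P2" by (rule empirical_P2[OF f(2)])+
        have \<mu>P: "\<mu> \<in> P2" using \<mu> MP by blast
        have "W2 (empirical (n k) (z \<alpha>)) (empirical (n k) (\<lambda>j. node ?K (m k) (\<alpha> j))) \<le> 1 / ?K"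
          by (rule W2_empirical_le[OF f(2) zc])
        moreover have "sqrt (truncation_error ?K \<mu>) < \<delta> / 4" using elim(4) \<mu> by blast
        moreover have "1 / ?K + 3 / ?K < \<delta> / 2" using elim(2) by (simp add: add_divide_distrib[symmetric])
        ultimately have "W2 (empirical (n k) (z \<alpha>)) \<mu> < \<delta>"
          using W2_triangle[OF E \<mu>P] W by linarith
        then have W': "W2 \<mu> (empirical (n k) (z \<alpha>)) < \<delta>" by (subst W2_commute)
        have dj: "dist (?pt j) (z \<alpha> j) < \<delta> / 2" if j: "j \<in> {l, l'}" for j
        proof -
          have jn: "j < n k" using j l by auto
          have pQ: "?pt j \<in> Q" using x y by simp
          have "norm (z \<alpha> j - ?pt j) \<le> norm (z \<alpha> j - node ?K (m k) (\<alpha> j)) + norm (node ?K (m k) (\<alpha> j) - sine_map ?K (?pt j)) + norm (sine_map ?K (?pt j) - ?pt j)"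
          proof -
            have "z \<alpha> j - ?pt j = (z \<alpha> j - node ?K (m k) (\<alpha> j)) + (node ?K (m k) (\<alpha> j) - sine_map ?K (?pt j)) + (sine_map ?K (?pt j) - ?pt j)"
              by simp
            then show ?thesis by (metis norm_triangle_mono order_refl)
          qed
          also have "\<dots> \<le> 1 / ?K + 1 / ?K + ?d * X\<^sup>2 / ?K" by (intro add_mono zc[OF jn] N[OF j] sm[OF pQ])
          also have "\<dots> = ?D / ?K" by (simp add: add_divide_distrib)
          also have "\<dots> < \<delta> / 2" by (rule elim(3))
          finally show ?thesis by (simp add: dist_norm norm_minus_commute)
        qed
        have "dist x (z \<alpha> l) < \<delta> / 2" using dj[of l] by simp
        moreover have "dist y (z \<alpha> l') < \<delta> / 2" using dj[of l'] ll by (auto split: if_splits)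
        moreover have "dist (x, y) (z \<alpha> l, z \<alpha> l') \<le> dist x (z \<alpha> l) + dist y (z \<alpha> l')"
          unfolding dist_Pair_Pair by (rule sqrt_sum_squares_le_sum) simp_all
        ultimately have "dist (x, y) (z \<alpha> l, z \<alpha> l') < \<delta>" by linarith
        then have "dist ?c (\<Psi> (empirical (n k) (z \<alpha>), (z \<alpha> l, z \<alpha> l'))) < \<epsilon> / 2"
          using \<delta>(2) \<mu> x y W' E(1) by blast
        then show "\<bar>\<Psi> (empirical (n k) (z \<alpha>), (z \<alpha> l, z \<alpha> l')) - ?c\<bar> \<le> \<epsilon> / 2"
          by (simp add: dist_real_def abs_minus_commute)
      qed (use \<mu> MP \<epsilon> l card2 in auto)
      also have "(1 + \<bar>?c\<bar>) / ?K \<le> (1 + C) / ?K" using C(2)[OF \<mu>, of "(x, y)"] x y by (intro divide_right_mono) auto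
      also have "\<dots> \<le> \<epsilon> / 2" using elim(1) by simp
      finally show "\<bar>sampled (m k) (n k) ?w (\<lambda>\<alpha>. \<Psi> (empirical (n k) (z \<alpha>), (z \<alpha> l, z \<alpha> l'))) - ?c\<bar> \<le> \<epsilon>" by simp
    qed
  qed
qed

end

section \<open>Averages\<close>

lemma average_close:
  fixes f :: "'i \<Rightarrow> real"
  assumes S: "finite S" "card S \<le> N" "0 < N" and f: "\<And>i. i \<in> S \<Longrightarrow> \<bar>f i - c\<bar> \<le> \<epsilon>" and \<epsilon>: "0 \<le> \<epsilon>"
  shows "\<bar>(\<Sum>i\<in>S. f i) / real N - c\<bar> \<le> \<epsilon> + \<bar>c\<bar> * ((real N - real (card S)) / real N)"
proof -
  have "\<bar>(\<Sum>i\<in>S. f i) - real N * c\<bar> = \<bar>(\<Sum>i\<in>S. f i - c) - (real N - real (card S)) * c\<bar>"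
    by (simp add: sum_subtractf algebra_simps)
  also have "\<dots> \<le> \<bar>\<Sum>i\<in>S. f i - c\<bar> + \<bar>(real N - real (card S)) * c\<bar>" by (rule abs_triangle_ineq4)
  also have "\<bar>\<Sum>i\<in>S. f i - c\<bar> \<le> (\<Sum>i\<in>S. \<bar>f i - c\<bar>)" by (rule sum_abs)
  also have "\<dots> \<le> (\<Sum>i\<in>S. \<epsilon>)" by (rule sum_mono) (rule f)
  also have "\<dots> = real (card S) * \<epsilon>" by simp
  also have "\<dots> \<le> real N * \<epsilon>" using S(2) \<epsilon> by (intro mult_right_mono) auto
  also have "\<bar>(real N - real (card S)) * c\<bar> = (real N - real (card S)) * \<bar>c\<bar>" using S(2) by (simp add: abs_mult)
  finally have le: "\<bar>(\<Sum>i\<in>S. f i) - real N * c\<bar> \<le> real N * \<epsilon> + (real N - real (card S)) * \<bar>c\<bar>" by simp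
  have "(\<Sum>i\<in>S. f i) / real N - c = ((\<Sum>i\<in>S. f i) - real N * c) / real N" using S(3) by (simp add: diff_divide_distrib)
  then have "\<bar>(\<Sum>i\<in>S. f i) / real N - c\<bar> = \<bar>(\<Sum>i\<in>S. f i) - real N * c\<bar> / real N" by (simp add: abs_divide)
  also have "\<dots> \<le> (real N * \<epsilon> + (real N - real (card S)) * \<bar>c\<bar>) / real N" by (rule divide_right_mono[OF le]) simp
  also have "\<dots> = \<epsilon> + \<bar>c\<bar> * ((real N - real (card S)) / real N)" using S(3) by (simp add: add_divide_distrib mult.commute)
  finally show ?thesis .
qed

lemma average_close_all:
  fixes f :: "nat \<Rightarrow> real"
  assumes "0 < N" and f: "\<And>i. i < N \<Longrightarrow> \<bar>f i - c\<bar> \<le> \<epsilon>" and \<epsilon>: "0 \<le> \<epsilon>"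
  shows "\<bar>(\<Sum>i<N. f i) / real N - c\<bar> \<le> \<epsilon>"
  using average_close[of "{..<N}" N f c \<epsilon>] assms by simp

lemma average_close_all_but_one:
  fixes f :: "nat \<Rightarrow> real"
  assumes "0 < N" "j < N" and f: "\<And>i. i < N \<Longrightarrow> i \<noteq> j \<Longrightarrow> \<bar>f i - c\<bar> \<le> \<epsilon>" and \<epsilon>: "0 \<le> \<epsilon>"
  shows "\<bar>(\<Sum>i\<in>{..<N} - {j}. f i) / real N - c\<bar> \<le> \<epsilon> + \<bar>c\<bar> / real N"
proof -
  have "real (card ({..<N} - {j})) = real N - 1" using assms(1,2) by (simp add: of_nat_diff)
  then show ?thesis using average_close[of "{..<N} - {j}" N f c \<epsilon>] assms by simp
qed

section \<open>Derivatives of the approximants\<close>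

definition approximant ::
  "real \<Rightarrow> nat \<Rightarrow> nat \<Rightarrow> ((real^'n::finite) measure \<Rightarrow> real) \<Rightarrow> (real^'n) measure \<Rightarrow> real" where
  "approximant K m n u \<mu> = sampled m n (\<lambda>_. mass K m \<mu>) (sample_value K m n u)"

lemma approximant_C_infty:
  fixes u :: "(real^'n::finite) measure \<Rightarrow> real"
  assumes P: "prob_space P" and U: "has_uniform_variable P"
  shows "approximant K m n u \<in> C_infty P"
proof -
  have mass: "cylinder j (\<lambda>\<mu> _. mass K m \<mu> \<zeta>)" for j and \<zeta> :: "'n \<times> nat \<Rightarrow> bool"
    unfolding mass_def by (rule cyl_integral[OF trig_pattern_weight])
  have "cylinder 0 (\<lambda>\<mu> _. approximant K m n u \<mu>)"
    unfolding approximant_def product_sum_def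
    by (intro cylinder_sum cyl_mult cylinder_prod mass cyl_const finite_PiE finite_lessThan finite_patterns)
  then show ?thesis unfolding C_infty_def using cylinder_Cn[OF P U] by blast
qed

text \<open>The slopes are the derivatives of the approximants up to cosine factors. They are sums of expected
  coin differences, with the samples carrying a differentiated weight drawn at the spatial variables.\<close>

definition slope ::
  "real \<Rightarrow> nat \<Rightarrow> nat \<Rightarrow> ((nat \<Rightarrow> 'n pattern) \<Rightarrow> real) \<Rightarrow> (real^'n::finite) measure \<Rightarrow> 'n \<Rightarrow> real^'n \<Rightarrow> real" where
  "slope K m n V \<mu> a x = (\<Sum>l<n. \<Sum>r<m.
     sampled m n ((\<lambda>_. mass K m \<mu>)(l := (\<lambda>\<zeta>. pattern_weight K m \<zeta> x))) (coin_diff l (a, r) V)) / (2 * K)"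

definition slope_dx ::
  "real \<Rightarrow> nat \<Rightarrow> nat \<Rightarrow> ((nat \<Rightarrow> 'n pattern) \<Rightarrow> real) \<Rightarrow> (real^'n::finite) measure \<Rightarrow> 'n \<Rightarrow> 'n \<Rightarrow> real^'n \<Rightarrow> real" where
  "slope_dx K m n V \<mu> a b x = (\<Sum>l<n. \<Sum>r<m. \<Sum>r'<m.
     sampled m n ((\<lambda>_. mass K m \<mu>)(l := (\<lambda>\<zeta>. pattern_weight K m \<zeta> x)))
       (coin_diff l (b, r') (coin_diff l (a, r) V))) / (2 * K)\<^sup>2"

definition slope_dmu ::
  "real \<Rightarrow> nat \<Rightarrow> nat \<Rightarrow> ((nat \<Rightarrow> 'n pattern) \<Rightarrow> real) \<Rightarrow> (real^'n::finite) measure \<Rightarrow> 'n \<Rightarrow> 'n \<Rightarrow> real^'n \<Rightarrow> real^'n \<Rightarrow> real" where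
  "slope_dmu K m n V \<mu> a b x y = (\<Sum>l<n. \<Sum>r<m. \<Sum>l'\<in>{..<n} - {l}. \<Sum>r'<m.
     sampled m n ((\<lambda>_. mass K m \<mu>)(l := (\<lambda>\<zeta>. pattern_weight K m \<zeta> x), l' := (\<lambda>\<zeta>. pattern_weight K m \<zeta> y)))
       (coin_diff l' (b, r') (coin_diff l (a, r) V))) / (2 * K)\<^sup>2"

lemma L_deriv_approximant:
  fixes u :: "(real^'n::finite) measure \<Rightarrow> real"
  assumes P: "prob_space P" and U: "has_uniform_variable P"
    and \<mu>: "\<mu> \<in> P2"
  shows "L_deriv P (approximant K m n u) \<mu> x $ a = cos (x $ a / K) * slope K m n (sample_value K m n u) \<mu> a x"
proof -
  let ?V = "sample_value K m n u"
  have "Lsmooth P (approximant K m n u)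
    (\<lambda>\<mu> y. \<chi> b. \<Sum>l<n. sampled m n ((\<lambda>_. mass K m \<mu>)(l := (\<lambda>\<zeta>. pattern_weight_partial K m b \<zeta> y))) ?V)"
    using Lsmooth_product_sum[OF P finite_lessThan[of n], where R="{}" and k=K and m=m and F="?V"]
    unfolding approximant_def[abs_def] by simp
  from L_deriv_eq[OF P U Lsmooth_has_L_deriv[OF P this] \<mu>, of x]
  have "L_deriv P (approximant K m n u) \<mu> x $ a =
    (\<Sum>l<n. sampled m n ((\<lambda>_. mass K m \<mu>)(l := (\<lambda>\<zeta>. pattern_weight_partial K m a \<zeta> x))) ?V)" by simp
  also have "\<dots> = (\<Sum>l<n. cos (x $ a / K) / (2 * K) * (\<Sum>r<m.
     sampled m n ((\<lambda>_. mass K m \<mu>)(l := (\<lambda>\<zeta>. pattern_weight K m \<zeta> x))) (coin_diff l (a, r) ?V)))"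
    by (rule sum.cong[OF refl]) (rule sampled_partial, simp)
  also have "\<dots> = cos (x $ a / K) / (2 * K) * (\<Sum>l<n. \<Sum>r<m.
     sampled m n ((\<lambda>_. mass K m \<mu>)(l := (\<lambda>\<zeta>. pattern_weight K m \<zeta> x))) (coin_diff l (a, r) ?V))"
    by (rule sum_distrib_left[symmetric])
  finally show ?thesis by (simp add: slope_def)
qed

lemma slope_has_derivative:
  fixes x :: "real^'n::finite"
  shows "(slope K m n V \<mu> a has_derivative (\<lambda>h. \<Sum>b\<in>UNIV. cos (x $ b / K) * slope_dx K m n V \<mu> a b x * h $ b)) (at x)"
proof -
  let ?S = "\<lambda>l x F. sampled m n ((\<lambda>_. mass K m \<mu>)(l := (\<lambda>\<zeta>. pattern_weight K m \<zeta> x))) F"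
  let ?S' = "\<lambda>l b x F. sampled m n ((\<lambda>_. mass K m \<mu>)(l := (\<lambda>\<zeta>. pattern_weight_partial K m b \<zeta> x))) F"
  have "((\<lambda>x. \<Sum>l<n. \<Sum>r<m. ?S l x (coin_diff l (a, r) V)) has_derivative
      (\<lambda>h. \<Sum>l<n. \<Sum>r<m. \<Sum>b\<in>UNIV. ?S' l b x (coin_diff l (a, r) V) * h $ b)) (at x)"
    by (intro has_derivative_sum sampled_has_derivative) simp
  from has_derivative_mult_right[OF this, of "1 / (2 * K)"]
  have D: "(slope K m n V \<mu> a has_derivative
      (\<lambda>h. 1 / (2 * K) * (\<Sum>l<n. \<Sum>r<m. \<Sum>b\<in>UNIV. ?S' l b x (coin_diff l (a, r) V) * h $ b))) (at x)"
    unfolding slope_def[abs_def] by simp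
  have S': "?S' l b x F = cos (x $ b / K) / (2 * K) * (\<Sum>r'<m. ?S l x (coin_diff l (b, r') F))" if "l < n" for l b F
    by (rule sampled_partial[OF that])
  have "1 / (2 * K) * (\<Sum>l<n. \<Sum>r<m. \<Sum>b\<in>UNIV. ?S' l b x (coin_diff l (a, r) V) * h $ b)
     = (\<Sum>b\<in>UNIV. cos (x $ b / K) * slope_dx K m n V \<mu> a b x * h $ b)" for h
  proof -
    have "(\<Sum>l<n. \<Sum>r<m. \<Sum>b\<in>UNIV. ?S' l b x (coin_diff l (a, r) V) * h $ b)
        = (\<Sum>l<n. \<Sum>b\<in>UNIV. \<Sum>r<m. ?S' l b x (coin_diff l (a, r) V) * h $ b)"
      by (intro sum.cong refl sum.swap)
    also have "\<dots> = (\<Sum>b\<in>UNIV. \<Sum>l<n. \<Sum>r<m. ?S' l b x (coin_diff l (a, r) V) * h $ b)" by (rule sum.swap)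
    finally have e: "(\<Sum>l<n. \<Sum>r<m. \<Sum>b\<in>UNIV. ?S' l b x (coin_diff l (a, r) V) * h $ b)
        = (\<Sum>b\<in>UNIV. \<Sum>l<n. \<Sum>r<m. ?S' l b x (coin_diff l (a, r) V) * h $ b)" .
    have "1 / (2 * K) * (\<Sum>b\<in>UNIV. \<Sum>l<n. \<Sum>r<m. ?S' l b x (coin_diff l (a, r) V) * h $ b)
        = (\<Sum>b\<in>UNIV. 1 / (2 * K) * (\<Sum>l<n. \<Sum>r<m. ?S' l b x (coin_diff l (a, r) V) * h $ b))"
      by (rule sum_distrib_left)
    also have "\<dots> = (\<Sum>b\<in>UNIV. cos (x $ b / K) * slope_dx K m n V \<mu> a b x * h $ b)"
    proof (rule sum.cong[OF refl])
      fix b :: 'n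
      have "(\<Sum>l<n. \<Sum>r<m. ?S' l b x (coin_diff l (a, r) V) * h $ b)
        = (\<Sum>l<n. \<Sum>r<m. cos (x $ b / K) / (2 * K) * (\<Sum>r'<m. ?S l x (coin_diff l (b, r') (coin_diff l (a, r) V))) * h $ b)"
        by (intro sum.cong refl arg_cong2[where f="(*)"] S') simp
      also have "\<dots> = cos (x $ b / K) / (2 * K) * (\<Sum>l<n. \<Sum>r<m. \<Sum>r'<m. ?S l x (coin_diff l (b, r') (coin_diff l (a, r) V))) * h $ b"
        unfolding sum_distrib_left sum_distrib_right ..
      finally show "1 / (2 * K) * (\<Sum>l<n. \<Sum>r<m. ?S' l b x (coin_diff l (a, r) V) * h $ b) = cos (x $ b / K) * slope_dx K m n V \<mu> a b x * h $ b"
        unfolding slope_dx_def by (simp add: power2_eq_square)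
    qed
    finally show ?thesis unfolding e .
  qed
  with D show ?thesis by simp
qed

text \<open>The second term comes from the cosine in front of the slope.\<close>

lemma dx_L_deriv_approximant:
  fixes u :: "(real^'n::finite) measure \<Rightarrow> real"
  assumes P: "prob_space P" and U: "has_uniform_variable P"
    and \<mu>: "\<mu> \<in> P2"
  shows "dx_L_deriv P (approximant K m n u) \<mu> x $ a $ b =
    cos (x $ a / K) * (cos (x $ b / K) * slope_dx K m n (sample_value K m n u) \<mu> a b x) - of_bool (a = b) * (sin (x $ a / K) / K * slope K m n (sample_value K m n u) \<mu> a x)"
proof -
  let ?V = "sample_value K m n u"
  let ?D = "\<lambda>a h. cos (x $ a / K) * (\<Sum>b\<in>UNIV. cos (x $ b / K) * slope_dx K m n ?V \<mu> a b x * h $ b)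
      + - (h $ a / K) * sin (x $ a / K) * slope K m n ?V \<mu> a x"
  have cosd: "((\<lambda>x. cos (x $ a / K)) has_derivative (\<lambda>h. - (h $ a / K) * sin (x $ a / K))) (at x)" for a
  proof -
    have "((\<lambda>x::real^'n. x $ a / K) has_derivative (\<lambda>h. h $ a / K)) (at x)"
      by (rule bounded_linear_imp_has_derivative)
         (rule bounded_linear_compose[OF bounded_linear_divide bounded_linear_vec_nth])
    from has_derivative_cos[OF this] show ?thesis by simp
  qed
  have "((\<lambda>x. \<Sum>a\<in>UNIV. (cos (x $ a / K) * slope K m n ?V \<mu> a x) *\<^sub>R axis a (1::real)) has_derivative
      (\<lambda>h. \<Sum>a\<in>UNIV. ?D a h *\<^sub>R axis a 1)) (at x)"
    by (intro has_derivative_sum has_derivative_scaleR_left has_derivative_mult cosd slope_has_derivative)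
  moreover have "(\<lambda>x. \<Sum>a\<in>UNIV. (cos (x $ a / K) * slope K m n ?V \<mu> a x) *\<^sub>R axis a (1::real)) = L_deriv P (approximant K m n u) \<mu>"
  proof
    fix x :: "real^'n"
    show "(\<Sum>a\<in>UNIV. (cos (x $ a / K) * slope K m n ?V \<mu> a x) *\<^sub>R axis a (1::real)) = L_deriv P (approximant K m n u) \<mu> x"
      unfolding vec_eq_iff
      by (simp add: L_deriv_approximant[OF P U \<mu>] axis_def if_distrib[where f="\<lambda>c. _ * c"] sum.delta cong: if_cong)
  qed
  ultimately have "(L_deriv P (approximant K m n u) \<mu> has_derivative (\<lambda>h. \<Sum>a\<in>UNIV. ?D a h *\<^sub>R axis a 1)) (at x)" by simp
  from frechet_derivative_at[OF this]
  have F: "frechet_derivative (L_deriv P (approximant K m n u) \<mu>) (at x) = (\<lambda>h. \<Sum>a\<in>UNIV. ?D a h *\<^sub>R axis a 1)" by simp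
  have comp: "(\<Sum>a'\<in>UNIV. d a' *\<^sub>R axis a' (1::real)) $ a = d a" for d :: "'n \<Rightarrow> real"
    by (simp add: axis_def if_distrib[where f="\<lambda>c. _ * c"] sum.delta cong: if_cong)
  have ax: "(\<Sum>b'\<in>UNIV. g b' * axis b (1::real) $ b') = g b" for g :: "'n \<Rightarrow> real"
    by (rule sum_axis)
  have "dx_L_deriv P (approximant K m n u) \<mu> x $ a $ b = ?D a (axis b 1)"
    unfolding dx_L_deriv_def matrix_def F by (simp only: vec_lambda_beta comp)
  also have "\<dots> = cos (x $ a / K) * (cos (x $ b / K) * slope_dx K m n ?V \<mu> a b x)
      + - (axis b (1::real) $ a / K) * sin (x $ a / K) * slope K m n ?V \<mu> a x"
    by (simp only: ax[of "\<lambda>b'. cos (x $ b' / K) * slope_dx K m n ?V \<mu> a b' x"])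
  finally show ?thesis by (simp add: axis_def)
qed

lemma Lsmooth_sampled_pinned:
  fixes v :: "('n::finite \<times> nat \<Rightarrow> bool) \<Rightarrow> real"
  assumes P: "prob_space P"
  shows "Lsmooth P (\<lambda>\<mu>. sampled m n ((\<lambda>_. mass K m \<mu>)(l := v)) F)
    (\<lambda>\<mu> y. \<chi> b. \<Sum>l'\<in>{..<n} - {l}. sampled m n ((\<lambda>_. mass K m \<mu>)(l := v, l' := (\<lambda>\<zeta>. pattern_weight_partial K m b \<zeta> y))) F)"
proof -
  have e: "(\<lambda>i. if i \<in> {l} then v else mass K m \<mu>) = (\<lambda>_. mass K m \<mu>)(l := v)" for \<mu> by auto
  show ?thesis
    using Lsmooth_product_sum[OF P finite_lessThan[of n], where R="{l}" and k=K and m=m and F=F and v="\<lambda>_. v"]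
    unfolding e .
qed

lemma L_deriv2_approximant:
  fixes u :: "(real^'n::finite) measure \<Rightarrow> real"
  assumes P: "prob_space P" and U: "has_uniform_variable P"
    and \<mu>: "\<mu> \<in> P2"
  shows "L_deriv2 P (approximant K m n u) \<mu> x y $ a $ b =
    cos (x $ a / K) * (cos (y $ b / K) * slope_dmu K m n (sample_value K m n u) \<mu> a b x y)"
proof -
  let ?V = "sample_value K m n u"
  let ?c = "cos (x $ a / K) / (2 * K)"
  let ?W = "\<lambda>\<mu> l. (\<lambda>_. mass K m \<mu>)(l := (\<lambda>\<zeta>. pattern_weight K m \<zeta> x))"
  have "L_deriv2 P (approximant K m n u) \<mu> x y $ a = L_deriv P (\<lambda>\<nu>. L_deriv P (approximant K m n u) \<nu> x $ a) \<mu> y"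
    by (simp add: L_deriv2_def)
  also have "L_deriv P (\<lambda>\<nu>. L_deriv P (approximant K m n u) \<nu> x $ a)
      = L_deriv P (\<lambda>\<nu>. ?c * (\<Sum>l<n. \<Sum>r<m. sampled m n (?W \<nu> l) (coin_diff l (a, r) ?V)))"
    by (rule L_deriv_cong[OF P]) (simp add: L_deriv_approximant[OF P U] slope_def)
  also have "\<dots> \<mu> y = ?c *\<^sub>R (\<Sum>l<n. \<Sum>r<m. \<chi> b. \<Sum>l'\<in>{..<n} - {l}.
      sampled m n ((?W \<mu> l)(l' := (\<lambda>\<zeta>. pattern_weight_partial K m b \<zeta> y))) (coin_diff l (a, r) ?V))"
    by (rule L_deriv_eq[OF P U _ \<mu>], rule Lsmooth_has_L_deriv[OF P])
       (intro Lsmooth_cmult[OF P] Lsmooth_sum[OF P finite_lessThan] Lsmooth_sampled_pinned[OF P])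
  finally have "L_deriv2 P (approximant K m n u) \<mu> x y $ a $ b = ?c * (\<Sum>l<n. \<Sum>r<m. \<Sum>l'\<in>{..<n} - {l}.
      sampled m n ((?W \<mu> l)(l' := (\<lambda>\<zeta>. pattern_weight_partial K m b \<zeta> y))) (coin_diff l (a, r) ?V))"
    by (simp only: vector_scaleR_component sum_component vec_lambda_beta real_scaleR_def)
  also have "\<dots> = ?c * (\<Sum>l<n. \<Sum>r<m. \<Sum>l'\<in>{..<n} - {l}. cos (y $ b / K) / (2 * K) * (\<Sum>r'<m.
      sampled m n ((?W \<mu> l)(l' := (\<lambda>\<zeta>. pattern_weight K m \<zeta> y))) (coin_diff l' (b, r') (coin_diff l (a, r) ?V))))"
    by (intro arg_cong2[where f="(*)"] sum.cong refl sampled_partial) simp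
  also have "\<dots> = ?c * (cos (y $ b / K) / (2 * K) * (\<Sum>l<n. \<Sum>r<m. \<Sum>l'\<in>{..<n} - {l}. \<Sum>r'<m.
      sampled m n ((?W \<mu> l)(l' := (\<lambda>\<zeta>. pattern_weight K m \<zeta> y))) (coin_diff l' (b, r') (coin_diff l (a, r) ?V))))"
    unfolding sum_distrib_left ..
  finally show ?thesis unfolding slope_dmu_def by (simp add: power2_eq_square)
qed

section \<open>Difference quotients as expectations of derivatives\<close>

text \<open>The mean value theorem holds sample by sample, so it passes to expectations under arbitrary weights.\<close>

lemma sampled_coin_diff:
  fixes u :: "(real^'n::finite) measure \<Rightarrow> real"
  assumes P: "prob_space P" and U: "has_uniform_variable P"
    and u: "has_L_deriv P u p" and K: "0 < K" and m: "0 < m" and l: "l < n" and r: "r < m"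
  obtains z where "\<forall>\<alpha>. near_sample K m n \<alpha> (z \<alpha>)"
    "\<And>w. sampled m n w (coin_diff l (a, r) (sample_value K m n u)) =
      2 * K / real m * (sampled m n w (\<lambda>\<alpha>. p (empirical n (z \<alpha>)) (z \<alpha> l) $ a) / real n)"
proof -
  have "\<exists>z. near_sample K m n \<alpha> z \<and>
    coin_diff l (a, r) (sample_value K m n u) \<alpha> = 2 * K / real m * (p (empirical n z) (z l) $ a / real n)" for \<alpha>
    by (rule coin_diff_mean_value[OF P U u K m l r, of \<alpha> a]) blast
  then obtain z where z: "\<And>\<alpha>. near_sample K m n \<alpha> (z \<alpha>)"
    "\<And>\<alpha>. coin_diff l (a, r) (sample_value K m n u) \<alpha> = 2 * K / real m * (p (empirical n (z \<alpha>)) (z \<alpha> l) $ a / real n)"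
    by metis
  have "sampled m n w (coin_diff l (a, r) (sample_value K m n u)) =
      2 * K / real m * (1 / real n * sampled m n w (\<lambda>\<alpha>. p (empirical n (z \<alpha>)) (z \<alpha> l) $ a))" for w
    unfolding product_sum_cmult[symmetric] by (rule product_sum_cong) (simp_all add: z(2))
  then show ?thesis by (intro that[of z]) (simp_all add: z(1))
qed

lemma sampled_coin_diff_coin_diff:
  fixes u :: "(real^'n::finite) measure \<Rightarrow> real"
  assumes P: "prob_space P" and U: "has_uniform_variable P"
    and u: "u \<in> C2 P" and K: "0 < K" and m: "0 < m" and l: "l < n" "l' < n" and r: "r < m" "r' < m"
    and ne: "(l, a, r) \<noteq> (l', b, r')"
  obtains z where "\<forall>\<alpha>. near_sample K m n \<alpha> (z \<alpha>)"
    "\<And>w. sampled m n w (coin_diff l' (b, r') (coin_diff l (a, r) (sample_value K m n u))) = (2 * K / real m)\<^sup>2 *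
      ((of_bool (l = l') * sampled m n w (\<lambda>\<alpha>. dx_L_deriv P u (empirical n (z \<alpha>)) (z \<alpha> l) $ a $ b)
        + sampled m n w (\<lambda>\<alpha>. L_deriv2 P u (empirical n (z \<alpha>)) (z \<alpha> l) (z \<alpha> l') $ a $ b) / real n) / real n)"
proof -
  let ?V = "sample_value K m n u"
  have "\<exists>z. near_sample K m n \<alpha> z \<and>
    coin_diff l (a, r) (coin_diff l' (b, r') ?V) \<alpha> = (2 * K / real m)\<^sup>2 *
      ((of_bool (l = l') * dx_L_deriv P u (empirical n z) (z l) $ a $ b
        + L_deriv2 P u (empirical n z) (z l) (z l') $ a $ b / real n) / real n)" for \<alpha>
    by (rule coin_diff_coin_diff_mean_value[OF P U u K m l r ne, of \<alpha>]) blast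
  then obtain z where z: "\<And>\<alpha>. near_sample K m n \<alpha> (z \<alpha>)"
    "\<And>\<alpha>. coin_diff l (a, r) (coin_diff l' (b, r') ?V) \<alpha> = (2 * K / real m)\<^sup>2 *
      ((of_bool (l = l') * dx_L_deriv P u (empirical n (z \<alpha>)) (z \<alpha> l) $ a $ b
        + L_deriv2 P u (empirical n (z \<alpha>)) (z \<alpha> l) (z \<alpha> l') $ a $ b / real n) / real n)"
    by metis
  have com: "coin_diff l' (b, r') (coin_diff l (a, r) ?V) = coin_diff l (a, r) (coin_diff l' (b, r') ?V)"
    by (rule coin_diff_commute) (use ne in auto)
  have "sampled m n w (coin_diff l (a, r) (coin_diff l' (b, r') ?V)) = (2 * K / real m)\<^sup>2 * (1 / real n *
      (of_bool (l = l') * sampled m n w (\<lambda>\<alpha>. dx_L_deriv P u (empirical n (z \<alpha>)) (z \<alpha> l) $ a $ b)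
        + 1 / real n * sampled m n w (\<lambda>\<alpha>. L_deriv2 P u (empirical n (z \<alpha>)) (z \<alpha> l) (z \<alpha> l') $ a $ b)))" for w
    unfolding product_sum_cmult[symmetric] product_sum_add[symmetric]
    by (rule product_sum_cong) (simp_all add: z(2))
  then show ?thesis by (intro that[of z]) (simp_all add: z(1) com)
qed

section \<open>Convergence of the slopes\<close>

lemma coin_diff_idem: "coin_diff l e (coin_diff l e F) = (\<lambda>_. 0)"
  by (rule ext) (simp add: coin_diff_def)

locale sampled_function = sampling_scheme Fam B m n
  for Fam :: "((real^'n::finite) measure \<times> ((real^'n) \<times> (real^'n)) \<Rightarrow> real) set" and B m n +
  fixes P :: "'w measure" and u :: "(real^'n) measure \<Rightarrow> real"
  assumes P: "prob_space P" and U: "has_uniform_variable P"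
begin

abbreviation "V k \<equiv> sample_value (real (Suc k)) (m k) (n k) u"
abbreviation "approximation k \<equiv> approximant (real (Suc k)) (m k) (n k) u"
abbreviation "slopes k \<equiv> slope (real (Suc k)) (m k) (n k) (V k)"
abbreviation "slopes_dx k \<equiv> slope_dx (real (Suc k)) (m k) (n k) (V k)"
abbreviation "slopes_dmu k \<equiv> slope_dmu (real (Suc k)) (m k) (n k) (V k)"

lemma slope_close:
  assumes u: "has_L_deriv P u (L_deriv P u)"
    and \<Psi>: "(\<lambda>(\<mu>, x, y). L_deriv P u \<mu> x $ a) \<in> Fam" and M: "compactin W2_top M" and Q: "compact Q" and \<epsilon>: "0 < \<epsilon>"
  shows "\<forall>\<^sub>F k in sequentially. \<forall>\<mu>\<in>M. \<forall>x\<in>Q.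
    \<bar>slopes k \<mu> a x - L_deriv P u \<mu> x $ a\<bar> \<le> \<epsilon>"
  using close_pair[OF \<Psi> M Q \<epsilon>]
proof eventually_elim
  case (elim k)
  define K where "K = real (Suc k)"
  have K: "0 < K" "1 \<le> K" by (simp_all add: K_def)
  note f = fineD[where k=k, folded K_def, OF K(2)] and close = elim[folded K_def]
  show ?case unfolding K_def[symmetric]
  proof (intro ballI)
    fix \<mu> x assume \<mu>: "\<mu> \<in> M" and x: "x \<in> Q"
    let ?c = "L_deriv P u \<mu> x $ a"
    define S where "S l r = sampled (m k) (n k) ((\<lambda>_. mass K (m k) \<mu>)(l := (\<lambda>\<zeta>. pattern_weight K (m k) \<zeta> x)))
      (coin_diff l (a, r) (sample_value K (m k) (n k) u))" for l r
    define s where "s l r = real (m k) * real (n k) / (2 * K) * S l r" for l r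
    have s: "\<bar>s l r - ?c\<bar> \<le> \<epsilon>" if l: "l < n k" and r: "r < m k" for l r
    proof -
      obtain z where z: "\<forall>\<alpha>. near_sample K (m k) (n k) \<alpha> (z \<alpha>)"
        "\<And>w. sampled (m k) (n k) w (coin_diff l (a, r) (sample_value K (m k) (n k) u)) =
          2 * K / real (m k) * (sampled (m k) (n k) w (\<lambda>\<alpha>. L_deriv P u (empirical (n k) (z \<alpha>)) (z \<alpha> l) $ a) / real (n k))"
        by (rule sampled_coin_diff[OF P U u K(1) f(1) l r, of a]) (rule that)
      have "s l r = sampled (m k) (n k) ((\<lambda>_. mass K (m k) \<mu>)(l := (\<lambda>\<zeta>. pattern_weight K (m k) \<zeta> x)))
          (\<lambda>\<alpha>. L_deriv P u (empirical (n k) (z \<alpha>)) (z \<alpha> l) $ a)"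
        unfolding s_def S_def z(2) using K f(1,2) by simp
      then show ?thesis
        using close[rule_format, OF \<mu> x x l l refl, of z] z(1) unfolding split_conv fun_upd_upd by simp
    qed
    have "slope K (m k) (n k) (sample_value K (m k) (n k) u) \<mu> a x = (\<Sum>l<n k. \<Sum>r<m k. S l r) / (2 * K)"
      by (simp add: slope_def S_def)
    also have "\<dots> = (\<Sum>l<n k. (\<Sum>r<m k. s l r) / real (m k)) / real (n k)"
      unfolding s_def sum_distrib_left[symmetric] sum_divide_distrib[symmetric] using K f(1,2) by simp
    finally have e: "slope K (m k) (n k) (sample_value K (m k) (n k) u) \<mu> a x
        = (\<Sum>l<n k. (\<Sum>r<m k. s l r) / real (m k)) / real (n k)" .
    show "\<bar>slope K (m k) (n k) (sample_value K (m k) (n k) u) \<mu> a x - ?c\<bar> \<le> \<epsilon>"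
      unfolding e by (intro average_close_all f(1,2) s less_imp_le[OF \<epsilon>])
  qed
qed

text \<open>A coin paired with itself has second difference zero; such pairs make up a fraction \<open>1 / m\<close> of all
  pairs for \<open>a = b\<close>. The second L-derivative enters with the factor \<open>1 / n\<close> and vanishes in the limit.\<close>

lemma slope_dx_close:
  assumes u: "u \<in> C2 P"
    and \<Psi>: "(\<lambda>(\<mu>, x, y). dx_L_deriv P u \<mu> x $ a $ b) \<in> Fam" "(\<lambda>(\<mu>, x, y). L_deriv2 P u \<mu> x y $ a $ b) \<in> Fam"
    and M: "compactin W2_top M" and Q: "compact Q" and \<epsilon>: "0 < \<epsilon>"
  shows "\<forall>\<^sub>F k in sequentially. \<forall>\<mu>\<in>M. \<forall>x\<in>Q.
    \<bar>slopes_dx k \<mu> a b x - dx_L_deriv P u \<mu> x $ a $ b\<bar> \<le> \<epsilon>"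
proof -
  have \<epsilon>2: "0 < \<epsilon> / 2" using \<epsilon> by simp
  have QQ: "compact (Q \<times> Q)" by (rule compact_Times[OF Q Q])
  obtain C1 where C1: "0 \<le> C1" "\<And>\<mu> s. \<mu> \<in> M \<Longrightarrow> s \<in> Q \<times> Q \<Longrightarrow> \<bar>(\<lambda>(\<mu>, x, y). dx_L_deriv P u \<mu> x $ a $ b) (\<mu>, s)\<bar> \<le> C1"
    by (rule W2_prod_compact_bounded[OF cont[OF \<Psi>(1)] M QQ]) (rule that)
  obtain C2 where C2: "0 \<le> C2" "\<And>\<mu> s. \<mu> \<in> M \<Longrightarrow> s \<in> Q \<times> Q \<Longrightarrow> \<bar>(\<lambda>(\<mu>, x, y). L_deriv2 P u \<mu> x y $ a $ b) (\<mu>, s)\<bar> \<le> C2"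
    by (rule W2_prod_compact_bounded[OF cont[OF \<Psi>(2)] M QQ]) (rule that)
  show ?thesis
    using close_pair[OF \<Psi>(1) M Q \<epsilon>2] close_pair[OF \<Psi>(2) M Q \<epsilon>2] eventually_div_Suc_less[OF \<epsilon>2, of "C1 + (C2 + \<epsilon> / 2)"]
  proof eventually_elim
    case (elim k)
    define K where "K = real (Suc k)"
    have K: "0 < K" "1 \<le> K" by (simp_all add: K_def)
    note f = fineD[where k=k, folded K_def, OF K(2)] and close = elim(1,2)[folded K_def]
    show ?case unfolding K_def[symmetric]
    proof (intro ballI)
      fix \<mu> x assume \<mu>: "\<mu> \<in> M" and x: "x \<in> Q"
      let ?c = "dx_L_deriv P u \<mu> x $ a $ b"
      let ?w = "\<lambda>l. (\<lambda>_. mass K (m k) \<mu>)(l := (\<lambda>\<zeta>. pattern_weight K (m k) \<zeta> x))"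
      define S where "S l r r' = sampled (m k) (n k) (?w l)
        (coin_diff l (b, r') (coin_diff l (a, r) (sample_value K (m k) (n k) u)))" for l r r'
      define s where "s l r r' = (real (m k))\<^sup>2 * real (n k) / (2 * K)\<^sup>2 * S l r r'" for l r r'
      define e where "e = \<epsilon> / 2 + (C2 + \<epsilon> / 2) / K"
      have e0: "0 \<le> e" using C2(1) \<epsilon> K by (simp add: e_def)
      have s: "\<bar>s l r r' - ?c\<bar> \<le> e" if l: "l < n k" and r: "r < m k" "r' < m k" and ne: "(a, r) \<noteq> (b, r')" for l r r'
      proof -
        have ne': "(l, a, r) \<noteq> (l, b, r')" using ne by simp
        obtain z where z: "\<forall>\<alpha>. near_sample K (m k) (n k) \<alpha> (z \<alpha>)"
          "\<And>w. sampled (m k) (n k) w (coin_diff l (b, r') (coin_diff l (a, r) (sample_value K (m k) (n k) u))) = (2 * K / real (m k))\<^sup>2 *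
            ((of_bool (l = l) * sampled (m k) (n k) w (\<lambda>\<alpha>. dx_L_deriv P u (empirical (n k) (z \<alpha>)) (z \<alpha> l) $ a $ b)
              + sampled (m k) (n k) w (\<lambda>\<alpha>. L_deriv2 P u (empirical (n k) (z \<alpha>)) (z \<alpha> l) (z \<alpha> l) $ a $ b) / real (n k)) / real (n k))"
          by (rule sampled_coin_diff_coin_diff[OF P U u K(1) f(1) l l r ne']) (rule that)
        define D where "D = sampled (m k) (n k) (?w l) (\<lambda>\<alpha>. dx_L_deriv P u (empirical (n k) (z \<alpha>)) (z \<alpha> l) $ a $ b)"
        define E where "E = sampled (m k) (n k) (?w l) (\<lambda>\<alpha>. L_deriv2 P u (empirical (n k) (z \<alpha>)) (z \<alpha> l) (z \<alpha> l) $ a $ b)"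
        have "s l r r' = D + E / real (n k)"
          unfolding s_def S_def z(2) D_def[symmetric] E_def[symmetric] using K f(1,2) by (simp add: power_divide)
        moreover have "\<bar>D - ?c\<bar> \<le> \<epsilon> / 2"
          using close(1)[rule_format, OF \<mu> x x l l refl, of z] z(1) unfolding split_conv fun_upd_upd D_def by simp
        moreover have "\<bar>E / real (n k)\<bar> \<le> (C2 + \<epsilon> / 2) / K"
        proof -
          have "\<bar>E - L_deriv2 P u \<mu> x x $ a $ b\<bar> \<le> \<epsilon> / 2"
            using close(2)[rule_format, OF \<mu> x x l l refl, of z] z(1) unfolding split_conv fun_upd_upd E_def by simp
          moreover have "\<bar>L_deriv2 P u \<mu> x x $ a $ b\<bar> \<le> C2" using C2(2)[OF \<mu>, of "(x, x)"] x by simp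
          ultimately have "\<bar>E\<bar> \<le> C2 + \<epsilon> / 2" by linarith
          then have "\<bar>E\<bar> / real (n k) \<le> (C2 + \<epsilon> / 2) / K" using K f(2,3) by (intro frac_le) auto
          then show ?thesis by simp
        qed
        ultimately show ?thesis unfolding e_def by linarith
      qed
      have inner: "\<bar>(\<Sum>r'<m k. s l r r') / real (m k) - ?c\<bar> \<le> e + \<bar>?c\<bar> / real (m k)" if l: "l < n k" and r: "r < m k" for l r
      proof (cases "a = b")
        case True
        have "s l r r = 0" unfolding s_def S_def True coin_diff_idem product_sum_def by simp
        then have "(\<Sum>r'<m k. s l r r') = (\<Sum>r'\<in>{..<m k} - {r}. s l r r')" using r by (subst sum.remove[of _ r]) auto
        then show ?thesis using average_close_all_but_one[OF f(1) r s[OF l r] e0] by auto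
      next
        case False
        have "\<bar>(\<Sum>r'<m k. s l r r') / real (m k) - ?c\<bar> \<le> e"
          by (rule average_close_all[OF f(1) s[OF l r] e0]) (use False in simp_all)
        then show ?thesis by (rule order_trans) simp
      qed
      have "slope_dx K (m k) (n k) (sample_value K (m k) (n k) u) \<mu> a b x = (\<Sum>l<n k. \<Sum>r<m k. \<Sum>r'<m k. S l r r') / (2 * K)\<^sup>2"
        by (simp add: slope_dx_def S_def)
      also have "\<dots> = (\<Sum>l<n k. (\<Sum>r<m k. (\<Sum>r'<m k. s l r r') / real (m k)) / real (m k)) / real (n k)"
        unfolding s_def sum_distrib_left[symmetric] sum_divide_distrib[symmetric] using K f(1,2) by (simp add: power2_eq_square)
      finally have eq: "slope_dx K (m k) (n k) (sample_value K (m k) (n k) u) \<mu> a b x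
          = (\<Sum>l<n k. (\<Sum>r<m k. (\<Sum>r'<m k. s l r r') / real (m k)) / real (m k)) / real (n k)" .
      have "\<bar>slope_dx K (m k) (n k) (sample_value K (m k) (n k) u) \<mu> a b x - ?c\<bar> \<le> e + \<bar>?c\<bar> / real (m k)"
        unfolding eq by (intro average_close_all f(1,2) inner) (use e0 in simp_all)
      also have "\<bar>?c\<bar> / real (m k) \<le> C1 / K"
        using C1(2)[OF \<mu>, of "(x, x)"] x K f(1,4) by (intro frac_le) auto
      also have "e + C1 / K = \<epsilon> / 2 + (C1 + (C2 + \<epsilon> / 2)) / K" by (simp add: e_def add_divide_distrib)
      also have "\<dots> \<le> \<epsilon>" using elim(3) unfolding K_def by linarith
      finally show "\<bar>slope_dx K (m k) (n k) (sample_value K (m k) (n k) u) \<mu> a b x - ?c\<bar> \<le> \<epsilon>" by simp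
    qed
  qed
qed

text \<open>The terms missing in the sum, those with \<open>l' = l\<close>, make up a fraction \<open>1 / n\<close>.\<close>

lemma slope_dmu_close:
  assumes u: "u \<in> C2 P" and \<Psi>: "(\<lambda>(\<mu>, x, y). L_deriv2 P u \<mu> x y $ a $ b) \<in> Fam"
    and M: "compactin W2_top M" and Q: "compact Q" and \<epsilon>: "0 < \<epsilon>"
  shows "\<forall>\<^sub>F k in sequentially. \<forall>\<mu>\<in>M. \<forall>x\<in>Q. \<forall>y\<in>Q.
    \<bar>slopes_dmu k \<mu> a b x y - L_deriv2 P u \<mu> x y $ a $ b\<bar> \<le> \<epsilon>"
proof -
  have \<epsilon>2: "0 < \<epsilon> / 2" using \<epsilon> by simp
  have QQ: "compact (Q \<times> Q)" by (rule compact_Times[OF Q Q])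
  obtain C where C: "0 \<le> C" "\<And>\<mu> s. \<mu> \<in> M \<Longrightarrow> s \<in> Q \<times> Q \<Longrightarrow> \<bar>(\<lambda>(\<mu>, x, y). L_deriv2 P u \<mu> x y $ a $ b) (\<mu>, s)\<bar> \<le> C"
    by (rule W2_prod_compact_bounded[OF cont[OF \<Psi>] M QQ]) (rule that)
  show ?thesis
    using close_pair[OF \<Psi> M Q \<epsilon>2] eventually_div_Suc_less[OF \<epsilon>2, of C]
  proof eventually_elim
    case (elim k)
    define K where "K = real (Suc k)"
    have K: "0 < K" "1 \<le> K" by (simp_all add: K_def)
    note f = fineD[where k=k, folded K_def, OF K(2)] and close = elim(1)[folded K_def]
    show ?case unfolding K_def[symmetric]
    proof (intro ballI)
      fix \<mu> x y assume \<mu>: "\<mu> \<in> M" and x: "x \<in> Q" and y: "y \<in> Q"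
      let ?c = "L_deriv2 P u \<mu> x y $ a $ b"
      let ?w = "\<lambda>l l'. (\<lambda>_. mass K (m k) \<mu>)(l := (\<lambda>\<zeta>. pattern_weight K (m k) \<zeta> x), l' := (\<lambda>\<zeta>. pattern_weight K (m k) \<zeta> y))"
      define S where "S l r l' r' = sampled (m k) (n k) (?w l l')
        (coin_diff l' (b, r') (coin_diff l (a, r) (sample_value K (m k) (n k) u)))" for l r l' r'
      define s where "s l r l' r' = (real (m k))\<^sup>2 * (real (n k))\<^sup>2 / (2 * K)\<^sup>2 * S l r l' r'" for l r l' r'
      have s: "\<bar>s l r l' r' - ?c\<bar> \<le> \<epsilon> / 2" if l: "l < n k" "l' < n k" and r: "r < m k" "r' < m k" and ne: "l' \<noteq> l" for l r l' r'
      proof -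
        have ne': "(l, a, r) \<noteq> (l', b, r')" using ne by simp
        obtain z where z: "\<forall>\<alpha>. near_sample K (m k) (n k) \<alpha> (z \<alpha>)"
          "\<And>w. sampled (m k) (n k) w (coin_diff l' (b, r') (coin_diff l (a, r) (sample_value K (m k) (n k) u))) = (2 * K / real (m k))\<^sup>2 *
            ((of_bool (l = l') * sampled (m k) (n k) w (\<lambda>\<alpha>. dx_L_deriv P u (empirical (n k) (z \<alpha>)) (z \<alpha> l) $ a $ b)
              + sampled (m k) (n k) w (\<lambda>\<alpha>. L_deriv2 P u (empirical (n k) (z \<alpha>)) (z \<alpha> l) (z \<alpha> l') $ a $ b) / real (n k)) / real (n k))"
          by (rule sampled_coin_diff_coin_diff[OF P U u K(1) f(1) l r ne']) (rule that)
        have "s l r l' r' = sampled (m k) (n k) (?w l l') (\<lambda>\<alpha>. L_deriv2 P u (empirical (n k) (z \<alpha>)) (z \<alpha> l) (z \<alpha> l') $ a $ b)"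
          unfolding s_def S_def z(2) using K f(1,2) ne by (simp add: power2_eq_square)
        moreover have "l = l' \<longrightarrow> x = y" using ne by simp
        ultimately show ?thesis
          using close[rule_format, OF \<mu> x y l _, of z] z(1) unfolding split_conv by simp
      qed
      have inner: "\<bar>(\<Sum>l'\<in>{..<n k} - {l}. (\<Sum>r'<m k. s l r l' r') / real (m k)) / real (n k) - ?c\<bar> \<le> \<epsilon> / 2 + \<bar>?c\<bar> / real (n k)"
        if l: "l < n k" and r: "r < m k" for l r
        by (intro average_close_all_but_one average_close_all f(1,2) s l r) (use \<epsilon> in simp_all)
      have "slope_dmu K (m k) (n k) (sample_value K (m k) (n k) u) \<mu> a b x y
          = (\<Sum>l<n k. \<Sum>r<m k. \<Sum>l'\<in>{..<n k} - {l}. \<Sum>r'<m k. S l r l' r') / (2 * K)\<^sup>2"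
        by (simp add: slope_dmu_def S_def)
      also have "\<dots> = (\<Sum>l<n k. (\<Sum>r<m k. (\<Sum>l'\<in>{..<n k} - {l}. (\<Sum>r'<m k. s l r l' r') / real (m k)) / real (n k)) / real (m k)) / real (n k)"
        unfolding s_def sum_distrib_left[symmetric] sum_divide_distrib[symmetric] using K f(1,2) by (simp add: power2_eq_square)
      finally have eq: "slope_dmu K (m k) (n k) (sample_value K (m k) (n k) u) \<mu> a b x y
          = (\<Sum>l<n k. (\<Sum>r<m k. (\<Sum>l'\<in>{..<n k} - {l}. (\<Sum>r'<m k. s l r l' r') / real (m k)) / real (n k)) / real (m k)) / real (n k)" .
      have "\<bar>slope_dmu K (m k) (n k) (sample_value K (m k) (n k) u) \<mu> a b x y - ?c\<bar> \<le> \<epsilon> / 2 + \<bar>?c\<bar> / real (n k)"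
        unfolding eq by (intro average_close_all f(1,2) inner) (use \<epsilon> in simp_all)
      also have "\<bar>?c\<bar> / real (n k) \<le> C / K"
        using C(2)[OF \<mu>, of "(x, y)"] x y K f(2,3) by (intro frac_le) auto
      also have "\<epsilon> / 2 + C / K \<le> \<epsilon>" using elim(2) unfolding K_def by linarith
      finally show "\<bar>slope_dmu K (m k) (n k) (sample_value K (m k) (n k) u) \<mu> a b x y - ?c\<bar> \<le> \<epsilon>" by simp
    qed
  qed
qed

end

section \<open>Uniform limits\<close>

lemma uniform_limit_real_leI:
  fixes f :: "'k \<Rightarrow> 's \<Rightarrow> real"
  assumes "\<And>\<epsilon>. 0 < \<epsilon> \<Longrightarrow> \<forall>\<^sub>F k in F. \<forall>s\<in>S. \<bar>f k s - l s\<bar> \<le> \<epsilon>"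
  shows "uniform_limit S f l F"
proof (rule uniform_limitI)
  fix \<epsilon> :: real assume e: "0 < \<epsilon>"
  then have "0 < \<epsilon> / 2" by simp
  from assms[OF this] show "\<forall>\<^sub>F k in F. \<forall>s\<in>S. dist (f k s) (l s) < \<epsilon>"
  proof eventually_elim
    case (elim k)
    show ?case
    proof
      fix s assume "s \<in> S"
      then have "\<bar>f k s - l s\<bar> \<le> \<epsilon> / 2" using elim by blast
      then show "dist (f k s) (l s) < \<epsilon>" using e by (simp add: dist_real_def)
    qed
  qed
qed

lemma uniform_limit_vec:
  fixes f :: "'k \<Rightarrow> 's \<Rightarrow> 'b::real_normed_vector^'n::finite"
  assumes "\<And>a. uniform_limit S (\<lambda>k s. f k s $ a) (\<lambda>s. l s $ a) F"
  shows "uniform_limit S f l F"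
proof (rule uniform_limitI)
  fix \<epsilon> :: real assume "0 < \<epsilon>"
  then have e: "0 < \<epsilon> / real CARD('n)" by simp
  have "\<forall>\<^sub>F k in F. \<forall>a. \<forall>s\<in>S. dist (f k s $ a) (l s $ a) < \<epsilon> / real CARD('n)"
    by (rule eventually_all_finite) (rule uniform_limitD[OF assms e])
  then show "\<forall>\<^sub>F k in F. \<forall>s\<in>S. dist (f k s) (l s) < \<epsilon>"
  proof eventually_elim
    case (elim k)
    show ?case
    proof
      fix s assume s: "s \<in> S"
      have "dist (f k s) (l s) \<le> (\<Sum>a\<in>UNIV. dist (f k s $ a) (l s $ a))"
        unfolding dist_vec_def by (rule L2_set_le_sum) simp
      also have "\<dots> < of_nat (card (UNIV :: 'n set)) * (\<epsilon> / real CARD('n))"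
        by (rule sum_bounded_above_strict) (use elim s in auto)
      finally show "dist (f k s) (l s) < \<epsilon>" by simp
    qed
  qed
qed

lemma abs_cos_minus_1_le: "\<bar>cos \<theta> - 1\<bar> \<le> \<bar>\<theta>\<bar>" for \<theta> :: real
proof -
  have "cos \<theta> - 1 = - 2 * (sin (\<theta> / 2))\<^sup>2" using cos_double_sin[of "\<theta> / 2"] by simp
  then have "\<bar>cos \<theta> - 1\<bar> = 2 * (\<bar>sin (\<theta> / 2)\<bar> * \<bar>sin (\<theta> / 2)\<bar>)" by (simp add: power2_eq_square abs_mult)
  also have "\<dots> \<le> 2 * (1 * \<bar>\<theta> / 2\<bar>)"
    by (intro mult_left_mono mult_mono abs_sin_x_le_abs_x) simp_all
  finally show ?thesis by simp
qed

lemma uniform_limit_cos_1: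
  fixes h :: "'s \<Rightarrow> real"
  assumes "bounded (h ` S)"
  shows "uniform_limit S (\<lambda>k s. cos (h s / real (Suc k))) (\<lambda>_. 1) sequentially"
proof (rule uniform_limit_real_leI)
  fix \<epsilon> :: real assume \<epsilon>: "0 < \<epsilon>"
  obtain B where B: "\<And>s. s \<in> S \<Longrightarrow> \<bar>h s\<bar> \<le> B" using assms unfolding bounded_real by blast
  show "\<forall>\<^sub>F k in sequentially. \<forall>s\<in>S. \<bar>cos (h s / real (Suc k)) - 1\<bar> \<le> \<epsilon>"
    using eventually_div_Suc_less[OF \<epsilon>, of B]
  proof eventually_elim
    case (elim k)
    show ?case
    proof
      fix s assume s: "s \<in> S"
      have "\<bar>cos (h s / real (Suc k)) - 1\<bar> \<le> \<bar>h s / real (Suc k)\<bar>" by (rule abs_cos_minus_1_le)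
      also have "\<dots> = \<bar>h s\<bar> / real (Suc k)" by (simp only: abs_divide abs_of_nat)
      also have "\<dots> \<le> B / real (Suc k)" by (rule divide_right_mono[OF B[OF s]]) simp
      finally show "\<bar>cos (h s / real (Suc k)) - 1\<bar> \<le> \<epsilon>" using elim by linarith
    qed
  qed
qed

lemma uniform_limit_sin_0:
  "uniform_limit S (\<lambda>k s. sin (h s / real (Suc k)) / real (Suc k)) (\<lambda>_. 0 :: real) sequentially"
proof (rule uniform_limit_real_leI)
  fix \<epsilon> :: real assume \<epsilon>: "0 < \<epsilon>"
  show "\<forall>\<^sub>F k in sequentially. \<forall>s\<in>S. \<bar>sin (h s / real (Suc k)) / real (Suc k) - 0\<bar> \<le> \<epsilon>"
    using eventually_div_Suc_less[OF \<epsilon>, of 1]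
  proof eventually_elim
    case (elim k)
    show ?case
    proof
      fix s assume "s \<in> S"
      have "\<bar>sin (h s / real (Suc k)) / real (Suc k)\<bar> \<le> 1 / real (Suc k)"
        unfolding abs_divide abs_of_nat by (rule divide_right_mono) simp_all
      then show "\<bar>sin (h s / real (Suc k)) / real (Suc k) - 0\<bar> \<le> \<epsilon>" using elim by simp
    qed
  qed
qed

lemma SUP_ennreal_tendsto_0:
  assumes "\<And>\<epsilon>. 0 < \<epsilon> \<Longrightarrow> \<forall>\<^sub>F k in F. \<forall>s\<in>S. g k s \<le> \<epsilon>"
  shows "((\<lambda>k. SUP s\<in>S. ennreal (g k s)) \<longlongrightarrow> 0) F"
proof (rule order_tendstoI)
  fix c :: ennreal assume "0 < c"
  then obtain d where d: "0 < d" "d < c" using dense by blast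
  then obtain r where r: "d = ennreal r" "0 \<le> r" by (cases d) auto
  then have "0 < r" using d(1) by (simp add: ennreal_less_zero_iff)
  from assms[OF this] show "\<forall>\<^sub>F k in F. (SUP s\<in>S. ennreal (g k s)) < c"
  proof eventually_elim
    case (elim k)
    then have "(SUP s\<in>S. ennreal (g k s)) \<le> ennreal r" by (intro SUP_least ennreal_leI) blast
    then show ?case using d(2) r(1) by (rule_tac le_less_trans) simp_all
  qed
qed simp

context sampled_function
begin

lemma bounded_on_compact:
  assumes \<Psi>: "\<Psi> \<in> Fam" and M: "compactin W2_top M" and Q: "compact Q"
  shows "bounded ((\<lambda>s. \<Psi> (fst s, fst (snd s), snd (snd s))) ` (M \<times> Q \<times> Q))"
proof -
  obtain C where C: "0 \<le> C" "\<And>\<mu> s. \<mu> \<in> M \<Longrightarrow> s \<in> Q \<times> Q \<Longrightarrow> \<bar>\<Psi> (\<mu>, s)\<bar> \<le> C"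
    by (rule W2_prod_compact_bounded[OF cont[OF \<Psi>] M compact_Times[OF Q Q]]) (rule that)
  show ?thesis unfolding bounded_real by (rule exI[of _ C]) (use C(2) in auto)
qed

lemma bounded_component:
  fixes Q :: "(real^'n) set" and M :: "'s set"
  assumes Q: "compact Q"
  shows "bounded ((\<lambda>s. fst (snd s) $ a) ` (M \<times> Q \<times> Q))" "bounded ((\<lambda>s. snd (snd s) $ a) ` (M \<times> Q \<times> Q))"
proof -
  obtain X where X: "\<And>x. x \<in> Q \<Longrightarrow> norm x \<le> X" using compact_imp_bounded[OF Q] unfolding bounded_iff by blast
  have le: "\<bar>x $ a\<bar> \<le> X" if "x \<in> Q" for x using component_le_norm_cart[of x a] X[OF that] by linarith
  show "bounded ((\<lambda>s. fst (snd s) $ a) ` (M \<times> Q \<times> Q))" "bounded ((\<lambda>s. snd (snd s) $ a) ` (M \<times> Q \<times> Q))"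
    unfolding bounded_real by (intro exI[of _ X]; use le in auto)+
qed

lemma approximation_uniform_limit:
  assumes "(\<lambda>(\<mu>, _). u \<mu>) \<in> Fam" "compactin W2_top M"
  shows "uniform_limit M approximation u sequentially"
  unfolding approximant_def by (rule uniform_limit_real_leI) (rule close_value[OF assms])

lemma slope_uniform_limit:
  assumes u: "has_L_deriv P u (L_deriv P u)"
    and \<Psi>: "(\<lambda>(\<mu>, x, y). L_deriv P u \<mu> x $ a) \<in> Fam" and M: "compactin W2_top M" and Q: "compact Q"
  shows "uniform_limit (M \<times> Q \<times> Q)
    (\<lambda>k s. slopes k (fst s) a (fst (snd s)))
    (\<lambda>s. L_deriv P u (fst s) (fst (snd s)) $ a) sequentially"
proof (rule uniform_limit_real_leI)
  fix \<epsilon> :: real assume "0 < \<epsilon>"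
  from slope_close[OF u \<Psi> M Q this]
  show "\<forall>\<^sub>F k in sequentially. \<forall>s\<in>M \<times> Q \<times> Q.
      \<bar>slopes k (fst s) a (fst (snd s)) - L_deriv P u (fst s) (fst (snd s)) $ a\<bar> \<le> \<epsilon>"
    by (rule eventually_mono) (simp only: mem_Times_iff Ball_def, blast)
qed

lemma L_deriv_uniform_limit:
  assumes u: "has_L_deriv P u (L_deriv P u)"
    and \<Psi>: "\<And>a. (\<lambda>(\<mu>, x, y). L_deriv P u \<mu> x $ a) \<in> Fam" and M: "compactin W2_top M" and Q: "compact Q"
  shows "uniform_limit (M \<times> Q \<times> Q) (\<lambda>k s. L_deriv P (approximation k) (fst s) (fst (snd s)))
    (\<lambda>s. L_deriv P u (fst s) (fst (snd s))) sequentially"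
proof (rule uniform_limit_vec)
  fix a :: 'n
  let ?S = "M \<times> Q \<times> Q"
  have MP: "M \<subseteq> P2" using compactin_subset_topspace[OF M] by simp
  have b: "bounded ((\<lambda>s. L_deriv P u (fst s) (fst (snd s)) $ a) ` ?S)"
    using bounded_on_compact[OF \<Psi>[of a] M Q] unfolding split_conv .
  have "uniform_limit ?S
    (\<lambda>k s. cos (fst (snd s) $ a / real (Suc k)) *
      slopes k (fst s) a (fst (snd s)))
    (\<lambda>s. 1 * (L_deriv P u (fst s) (fst (snd s)) $ a)) sequentially"
    by (rule uniform_lim_mult[OF uniform_limit_cos_1[OF bounded_component(1)[OF Q]] slope_uniform_limit[OF u \<Psi> M Q] _ b])
       (rule bounded_subset[of "{1}"], simp, blast)
  then show "uniform_limit ?S (\<lambda>k s. L_deriv P (approximation k) (fst s) (fst (snd s)) $ a)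
      (\<lambda>s. L_deriv P u (fst s) (fst (snd s)) $ a) sequentially"
    by (rule uniform_limit_cong'[THEN iffD1, rotated -1])
       (use MP in \<open>auto simp: L_deriv_approximant[OF P U] simp del: of_nat_Suc\<close>)
qed

lemma dx_L_deriv_uniform_limit:
  assumes u: "u \<in> C2 P" "has_L_deriv P u (L_deriv P u)"
    and \<Psi>1: "\<And>a. (\<lambda>(\<mu>, x, y). L_deriv P u \<mu> x $ a) \<in> Fam"
    and \<Psi>2: "\<And>a b. (\<lambda>(\<mu>, x, y). dx_L_deriv P u \<mu> x $ a $ b) \<in> Fam" "\<And>a b. (\<lambda>(\<mu>, x, y). L_deriv2 P u \<mu> x y $ a $ b) \<in> Fam"
    and M: "compactin W2_top M" and Q: "compact Q"
  shows "uniform_limit (M \<times> Q \<times> Q) (\<lambda>k s. dx_L_deriv P (approximation k) (fst s) (fst (snd s)))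
    (\<lambda>s. dx_L_deriv P u (fst s) (fst (snd s))) sequentially"
proof (rule uniform_limit_vec, rule uniform_limit_vec)
  fix a b :: 'n
  let ?S = "M \<times> Q \<times> Q"
  have MP: "M \<subseteq> P2" using compactin_subset_topspace[OF M] by simp
  have b1: "bounded ((\<lambda>_. c) ` ?S)" for c :: real by (rule bounded_subset[of "{c}"]) auto
  have bD: "bounded ((\<lambda>s. dx_L_deriv P u (fst s) (fst (snd s)) $ a $ b) ` ?S)"
    using bounded_on_compact[OF \<Psi>2(1)[of a b] M Q] unfolding split_conv .
  have bL: "bounded ((\<lambda>s. L_deriv P u (fst s) (fst (snd s)) $ a) ` ?S)"
    using bounded_on_compact[OF \<Psi>1[of a] M Q] unfolding split_conv .
  have "uniform_limit ?S (\<lambda>k s. slopes_dx k (fst s) a b (fst (snd s)))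
      (\<lambda>s. dx_L_deriv P u (fst s) (fst (snd s)) $ a $ b) sequentially"
  proof (rule uniform_limit_real_leI)
    fix \<epsilon> :: real assume "0 < \<epsilon>"
    from slope_dx_close[OF u(1) \<Psi>2 M Q this]
    show "\<forall>\<^sub>F k in sequentially. \<forall>s\<in>?S.
        \<bar>slopes_dx k (fst s) a b (fst (snd s)) - dx_L_deriv P u (fst s) (fst (snd s)) $ a $ b\<bar> \<le> \<epsilon>"
      by (rule eventually_mono) (simp only: mem_Times_iff Ball_def, blast)
  qed
  from uniform_lim_mult[OF uniform_limit_cos_1[OF bounded_component(1)[OF Q]] this b1 bD]
  have 1: "uniform_limit ?S (\<lambda>k s. cos (fst (snd s) $ b / real (Suc k)) * slopes_dx k (fst s) a b (fst (snd s)))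
      (\<lambda>s. dx_L_deriv P u (fst s) (fst (snd s)) $ a $ b) sequentially" by simp
  from uniform_lim_mult[OF uniform_limit_cos_1[OF bounded_component(1)[OF Q]] 1 b1 bD]
  have 2: "uniform_limit ?S (\<lambda>k s. cos (fst (snd s) $ a / real (Suc k)) *
        (cos (fst (snd s) $ b / real (Suc k)) * slopes_dx k (fst s) a b (fst (snd s))))
      (\<lambda>s. dx_L_deriv P u (fst s) (fst (snd s)) $ a $ b) sequentially" by simp
  from uniform_lim_mult[OF uniform_limit_sin_0 slope_uniform_limit[OF u(2) \<Psi>1 M Q] b1 bL]
  have "uniform_limit ?S (\<lambda>k s. sin (fst (snd s) $ a / real (Suc k)) / real (Suc k) * slopes k (fst s) a (fst (snd s)))
      (\<lambda>_. 0) sequentially" by simp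
  from uniform_lim_mult[OF uniform_limit_const[of "\<lambda>_. of_bool (a = b)" ?S] this b1 b1]
  have 3: "uniform_limit ?S (\<lambda>k s. of_bool (a = b) *
        (sin (fst (snd s) $ a / real (Suc k)) / real (Suc k) * slopes k (fst s) a (fst (snd s))))
      (\<lambda>_. 0) sequentially" by simp
  from uniform_limit_minus[OF 2 3]
  have "uniform_limit ?S (\<lambda>k s. cos (fst (snd s) $ a / real (Suc k)) *
        (cos (fst (snd s) $ b / real (Suc k)) * slopes_dx k (fst s) a b (fst (snd s)))
      - of_bool (a = b) *
        (sin (fst (snd s) $ a / real (Suc k)) / real (Suc k) * slopes k (fst s) a (fst (snd s))))
      (\<lambda>s. dx_L_deriv P u (fst s) (fst (snd s)) $ a $ b) sequentially" by simp
  then show "uniform_limit ?S (\<lambda>k s. dx_L_deriv P (approximation k) (fst s) (fst (snd s)) $ a $ b)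
      (\<lambda>s. dx_L_deriv P u (fst s) (fst (snd s)) $ a $ b) sequentially"
    by (rule uniform_limit_cong'[THEN iffD1, rotated -1])
       (use MP in \<open>auto simp: dx_L_deriv_approximant[OF P U] simp del: of_nat_Suc\<close>)
qed

lemma L_deriv2_uniform_limit:
  assumes u: "u \<in> C2 P" and \<Psi>: "\<And>a b. (\<lambda>(\<mu>, x, y). L_deriv2 P u \<mu> x y $ a $ b) \<in> Fam"
    and M: "compactin W2_top M" and Q: "compact Q"
  shows "uniform_limit (M \<times> Q \<times> Q) (\<lambda>k s. L_deriv2 P (approximation k) (fst s) (fst (snd s)) (snd (snd s)))
    (\<lambda>s. L_deriv2 P u (fst s) (fst (snd s)) (snd (snd s))) sequentially"
proof (rule uniform_limit_vec, rule uniform_limit_vec)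
  fix a b :: 'n
  let ?S = "M \<times> Q \<times> Q"
  have MP: "M \<subseteq> P2" using compactin_subset_topspace[OF M] by simp
  have b1: "bounded ((\<lambda>_. c) ` ?S)" for c :: real by (rule bounded_subset[of "{c}"]) auto
  have bD: "bounded ((\<lambda>s. L_deriv2 P u (fst s) (fst (snd s)) (snd (snd s)) $ a $ b) ` ?S)"
    using bounded_on_compact[OF \<Psi>[of a b] M Q] unfolding split_conv .
  have "uniform_limit ?S (\<lambda>k s. slopes_dmu k (fst s) a b (fst (snd s)) (snd (snd s)))
      (\<lambda>s. L_deriv2 P u (fst s) (fst (snd s)) (snd (snd s)) $ a $ b) sequentially"
  proof (rule uniform_limit_real_leI)
    fix \<epsilon> :: real assume "0 < \<epsilon>"
    from slope_dmu_close[OF u \<Psi> M Q this]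
    show "\<forall>\<^sub>F k in sequentially. \<forall>s\<in>?S.
        \<bar>slopes_dmu k (fst s) a b (fst (snd s)) (snd (snd s)) - L_deriv2 P u (fst s) (fst (snd s)) (snd (snd s)) $ a $ b\<bar> \<le> \<epsilon>"
      by (rule eventually_mono) (simp only: mem_Times_iff Ball_def, blast)
  qed
  from uniform_lim_mult[OF uniform_limit_cos_1[OF bounded_component(2)[OF Q]] this b1 bD]
  have 1: "uniform_limit ?S (\<lambda>k s. cos (snd (snd s) $ b / real (Suc k)) * slopes_dmu k (fst s) a b (fst (snd s)) (snd (snd s)))
      (\<lambda>s. L_deriv2 P u (fst s) (fst (snd s)) (snd (snd s)) $ a $ b) sequentially" by simp
  from uniform_lim_mult[OF uniform_limit_cos_1[OF bounded_component(1)[OF Q]] 1 b1 bD]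
  have "uniform_limit ?S (\<lambda>k s. cos (fst (snd s) $ a / real (Suc k)) *
        (cos (snd (snd s) $ b / real (Suc k)) * slopes_dmu k (fst s) a b (fst (snd s)) (snd (snd s))))
      (\<lambda>s. L_deriv2 P u (fst s) (fst (snd s)) (snd (snd s)) $ a $ b) sequentially" by simp
  then show "uniform_limit ?S (\<lambda>k s. L_deriv2 P (approximation k) (fst s) (fst (snd s)) (snd (snd s)) $ a $ b)
      (\<lambda>s. L_deriv2 P u (fst s) (fst (snd s)) (snd (snd s)) $ a $ b) sequentially"
    by (rule uniform_limit_cong'[THEN iffD1, rotated -1])
       (use MP in \<open>auto simp: L_deriv2_approximant[OF P U] simp del: of_nat_Suc\<close>)
qed

end

section \<open>The approximation theorem\<close>

lemma continuous_map_component: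
  fixes f :: "'s \<Rightarrow> 'b::real_normed_vector^'n::finite"
  assumes "continuous_map T euclidean f"
  shows "continuous_map T euclidean (\<lambda>s. f s $ a)"
proof -
  have "continuous_map euclidean euclidean (\<lambda>v :: 'b^'n. v $ a)"
    by (simp add: continuous_on_component)
  from continuous_map_compose[OF assms this] show ?thesis by (simp add: o_def)
qed

lemma continuous_map_ignore_last:
  fixes f :: "'s \<times> 'b::topological_space \<Rightarrow> 'c::topological_space"
  assumes "continuous_map (prod_topology T euclidean) euclidean (\<lambda>(\<mu>, x). g \<mu> x)"
  shows "continuous_map (prod_topology T (euclidean :: ('b \<times> 'd::topological_space) topology)) euclidean (\<lambda>(\<mu>, x, y). g \<mu> x)"
proof -
  have "continuous_map (euclidean :: ('b \<times> 'd) topology) euclidean fst" by (simp add: continuous_on_fst)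
  from continuous_map_compose[OF continuous_map_snd this]
  have "continuous_map (prod_topology T (euclidean :: ('b \<times> 'd) topology)) (prod_topology T euclidean) (\<lambda>s. (fst s, fst (snd s)))"
    by (intro continuous_map_pairedI continuous_map_fst) (simp add: o_def)
  from continuous_map_compose[OF this assms] show ?thesis by (simp add: o_def case_prod_unfold)
qed

lemma uniform_limit_SUP:
  fixes f :: "nat \<Rightarrow> 's \<Rightarrow> 'b::real_normed_vector"
  assumes "uniform_limit S f l sequentially"
  shows "(\<lambda>k. SUP s\<in>S. ennreal (norm (f k s - l s))) \<longlonglongrightarrow> 0"
proof (rule SUP_ennreal_tendsto_0)
  fix \<epsilon> :: real assume "0 < \<epsilon>"
  from uniform_limitD[OF assms this]
  show "\<forall>\<^sub>F k in sequentially. \<forall>s\<in>S. norm (f k s - l s) \<le> \<epsilon>"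
    by (rule eventually_mono) (simp add: dist_norm less_imp_le)
qed

theorem theorem4p4:
  fixes P :: "'w measure" and u :: "(real^'n) measure \<Rightarrow> real"
  assumes "prob_space P"
    and "\<exists>U \<in> borel_measurable P. distr P borel U = uniform_measure lborel {0..1::real}"
    and "continuous_map W2_top euclideanreal u"
  shows "\<exists>v :: nat \<Rightarrow> (real^'n) measure \<Rightarrow> real.
    (\<forall>k. v k \<in> C_infty P) \<and>
    (\<forall>\<M>. compactin W2_top \<M> \<longrightarrow>
       (\<lambda>k. SUP \<mu>\<in>\<M>. ennreal \<bar>v k \<mu> - u \<mu>\<bar>) \<longlonglongrightarrow> 0) \<and>
    (u \<in> C1 P \<longrightarrow>
       (\<forall>\<M> K. compactin W2_top \<M> \<and> compact K \<longrightarrow>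
          (\<lambda>k. SUP (\<mu>, x)\<in>\<M> \<times> K. ennreal (norm (L_deriv P (v k) \<mu> x - L_deriv P u \<mu> x)))
            \<longlonglongrightarrow> 0)) \<and>
    (u \<in> C2 P \<longrightarrow>
       (\<forall>\<M> K. compactin W2_top \<M> \<and> compact K \<longrightarrow>
          (\<lambda>k. SUP (\<mu>, x, y)\<in>\<M> \<times> K \<times> K.
             ennreal (norm (dx_L_deriv P (v k) \<mu> x - dx_L_deriv P u \<mu> x)
               + norm (L_deriv2 P (v k) \<mu> x y - L_deriv2 P u \<mu> x y)))
            \<longlonglongrightarrow> 0))"
proof -
  note P = assms(1) and U = assms(2)
  \<comment> \<open>The same approximants serve all claims, so the derivatives that exist are collected before the scheme is chosen.\<close>
  define Fam1 where "Fam1 = (if u \<in> C1 P then range (\<lambda>a (\<mu>, x, y). L_deriv P u \<mu> x $ a) else {} ::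
    ((real^'n) measure \<times> ((real^'n) \<times> (real^'n)) \<Rightarrow> real) set)"
  define Fam2 where "Fam2 = (if u \<in> C2 P then range (\<lambda>(a, b) (\<mu>, x, y). dx_L_deriv P u \<mu> x $ a $ b)
      \<union> range (\<lambda>(a, b) (\<mu>, x, y). L_deriv2 P u \<mu> x y $ a $ b) else {} ::
    ((real^'n) measure \<times> ((real^'n) \<times> (real^'n)) \<Rightarrow> real) set)"
  define Fam where "Fam = insert (\<lambda>(\<mu>, _). u \<mu>) (Fam1 \<union> Fam2)"
  have fin: "finite Fam" by (simp add: Fam_def Fam1_def Fam2_def)
  have hL: "has_L_deriv P u (L_deriv P u)" if "u \<in> C1 P"
    using that unfolding C1_def using has_L_deriv_L_deriv by blast
  have cont1: "continuous_map (prod_topology W2_top euclidean) euclideanreal \<Psi>" if \<Psi>F: "\<Psi> \<in> Fam1" for \<Psi>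
  proof (cases "u \<in> C1 P")
    case True
    then obtain a where \<Psi>: "\<Psi> = (\<lambda>(\<mu>, x, y). L_deriv P u \<mu> x $ a)" using \<Psi>F unfolding Fam1_def by auto
    show ?thesis unfolding \<Psi>
      by (rule continuous_map_ignore_last)
         (use continuous_map_component[OF has_L_deriv_cont[OF hL[OF True]], of a] in \<open>simp add: case_prod_unfold\<close>)
  qed (use \<Psi>F in \<open>simp add: Fam1_def\<close>)
  have cont2: "continuous_map (prod_topology W2_top euclidean) euclideanreal \<Psi>" if \<Psi>F: "\<Psi> \<in> Fam2" for \<Psi>
  proof (cases "u \<in> C2 P")
    case True
    then consider a b where "\<Psi> = (\<lambda>(\<mu>, x, y). dx_L_deriv P u \<mu> x $ a $ b)"
      | a b where "\<Psi> = (\<lambda>(\<mu>, x, y). L_deriv2 P u \<mu> x y $ a $ b)"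
      using \<Psi>F unfolding Fam2_def by auto
    then show ?thesis
    proof cases
      case \<Psi>: 1
      show ?thesis unfolding \<Psi>
        by (rule continuous_map_ignore_last)
           (use continuous_map_component[OF continuous_map_component[OF C2D(3)[OF True], of a], of b] in \<open>simp add: case_prod_unfold\<close>)
    next
      case \<Psi>: 2
      show ?thesis unfolding \<Psi>
        using continuous_map_component[OF continuous_map_component[OF C2D(5)[OF True], of a], of b] by (simp add: case_prod_unfold)
    qed
  qed (use \<Psi>F in \<open>simp add: Fam2_def\<close>)
  have cont0: "continuous_map (prod_topology W2_top (euclidean :: ((real^'n) \<times> (real^'n)) topology)) euclideanreal (\<lambda>(\<mu>, _). u \<mu>)"
    using continuous_map_compose[OF continuous_map_fst assms(3)] by (simp add: o_def case_prod_unfold)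
  have cont: "continuous_map (prod_topology W2_top euclidean) euclideanreal \<Psi>" if "\<Psi> \<in> Fam" for \<Psi>
    using that cont0 cont1 cont2 unfolding Fam_def by blast
  obtain B m n where "sampling_scheme Fam B m n" using sampling_scheme_ex[OF fin cont] by blast
  then interpret sampled_function Fam B m n P u
    by (rule sampled_function.intro[OF _ sampled_function_axioms.intro[OF P U]])
  have Fam0: "(\<lambda>(\<mu>, _). u \<mu>) \<in> Fam" by (simp add: Fam_def)
  have FamL: "(\<lambda>(\<mu>, x, y). L_deriv P u \<mu> x $ a) \<in> Fam" if "u \<in> C1 P" for a
    using that unfolding Fam_def Fam1_def by auto
  have FamD: "(\<lambda>(\<mu>, x, y). dx_L_deriv P u \<mu> x $ a $ b) \<in> Fam" "(\<lambda>(\<mu>, x, y). L_deriv2 P u \<mu> x y $ a $ b) \<in> Fam" if "u \<in> C2 P" for a b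
    using that unfolding Fam_def Fam2_def by (auto intro!: rev_image_eqI[of "(a, b)"])
  have "(\<lambda>k. SUP \<mu>\<in>\<M>. ennreal \<bar>approximation k \<mu> - u \<mu>\<bar>) \<longlonglongrightarrow> 0" if "compactin W2_top \<M>" for \<M>
    using uniform_limit_SUP[OF approximation_uniform_limit[OF Fam0 that]] by simp
  moreover have "(\<lambda>k. SUP (\<mu>, x)\<in>\<M> \<times> K. ennreal (norm (L_deriv P (approximation k) \<mu> x - L_deriv P u \<mu> x))) \<longlonglongrightarrow> 0"
    if u: "u \<in> C1 P" and M: "compactin W2_top \<M>" and K: "compact K" for \<M> K
  proof -
    have "uniform_limit (\<M> \<times> K) (\<lambda>k s. L_deriv P (approximation k) (fst s) (snd s)) (\<lambda>s. L_deriv P u (fst s) (snd s)) sequentially"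
    proof (rule uniform_limitI)
      fix \<epsilon> :: real assume "0 < \<epsilon>"
      from uniform_limitD[OF L_deriv_uniform_limit[OF hL[OF u] FamL[OF u] M K] this]
      show "\<forall>\<^sub>F k in sequentially. \<forall>s\<in>\<M> \<times> K. dist (L_deriv P (approximation k) (fst s) (snd s)) (L_deriv P u (fst s) (snd s)) < \<epsilon>"
        by (rule eventually_mono) (auto simp del: of_nat_Suc)
    qed
    from uniform_limit_SUP[OF this] show ?thesis by (simp only: case_prod_unfold)
  qed
  moreover have "(\<lambda>k. SUP (\<mu>, x, y)\<in>\<M> \<times> K \<times> K.
      ennreal (norm (dx_L_deriv P (approximation k) \<mu> x - dx_L_deriv P u \<mu> x)
        + norm (L_deriv2 P (approximation k) \<mu> x y - L_deriv2 P u \<mu> x y))) \<longlonglongrightarrow> 0"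
    if u: "u \<in> C2 P" and M: "compactin W2_top \<M>" and K: "compact K" for \<M> K
  proof -
    note u1 = C2D(1)[OF u]
    have "(\<lambda>k. SUP s\<in>\<M> \<times> K \<times> K.
      ennreal (norm (dx_L_deriv P (approximation k) (fst s) (fst (snd s)) - dx_L_deriv P u (fst s) (fst (snd s)))
        + norm (L_deriv2 P (approximation k) (fst s) (fst (snd s)) (snd (snd s)) - L_deriv2 P u (fst s) (fst (snd s)) (snd (snd s))))) \<longlonglongrightarrow> 0"
    proof (rule SUP_ennreal_tendsto_0)
      fix \<epsilon> :: real assume "0 < \<epsilon>"
      then have e: "0 < \<epsilon> / 2" by simp
      show "\<forall>\<^sub>F k in sequentially. \<forall>s\<in>\<M> \<times> K \<times> K.
        norm (dx_L_deriv P (approximation k) (fst s) (fst (snd s)) - dx_L_deriv P u (fst s) (fst (snd s)))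
        + norm (L_deriv2 P (approximation k) (fst s) (fst (snd s)) (snd (snd s)) - L_deriv2 P u (fst s) (fst (snd s)) (snd (snd s))) \<le> \<epsilon>"
        using uniform_limitD[OF dx_L_deriv_uniform_limit[OF u hL[OF u1] FamL[OF u1] FamD[OF u] M K] e]
          uniform_limitD[OF L_deriv2_uniform_limit[OF u FamD(2)[OF u] M K] e]
      proof eventually_elim
        case (elim k)
        show ?case
        proof
          fix s assume s: "s \<in> \<M> \<times> K \<times> K"
          show "norm (dx_L_deriv P (approximation k) (fst s) (fst (snd s)) - dx_L_deriv P u (fst s) (fst (snd s)))
            + norm (L_deriv2 P (approximation k) (fst s) (fst (snd s)) (snd (snd s)) - L_deriv2 P u (fst s) (fst (snd s)) (snd (snd s))) \<le> \<epsilon>"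
            using bspec[OF elim(1) s] bspec[OF elim(2) s] unfolding dist_norm by linarith
        qed
      qed
    qed
    then show ?thesis by (simp only: case_prod_unfold)
  qed
  moreover have "approximation k \<in> C_infty P" for k by (rule approximant_C_infty[OF P U])
  ultimately show ?thesis by (intro exI[of _ approximation]) blast
qed

end
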